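(* Let $F$ be a field of characteristic $2$, let $\varphi$ be a quadratic form over $F$ with $\dim\varphi\geq 2$, and let $\pi$ be a bilinear form over $F$ that is similar to an anisotropic bilinear Pfister form, such that $\pi\otimes\varphi$ is anisotropic over $F$. Then \[\mathfrak{i}_1(\pi\otimes\varphi)\geq (\dim\pi)\,\mathfrak{i}_1(\varphi).\]
   Context: Quadratic forms over a field $F$ of characteristic $2$: every quadratic form $\varphi$ is isometric to $[a_1,b_1]\perp\dots\perp[a_r,b_r]\perp\langle c_1,\dots,c_s\rangle$, where $[a,b]$ denotes $ax^2+xy+by^2$ and $\langle c\rangle$ denotes $cz^2$. Every $\varphi$ decomposes as $\varphi\cong i\times\mathbb{H}\perp\varphi_{\mathrm{an}}\perp j\times\langle 0\rangle$ with $\mathbb{H}=[0,0]$, $\varphi_{\mathrm{an}}$ anisotropic (unique up to isometry) and $i,j$ unique; the total isotropy index is $\mathfrak{i}_t(\varphi)=i+j$. For a diagonal bilinear form $\mathfrak{b}\cong\langle a_1,\dots,a_k\rangle_b$, $\mathfrak{b}\otimes\varphi:=a_1\varphi\perp\dots\perp a_k\varphi$. An $n$-fold bilinear Pfister form is $\langle\langle a_1,\dots,a_n\rangle\rangle=\langle 1,a_1\rangle_b\otimes\dots\otimes\langle 1,a_n\rangle_b$ with $a_i\in F^*$. For an anisotropic quadratic form $\psi$ of dimension $n\geq2$, the polynomial $\psi(X_1,\dots,X_n)$ is irreducible and the function field $F(\psi)$ is the fraction field of $F[X_2,\dots,X_n]/(\psi(1,X_2,\dots,X_n))$. For a quadratic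 form $\varphi$ with $\dim\varphi_{\mathrm{an}}\geq2$, the first isotropy index is $\mathfrak{i}_1(\varphi)=\mathfrak{i}_t(\varphi_{F(\varphi_{\mathrm{an}})})$. *)

theory Defs
  imports "HOL-Algebra.Algebra"
begin

section \<open>Fields and function fields\<close>

definition ring_char :: "('a, 'm) ring_scheme \<Rightarrow> nat" where
  "ring_char R =
    (if \<exists>n>0. [(n::nat)] \<cdot>\<^bsub>R\<^esub> \<one>\<^bsub>R\<^esub> = \<zero>\<^bsub>R\<^esub>
     then LEAST n. n > 0 \<and> [n] \<cdot>\<^bsub>R\<^esub> \<one>\<^bsub>R\<^esub> = \<zero>\<^bsub>R\<^esub> else 0)"

text \<open>
  \<open>R[X\<^sub>i | i \<in> I]\<close>, on the carrier of \<^theory>\<open>HOL-Algebra.Indexed_Polynomials\<close>: a monomial is the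
  multiset of its variables, a polynomial maps monomials to coefficients.
\<close>

definition mpoly_ring :: "('a, 'm) ring_scheme \<Rightarrow> 'c set \<Rightarrow> ('c multiset \<Rightarrow> 'a) ring" where
  "mpoly_ring R I =
    \<lparr> carrier = ring.indexed_pset R I (carrier R),
      monoid.mult = (\<lambda>P Q m. \<Oplus>\<^bsub>R\<^esub>k\<in>{k. k \<subseteq># m}. P k \<otimes>\<^bsub>R\<^esub> Q (m - k)),
      one = ring.indexed_const R \<one>\<^bsub>R\<^esub>,
      ring.zero = ring.indexed_const R \<zero>\<^bsub>R\<^esub>,
      ring.add = ring.indexed_padd R \<rparr>"

definition frac_rel :: "('a, 'm) ring_scheme \<Rightarrow> (('a \<times> 'a) \<times> ('a \<times> 'a)) set" where
  "frac_rel R =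
    {((a, b), (c, d)). a \<in> carrier R \<and> b \<in> carrier R - {\<zero>\<^bsub>R\<^esub>} \<and>
                       c \<in> carrier R \<and> d \<in> carrier R - {\<zero>\<^bsub>R\<^esub>} \<and>
                       a \<otimes>\<^bsub>R\<^esub> d = c \<otimes>\<^bsub>R\<^esub> b}"

definition frac_class :: "('a, 'm) ring_scheme \<Rightarrow> 'a \<Rightarrow> 'a \<Rightarrow> ('a \<times> 'a) set" where
  "frac_class R a b = frac_rel R `` {(a, b)}"

text \<open>The fraction field of an integral domain \<open>R\<close>.\<close>

definition fraction_field :: "('a, 'm) ring_scheme \<Rightarrow> ('a \<times> 'a) set ring" where
  "fraction_field R =
    \<lparr> carrier = (carrier R \<times> (carrier R - {\<zero>\<^bsub>R\<^esub>})) // frac_rel R,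
      monoid.mult = (\<lambda>x y. \<Union>(a, b)\<in>x. \<Union>(c, d)\<in>y. frac_class R (a \<otimes>\<^bsub>R\<^esub> c) (b \<otimes>\<^bsub>R\<^esub> d)),
      one = frac_class R \<one>\<^bsub>R\<^esub> \<one>\<^bsub>R\<^esub>,
      ring.zero = frac_class R \<zero>\<^bsub>R\<^esub> \<one>\<^bsub>R\<^esub>,
      ring.add = (\<lambda>x y. \<Union>(a, b)\<in>x. \<Union>(c, d)\<in>y.
               frac_class R ((a \<otimes>\<^bsub>R\<^esub> d) \<oplus>\<^bsub>R\<^esub> (c \<otimes>\<^bsub>R\<^esub> b)) (b \<otimes>\<^bsub>R\<^esub> d)) \<rparr>"


section \<open>Quadratic forms\<close>

text \<open>
  \<open>QForm n c\<close> is the form \<open>\<Sum>i\<le>j<n. c i j x\<^sub>i x\<^sub>j\<close> on \<open>F\<^sup>n\<close>; the values \<open>c i j\<close> outside \<open>i \<le> j < n\<close>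
  are irrelevant. Vectors are extensional functions on \<open>{..<n}\<close>.
\<close>

datatype 'a qform = QForm (qdim: nat) (qcoeff: "nat \<Rightarrow> nat \<Rightarrow> 'a")

definition quadratic_form :: "('a, 'm) ring_scheme \<Rightarrow> 'a qform \<Rightarrow> bool" where
  "quadratic_form F \<phi> \<longleftrightarrow> (\<forall>i j. i \<le> j \<and> j < qdim \<phi> \<longrightarrow> qcoeff \<phi> i j \<in> carrier F)"

definition qeval :: "('a, 'm) ring_scheme \<Rightarrow> 'a qform \<Rightarrow> (nat \<Rightarrow> 'a) \<Rightarrow> 'a" where
  "qeval F \<phi> x =
    (\<Oplus>\<^bsub>F\<^esub>j\<in>{..<qdim \<phi>}. \<Oplus>\<^bsub>F\<^esub>i\<in>{..j}. qcoeff \<phi> i j \<otimes>\<^bsub>F\<^esub> x i \<otimes>\<^bsub>F\<^esub> x j)"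

definition vecs :: "('a, 'm) ring_scheme \<Rightarrow> nat \<Rightarrow> (nat \<Rightarrow> 'a) set" where
  "vecs F n = {..<n} \<rightarrow>\<^sub>E carrier F"

definition zero_vec :: "('a, 'm) ring_scheme \<Rightarrow> nat \<Rightarrow> nat \<Rightarrow> 'a" where
  "zero_vec F n = (\<lambda>i\<in>{..<n}. \<zero>\<^bsub>F\<^esub>)"

definition linear_iso :: "('a, 'm) ring_scheme \<Rightarrow> nat \<Rightarrow> ((nat \<Rightarrow> 'a) \<Rightarrow> nat \<Rightarrow> 'a) \<Rightarrow> bool" where
  "linear_iso F n T \<longleftrightarrow>
    bij_betw T (vecs F n) (vecs F n) \<and>
    (\<forall>x\<in>vecs F n. \<forall>y\<in>vecs F n.
       T (\<lambda>i\<in>{..<n}. x i \<oplus>\<^bsub>F\<^esub> y i) = (\<lambda>i\<in>{..<n}. T x i \<oplus>\<^bsub>F\<^esub> T y i)) \<and>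
    (\<forall>a\<in>carrier F. \<forall>x\<in>vecs F n.
       T (\<lambda>i\<in>{..<n}. a \<otimes>\<^bsub>F\<^esub> x i) = (\<lambda>i\<in>{..<n}. a \<otimes>\<^bsub>F\<^esub> T x i))"

definition qisometric :: "('a, 'm) ring_scheme \<Rightarrow> 'a qform \<Rightarrow> 'a qform \<Rightarrow> bool" where
  "qisometric F \<phi> \<psi> \<longleftrightarrow> qdim \<phi> = qdim \<psi> \<and>
    (\<exists>T. linear_iso F (qdim \<phi>) T \<and> (\<forall>x\<in>vecs F (qdim \<phi>). qeval F \<psi> (T x) = qeval F \<phi> x))"

definition qanisotropic :: "('a, 'm) ring_scheme \<Rightarrow> 'a qform \<Rightarrow> bool" where
  "qanisotropic F \<phi> \<longleftrightarrow>
    (\<forall>x\<in>vecs F (qdim \<phi>). x \<noteq> zero_vec F (qdim \<phi>) \<longrightarrow> qeval F \<phi> x \<noteq> \<zero>\<^bsub>F\<^esub>)"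

definition map_qform :: "('a \<Rightarrow> 'b) \<Rightarrow> 'a qform \<Rightarrow> 'b qform" where
  "map_qform h \<phi> = QForm (qdim \<phi>) (\<lambda>i j. h (qcoeff \<phi> i j))"

definition qscale :: "('a, 'm) ring_scheme \<Rightarrow> 'a \<Rightarrow> 'a qform \<Rightarrow> 'a qform" where
  "qscale F a = map_qform (\<lambda>c. a \<otimes>\<^bsub>F\<^esub> c)"

definition qzero :: "('a, 'm) ring_scheme \<Rightarrow> 'a qform" where
  "qzero F = QForm 0 (\<lambda>_ _. \<zero>\<^bsub>F\<^esub>)"

definition qsum :: "('a, 'm) ring_scheme \<Rightarrow> 'a qform \<Rightarrow> 'a qform \<Rightarrow> 'a qform" where
  "qsum F \<phi> \<psi> = QForm (qdim \<phi> + qdim \<psi>)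
    (\<lambda>i j. if i < qdim \<phi> \<and> j < qdim \<phi> then qcoeff \<phi> i j
           else if qdim \<phi> \<le> i \<and> qdim \<phi> \<le> j then qcoeff \<psi> (i - qdim \<phi>) (j - qdim \<phi>)
           else \<zero>\<^bsub>F\<^esub>)"

text \<open>\<open>k \<times> \<phi> = \<phi> \<bottom> \<dots> \<bottom> \<phi>\<close>\<close>

definition qtimes :: "('a, 'm) ring_scheme \<Rightarrow> nat \<Rightarrow> 'a qform \<Rightarrow> 'a qform" where
  "qtimes F k \<phi> = (qsum F \<phi> ^^ k) (qzero F)"

text \<open>\<open>[a, b] = a x\<^sup>2 + x y + b y\<^sup>2\<close> and \<open>\<langle>c\<rangle> = c z\<^sup>2\<close>\<close>

definition qbinary :: "('a, 'm) ring_scheme \<Rightarrow> 'a \<Rightarrow> 'a \<Rightarrow> 'a qform" where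
  "qbinary F a b = QForm 2
    (\<lambda>i j. if i = 0 \<and> j = 0 then a else if i = 0 \<and> j = 1 then \<one>\<^bsub>F\<^esub>
           else if i = 1 \<and> j = 1 then b else \<zero>\<^bsub>F\<^esub>)"

definition qunary :: "'a \<Rightarrow> 'a qform" where
  "qunary c = QForm 1 (\<lambda>_ _. c)"

definition hyperbolic_plane :: "('a, 'm) ring_scheme \<Rightarrow> 'a qform" where
  "hyperbolic_plane F = qbinary F \<zero>\<^bsub>F\<^esub> \<zero>\<^bsub>F\<^esub>"

text \<open>\<open>\<phi> \<cong> i \<times> \<H> \<bottom> \<psi> \<bottom> j \<times> \<langle>0\<rangle>\<close> with \<open>\<psi>\<close> anisotropic\<close>

definition witt_decomposition ::
    "('a, 'm) ring_scheme \<Rightarrow> 'a qform \<Rightarrow> nat \<Rightarrow> 'a qform \<Rightarrow> nat \<Rightarrow> bool" where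
  "witt_decomposition F \<phi> i \<psi> j \<longleftrightarrow>
    quadratic_form F \<psi> \<and> qanisotropic F \<psi> \<and>
    qisometric F \<phi>
      (qsum F (qtimes F i (hyperbolic_plane F)) (qsum F \<psi> (qtimes F j (qunary \<zero>\<^bsub>F\<^esub>))))"

text \<open>
  The anisotropic part is unique only up to isometry, so a representative is chosen. The definite
  description below relies on the uniqueness of \<open>i\<close> and \<open>j\<close>.
\<close>

definition anisotropic_part :: "('a, 'm) ring_scheme \<Rightarrow> 'a qform \<Rightarrow> 'a qform" where
  "anisotropic_part F \<phi> = (SOME \<psi>. \<exists>i j. witt_decomposition F \<phi> i \<psi> j)"

definition total_isotropy_index :: "('a, 'm) ring_scheme \<Rightarrow> 'a qform \<Rightarrow> nat" where
  "total_isotropy_index F \<phi> = (THE k. \<exists>i \<psi> j. witt_decomposition F \<phi> i \<psi> j \<and> k = i + j)"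

text \<open>
  \<open>F(\<psi>) = Frac (F[X\<^sub>1, \<dots>, X\<^bsub>n-1\<^esub>] / (\<psi>(1, X\<^sub>1, \<dots>, X\<^bsub>n-1\<^esub>)))\<close> with coordinates numbered from 0,
  together with the canonical map \<open>F \<rightarrow> F(\<psi>)\<close>; meaningful for anisotropic \<open>\<psi>\<close> of dimension \<open>\<ge> 2\<close>.
\<close>

definition dehomogenized :: "('a, 'm) ring_scheme \<Rightarrow> 'a qform \<Rightarrow> nat multiset \<Rightarrow> 'a" where
  "dehomogenized F \<psi> =
    (let P = mpoly_ring F {1..<qdim \<psi>} in
     qeval P (map_qform (ring.indexed_const F) \<psi>)
       (\<lambda>i. if i = 0 then \<one>\<^bsub>P\<^esub> else ring.indexed_var F i))"

definition coordinate_ring ::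
    "('a, 'm) ring_scheme \<Rightarrow> 'a qform \<Rightarrow> (nat multiset \<Rightarrow> 'a) set ring" where
  "coordinate_ring F \<psi> =
    (let P = mpoly_ring F {1..<qdim \<psi>} in P Quot (PIdl\<^bsub>P\<^esub> (dehomogenized F \<psi>)))"

definition function_field ::
    "('a, 'm) ring_scheme \<Rightarrow> 'a qform \<Rightarrow>
      ((nat multiset \<Rightarrow> 'a) set \<times> (nat multiset \<Rightarrow> 'a) set) set ring" where
  "function_field F \<psi> = fraction_field (coordinate_ring F \<psi>)"

definition function_field_emb ::
    "('a, 'm) ring_scheme \<Rightarrow> 'a qform \<Rightarrow> 'a \<Rightarrow>
      ((nat multiset \<Rightarrow> 'a) set \<times> (nat multiset \<Rightarrow> 'a) set) set" where
  "function_field_emb F \<psi> a =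
    (let P = mpoly_ring F {1..<qdim \<psi>}; A = coordinate_ring F \<psi> in
     frac_class A (PIdl\<^bsub>P\<^esub> (dehomogenized F \<psi>) +>\<^bsub>P\<^esub> ring.indexed_const F a) \<one>\<^bsub>A\<^esub>)"

definition first_isotropy_index :: "('a, 'm) ring_scheme \<Rightarrow> 'a qform \<Rightarrow> nat" where
  "first_isotropy_index F \<phi> =
    (let \<psi> = anisotropic_part F \<phi> in
     total_isotropy_index (function_field F \<psi>) (map_qform (function_field_emb F \<psi>) \<phi>))"


section \<open>Bilinear forms\<close>

text \<open>\<open>BForm n b\<close> is the bilinear form on \<open>F\<^sup>n\<close> with Gram matrix \<open>(b i j)\<^bsub>i,j<n\<^esub>\<close>.\<close>

datatype 'a bform = BForm (bdim: nat) (gram: "nat \<Rightarrow> nat \<Rightarrow> 'a")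

definition bilinear_form :: "('a, 'm) ring_scheme \<Rightarrow> 'a bform \<Rightarrow> bool" where
  "bilinear_form F B \<longleftrightarrow>
    (\<forall>i<bdim B. \<forall>j<bdim B. gram B i j \<in> carrier F \<and> gram B i j = gram B j i)"

definition beval :: "('a, 'm) ring_scheme \<Rightarrow> 'a bform \<Rightarrow> (nat \<Rightarrow> 'a) \<Rightarrow> (nat \<Rightarrow> 'a) \<Rightarrow> 'a" where
  "beval F B x y =
    (\<Oplus>\<^bsub>F\<^esub>i\<in>{..<bdim B}. \<Oplus>\<^bsub>F\<^esub>j\<in>{..<bdim B}. gram B i j \<otimes>\<^bsub>F\<^esub> x i \<otimes>\<^bsub>F\<^esub> y j)"

definition bisometric :: "('a, 'm) ring_scheme \<Rightarrow> 'a bform \<Rightarrow> 'a bform \<Rightarrow> bool" where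
  "bisometric F B C \<longleftrightarrow> bdim B = bdim C \<and>
    (\<exists>T. linear_iso F (bdim B) T \<and>
      (\<forall>x\<in>vecs F (bdim B). \<forall>y\<in>vecs F (bdim B). beval F C (T x) (T y) = beval F B x y))"

definition banisotropic :: "('a, 'm) ring_scheme \<Rightarrow> 'a bform \<Rightarrow> bool" where
  "banisotropic F B \<longleftrightarrow>
    (\<forall>x\<in>vecs F (bdim B). x \<noteq> zero_vec F (bdim B) \<longrightarrow> beval F B x x \<noteq> \<zero>\<^bsub>F\<^esub>)"

definition bscale :: "('a, 'm) ring_scheme \<Rightarrow> 'a \<Rightarrow> 'a bform \<Rightarrow> 'a bform" where
  "bscale F a B = BForm (bdim B) (\<lambda>i j. a \<otimes>\<^bsub>F\<^esub> gram B i j)"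

definition bsimilar :: "('a, 'm) ring_scheme \<Rightarrow> 'a bform \<Rightarrow> 'a bform \<Rightarrow> bool" where
  "bsimilar F B C \<longleftrightarrow> (\<exists>a\<in>carrier F - {\<zero>\<^bsub>F\<^esub>}. bisometric F B (bscale F a C))"

definition bdiag :: "('a, 'm) ring_scheme \<Rightarrow> 'a list \<Rightarrow> 'a bform" where
  "bdiag F as = BForm (length as) (\<lambda>i j. if i = j then as ! i else \<zero>\<^bsub>F\<^esub>)"

text \<open>The basis vector \<open>e\<^sub>p \<otimes> f\<^sub>q\<close> of the tensor product has index \<open>p * bdim C + q\<close>.\<close>

definition btensor :: "('a, 'm) ring_scheme \<Rightarrow> 'a bform \<Rightarrow> 'a bform \<Rightarrow> 'a bform" where
  "btensor F B C = BForm (bdim B * bdim C)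
    (\<lambda>i j. gram B (i div bdim C) (j div bdim C) \<otimes>\<^bsub>F\<^esub> gram C (i mod bdim C) (j mod bdim C))"

text \<open>\<open>\<langle>\<langle>a\<^sub>1, \<dots>, a\<^sub>n\<rangle>\<rangle>\<close>; the 0-fold Pfister form is \<open>\<langle>1\<rangle>\<^sub>b\<close>.\<close>

definition pfister :: "('a, 'm) ring_scheme \<Rightarrow> 'a list \<Rightarrow> 'a bform" where
  "pfister F as = foldr (\<lambda>a. btensor F (bdiag F [\<one>\<^bsub>F\<^esub>, a])) as (bdiag F [\<one>\<^bsub>F\<^esub>])"

definition bilinear_pfister_form :: "('a, 'm) ring_scheme \<Rightarrow> 'a bform \<Rightarrow> bool" where
  "bilinear_pfister_form F B \<longleftrightarrow>
    bilinear_form F B \<and> (\<exists>as. set as \<subseteq> carrier F - {\<zero>\<^bsub>F\<^esub>} \<and> bisometric F B (pfister F as))"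

text \<open>
  \<open>B \<otimes> \<phi> = a\<^sub>1\<phi> \<bottom> \<dots> \<bottom> a\<^sub>k\<phi>\<close> for a diagonalization \<open>B \<cong> \<langle>a\<^sub>1, \<dots>, a\<^sub>k\<rangle>\<^sub>b\<close>. Up to isometry the result
  does not depend on the chosen diagonalization; \<open>B\<close> must be diagonalizable.
\<close>

definition qtensor :: "('a, 'm) ring_scheme \<Rightarrow> 'a bform \<Rightarrow> 'a qform \<Rightarrow> 'a qform" where
  "qtensor F B \<phi> =
    (let as = (SOME as. set as \<subseteq> carrier F \<and> bisometric F B (bdiag F as)) in
     foldr (\<lambda>a. qsum F (qscale F a \<phi>)) as (qzero F))"

end

theory Submission
  imports Defs "HOL-Algebra.Algebraic_Closure_Type"
    "HOL-Library.Poly_Mapping" "HOL-Library.Multiset_Order"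
begin

text \<open>
  Let \<open>m\<close> be the first isotropy index of \<open>\<phi>\<close>. Over any field the total isotropy index is the largest
  dimension of a totally isotropic subspace, so \<open>\<phi>\<close> has a totally isotropic subspace of dimension \<open>m\<close>
  over \<open>F(\<phi>)\<close>. Specialising the generic zero of \<open>\<phi>\<close> shows (*): if \<open>\<phi>\<close> is anisotropic over an
  extension \<open>E\<close> of \<open>F\<close> and isotropic over a quadratic extension \<open>E(z)\<close>, then it has a totally isotropic
  subspace of dimension \<open>m\<close> over \<open>E(z)\<close>.

  If (*) holds for \<open>(q, m)\<close>, then it holds for \<open>(q \<bottom> aq, 2m)\<close>. This is clear when \<open>q\<close> is isotropic over
  \<open>E' = E(z)\<close>. Otherwise let \<open>q(x) + a q(y) = 0\<close> over \<open>E'\<close>. If \<open>x\<close> and \<open>y\<close> are independent, then \<open>q(x + z'y) = 0\<close>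
  for some \<open>z'\<close> with \<open>z'\<^sup>2 = p z' + a\<close>, so \<open>q\<close> is totally isotropic on a space of dimension \<open>m\<close> over
  \<open>E'(z')\<close>; the vectors \<open>(u, v)\<close> for the elements \<open>u + z'v\<close> of this space form a totally isotropic space
  of dimension \<open>2m\<close> over \<open>E'\<close>. If they are dependent, then \<open>a = b\<^sup>2\<close> in \<open>E'\<close> and the vectors \<open>(bw, w)\<close>
  form a totally isotropic space of dimension \<open>dim q \<ge> 2m\<close>.

  Running through the slots of the Pfister form yields (*) for \<open>(\<pi> \<otimes> \<phi>, dim \<pi> \<cdot> m)\<close>. Finally
  \<open>F(\<pi> \<otimes> \<phi>)\<close> is a quadratic extension of a purely transcendental extension of \<open>F\<close>.
\<close>

section \<open>Echelon families over subfields\<close>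

text \<open>The property about all \<open>E\<close> and all \<open>E(z)\<close> mentions no function
  field, so it can pass from one slot to the next although the function field changes with the form.
  Three obstacles shape the rest. Function fields are records. They are embedded into one
  algebraically closed type, where fields are subsets and composita such as E(t)(T) need no maps;
  the new variables must be transcendental over every \<open>E\<close> at once, so all
  \<open>E\<close> stay inside an algebraically closed subfield \<open>A\<close> and the variables
  are taken outside it. Secondly, specialisation must not lose dimension: over a valuation ring a
  subspace has a basis in echelon form, whose pivot entries 0 and 1 survive reduction. The same
  pivots give independence when vectors over E(z) are split into two components over E. Finally,
  hyperbolic planes and zeros must be counted together: \<open>i + j\<close> is recovered as the
  largest dimension of a totally isotropic subspace, which also makes it independent of the
  decomposition.\<close>

definition subfld :: "'w::field set \<Rightarrow> bool" where
  "subfld K \<longleftrightarrow> 0 \<in> K \<and> 1 \<in> K \<and> (\<forall>x\<in>K. \<forall>y\<in>K. x + y \<in> K \<and> x * y \<in> K) \<and>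
    (\<forall>x\<in>K. - x \<in> K \<and> inverse x \<in> K)"

lemma subfldD:
  assumes "subfld K"
  shows "0 \<in> K" "1 \<in> K" "\<And>x y. x \<in> K \<Longrightarrow> y \<in> K \<Longrightarrow> x + y \<in> K" "\<And>x y. x \<in> K \<Longrightarrow> y \<in> K \<Longrightarrow> x * y \<in> K"
    "\<And>x. x \<in> K \<Longrightarrow> - x \<in> K" "\<And>x. x \<in> K \<Longrightarrow> inverse x \<in> K"
    "\<And>x y. x \<in> K \<Longrightarrow> y \<in> K \<Longrightarrow> x - y \<in> K" "\<And>x y. x \<in> K \<Longrightarrow> y \<in> K \<Longrightarrow> x / y \<in> K"
    "\<And>x m. x \<in> K \<Longrightarrow> x ^ m \<in> K"
proof -
  show 0: "0 \<in> K" "1 \<in> K" "\<And>x y. x \<in> K \<Longrightarrow> y \<in> K \<Longrightarrow> x + y \<in> K" "\<And>x y. x \<in> K \<Longrightarrow> y \<in> K \<Longrightarrow> x * y \<in> K"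
    "\<And>x. x \<in> K \<Longrightarrow> - x \<in> K" "\<And>x. x \<in> K \<Longrightarrow> inverse x \<in> K"
    using assms unfolding subfld_def by auto
  show "\<And>x y. x \<in> K \<Longrightarrow> y \<in> K \<Longrightarrow> x - y \<in> K" using 0(3,5) by (metis diff_conv_add_uminus)
  show "\<And>x y. x \<in> K \<Longrightarrow> y \<in> K \<Longrightarrow> x / y \<in> K" using 0(4,6) by (metis field_class.field_divide_inverse)
  show "x ^ m \<in> K" if "x \<in> K" for x m using 0 that by (induction m) auto
qed

lemma subfld_sum:
  assumes "subfld K" "\<And>i. i \<in> I \<Longrightarrow> f i \<in> K"
  shows "sum f I \<in> K"
  using assms(2) by (induction I rule: infinite_finite_induct) (auto intro: subfldD[OF assms(1)])

text \<open>\<open>R = K\<close> is allowed, so one elimination theorem serves both for ordinary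
  echelon forms and for those that survive a place.\<close>

definition valuation_ring :: "'w::field set \<Rightarrow> 'w set \<Rightarrow> bool" where
  "valuation_ring K R \<longleftrightarrow> R \<subseteq> K \<and> 0 \<in> R \<and> 1 \<in> R \<and> (\<forall>x\<in>R. \<forall>y\<in>R. x + y \<in> R \<and> x * y \<in> R) \<and>
    (\<forall>x\<in>R. - x \<in> R) \<and> (\<forall>x\<in>K. x \<noteq> 0 \<longrightarrow> x \<in> R \<or> inverse x \<in> R)"

lemma subfld_valuation_ring: "subfld K \<Longrightarrow> valuation_ring K K"
  unfolding valuation_ring_def using subfldD[of K] by auto

lemma valuation_ring_minus: "valuation_ring K R \<Longrightarrow> x \<in> R \<Longrightarrow> y \<in> R \<Longrightarrow> x - y \<in> R"
  unfolding valuation_ring_def by (metis diff_conv_add_uminus)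

text \<open>Divisibility over \<open>R\<close> is a total preorder on the nonzero elements of
  \<open>K\<close>, so a finite set has a member that divides all others. It is the right pivot:
  dividing by it stays inside \<open>R\<close>.\<close>

lemma valuation_ring_max:
  assumes K: "subfld K" and R: "valuation_ring K R" and "finite J" "J \<noteq> {}"
    and "\<And>j. j \<in> J \<Longrightarrow> x j \<in> K" "\<And>j. j \<in> J \<Longrightarrow> x j \<noteq> 0"
  shows "\<exists>i\<in>J. \<forall>j\<in>J. x j / x i \<in> R"
  using assms(3-6)
proof (induction J rule: finite_ne_induct)
  case (singleton a)
  then show ?case using R by (auto simp: valuation_ring_def)
next
  case (insert k J)
  then obtain i where i: "i \<in> J" "\<forall>j\<in>J. x j / x i \<in> R" by auto
  show ?case
  proof (cases "x k / x i \<in> R")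
    case True
    then show ?thesis using i by auto
  next
    case False
    have "x k / x i \<in> K" "x k / x i \<noteq> 0" using insert i subfldD(8)[OF K] by auto
    with False R have "inverse (x k / x i) \<in> R" unfolding valuation_ring_def by blast
    then have 1: "x i / x k \<in> R" by (simp add: field_simps)
    have "x j / x k \<in> R" if "j \<in> J" for j
    proof -
      have "x j / x k = (x j / x i) * (x i / x k)" using i insert.prems by simp
      then show ?thesis using 1 i(2) that R unfolding valuation_ring_def by metis
    qed
    moreover have "x k / x k \<in> R" using insert.prems R by (simp add: valuation_ring_def)
    ultimately show ?thesis by auto
  qed
qed

text \<open>
  Vectors and coefficient matrices are functions on \<open>nat\<close>; only the entries with indices below the
  dimension \<open>n\<close> matter.
\<close>

definition vin :: "'w set \<Rightarrow> nat \<Rightarrow> (nat \<Rightarrow> 'w) \<Rightarrow> bool" where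
  "vin K n x \<longleftrightarrow> (\<forall>i<n. x i \<in> K)"

text \<open>The family is indexed by its own pivots.\<close>

definition echelon :: "'w::field set \<Rightarrow> nat \<Rightarrow> nat set \<Rightarrow> (nat \<Rightarrow> nat \<Rightarrow> 'w) \<Rightarrow> bool" where
  "echelon R n S w \<longleftrightarrow> S \<subseteq> {..<n} \<and>
    (\<forall>s\<in>S. vin R n (w s) \<and> (\<forall>t\<in>S. w s t = (if s = t then 1 else 0)))"

lemma echelon_finite: "echelon R n S w \<Longrightarrow> finite S"
  unfolding echelon_def using finite_subset by blast

lemma echelon_card: "echelon R n S w \<Longrightarrow> card S \<le> n"
  unfolding echelon_def using card_mono[of "{..<n}" S] by auto

lemma echelon_subset: "echelon R n S w \<Longrightarrow> T \<subseteq> S \<Longrightarrow> echelon R n T w"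
  unfolding echelon_def by blast

text \<open>The pivot \<open>p\<close> is an entry of \<open>v\<close> that divides all others over
  \<open>R\<close>. Subtracting multiples of the normalised \<open>v\<close> clears column
  \<open>p\<close> of the old vectors and leaves the old pivot columns alone, since \<open>v\<close>
  vanishes there.\<close>

lemma echelon_extend:
  assumes K: "subfld K" and R: "valuation_ring K R" and e: "echelon R n S w"
    and v: "vin K n v" "\<And>s. s \<in> S \<Longrightarrow> v s = 0" "\<exists>k<n. v k \<noteq> 0"
  shows "\<exists>p. p < n \<and> p \<notin> S \<and> v p \<noteq> 0 \<and> echelon R n (insert p S)
    (\<lambda>s. if s = p then (\<lambda>k. v k / v p) else (\<lambda>k. w s k - w s p * (v k / v p)))"
proof -
  let ?J = "{k. k < n \<and> v k \<noteq> 0}"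
  have "\<exists>i\<in>?J. \<forall>j\<in>?J. v j / v i \<in> R"
    by (rule valuation_ring_max[OF K R]) (use v in \<open>auto simp: vin_def\<close>)
  then obtain p where p: "p < n" "v p \<noteq> 0" "\<forall>j\<in>?J. v j / v p \<in> R" by blast
  have 1: "v j / v p \<in> R" if "j < n" for j
    using p that R by (cases "v j = 0") (auto simp: valuation_ring_def)
  have "p \<notin> S" using p v(2) by auto
  moreover have "w s k - w s p * (v k / v p) \<in> R" if "s \<in> S" "k < n" for s k
    using that e 1 p R valuation_ring_minus[OF R] unfolding echelon_def vin_def valuation_ring_def by blast
  ultimately show ?thesis using p e v(2) 1
    by (intro exI[of _ p]) (auto simp: echelon_def vin_def)
qed

section \<open>Spans and linear independence over a subfield\<close>

definition lin_span :: "'w::field set \<Rightarrow> 'i set \<Rightarrow> ('i \<Rightarrow> nat \<Rightarrow> 'w) \<Rightarrow> (nat \<Rightarrow> 'w) set" where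
  "lin_span K I v = {u. \<exists>a. (\<forall>i\<in>I. a i \<in> K) \<and> u = (\<lambda>k. \<Sum>i\<in>I. a i * v i k)}"

lemma lin_span_zero: "subfld K \<Longrightarrow> (\<lambda>k. 0) \<in> lin_span K I v"
  unfolding lin_span_def using subfldD(1) by (auto intro!: exI[of _ "\<lambda>_. 0"])

lemma lin_span_add: "subfld K \<Longrightarrow> x \<in> lin_span K I v \<Longrightarrow> y \<in> lin_span K I v \<Longrightarrow> (\<lambda>k. x k + y k) \<in> lin_span K I v"
proof -
  assume K: "subfld K" and "x \<in> lin_span K I v" "y \<in> lin_span K I v"
  then obtain a b where "\<forall>i\<in>I. a i \<in> K" "x = (\<lambda>k. \<Sum>i\<in>I. a i * v i k)"
    "\<forall>i\<in>I. b i \<in> K" "y = (\<lambda>k. \<Sum>i\<in>I. b i * v i k)" unfolding lin_span_def by blast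
  then show ?thesis unfolding lin_span_def
    by (auto intro!: exI[of _ "\<lambda>i. a i + b i"] subfldD[OF K] simp: sum.distrib algebra_simps)
qed

lemma lin_span_scale: "subfld K \<Longrightarrow> x \<in> lin_span K I v \<Longrightarrow> d \<in> K \<Longrightarrow> (\<lambda>k. d * x k) \<in> lin_span K I v"
proof -
  assume K: "subfld K" and "x \<in> lin_span K I v" and d: "d \<in> K"
  then obtain a where "\<forall>i\<in>I. a i \<in> K" "x = (\<lambda>k. \<Sum>i\<in>I. a i * v i k)" unfolding lin_span_def by blast
  then show ?thesis using d unfolding lin_span_def
    by (auto intro!: exI[of _ "\<lambda>i. d * a i"] subfldD[OF K] simp: sum_distrib_left algebra_simps)
qed

lemma lin_span_diff: "subfld K \<Longrightarrow> x \<in> lin_span K I v \<Longrightarrow> y \<in> lin_span K I v \<Longrightarrow> (\<lambda>k. x k - y k) \<in> lin_span K I v"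
  using lin_span_add[of K x I v "\<lambda>k. - 1 * y k"] lin_span_scale[of K y I v "- 1"] subfldD[of K] by simp

lemma lin_span_sum:
  assumes "subfld K" "\<And>s. s \<in> S \<Longrightarrow> x s \<in> lin_span K I v" "\<And>s. s \<in> S \<Longrightarrow> d s \<in> K"
  shows "(\<lambda>k. \<Sum>s\<in>S. d s * x s k) \<in> lin_span K I v"
  using assms(2,3)
proof (induction S rule: infinite_finite_induct)
  case (insert s S)
  then show ?case
    using lin_span_add[OF assms(1) lin_span_scale[OF assms(1), of "x s" I v "d s"], of "\<lambda>k. \<Sum>s\<in>S. d s * x s k"] by simp
qed (simp_all add: lin_span_zero assms(1))

lemma lin_span_base:
  assumes "subfld K" "finite I" "i \<in> I"
  shows "v i \<in> lin_span K I v"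
proof -
  have "v i k = (\<Sum>j\<in>I. (if j = i then 1 else 0) * v j k)" for k
    using assms(2,3) by (simp add: if_distribR mult_delta_left cong: if_cong)
  then show ?thesis unfolding lin_span_def using subfldD(1,2)[OF assms(1)]
    by (auto intro!: exI[of _ "\<lambda>j. if j = i then 1 else 0"])
qed

lemma lin_span_vin:
  assumes "subfld K" "\<And>i. i \<in> I \<Longrightarrow> vin K n (v i)" "u \<in> lin_span K I v"
  shows "vin K n u"
  using assms unfolding lin_span_def vin_def by (auto intro!: subfld_sum subfldD[OF assms(1)])

definition lin_indep :: "'w::field set \<Rightarrow> nat \<Rightarrow> 'i set \<Rightarrow> ('i \<Rightarrow> nat \<Rightarrow> 'w) \<Rightarrow> bool" where
  "lin_indep K n I v \<longleftrightarrow> (\<forall>a. (\<forall>i\<in>I. a i \<in> K) \<and> (\<forall>k<n. (\<Sum>i\<in>I. a i * v i k) = 0) \<longrightarrow> (\<forall>i\<in>I. a i = 0))"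

lemma indepD: "lin_indep K n I v \<Longrightarrow> (\<And>i. i \<in> I \<Longrightarrow> a i \<in> K) \<Longrightarrow> (\<And>k. k < n \<Longrightarrow> (\<Sum>i\<in>I. a i * v i k) = 0) \<Longrightarrow> i \<in> I \<Longrightarrow> a i = 0"
  unfolding lin_indep_def by metis

lemma lin_indep_insertD:
  assumes K: "subfld K" and "finite I" "j \<notin> I" "lin_indep K n (insert j I) v"
  shows "lin_indep K n I v"
  unfolding lin_indep_def
proof safe
  fix a i assume a: "\<forall>i\<in>I. a i \<in> K" "\<forall>k<n. (\<Sum>i\<in>I. a i * v i k) = 0" "i \<in> I"
  have "(if i = j then 0 else a i) = 0"
  proof (rule indepD[OF assms(4), of "\<lambda>i. if i = j then 0 else a i"])
    show "(if i = j then 0 else a i) \<in> K" if "i \<in> insert j I" for i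
      using a that subfldD(1)[OF K] by auto
    fix k assume "k < n"
    have "(\<Sum>i\<in>I. (if i = j then 0 else a i) * v i k) = (\<Sum>i\<in>I. a i * v i k)"
      using assms(3) by (intro sum.cong) auto
    then show "(\<Sum>i\<in>insert j I. (if i = j then 0 else a i) * v i k) = 0"
      using assms a \<open>k < n\<close> by simp
  qed (use a in auto)
  then show "a i = 0" using assms(3) a(3) by (auto split: if_splits)
qed

text \<open>Gaussian elimination with pivots chosen by divisibility. It reflects that a subspace of
  \<open>K^n\<close> meets \<open>R^n\<close> in a free direct summand of the same rank.\<close>

theorem echelon_exists:
  assumes K: "subfld K" and R: "valuation_ring K R" and "finite I" "\<And>i. i \<in> I \<Longrightarrow> vin K n (v i)" "lin_indep K n I v"
  shows "\<exists>S w. card S = card I \<and> echelon R n S w \<and> (\<forall>s\<in>S. w s \<in> lin_span K I v)"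
  using assms(3-5)
proof (induction I rule: finite_induct)
  case empty
  show ?case by (intro exI[of _ "{}"]) (auto simp: echelon_def)
next
  case (insert j I)
  have indI: "lin_indep K n I v" using lin_indep_insertD[OF K insert.hyps insert.prems(2)] .
  with insert obtain S w where S: "card S = card I" "echelon R n S w" "\<forall>s\<in>S. w s \<in> lin_span K I v"
    by auto
  \<comment> \<open>The new vector minus its components at the old pivots; it vanishes at every
    element of \<open>S\<close>.\<close>
  define v' where "v' = (\<lambda>k. v j k - (\<Sum>s\<in>S. v j s * w s k))"
  have fS: "finite S" using echelon_finite[OF S(2)] .
  have vj: "v j s \<in> K" if "s \<in> S" for s
    using that insert.prems(1)[of j] S(2) by (auto simp: echelon_def vin_def)
  have mono: "lin_span K I v \<subseteq> lin_span K (insert j I) v"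
  proof
    fix u assume "u \<in> lin_span K I v"
    then obtain a where a: "\<forall>i\<in>I. a i \<in> K" "u = (\<lambda>k. \<Sum>i\<in>I. a i * v i k)" unfolding lin_span_def by blast
    have "(\<Sum>i\<in>I. (if i = j then 0 else a i) * v i k) = (\<Sum>i\<in>I. a i * v i k)" for k
      using insert(2) by (intro sum.cong) auto
    then show "u \<in> lin_span K (insert j I) v" unfolding lin_span_def using a insert.hyps subfldD(1)[OF K]
      by (auto intro!: exI[of _ "\<lambda>i. if i = j then 0 else a i"])
  qed
  have w: "w s \<in> lin_span K (insert j I) v" if "s \<in> S" for s using that S(3) mono by blast
  have v'l: "v' \<in> lin_span K (insert j I) v"
    unfolding v'_def
    by (rule lin_span_diff[OF K lin_span_base[OF K] lin_span_sum[OF K]]) (use insert.hyps w vj in auto)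
  have v'K: "vin K n v'" using lin_span_vin[OF K insert.prems(1) v'l] .
  have v'S: "v' t = 0" if "t \<in> S" for t
  proof -
    have "(\<Sum>s\<in>S. v j s * w s t) = (\<Sum>s\<in>S. v j s * (if s = t then 1 else 0))"
      using S(2) that by (intro sum.cong) (auto simp: echelon_def)
    also have "\<dots> = v j t" using fS that by (simp add: mult_delta_right cong: if_cong)
    finally show ?thesis unfolding v'_def by simp
  qed
  \<comment> \<open>If \<open>v'\<close> vanished, \<open>v j\<close> would be a combination of the
    vectors from \<open>I\<close>, a relation with coefficient -1 at \<open>j\<close>.\<close>
  have "\<exists>k<n. v' k \<noteq> 0"
  proof (rule ccontr)
    assume "\<not> (\<exists>k<n. v' k \<noteq> 0)"
    then have v'0: "\<And>k. k < n \<Longrightarrow> v' k = 0" by auto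
    have "(\<lambda>k. \<Sum>s\<in>S. v j s * w s k) \<in> lin_span K I v" by (rule lin_span_sum[OF K]) (use S(3) vj in auto)
    then obtain a where a: "\<forall>i\<in>I. a i \<in> K" "(\<lambda>k. \<Sum>s\<in>S. v j s * w s k) = (\<lambda>k. \<Sum>i\<in>I. a i * v i k)"
      unfolding lin_span_def by blast
    define a' where "a' = (\<lambda>i. if i = j then - 1 else a i)"
    have s: "(\<Sum>i\<in>I. a' i * v i k) = (\<Sum>i\<in>I. a i * v i k)" for k
      using insert(2) unfolding a'_def by (intro sum.cong) auto
    have "a' j = 0"
    proof (rule indepD[OF insert.prems(2)])
      show "a' i \<in> K" if "i \<in> insert j I" for i
        using a(1) that subfldD(2,5)[OF K] by (auto simp: a'_def)
      fix k assume k: "k < n"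
      have "(\<Sum>i\<in>insert j I. a' i * v i k) = - v j k + (\<Sum>i\<in>I. a i * v i k)"
        using insert.hyps s by (simp add: a'_def)
      also have "\<dots> = - v' k" using fun_cong[OF a(2), of k] by (simp add: v'_def)
      finally show "(\<Sum>i\<in>insert j I. a' i * v i k) = 0" using v'0 k by simp
    qed simp
    then show False by (simp add: a'_def)
  qed
  from echelon_extend[OF K R S(2) v'K v'S this] obtain p where p: "p < n" "p \<notin> S" "v' p \<noteq> 0"
    and e: "echelon R n (insert p S)
      (\<lambda>s. if s = p then (\<lambda>k. v' k / v' p) else (\<lambda>k. w s k - w s p * (v' k / v' p)))" by blast
  have c: "(\<lambda>k. v' k / v' p) \<in> lin_span K (insert j I) v"
    using lin_span_scale[OF K v'l, of "inverse (v' p)"] v'K p(1) subfldD(6)[OF K]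
    by (simp add: vin_def field_simps)
  have "w s p \<in> K" if "s \<in> S" for s
    using lin_span_vin[OF K insert.prems(1) w[OF that]] p(1) by (simp add: vin_def)
  then have "(\<lambda>k. w s k - w s p * (v' k / v' p)) \<in> lin_span K (insert j I) v" if "s \<in> S" for s
    using lin_span_diff[OF K w[OF that] lin_span_scale[OF K c, of "w s p"]] that by simp
  then show ?case using e c p(2) S(1) fS insert.hyps
    by (intro exI[of _ "insert p S"]
        exI[of _ "\<lambda>s. if s = p then (\<lambda>k. v' k / v' p) else (\<lambda>k. w s k - w s p * (v' k / v' p))"]) auto
qed

text \<open>Elimination replaces the family by equally many pivots, and these are distinct
  coordinates.\<close>

lemma lin_indep_card_le:
  assumes "subfld K" "finite I" "\<And>i. i \<in> I \<Longrightarrow> vin K n (v i)" "lin_indep K n I v"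
  shows "card I \<le> n"
  using echelon_exists[OF assms(1) subfld_valuation_ring[OF assms(1)] assms(2-4)] echelon_card by metis

lemma echelon_lin_indep:
  assumes "echelon K n S w"
  shows "lin_indep K n S w"
  unfolding lin_indep_def
proof safe
  fix a i assume a: "\<forall>k<n. (\<Sum>i\<in>S. a i * w i k) = 0" "i \<in> S"
  have "(\<Sum>j\<in>S. a j * w j i) = (\<Sum>j\<in>S. a j * (if j = i then 1 else 0))"
    using assms a(2) by (intro sum.cong) (auto simp: echelon_def)
  also have "\<dots> = a i" using a(2) echelon_finite[OF assms] by (simp add: mult_delta_right cong: if_cong)
  finally show "a i = 0" using a assms by (auto simp: echelon_def)
qed

text \<open>The echelon basis is one with the largest number of pivots.\<close>

lemma subspace_echelon_basis:
  assumes K: "subfld K" and U: "\<And>u. u \<in> U \<Longrightarrow> vin K n u"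
    "\<And>x y. x \<in> U \<Longrightarrow> y \<in> U \<Longrightarrow> (\<lambda>k. x k - y k) \<in> U"
    "\<And>x a. x \<in> U \<Longrightarrow> a \<in> K \<Longrightarrow> (\<lambda>k. a * x k) \<in> U"
  shows "\<exists>S w. echelon K n S w \<and> (\<forall>s\<in>S. w s \<in> U) \<and> (\<forall>u\<in>U. \<forall>k<n. u k = (\<Sum>s\<in>S. u s * w s k))"
proof -
  let ?P = "\<lambda>m. \<exists>S w. echelon K n S w \<and> (\<forall>s\<in>S. w s \<in> U) \<and> card S = m"
  have P0: "?P 0" by (intro exI[of _ "{}"]) (auto simp: echelon_def)
  have bd: "\<And>m. ?P m \<Longrightarrow> m \<le> n" using echelon_card by metis
  obtain m where m: "?P m" "\<And>m'. ?P m' \<Longrightarrow> m' \<le> m"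
    using Nat.ex_has_greatest_nat[of ?P 0 n] P0 bd by metis
  obtain S w where S: "echelon K n S w" "\<forall>s\<in>S. w s \<in> U" "card S = m" using m(1) by blast
  have fS: "finite S" using echelon_finite[OF S(1)] .
  have "u k = (\<Sum>s\<in>S. u s * w s k)" if u: "u \<in> U" "k < n" for u k
  proof (rule ccontr)
    assume ne: "u k \<noteq> (\<Sum>s\<in>S. u s * w s k)"
    \<comment> \<open>A vector not recovered from its pivot entries leaves this nonzero remainder,
      which lies in \<open>U\<close> and vanishes at the pivots; it would enlarge the maximal
      family.\<close>
    define v' where "v' = (\<lambda>k. u k - (\<Sum>s\<in>S. u s * w s k))"
    have uS: "u s \<in> K" if "s \<in> S" for s using that U(1)[OF u(1)] S(1) by (auto simp: echelon_def vin_def)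
    have "(\<lambda>k. x k - (\<Sum>s\<in>T. u s * w s k)) \<in> U" if "x \<in> U" "T \<subseteq> S" for x T
      using finite_subset[OF that(2) fS] that
    proof (induction T arbitrary: x rule: finite_induct)
      case (insert t T)
      have "(\<lambda>k. x k - u t * w t k) \<in> U" using insert U(2,3) S(2) uS by auto
      from insert(3)[OF this] show ?case using insert by (simp add: algebra_simps)
    qed simp
    then have v'U: "v' \<in> U" unfolding v'_def using u(1) by blast
    have v'S: "v' t = 0" if "t \<in> S" for t
    proof -
      have "(\<Sum>s\<in>S. u s * w s t) = (\<Sum>s\<in>S. u s * (if s = t then 1 else 0))"
        using S(1) that by (intro sum.cong) (auto simp: echelon_def)
      also have "\<dots> = u t" using fS that by (simp add: mult_delta_right cong: if_cong)
      finally show ?thesis unfolding v'_def by simp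
    qed
    from echelon_extend[OF K subfld_valuation_ring[OF K] S(1) U(1)[OF v'U] v'S] ne u(2)
    obtain p where p: "p < n" "p \<notin> S" "v' p \<noteq> 0"
    and e: "echelon K n (insert p S)
      (\<lambda>s. if s = p then (\<lambda>k. v' k / v' p) else (\<lambda>k. w s k - w s p * (v' k / v' p)))"
      by (auto simp: v'_def)
    have c: "(\<lambda>k. v' k / v' p) \<in> U"
      using U(3)[OF v'U, of "inverse (v' p)"] U(1)[OF v'U] p(1) subfldD(6)[OF K]
      by (simp add: vin_def field_simps)
    have "(\<lambda>k. w s k - w s p * (v' k / v' p)) \<in> U" if "s \<in> S" for s
      using U(2)[OF _ U(3)[OF c]] S(2) that U(1)[of "w s"] p(1) by (auto simp: vin_def)
    with e c p(2) have "?P (card (insert p S))"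
      by (intro exI[of _ "insert p S"]
        exI[of _ "\<lambda>s. if s = p then (\<lambda>k. v' k / v' p) else (\<lambda>k. w s k - w s p * (v' k / v' p))"]) auto
    then have "card (insert p S) \<le> m" by (rule m(2))
    then show False using p(2) fS S(3) by simp
  qed
  then show ?thesis using S by blast
qed



section \<open>Totally isotropic subspaces\<close>

definition qv :: "nat \<Rightarrow> (nat \<Rightarrow> nat \<Rightarrow> 'w::field) \<Rightarrow> (nat \<Rightarrow> 'w) \<Rightarrow> 'w" where
  "qv n c x = (\<Sum>j<n. \<Sum>i\<le>j. c i j * x i * x j)"

text \<open>The diagonal is kept and contributes \<open>2 * c j j * x j * y j\<close>. So this is
  the polar form in every characteristic, and it becomes alternating when
  \<open>2 = 0\<close>.\<close>

definition pol :: "nat \<Rightarrow> (nat \<Rightarrow> nat \<Rightarrow> 'w::field) \<Rightarrow> (nat \<Rightarrow> 'w) \<Rightarrow> (nat \<Rightarrow> 'w) \<Rightarrow> 'w" where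
  "pol n c x y = (\<Sum>j<n. \<Sum>i\<le>j. c i j * (x i * y j + y i * x j))"

definition cin :: "'w set \<Rightarrow> nat \<Rightarrow> (nat \<Rightarrow> nat \<Rightarrow> 'w) \<Rightarrow> bool" where
  "cin K n c \<longleftrightarrow> (\<forall>j<n. \<forall>i\<le>j. c i j \<in> K)"

lemma qv_add: "qv n c (\<lambda>k. x k + y k) = qv n c x + qv n c y + pol n c x y"
  unfolding qv_def pol_def by (simp add: sum.distrib[symmetric] algebra_simps)

lemma qv_scale: "qv n c (\<lambda>k. a * x k) = a\<^sup>2 * qv n c x"
  unfolding qv_def by (simp add: sum_distrib_left power2_eq_square algebra_simps)

lemma qv_zero [simp]: "qv n c (\<lambda>k. 0) = 0"
  unfolding qv_def by simp

lemma qv_cong: "(\<And>i. i < n \<Longrightarrow> x i = y i) \<Longrightarrow> qv n c x = qv n c y"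
  unfolding qv_def by (intro sum.cong) auto

lemma qv_ccong: "(\<And>i j. i \<le> j \<Longrightarrow> j < n \<Longrightarrow> c i j = d i j) \<Longrightarrow> qv n c x = qv n d x"
  unfolding qv_def by (intro sum.cong) auto

lemma pol_cong: "(\<And>i. i < n \<Longrightarrow> x i = x' i) \<Longrightarrow> (\<And>i. i < n \<Longrightarrow> y i = y' i) \<Longrightarrow> pol n c x y = pol n c x' y'"
  unfolding pol_def by (intro sum.cong) auto

lemma pol_sym: "pol n c x y = pol n c y x"
  unfolding pol_def by (simp add: algebra_simps)

lemma pol_add: "pol n c x (\<lambda>k. y k + z k) = pol n c x y + pol n c x z"
  unfolding pol_def by (simp add: sum.distrib[symmetric] algebra_simps)

lemma pol_scale: "pol n c x (\<lambda>k. a * y k) = a * pol n c x y"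
  unfolding pol_def by (simp add: sum_distrib_left algebra_simps)

lemma pol_zero [simp]: "pol n c x (\<lambda>k. 0) = 0" "pol n c (\<lambda>k. 0) x = 0"
  unfolding pol_def by simp_all

lemma pol_add2: "pol n c (\<lambda>k. y k + z k) x = pol n c y x + pol n c z x"
  by (metis pol_add pol_sym)

lemma pol_scale2: "pol n c (\<lambda>k. a * y k) x = a * pol n c y x"
  by (metis pol_scale pol_sym)

lemma pol_diff: "pol n c x (\<lambda>k. y k - z k) = pol n c x y - pol n c x z"
  using pol_add[of n c x y "\<lambda>k. - 1 * z k"] by (simp only: pol_scale) simp

lemma pol_diff2: "pol n c (\<lambda>k. y k - z k) x = pol n c y x - pol n c z x"
  by (metis pol_diff pol_sym)

lemma pol_sum: "pol n c x (\<lambda>k. \<Sum>i\<in>I. a i * v i k) = (\<Sum>i\<in>I. a i * pol n c x (v i))"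
proof (induction I rule: infinite_finite_induct)
  case (insert i I)
  then show ?case using pol_add[of n c x "\<lambda>k. a i * v i k" "\<lambda>k. \<Sum>i\<in>I. a i * v i k"] pol_scale by simp
qed simp_all

lemma pol_sum2: "pol n c (\<lambda>k. \<Sum>i\<in>I. a i * v i k) x = (\<Sum>i\<in>I. a i * pol n c (v i) x)"
  using pol_sum[of n c x a v I] by (simp add: pol_sym)

lemma pol_self: "pol n c x x = 2 * qv n c x"
  unfolding pol_def qv_def by (simp add: sum_distrib_left algebra_simps)

lemma pol_self_char2: "(2::'w::field) = 0 \<Longrightarrow> pol n c (x :: nat \<Rightarrow> 'w) x = 0"
  by (simp add: pol_self)

lemma qv_in: "subfld K \<Longrightarrow> cin K n c \<Longrightarrow> vin K n x \<Longrightarrow> qv n c x \<in> K"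
  unfolding qv_def cin_def vin_def by (auto intro!: subfld_sum subfldD(4)[of K])

lemma pol_in: "subfld K \<Longrightarrow> cin K n c \<Longrightarrow> vin K n x \<Longrightarrow> vin K n y \<Longrightarrow> pol n c x y \<in> K"
  unfolding pol_def cin_def vin_def by (auto intro!: subfld_sum subfldD(3,4)[of K])

text \<open>Values and polar products of the generators determine the form on their span. Compared
  with \<open>qv_split\<close>, this decides when a matrix is an isometry.\<close>

lemma qv_sum: "qv n c (\<lambda>k. \<Sum>i<(m::nat). u i * b i k) =
  (\<Sum>j<m. (u j)\<^sup>2 * qv n c (b j) + (\<Sum>i<j. u i * u j * pol n c (b i) (b j)))"
proof (induction m)
  case (Suc m)
  have "qv n c (\<lambda>k. \<Sum>i<Suc m. u i * b i k) = qv n c (\<lambda>k. (\<Sum>i<m. u i * b i k) + u m * b m k)" by simp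
  also have "\<dots> = qv n c (\<lambda>k. \<Sum>i<m. u i * b i k) + (u m)\<^sup>2 * qv n c (b m)
     + pol n c (\<lambda>k. \<Sum>i<m. u i * b i k) (\<lambda>k. u m * b m k)"
    by (simp only: qv_add qv_scale)
  also have "pol n c (\<lambda>k. \<Sum>i<m. u i * b i k) (\<lambda>k. u m * b m k) = (\<Sum>i<m. u i * u m * pol n c (b i) (b m))"
    by (simp add: pol_scale pol_sum2 sum_distrib_left algebra_simps)
  finally show ?case using Suc by simp
qed simp

lemma qv_split: "qv n c u = (\<Sum>j<n. (u j)\<^sup>2 * c j j + (\<Sum>i<j. u i * u j * c i j))"
  unfolding qv_def
proof (rule sum.cong)
  fix j :: nat
  have "{..j} = insert j {..<j}" by auto
  then show "(\<Sum>i\<le>j. c i j * u i * u j) = (u j)\<^sup>2 * c j j + (\<Sum>i<j. u i * u j * c i j)"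
    by (simp add: power2_eq_square algebra_simps)
qed simp

text \<open>Zeros of \<open>q\<close> need not span a space of zeros; the polar products must vanish
  too. Both conditions together suffice by \<open>isotropic_family_lin_span\<close>.\<close>

definition isotropic_family :: "nat \<Rightarrow> (nat \<Rightarrow> nat \<Rightarrow> 'w::field) \<Rightarrow> 'i set \<Rightarrow> ('i \<Rightarrow> nat \<Rightarrow> 'w) \<Rightarrow> bool" where
  "isotropic_family n c I v \<longleftrightarrow> (\<forall>s\<in>I. qv n c (v s) = 0 \<and> (\<forall>t\<in>I. pol n c (v s) (v t) = 0))"

lemma isotropic_family_lin_span_pol:
  assumes "isotropic_family n c I v" "x \<in> lin_span K I v" "y \<in> lin_span K I v"
  shows "pol n c x y = 0"
proof -
  obtain a b where "x = (\<lambda>k. \<Sum>i\<in>I. a i * v i k)" "y = (\<lambda>k. \<Sum>i\<in>I. b i * v i k)"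
    using assms unfolding lin_span_def by blast
  then show ?thesis using assms(1) unfolding isotropic_family_def by (simp add: pol_sum pol_sum2)
qed

lemma isotropic_family_lin_span:
  assumes "isotropic_family n c I v" "x \<in> lin_span K I v"
  shows "qv n c x = 0"
proof -
  obtain a where a: "x = (\<lambda>k. \<Sum>i\<in>I. a i * v i k)"
    using assms unfolding lin_span_def by blast
  have "qv n c (\<lambda>k. \<Sum>i\<in>I. a i * v i k) = 0" using assms(1)
  proof (induction I rule: infinite_finite_induct)
    case (insert i I)
    have "qv n c (\<lambda>k. \<Sum>i\<in>insert i I. a i * v i k) = qv n c (\<lambda>k. a i * v i k + (\<Sum>i\<in>I. a i * v i k))"
      using insert by simp
    also have "\<dots> = (a i)\<^sup>2 * qv n c (v i) + qv n c (\<lambda>k. \<Sum>i\<in>I. a i * v i k)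
       + a i * (\<Sum>j\<in>I. a j * pol n c (v i) (v j))"
      by (simp only: qv_add qv_scale pol_scale2 pol_sum)
    also have "\<dots> = 0" using insert by (simp add: isotropic_family_def)
    finally show ?case .
  qed simp_all
  then show ?thesis using a by simp
qed

text \<open>Any independent family would define the same notion, by \<open>tot_isotropic_I\<close>.
  The echelon form is built in because doubling a subspace and splitting it over a quadratic
  extension both work with the pivot entries.\<close>

definition tot_isotropic :: "'w::field set \<Rightarrow> nat \<Rightarrow> (nat \<Rightarrow> nat \<Rightarrow> 'w) \<Rightarrow> nat \<Rightarrow> bool" where
  "tot_isotropic K n c m \<longleftrightarrow> (\<exists>S w. card S = m \<and> echelon K n S w \<and> isotropic_family n c S w)"

lemma tot_isotropic_I:
  assumes K: "subfld K" and "finite I" "\<And>i. i \<in> I \<Longrightarrow> vin K n (v i)" "lin_indep K n I v" "isotropic_family n c I v"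
  shows "tot_isotropic K n c (card I)"
proof -
  obtain S w where S: "card S = card I" "echelon K n S w" "\<forall>s\<in>S. w s \<in> lin_span K I v"
    using echelon_exists[OF K subfld_valuation_ring[OF K] assms(2-4)] by blast
  have "isotropic_family n c S w" unfolding isotropic_family_def
    using S(3) isotropic_family_lin_span[OF assms(5)] isotropic_family_lin_span_pol[OF assms(5)] by blast
  then show ?thesis unfolding tot_isotropic_def using S by blast
qed

lemma tot_isotropic_mono: "tot_isotropic K n c m \<Longrightarrow> K \<subseteq> L \<Longrightarrow> tot_isotropic L n c m"
  unfolding tot_isotropic_def echelon_def vin_def by blast

lemma tot_isotropic_le: "tot_isotropic K n c m \<Longrightarrow> m' \<le> m \<Longrightarrow> tot_isotropic K n c m'"
proof -
  assume "tot_isotropic K n c m" "m' \<le> m"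
  then obtain S w where S: "card S = m" "echelon K n S w" "isotropic_family n c S w" unfolding tot_isotropic_def by blast
  obtain T where "T \<subseteq> S" "card T = m'" using \<open>m' \<le> m\<close> S(1) obtain_subset_with_card_n by metis
  then show ?thesis using S echelon_subset unfolding tot_isotropic_def isotropic_family_def by blast
qed

definition aniso :: "'w::field set \<Rightarrow> nat \<Rightarrow> (nat \<Rightarrow> nat \<Rightarrow> 'w) \<Rightarrow> bool" where
  "aniso K n c \<longleftrightarrow> (\<forall>x. vin K n x \<and> qv n c x = 0 \<longrightarrow> (\<forall>i<n. x i = 0))"

lemma anisD: "aniso K n c \<Longrightarrow> vin K n x \<Longrightarrow> qv n c x = 0 \<Longrightarrow> i < n \<Longrightarrow> x i = 0"
  unfolding aniso_def by blast

lemma aniso_tot_isotropic: "aniso K n c \<Longrightarrow> tot_isotropic K n c m \<Longrightarrow> m = 0"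
proof (rule ccontr)
  assume a: "aniso K n c" "tot_isotropic K n c m" "m \<noteq> 0"
  then obtain S w s where S: "echelon K n S w" "isotropic_family n c S w" "s \<in> S" unfolding tot_isotropic_def
    by (metis card.empty ex_in_conv)
  then have "w s s = 0" using a(1) by (intro anisD[of K n c "w s" s]) (auto simp: echelon_def isotropic_family_def)
  then show False using S by (auto simp: echelon_def)
qed

lemma not_aniso_tot_isotropic:
  assumes K: "subfld K" and c2: "(2::'w::field) = 0" and "\<not> aniso K n (c :: nat \<Rightarrow> nat \<Rightarrow> 'w)"
  shows "tot_isotropic K n c 1"
proof -
  obtain x k where x: "vin K n x" "qv n c x = 0" "k < n" "x k \<noteq> 0" using assms(3) unfolding aniso_def by blast
  have "tot_isotropic K n c (card {0::nat})"
    by (rule tot_isotropic_I[OF K, of _ n "\<lambda>_. x"]) (use x pol_self_char2[OF c2] in \<open>auto simp: lin_indep_def isotropic_family_def\<close>)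
  then show ?thesis by simp
qed

text \<open>A relation \<open>P\<close> as below is the graph of a place \<open>L \<rightarrow> K'\<close> over the field of the coefficients.\<close>

lemma tot_isotropic_place:
  assumes L: "subfld L" and P: "\<And>u u'. P u u' \<Longrightarrow> u \<in> L \<and> u' \<in> K'"
    "\<And>u u' v v'. P u u' \<Longrightarrow> P v v' \<Longrightarrow> P (u + v) (u' + v')"
    "\<And>u u' v v'. P u u' \<Longrightarrow> P v v' \<Longrightarrow> P (u * v) (u' * v')"
    "\<And>u'. P 0 u' \<Longrightarrow> u' = 0"
    "\<And>u. u \<in> L \<Longrightarrow> u \<noteq> 0 \<Longrightarrow> \<exists>u'. P u u' \<or> P (inverse u) u'"
    "\<And>e. e \<in> E \<Longrightarrow> P e e" and E: "subfld E" and c: "cin E n c"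
    and tot_isotropic: "tot_isotropic L n c m"
  shows "tot_isotropic K' n c m"
proof -
  have E0: "P 0 0" "P 1 1" "P (- 1) (- 1)" using P(6) subfldD[OF E] by blast+
  have neg: "P (- u) (- u')" if "P u u'" for u u' using P(3)[OF E0(3) that] by simp
  \<comment> \<open>Values are assumed unique only at 0; additivity gives uniqueness
    everywhere.\<close>
  have uniq: "u' = v'" if "P u u'" "P u v'" for u u' v'
    using P(4)[of "u' - v'"] P(2)[OF that(1) neg[OF that(2)]] by simp
  define R where "R = {u. \<exists>u'. P u u'}"
  have R: "valuation_ring L R" unfolding valuation_ring_def
  proof (intro conjI ballI impI)
    show "R \<subseteq> L" "0 \<in> R" "1 \<in> R" using P(1) E0 unfolding R_def by blast+
    show "x + y \<in> R" "x * y \<in> R" if "x \<in> R" "y \<in> R" for x y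
      using P(2)[of x _ y] P(3)[of x _ y] that unfolding R_def by blast+
    show "- x \<in> R" if "x \<in> R" for x using neg[of x] that unfolding R_def by blast
    show "x \<in> R \<or> inverse x \<in> R" if "x \<in> L" "x \<noteq> 0" for x
      using P(5)[OF that] unfolding R_def by blast
  qed
  obtain S w where S: "card S = m" "echelon L n S w" "isotropic_family n c S w" using tot_isotropic unfolding tot_isotropic_def by blast
  \<comment> \<open>The basis is renormalised over the valuation ring of the place, so that every
    entry has a value.\<close>
  obtain S' w' where S': "card S' = card S" "echelon R n S' w'" "\<forall>s\<in>S'. w' s \<in> lin_span L S w"
    using echelon_exists[OF L R echelon_finite[OF S(2)] _ echelon_lin_indep[OF S(2)]] S(2)
    unfolding echelon_def by blast
  have iso: "isotropic_family n c S' w'" unfolding isotropic_family_def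
    using S'(3) isotropic_family_lin_span[OF S(3)] isotropic_family_lin_span_pol[OF S(3)] by blast
  have "\<forall>s k. \<exists>r. s \<in> S' \<and> k < n \<longrightarrow> P (w' s k) r" using S'(2) unfolding echelon_def vin_def R_def by blast
  then obtain r where r: "\<And>s k. s \<in> S' \<Longrightarrow> k < n \<Longrightarrow> P (w' s k) (r s k)" by metis
  have sub: "S' \<subseteq> {..<n}" using S'(2) unfolding echelon_def by blast
  have sum: "P (sum f I) (sum g I)" if "\<And>i. i \<in> I \<Longrightarrow> P (f i) (g i)" for f g and I :: "nat set"
    using that by (induction I rule: infinite_finite_induct) (auto intro: P E0)
  have q: "P (qv n c (w' s)) (qv n c (r s))" if "s \<in> S'" for s
    unfolding qv_def using c that by (intro sum P(3) P(6) r) (auto simp: cin_def)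
  have b: "P (pol n c (w' s) (w' t)) (pol n c (r s) (r t))" if "s \<in> S'" "t \<in> S'" for s t
    unfolding pol_def using c that by (intro sum P(3) P(2) P(6) r) (auto simp: cin_def)
  \<comment> \<open>The pivot entries 0 and 1 keep their values, so no dimension is lost.\<close>
  have "echelon K' n S' r" unfolding echelon_def
  proof (intro conjI ballI sub)
    fix s assume s: "s \<in> S'"
    show "vin K' n (r s)" unfolding vin_def using r[OF s] P(1) by blast
    fix t assume t: "t \<in> S'"
    then have "P (w' s t) (r s t)" using r s sub by blast
    moreover have "w' s t = (if s = t then 1 else 0)" using S'(2) s t unfolding echelon_def by blast
    ultimately show "r s t = (if s = t then 1 else 0)" using uniq E0 by (metis (full_types))
  qed
  moreover have "isotropic_family n c S' r" unfolding isotropic_family_def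
    using q b iso P(4) unfolding isotropic_family_def by metis
  ultimately show ?thesis unfolding tot_isotropic_def using S'(1) S(1) by blast
qed

text \<open>Row \<open>B i\<close> is the image of the basis vector \<open>i\<close>; the right
  inverse \<open>C\<close> makes the map injective over every larger field. The diagonal is compared
  through \<open>qv\<close> because in characteristic 2 the polar form does not determine it. All
  entries lie in \<open>K\<close>, so the embedding extends to every field above
  \<open>K\<close>.\<close>

definition qembed :: "'w::field set \<Rightarrow> nat \<Rightarrow> (nat \<Rightarrow> nat \<Rightarrow> 'w) \<Rightarrow> nat \<Rightarrow> (nat \<Rightarrow> nat \<Rightarrow> 'w) \<Rightarrow> bool" where
  "qembed K n c n' c' \<longleftrightarrow> (\<exists>B C. (\<forall>i<n. vin K n' (B i)) \<and> (\<forall>k<n'. vin K n (C k)) \<and>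
     (\<forall>i<n. \<forall>j<n. (\<Sum>k<n'. B i k * C k j) = (if i = j then 1 else 0)) \<and>
     (\<forall>i<n. qv n' c' (B i) = c i i) \<and> (\<forall>j<n. \<forall>i<j. pol n' c' (B i) (B j) = c i j))"

lemma qembedE:
  assumes "qembed F n c n' c'" and F: "F \<subseteq> K" and K: "subfld K"
  obtains T where "\<And>u. vin K n u \<Longrightarrow> vin K n' (T u)" "\<And>u. qv n' c' (T u) = qv n c u"
    "\<And>u u'. pol n' c' (T u) (T u') = pol n c u u'"
    "\<And>a u (I :: nat set). T (\<lambda>k. \<Sum>i\<in>I. a i * u i k) = (\<lambda>k. \<Sum>i\<in>I. a i * T (u i) k)"
    "\<And>u i. \<forall>k<n'. T u k = 0 \<Longrightarrow> i < n \<Longrightarrow> u i = 0"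
proof -
  obtain B C where B: "\<forall>i<n. vin F n' (B i)" "\<forall>k<n'. vin F n (C k)"
     "\<forall>i<n. \<forall>j<n. (\<Sum>k<n'. B i k * C k j) = (if i = j then 1 else 0)"
     "\<forall>i<n. qv n' c' (B i) = c i i" "\<forall>j<n. \<forall>i<j. pol n' c' (B i) (B j) = c i j"
    using assms(1) unfolding qembed_def by blast
  define T where "T = (\<lambda>u k. \<Sum>i<n. u i * B i k)"
  have 1: "vin K n' (T u)" if "vin K n u" for u
    unfolding T_def vin_def using that B(1) F unfolding vin_def by (auto intro!: subfld_sum[OF K] subfldD(4)[OF K])
  have 2: "qv n' c' (T u) = qv n c u" for u
    unfolding T_def qv_sum[of n' c'] qv_split[of n c u] using B(4,5) by (intro sum.cong arg_cong2[of _ _ _ _ "(+)"]) auto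
  have Tadd: "T (\<lambda>k. u k + u' k) = (\<lambda>k. T u k + T u' k)" for u u'
    unfolding T_def by (simp add: sum.distrib algebra_simps)
  have 3: "pol n' c' (T u) (T u') = pol n c u u'" for u u'
    using qv_add[of n' c' "T u" "T u'"] qv_add[of n c u u'] 2[of u] 2[of u'] 2[of "\<lambda>k. u k + u' k"]
    by (simp add: Tadd)
  have 4: "T (\<lambda>k. \<Sum>i\<in>I. a i * u i k) = (\<lambda>k. \<Sum>i\<in>I. a i * T (u i) k)" for a u and I :: "nat set"
    unfolding T_def
    by (rule ext) (simp add: sum_distrib_left sum_distrib_right sum.swap[of _ I] mult.assoc)
  have 5: "u i = 0" if "\<forall>k<n'. T u k = 0" "i < n" for u i
  proof -
    have "0 = (\<Sum>k<n'. T u k * C k i)" using that by simp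
    also have "\<dots> = (\<Sum>k<n'. \<Sum>j<n. u j * (B j k * C k i))"
      unfolding T_def by (simp add: sum_distrib_right mult.assoc)
    also have "\<dots> = (\<Sum>j<n. u j * (\<Sum>k<n'. B j k * C k i))"
      unfolding sum_distrib_left by (rule sum.swap)
    also have "\<dots> = (\<Sum>j<n. u j * (if j = i then 1 else 0))" using B(3) that(2) by (intro sum.cong) auto
    also have "\<dots> = u i" using that(2) by (simp add: mult_delta_right cong: if_cong)
    finally show ?thesis by simp
  qed
  show thesis using that[of T] 1 2 3 4 5 by blast
qed

lemma qembed_tot_isotropic:
  assumes e: "qembed F n c n' c'" and F: "F \<subseteq> K" and K: "subfld K" and "tot_isotropic K n c m"
  shows "tot_isotropic K n' c' m"
proof -
  obtain S w where S: "card S = m" "echelon K n S w" "isotropic_family n c S w" using assms(4) unfolding tot_isotropic_def by blast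
  obtain T where T: "\<And>u. vin K n u \<Longrightarrow> vin K n' (T u)" "\<And>u. qv n' c' (T u) = qv n c u"
    "\<And>u u'. pol n' c' (T u) (T u') = pol n c u u'"
    "\<And>a u (I :: nat set). T (\<lambda>k. \<Sum>i\<in>I. a i * u i k) = (\<lambda>k. \<Sum>i\<in>I. a i * T (u i) k)"
    "\<And>u i. \<forall>k<n'. T u k = 0 \<Longrightarrow> i < n \<Longrightarrow> u i = 0"
    by (rule qembedE[OF e F K]) (rule that; assumption)
  have "tot_isotropic K n' c' (card S)"
  proof (rule tot_isotropic_I[OF K echelon_finite[OF S(2)], of n' "\<lambda>s. T (w s)"])
    show "vin K n' (T (w s))" if "s \<in> S" for s using that S(2) T(1) unfolding echelon_def by blast
    show "isotropic_family n' c' S (\<lambda>s. T (w s))" using S(3) T(2,3) unfolding isotropic_family_def by simp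
    show "lin_indep K n' S (\<lambda>s. T (w s))" unfolding lin_indep_def
    proof safe
      fix a i assume a: "\<forall>i\<in>S. a i \<in> K" "\<forall>k<n'. (\<Sum>i\<in>S. a i * T (w i) k) = 0" "i \<in> S"
      have "\<forall>k<n'. T (\<lambda>k. \<Sum>i\<in>S. a i * w i k) k = 0" using a(2) unfolding T(4) .
      then have "(\<Sum>i\<in>S. a i * w i k) = 0" if "k < n" for k using T(5) that by blast
      then show "a i = 0" using indepD[OF echelon_lin_indep[OF S(2)], of a i] a by blast
    qed
  qed
  then show ?thesis using S(1) by simp
qed

lemma qembed_aniso:
  assumes e: "qembed F n c n' c'" and F: "F \<subseteq> K" and K: "subfld K" and a: "aniso K n' c'"
  shows "aniso K n c"
  unfolding aniso_def
proof safe
  fix x i assume x: "vin K n x" "qv n c x = 0" "i < n"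
  show "x i = 0"
  proof (rule qembedE[OF e F K])
    fix T assume T: "\<And>u. vin K n u \<Longrightarrow> vin K n' (T u)" "\<And>u. qv n' c' (T u) = qv n c u"
      "\<And>u i. \<forall>k<n'. T u k = 0 \<Longrightarrow> i < n \<Longrightarrow> u i = 0"
    show "x i = 0" by (rule T(3)[OF _ x(3)]) (use anisD[OF a T(1)[OF x(1)]] T(2) x(2) in simp)
  qed
qed


section \<open>Simple extensions and specialisation\<close>

definition pin :: "'w::field set \<Rightarrow> 'w poly \<Rightarrow> bool" where
  "pin K p \<longleftrightarrow> (\<forall>i. Polynomial.coeff p i \<in> K)"

definition transcendental :: "'w::field set \<Rightarrow> 'w \<Rightarrow> bool" where
  "transcendental K t \<longleftrightarrow> (\<forall>p. pin K p \<and> poly p t = 0 \<longrightarrow> p = 0)"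

definition adj :: "'w::field set \<Rightarrow> 'w \<Rightarrow> 'w set" where
  "adj K t = {poly p t / poly r t | p r. pin K p \<and> pin K r \<and> poly r t \<noteq> 0}"

text \<open>Only the span of 1 and \<open>z\<close>. By \<open>subfld_qadj\<close> it is a field
  when \<open>z\<close> lies outside \<open>K\<close> and satisfies a monic quadratic equation over
  \<open>K\<close>.\<close>

definition qadj :: "'w::field set \<Rightarrow> 'w \<Rightarrow> 'w set" where
  "qadj K z = {a + b * z | a b. a \<in> K \<and> b \<in> K}"

lemma pin_intros:
  assumes K: "subfld K"
  shows "pin K 0" "pin K 1" "a \<in> K \<Longrightarrow> pin K p \<Longrightarrow> pin K (pCons a p)"
    "pin K p \<Longrightarrow> pin K r \<Longrightarrow> pin K (p + r)" "pin K p \<Longrightarrow> pin K r \<Longrightarrow> pin K (p * r)"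
    "pin K p \<Longrightarrow> pin K (- p)" "pin K p \<Longrightarrow> pin K r \<Longrightarrow> pin K (p - r)"
    "pin K p \<Longrightarrow> pin K (p ^ m)"
proof -
  note c = subfldD[OF K]
  show 0: "pin K 0" "pin K 1" by (auto simp: pin_def c)
  show "a \<in> K \<Longrightarrow> pin K p \<Longrightarrow> pin K (pCons a p)" by (auto simp: pin_def coeff_pCons split: nat.split)
  show "pin K p \<Longrightarrow> pin K r \<Longrightarrow> pin K (p + r)" by (auto simp: pin_def c)
  show m: "pin K p \<Longrightarrow> pin K r \<Longrightarrow> pin K (p * r)" for p r
    by (auto simp: pin_def coeff_mult intro!: subfld_sum[OF K] c(4))
  show "pin K p \<Longrightarrow> pin K (- p)" by (auto simp: pin_def c)
  show "pin K p \<Longrightarrow> pin K r \<Longrightarrow> pin K (p - r)" by (auto simp: pin_def c)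
  show "pin K p \<Longrightarrow> pin K (p ^ m)" by (induction m) (auto simp: 0 m)
qed

lemma pin_mono: "pin K p \<Longrightarrow> K \<subseteq> L \<Longrightarrow> pin L p"
  unfolding pin_def by blast

lemma pin_poly: "subfld K \<Longrightarrow> pin K p \<Longrightarrow> a \<in> K \<Longrightarrow> poly p a \<in> K"
  unfolding poly_altdef pin_def by (intro subfld_sum subfldD(4)[of K] subfldD(9)[of K]) auto

lemma pin_pCons: "pin K (pCons a p) \<Longrightarrow> a \<in> K \<and> pin K p"
  unfolding pin_def by (metis coeff_pCons_0 coeff_pCons_Suc)

lemma transcendental_mono: "transcendental K t \<Longrightarrow> F \<subseteq> K \<Longrightarrow> transcendental F t"
  unfolding transcendental_def using pin_mono by blast

lemma transcendental_notin: "subfld K \<Longrightarrow> transcendental K t \<Longrightarrow> t \<notin> K"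
proof
  assume a: "subfld K" "transcendental K t" "t \<in> K"
  then have "pin K [:- t, 1:]" by (simp add: pin_intros subfldD)
  then show False using a(2) unfolding transcendental_def by fastforce
qed

lemma transcendental_affine:
  assumes K: "subfld K" and t: "transcendental K t" and "a \<in> K" "b \<in> K" "b \<noteq> 0"
  shows "transcendental K (a + b * t)"
  unfolding transcendental_def
proof safe
  fix p assume p: "pin K p" "poly p (a + b * t) = 0"
  have pc: "pin K (pcompose p [:a, b:])" if "pin K p" for p
    using that
  proof (induction p)
    case (pCons d p)
    then have "d \<in> K" "pin K p" using pin_pCons by blast+
    then show ?case using pCons assms
      by (simp add: pcompose_pCons pin_intros[OF K] subfldD[OF K] del: mult_pCons_left)
  qed (simp add: pin_intros[OF K])
  have "poly (pcompose p [:a, b:]) t = 0" using p(2) by (simp add: poly_pcompose algebra_simps)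
  then have "pcompose p [:a, b:] = 0" using t pc[OF p(1)] unfolding transcendental_def by blast
  then show "p = 0" using assms(5) by (simp add: pcompose_eq_0_iff)
qed

lemma adjI: "pin K p \<Longrightarrow> pin K r \<Longrightarrow> poly r t \<noteq> 0 \<Longrightarrow> x = poly p t / poly r t \<Longrightarrow> x \<in> adj K t"
  unfolding adj_def by blast

lemma adj_base: "subfld K \<Longrightarrow> K \<subseteq> adj K t"
proof
  fix x assume "subfld K" "x \<in> K"
  then show "x \<in> adj K t" by (intro adjI[of K "[:x:]" 1]) (simp_all add: pin_intros)
qed

lemma adj_gen: "subfld K \<Longrightarrow> t \<in> adj K t"
  by (rule adjI[of K "[:0, 1:]" 1]) (simp_all add: pin_intros subfldD)

lemma adj_least: "subfld L \<Longrightarrow> K \<subseteq> L \<Longrightarrow> t \<in> L \<Longrightarrow> adj K t \<subseteq> L"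
  unfolding adj_def using pin_mono[of K _ L] pin_poly[of L _ t] subfldD(8)[of L] by fastforce

lemma subfld_adj: assumes K: "subfld K" shows "subfld (adj K t)"
  unfolding subfld_def
proof (intro conjI ballI)
  show "0 \<in> adj K t" "1 \<in> adj K t" using adj_base[OF K] subfldD[OF K] by blast+
  fix x assume "x \<in> adj K t"
  then obtain p r where x: "x = poly p t / poly r t" "pin K p" "pin K r" "poly r t \<noteq> 0" unfolding adj_def by blast
  show "- x \<in> adj K t" by (rule adjI[of K "- p" r]) (use x in \<open>simp_all add: pin_intros[OF K]\<close>)
  show "inverse x \<in> adj K t"
  proof (cases "poly p t = 0")
    case True
    then show ?thesis using x \<open>0 \<in> adj K t\<close> by simp
  next
    case False
    then show ?thesis using x by (intro adjI[of K r p]) simp_all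
  qed
  fix y assume "y \<in> adj K t"
  then obtain p' r' where y: "y = poly p' t / poly r' t" "pin K p'" "pin K r'" "poly r' t \<noteq> 0" unfolding adj_def by blast
  have "x + y = poly (p * r' + p' * r) t / poly (r * r') t" "x * y = poly (p * p') t / poly (r * r') t"
    unfolding x(1) y(1) using x(4) y(4) by (simp_all add: add_frac_eq algebra_simps)
  then show "x + y \<in> adj K t" "x * y \<in> adj K t"
    using x(2-4) y(2-4) pin_intros[OF K] adjI[of K "p * r' + p' * r" "r * r'"] adjI[of K "p * p'" "r * r'"] by auto
qed

lemma adj_mono: "subfld L \<Longrightarrow> K \<subseteq> L \<Longrightarrow> adj K t \<subseteq> adj L t"
  using adj_least[OF subfld_adj, of L K t t] adj_base[of L t] adj_gen[of L t] by auto

lemma qadj_base: "subfld K \<Longrightarrow> K \<subseteq> qadj K z"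
  unfolding qadj_def using subfldD(1)[of K] by force

lemma qadj_gen: "subfld K \<Longrightarrow> z \<in> qadj K z"
  unfolding qadj_def using subfldD(1,2)[of K] by force

lemma qadjI: "a \<in> K \<Longrightarrow> b \<in> K \<Longrightarrow> x = a + b * z \<Longrightarrow> x \<in> qadj K z"
  unfolding qadj_def by blast

lemma qadj_least: "subfld L \<Longrightarrow> K \<subseteq> L \<Longrightarrow> z \<in> L \<Longrightarrow> qadj K z \<subseteq> L"
  unfolding qadj_def using subfldD(3,4)[of L] by (auto simp: subset_iff)

text \<open>The other root of the equation is \<open>f - z\<close>, so the second factor is the
  conjugate of the first and the right side is the norm.\<close>

lemma quadratic_norm:
  fixes a b z :: "'w::field"
  assumes "z ^ 2 = f * z + g"
  shows "(a + b * z) * (a + b * f - b * z) = a ^ 2 + a * b * f - b ^ 2 * g"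
proof -
  have "(a + b * z) * (a + b * f - b * z) = a ^ 2 + a * b * f + b ^ 2 * (f * z - z ^ 2)"
    by (simp add: algebra_simps power2_eq_square)
  also have "f * z - z ^ 2 = - g" using assms by simp
  finally show ?thesis by simp
qed

text \<open>As \<open>z\<close> lies outside \<open>K\<close>, 1 and \<open>z\<close> are
  independent over \<open>K\<close>. This applies to the element and to its conjugate, and the norm
  is their product.\<close>

lemma norm_nonzero:
  assumes K: "subfld K" and z: "z ^ 2 = f * z + g" "f \<in> K" "z \<notin> K" and ab: "a \<in> K" "b \<in> K" "a \<noteq> 0 \<or> b \<noteq> 0"
  shows "a ^ 2 + a * b * f - b ^ 2 * g \<noteq> 0" "a + b * z \<noteq> 0"
proof -
  have 1: "a + b * z \<noteq> 0" if "a \<in> K" "b \<in> K" "a \<noteq> 0 \<or> b \<noteq> 0" for a b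
  proof
    assume "a + b * z = 0"
    then have "b \<noteq> 0" "b * z = - a" using that by (auto simp: eq_neg_iff_add_eq_0 algebra_simps)
    then have "z = - a / b" by (metis nonzero_mult_div_cancel_left)
    moreover have "- a / b \<in> K" using that by (simp add: subfldD[OF K])
    ultimately show False using z(3) by simp
  qed
  show "a + b * z \<noteq> 0" using 1 ab by blast
  have "(a + b * f) + (- b) * z \<noteq> 0" by (rule 1) (use ab z(2) subfldD[OF K] in auto)
  then show "a ^ 2 + a * b * f - b ^ 2 * g \<noteq> 0"
    unfolding quadratic_norm[OF z(1), symmetric] using 1[OF ab] by simp
qed

lemma subfld_qadj:
  assumes K: "subfld K" and z: "z ^ 2 = f * z + g" "f \<in> K" "g \<in> K" "z \<notin> K"
  shows "subfld (qadj K z)"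
  unfolding subfld_def
proof (intro conjI ballI)
  note c = subfldD[OF K]
  show "0 \<in> qadj K z" "1 \<in> qadj K z" using qadj_base[OF K] c by blast+
  fix x assume "x \<in> qadj K z"
  then obtain a b where x: "x = a + b * z" "a \<in> K" "b \<in> K" unfolding qadj_def by blast
  have "- x = - a + (- b) * z" using x by simp
  then show "- x \<in> qadj K z" using x by (intro qadjI[of "- a" K "- b"]) (simp_all add: c)
  show "inverse x \<in> qadj K z"
  proof (cases "a \<noteq> 0 \<or> b \<noteq> 0")
    case True
    define N where "N = a ^ 2 + a * b * f - b ^ 2 * g"
    have N: "N \<noteq> 0" "x \<noteq> 0" using norm_nonzero[OF K z(1,2,4) x(2,3) True] x by (auto simp: N_def)
    have "N \<in> K" unfolding N_def using x z c by simp
    have "x * (a + b * f - b * z) = N" unfolding N_def x(1) by (rule quadratic_norm[OF z(1)])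
    then have "inverse x = (a + b * f) / N + (- b / N) * z"
      using N by (simp add: inverse_eq_divide divide_simps) (simp add: algebra_simps)
    then show ?thesis using x z \<open>N \<in> K\<close> by (intro qadjI[of "(a + b * f) / N" K "- b / N"]) (simp_all add: c)
  next
    case False
    then show ?thesis using x \<open>0 \<in> qadj K z\<close> by simp
  qed
  fix y assume "y \<in> qadj K z"
  then obtain a' b' where y: "y = a' + b' * z" "a' \<in> K" "b' \<in> K" unfolding qadj_def by blast
  have "x + y = (a + a') + (b + b') * z" using x y by (simp add: algebra_simps)
  then show "x + y \<in> qadj K z" using x y by (intro qadjI[of "a + a'" K "b + b'"]) (simp_all add: c algebra_simps)
  have "x * y = a * a' + (a * b' + a' * b) * z + b * b' * z ^ 2"
    using x y by (simp add: algebra_simps power2_eq_square)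
  also have "\<dots> = (a * a' + b * b' * g) + (a * b' + a' * b + b * b' * f) * z"
    unfolding z(1) by (simp add: algebra_simps)
  finally show "x * y \<in> qadj K z" using x y z by (intro qadjI[OF _ _ _]) (simp_all add: c)
qed

text \<open>Splitting off the largest common power of \<open>X\<close> makes the order of
  \<open>a + b Z\<close> at \<open>X = 0\<close> explicit: the cofactors do not both vanish
  there.\<close>

lemma factor_X:
  assumes "subfld K" "pin K a" "pin K b" "a \<noteq> 0 \<or> b \<noteq> 0"
  shows "\<exists>k a' b'. a = [:0, 1:] ^ k * a' \<and> b = [:0, 1:] ^ k * b' \<and> pin K a' \<and> pin K b' \<and>
    (poly a' 0 \<noteq> 0 \<or> poly b' 0 \<noteq> 0)"
  using assms(2-4)
proof (induction "Polynomial.degree a + Polynomial.degree b" arbitrary: a b rule: less_induct)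
  case less
  show ?case
  proof (cases "poly a 0 \<noteq> 0 \<or> poly b 0 \<noteq> 0")
    case True
    then show ?thesis using less.prems by (intro exI[of _ 0] exI[of _ a] exI[of _ b]) auto
  next
    case False
    obtain u a' v b' where ab: "a = pCons u a'" "b = pCons v b'" by (metis pCons_cases)
    have uv: "u = 0" "v = 0" using False ab by auto
    have p: "pin K a'" "pin K b'" using less.prems ab pin_pCons by blast+
    have n: "a' \<noteq> 0 \<or> b' \<noteq> 0" using less.prems(3) ab uv by auto
    then have "Polynomial.degree a' + Polynomial.degree b' < Polynomial.degree a + Polynomial.degree b"
      using ab uv by auto
    from less.hyps[OF this p n] obtain k a2 b2 where
      k: "a' = [:0, 1:] ^ k * a2" "b' = [:0, 1:] ^ k * b2" "pin K a2" "pin K b2" "poly a2 0 \<noteq> 0 \<or> poly b2 0 \<noteq> 0"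
      by blast
    have "a = [:0, 1:] * a'" "b = [:0, 1:] * b'" using ab uv by simp_all
    then have "a = [:0, 1:] ^ Suc k * a2" "b = [:0, 1:] ^ Suc k * b2"
      using k(1,2) by (simp_all only: power_Suc mult.assoc)
    then show ?thesis using k(3-5) by blast
  qed
qed

text \<open>
  The place is \<open>\<tau> \<mapsto> 0\<close>, \<open>Z \<mapsto> z\<close>. It has value group \<open>\<int>\<close> and residue field exactly \<open>E(z)\<close>
  because \<open>1, z\<close> are linearly independent over \<open>E\<close>.
\<close>

theorem tot_isotropic_specialise:
  assumes E: "subfld E" and t: "transcendental E \<tau>" and fg: "pin E f" "pin E g"
    and Z: "Z ^ 2 = poly f \<tau> * Z + poly g \<tau>" "Z \<notin> adj E \<tau>"
    and z: "z ^ 2 = poly f 0 * z + poly g 0" "z \<notin> E"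
    and c: "cin E n c" and tot_isotropic: "tot_isotropic (qadj (adj E \<tau>) Z) n c m"
  shows "tot_isotropic (qadj E z) n c m"
proof -
  define M where "M = adj E \<tau>"
  have M: "subfld M" unfolding M_def by (rule subfld_adj[OF E])
  have pM: "poly p \<tau> \<in> M" if "pin E p" for p
    unfolding M_def using pin_poly[OF subfld_adj[OF E] pin_mono[OF that adj_base[OF E]] adj_gen[OF E]] .
  have p0: "poly p 0 \<in> E" if "pin E p" for p using pin_poly[OF E that] subfldD(1)[OF E] by simp
  have nz: "poly p \<tau> \<noteq> 0" if "pin E p" "p \<noteq> 0" for p using t that unfolding transcendental_def by blast
  have nz0: "poly p \<tau> \<noteq> 0" if "pin E p" "poly p 0 \<noteq> 0" for p using nz that by fastforce
  have fM: "poly f \<tau> \<in> M" "poly g \<tau> \<in> M" using pM fg by blast+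
  \<comment> \<open>Elements with a denominator that does not vanish at 0, related to the value
    obtained from \<open>\<tau> = 0\<close> and \<open>Z = z\<close>.\<close>
  define P where "P = (\<lambda>u u'. \<exists>A B D. pin E A \<and> pin E B \<and> pin E D \<and> poly D 0 \<noteq> 0 \<and>
    u = (poly A \<tau> + poly B \<tau> * Z) / poly D \<tau> \<and> u' = (poly A 0 + poly B 0 * z) / poly D 0)"
  have PI: "P ((poly A \<tau> + poly B \<tau> * Z) / poly D \<tau>) ((poly A 0 + poly B 0 * z) / poly D 0)"
    if "pin E A" "pin E B" "pin E D" "poly D 0 \<noteq> 0" for A B D
    unfolding P_def using that by blast
  have L: "subfld (qadj M Z)" by (rule subfld_qadj[OF M Z(1) fM]) (use Z(2) M_def in simp)
  show ?thesis
  proof (rule tot_isotropic_place[OF L _ _ _ _ _ _ E c, of P])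
    show "tot_isotropic (qadj M Z) n c m" using tot_isotropic unfolding M_def .
    show "u \<in> qadj M Z \<and> u' \<in> qadj E z" if h: "P u u'" for u u'
    proof -
      obtain A B D where A: "pin E A" "pin E B" "pin E D" "poly D 0 \<noteq> 0"
        "u = (poly A \<tau> + poly B \<tau> * Z) / poly D \<tau>" "u' = (poly A 0 + poly B 0 * z) / poly D 0"
        using h unfolding P_def by blast
      have "u = poly A \<tau> / poly D \<tau> + poly B \<tau> / poly D \<tau> * Z" "u' = poly A 0 / poly D 0 + poly B 0 / poly D 0 * z"
        using A(5,6) by (simp_all add: add_divide_distrib)
      moreover have "poly A \<tau> / poly D \<tau> \<in> M" "poly B \<tau> / poly D \<tau> \<in> M" "poly A 0 / poly D 0 \<in> E" "poly B 0 / poly D 0 \<in> E"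
        using A pM p0 by (auto intro: subfldD(8)[OF M] subfldD(8)[OF E])
      ultimately show ?thesis using qadjI by metis
    qed
    show "P e e" if "e \<in> E" for e
      using PI[of "[:e:]" 0 1] that by (simp add: pin_intros[OF E])
    show "P (u + v) (u' + v')" "P (u * v) (u' * v')" if h: "P u u'" "P v v'" for u u' v v'
    proof -
      obtain A B D where A: "pin E A" "pin E B" "pin E D" "poly D 0 \<noteq> 0"
        "u = (poly A \<tau> + poly B \<tau> * Z) / poly D \<tau>" "u' = (poly A 0 + poly B 0 * z) / poly D 0"
        using h(1) unfolding P_def by blast
      obtain A' B' D' where A': "pin E A'" "pin E B'" "pin E D'" "poly D' 0 \<noteq> 0"
        "v = (poly A' \<tau> + poly B' \<tau> * Z) / poly D' \<tau>" "v' = (poly A' 0 + poly B' 0 * z) / poly D' 0"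
        using h(2) unfolding P_def by blast
      have d: "poly D \<tau> \<noteq> 0" "poly D' \<tau> \<noteq> 0" using nz0 A A' by auto
      have "P ((poly (A * D' + A' * D) \<tau> + poly (B * D' + B' * D) \<tau> * Z) / poly (D * D') \<tau>)
              ((poly (A * D' + A' * D) 0 + poly (B * D' + B' * D) 0 * z) / poly (D * D') 0)"
        by (rule PI) (use A A' pin_intros[OF E] in auto)
      moreover have "u + v = (poly (A * D' + A' * D) \<tau> + poly (B * D' + B' * D) \<tau> * Z) / poly (D * D') \<tau>"
        using d unfolding A(5) A'(5) by (simp add: field_simps)
      moreover have "u' + v' = (poly (A * D' + A' * D) 0 + poly (B * D' + B' * D) 0 * z) / poly (D * D') 0"
        using A(4) A'(4) unfolding A(6) A'(6) by (simp add: field_simps)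
      ultimately show "P (u + v) (u' + v')" by simp
      have prod: "(a + b * y) * (a' + b' * y) = (a * a' + b * b' * s) + (a * b' + a' * b + b * b' * r) * y"
        if "y ^ 2 = r * y + s" for a b a' b' r s y :: 'a
      proof -
        have "(a + b * y) * (a' + b' * y) = a * a' + (a * b' + a' * b) * y + b * b' * y ^ 2"
          by (simp add: algebra_simps power2_eq_square)
        then show ?thesis unfolding that by (simp add: algebra_simps)
      qed
      have "P ((poly (A * A' + B * B' * g) \<tau> + poly (A * B' + A' * B + B * B' * f) \<tau> * Z) / poly (D * D') \<tau>)
              ((poly (A * A' + B * B' * g) 0 + poly (A * B' + A' * B + B * B' * f) 0 * z) / poly (D * D') 0)"
        by (rule PI) (use A A' fg pin_intros[OF E] in auto)
      moreover have "u * v = (poly (A * A' + B * B' * g) \<tau> + poly (A * B' + A' * B + B * B' * f) \<tau> * Z) / poly (D * D') \<tau>"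
        unfolding A(5) A'(5) times_divide_times_eq prod[OF Z(1)] by simp
      moreover have "u' * v' = (poly (A * A' + B * B' * g) 0 + poly (A * B' + A' * B + B * B' * f) 0 * z) / poly (D * D') 0"
        unfolding A(6) A'(6) times_divide_times_eq prod[OF z(1)] by simp
      ultimately show "P (u * v) (u' * v')" by simp
    qed
    show "u' = 0" if h: "P 0 u'" for u'
    proof -
      obtain A B D where A: "pin E A" "pin E B" "pin E D" "poly D 0 \<noteq> 0"
        "0 = (poly A \<tau> + poly B \<tau> * Z) / poly D \<tau>" "u' = (poly A 0 + poly B 0 * z) / poly D 0"
        using h unfolding P_def by blast
      \<comment> \<open>Independence of 1 and \<open>Z\<close> over \<open>E(\<tau>)\<close> and
        transcendence of \<open>\<tau>\<close> leave only \<open>A = B = 0\<close> as numerators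
        representing 0.\<close>
      have "poly A \<tau> + poly B \<tau> * Z = 0" using A nz0 by simp
      moreover have "poly f \<tau> \<in> M" "Z \<notin> M" using fM Z(2) M_def by auto
      ultimately have "poly A \<tau> = 0" "poly B \<tau> = 0"
        using norm_nonzero(2)[OF M Z(1), of "poly A \<tau>" "poly B \<tau>"] pM A by blast+
      then have "A = 0" "B = 0" using nz A by blast+
      then show ?thesis using A by simp
    qed
    show "\<exists>u'. P u u' \<or> P (inverse u) u'" if u: "u \<in> qadj M Z" "u \<noteq> 0" for u
    proof -
      obtain a b where ab: "u = a + b * Z" "a \<in> M" "b \<in> M" using u unfolding qadj_def by blast
      obtain p1 r1 p2 r2 where pr: "a = poly p1 \<tau> / poly r1 \<tau>" "pin E p1" "pin E r1" "poly r1 \<tau> \<noteq> 0"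
        "b = poly p2 \<tau> / poly r2 \<tau>" "pin E p2" "pin E r2" "poly r2 \<tau> \<noteq> 0"
        using ab(2,3) unfolding M_def adj_def by blast
      define A B D where "A = p1 * r2" and "B = p2 * r1" and "D = r1 * r2"
      have pABD: "pin E A" "pin E B" "pin E D" unfolding A_def B_def D_def using pr pin_intros[OF E] by blast+
      have u1: "u = (poly A \<tau> + poly B \<tau> * Z) / poly D \<tau>"
        unfolding ab pr A_def B_def D_def using pr(4,8) by (simp add: field_simps)
      have "A \<noteq> 0 \<or> B \<noteq> 0" using u(2) u1 by auto
      from factor_X[OF E pABD(1,2) this] obtain k A' B' where
        k: "A = [:0, 1:] ^ k * A'" "B = [:0, 1:] ^ k * B'" "pin E A'" "pin E B'" "poly A' 0 \<noteq> 0 \<or> poly B' 0 \<noteq> 0"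
        by blast
      have "D \<noteq> 0 \<or> D \<noteq> 0" using pr(4,8) by (auto simp: D_def)
      from factor_X[OF E pABD(3,3) this] obtain l D' where
        l: "D = [:0, 1:] ^ l * D'" "pin E D'" "poly D' 0 \<noteq> 0" by blast
      have D'0: "poly D' \<tau> \<noteq> 0" using nz0 l by blast
      have t0: "\<tau> \<noteq> 0" using nz[of "[:0,1:]"] pin_intros[OF E] subfldD[OF E] by auto
      \<comment> \<open>A power of \<open>\<tau>\<close> with exponent \<open>k - l\<close> times a
        part of order 0. The sign of \<open>k - l\<close> decides whether \<open>u\<close> or its
        inverse has a value.\<close>
      have u2: "u = \<tau> ^ k * (poly A' \<tau> + poly B' \<tau> * Z) / (\<tau> ^ l * poly D' \<tau>)"
        unfolding u1 k l by (simp add: algebra_simps)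
      have pX: "pin E ([:0, 1:] ^ j)" for j using pin_intros[OF E] subfldD[OF E] by auto
      show ?thesis
      proof (cases "l \<le> k")
        case True
        have "u = (poly ([:0,1:] ^ (k - l) * A') \<tau> + poly ([:0,1:] ^ (k - l) * B') \<tau> * Z) / poly D' \<tau>"
        proof -
          have "\<tau> ^ k = \<tau> ^ l * \<tau> ^ (k - l)" using True by (simp flip: power_add)
          then show ?thesis unfolding u2 using t0 by (simp add: add_divide_distrib algebra_simps)
        qed
        moreover note PI[of "[:0,1:] ^ (k - l) * A'" "[:0,1:] ^ (k - l) * B'" D']
        moreover have "pin E ([:0,1:] ^ (k - l) * A')" "pin E ([:0,1:] ^ (k - l) * B')"
          by (rule pin_intros(5)[OF E] pX k(3,4))+
        ultimately show ?thesis using l(2,3) by metis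
      next
        case False
        \<comment> \<open>The norm of the numerator \<open>A' + B' Z\<close> as a polynomial in
          \<open>\<tau>\<close>. Its value at 0 is the norm of a nonzero element of
          \<open>E(z)\<close>, so it is an admissible denominator for the inverse.\<close>
        define N where "N = A' ^ 2 + A' * B' * f - B' ^ 2 * g"
        have pN: "pin E N" unfolding N_def using k fg pin_intros[OF E] by simp
        have "poly N 0 \<noteq> 0" unfolding N_def
          using norm_nonzero(1)[OF E z(1) p0[OF fg(1)] z(2) p0[OF k(3)] p0[OF k(4)] k(5)] by simp
        then have N: "poly N \<tau> \<noteq> 0" "poly N 0 \<noteq> 0" using nz0[OF pN] by auto
        have NN: "(poly A' \<tau> + poly B' \<tau> * Z) * (poly A' \<tau> + poly B' \<tau> * poly f \<tau> - poly B' \<tau> * Z) = poly N \<tau>"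
          unfolding N_def quadratic_norm[OF Z(1)] by simp
        then have n0: "poly A' \<tau> + poly B' \<tau> * Z \<noteq> 0" using N by auto
        have i: "inverse (poly A' \<tau> + poly B' \<tau> * Z) = (poly A' \<tau> + poly B' \<tau> * poly f \<tau> - poly B' \<tau> * Z) / poly N \<tau>"
          by (rule inverse_unique) (use NN N in simp)
        have "\<tau> ^ l = \<tau> ^ k * \<tau> ^ (l - k)" using False by (simp flip: power_add)
        then have "inverse u = \<tau> ^ (l - k) * poly D' \<tau> * inverse (poly A' \<tau> + poly B' \<tau> * Z)"
          unfolding u2 using t0 by (simp add: divide_inverse)
        then have "inverse u = (poly ([:0,1:] ^ (l - k) * D' * (A' + B' * f)) \<tau>
            + poly ([:0,1:] ^ (l - k) * D' * (- B')) \<tau> * Z) / poly N \<tau>"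
          unfolding i by (simp add: algebra_simps diff_divide_distrib add_divide_distrib)
        moreover note PI[of "[:0,1:] ^ (l - k) * D' * (A' + B' * f)" "[:0,1:] ^ (l - k) * D' * (- B')" N]
        moreover have "pin E ([:0,1:] ^ (l - k) * D' * (A' + B' * f))" "pin E ([:0,1:] ^ (l - k) * D' * (- B'))"
          by (rule pin_intros(4-6)[OF E] pX k(3,4) l(2) fg)+
        ultimately show ?thesis using N(2) pN by metis
      qed
    qed
  qed
qed

text \<open>The place \<open>\<tau> \<mapsto> 0\<close> of \<open>E(\<tau>)\<close> has residue
  field \<open>E\<close> and turns an isotropic vector over \<open>E(\<tau>)\<close> into one over
  \<open>E\<close>.\<close>

lemma aniso_adj:
  assumes c2: "(2::'w::field) = 0" and E: "subfld E" and t: "transcendental E (\<tau>::'w)" and c: "cin E n c" and a: "aniso E n c"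
  shows "aniso (adj E \<tau>) n c"
proof (rule ccontr)
  assume "\<not> aniso (adj E \<tau>) n c"
  then have tot_isotropic: "tot_isotropic (adj E \<tau>) n c 1" by (rule not_aniso_tot_isotropic[OF subfld_adj[OF E] c2])
  have p0: "poly p 0 \<in> E" if "pin E p" for p using pin_poly[OF E that] subfldD(1)[OF E] by simp
  have nz: "poly p \<tau> \<noteq> 0" if "pin E p" "p \<noteq> 0" for p using t that unfolding transcendental_def by blast
  have nz0: "poly p \<tau> \<noteq> 0" if "pin E p" "poly p 0 \<noteq> 0" for p using nz that by fastforce
  define P where "P = (\<lambda>u u'. \<exists>A D. pin E A \<and> pin E D \<and> poly D 0 \<noteq> 0 \<and>
    u = poly A \<tau> / poly D \<tau> \<and> u' = poly A 0 / poly D 0)"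
  have PI: "P (poly A \<tau> / poly D \<tau>) (poly A 0 / poly D 0)"
    if "pin E A" "pin E D" "poly D 0 \<noteq> 0" for A D
    unfolding P_def using that by blast
  have "tot_isotropic E n c 1"
  proof (rule tot_isotropic_place[OF subfld_adj[OF E] _ _ _ _ _ _ E c tot_isotropic, of P])
    show "u \<in> adj E \<tau> \<and> u' \<in> E" if h: "P u u'" for u u'
    proof -
      obtain A D where "pin E A" "pin E D" "poly D 0 \<noteq> 0"
        "u = poly A \<tau> / poly D \<tau>" "u' = poly A 0 / poly D 0"
        using h unfolding P_def by blast
      then show ?thesis using adjI[of E A D \<tau> u] nz0 p0 subfldD(8)[OF E] by simp
    qed
    show "P e e" if "e \<in> E" for e
      using PI[of "[:e:]" 1] that by (simp add: pin_intros[OF E])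
    show "P (u + v) (u' + v')" "P (u * v) (u' * v')" if h: "P u u'" "P v v'" for u u' v v'
    proof -
      obtain A D where A: "pin E A" "pin E D" "poly D 0 \<noteq> 0"
        "u = poly A \<tau> / poly D \<tau>" "u' = poly A 0 / poly D 0"
        using h(1) unfolding P_def by blast
      obtain A' D' where A': "pin E A'" "pin E D'" "poly D' 0 \<noteq> 0"
        "v = poly A' \<tau> / poly D' \<tau>" "v' = poly A' 0 / poly D' 0"
        using h(2) unfolding P_def by blast
      have d: "poly D \<tau> \<noteq> 0" "poly D' \<tau> \<noteq> 0" using nz0 A A' by auto
      have "P (poly (A * D' + A' * D) \<tau> / poly (D * D') \<tau>) (poly (A * D' + A' * D) 0 / poly (D * D') 0)"
        by (rule PI) (use A A' pin_intros[OF E] in auto)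
      then show "P (u + v) (u' + v')" using A A' d by (simp add: add_frac_eq)
      have "P (poly (A * A') \<tau> / poly (D * D') \<tau>) (poly (A * A') 0 / poly (D * D') 0)"
        by (rule PI) (use A A' pin_intros[OF E] in auto)
      then show "P (u * v) (u' * v')" using A A' d by simp
    qed
    show "u' = 0" if h: "P 0 u'" for u'
    proof -
      obtain A D where A: "pin E A" "pin E D" "poly D 0 \<noteq> 0"
        "0 = poly A \<tau> / poly D \<tau>" "u' = poly A 0 / poly D 0"
        using h unfolding P_def by blast
      then have "poly A \<tau> = 0" using nz0 by simp
      then have "A = 0" using nz A by blast
      then show ?thesis using A by simp
    qed
    show "\<exists>u'. P u u' \<or> P (inverse u) u'" if u: "u \<in> adj E \<tau>" "u \<noteq> 0" for u
    proof -
      obtain A B where A: "u = poly A \<tau> / poly B \<tau>" "pin E A" "pin E B" "poly B \<tau> \<noteq> 0"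
        using u(1) unfolding adj_def by blast
      have "A \<noteq> 0 \<or> B \<noteq> 0" using A by auto
      from factor_X[OF E A(2,3) this] obtain k A' B' where
        k: "A = [:0, 1:] ^ k * A'" "B = [:0, 1:] ^ k * B'" "pin E A'" "pin E B'" "poly A' 0 \<noteq> 0 \<or> poly B' 0 \<noteq> 0"
        by blast
      have t0: "\<tau> \<noteq> 0" using nz[of "[:0,1:]"] pin_intros[OF E] subfldD[OF E] by auto
      have u1: "u = poly A' \<tau> / poly B' \<tau>" unfolding A k using t0 by simp
      then have u2: "inverse u = poly B' \<tau> / poly A' \<tau>" by simp
      show ?thesis using k(5) PI[OF k(3,4)] PI[OF k(4,3)] u1 u2 by metis
    qed
  qed
  then show False using aniso_tot_isotropic[OF a] by auto
qed


section \<open>Orthogonal sums and multiplication by a Pfister form\<close>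

definition orth_sum :: "nat \<Rightarrow> (nat \<Rightarrow> nat \<Rightarrow> 'w::zero) \<Rightarrow> (nat \<Rightarrow> nat \<Rightarrow> 'w) \<Rightarrow> nat \<Rightarrow> nat \<Rightarrow> 'w" where
  "orth_sum n c d = (\<lambda>i j. if i < n \<and> j < n then c i j else if n \<le> i \<and> n \<le> j then d (i - n) (j - n) else 0)"

definition cat :: "nat \<Rightarrow> (nat \<Rightarrow> 'w) \<Rightarrow> (nat \<Rightarrow> 'w) \<Rightarrow> nat \<Rightarrow> 'w" where
  "cat n x y = (\<lambda>k. if k < n then x k else y (k - n))"

lemma sum_split_lt: "(\<Sum>i<n + (m::nat). f i) = (\<Sum>i<n. f i) + (\<Sum>i<m. f (n + i))" for f :: "nat \<Rightarrow> 'b::comm_monoid_add"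
  by (induction m) (simp_all add: algebra_simps)

lemma sum_split_le: "(\<Sum>i\<le>n + (m::nat). f i) = (\<Sum>i<n. f i) + (\<Sum>i\<le>m. f (n + i))" for f :: "nat \<Rightarrow> 'b::comm_monoid_add"
  using sum_split_lt[of f n "Suc m"] by (simp add: lessThan_Suc_atMost)

lemma qv_orth_sum: "qv (n + m) (orth_sum n c d) x = qv n c x + qv m d (\<lambda>k. x (n + k))"
proof -
  have "(\<Sum>i\<le>j. orth_sum n c d i j * x i * x j) = (\<Sum>i\<le>j. c i j * x i * x j)" if "j < n" for j
    using that by (intro sum.cong) (auto simp: orth_sum_def)
  moreover have "(\<Sum>i\<le>n + j. orth_sum n c d i (n + j) * x i * x (n + j)) = (\<Sum>i\<le>j. d i j * x (n + i) * x (n + j))" for j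
    unfolding sum_split_le by (simp add: orth_sum_def)
  ultimately show ?thesis unfolding qv_def sum_split_lt by simp
qed

lemma pol_qv: "pol n c x y = qv n c (\<lambda>k. x k + y k) - qv n c x - qv n c y"
  by (simp add: qv_add)

lemma pol_orth_sum: "pol (n + m) (orth_sum n c d) x y = pol n c x y + pol m d (\<lambda>k. x (n + k)) (\<lambda>k. y (n + k))"
  unfolding pol_qv qv_orth_sum by simp

lemma qv_cat: "qv (n + m) (orth_sum n c d) (cat n x y) = qv n c x + qv m d y"
  unfolding qv_orth_sum by (intro arg_cong2[of _ _ _ _ "(+)"] qv_cong) (auto simp: cat_def)

lemma pol_cat: "pol (n + m) (orth_sum n c d) (cat n x y) (cat n x' y') = pol n c x x' + pol m d y y'"
  unfolding pol_orth_sum by (intro arg_cong2[of _ _ _ _ "(+)"] pol_cong) (auto simp: cat_def)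

lemma cin_orth_sum: "0 \<in> K \<Longrightarrow> cin K n c \<Longrightarrow> cin K m d \<Longrightarrow> cin K (n + m) (orth_sum n c d)"
  unfolding cin_def orth_sum_def by auto

lemma vin_cat: "vin K n x \<Longrightarrow> vin K m y \<Longrightarrow> vin K (n + m) (cat n x y)"
  unfolding vin_def cat_def by auto

lemma qv_scalec: "qv n (\<lambda>i j. a * c i j) x = a * qv n c x"
  unfolding qv_def by (simp add: sum_distrib_left algebra_simps)

lemma pol_scalec: "pol n (\<lambda>i j. a * c i j) x y = a * pol n c x y"
  unfolding pol_def by (simp add: sum_distrib_left algebra_simps)

lemma tot_isotropic_scale:
  assumes "tot_isotropic K n c m" shows "tot_isotropic K n (\<lambda>i j. a * c i j) m"
  using assms unfolding tot_isotropic_def isotropic_family_def by (auto simp: qv_scalec pol_scalec)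

text \<open>The vectors \<open>(f s, f' s)\<close> keep the pivots \<open>S\<close> and the vectors
  \<open>(h' s, h s)\<close> receive the pivots \<open>n + S\<close>. This needs the parts
  \<open>f'\<close> and \<open>h'\<close> to vanish on \<open>S\<close>, which holds for second
  components over a quadratic extension.\<close>

lemma echelon_cat:
  assumes S: "echelon K n S w"
    and f: "\<And>s. s \<in> S \<Longrightarrow> vin K n (f s)" "\<And>s t. s \<in> S \<Longrightarrow> t \<in> S \<Longrightarrow> f s t = (if s = t then 1 else 0)"
    and f': "\<And>s. s \<in> S \<Longrightarrow> vin K n (f' s)" "\<And>s t. s \<in> S \<Longrightarrow> t \<in> S \<Longrightarrow> f' s t = 0"
    and h: "\<And>s. s \<in> S \<Longrightarrow> vin K n (h s)" "\<And>s t. s \<in> S \<Longrightarrow> t \<in> S \<Longrightarrow> h s t = (if s = t then 1 else 0)"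
    and h': "\<And>s. s \<in> S \<Longrightarrow> vin K n (h' s)" "\<And>s t. s \<in> S \<Longrightarrow> t \<in> S \<Longrightarrow> h' s t = 0"
  shows "card (S \<union> (+) n ` S) = 2 * card S"
    "echelon K (n + n) (S \<union> (+) n ` S) (\<lambda>s. if s < n then cat n (f s) (f' s) else cat n (h' (s - n)) (h (s - n)))"
proof -
  have sub: "S \<subseteq> {..<n}" and fin: "finite S" using S echelon_finite[OF S] unfolding echelon_def by auto
  have "S \<inter> (+) n ` S = {}" using sub by auto
  then show "card (S \<union> (+) n ` S) = 2 * card S"
    using fin by (simp add: card_Un_disjoint card_image)
  have lt: "s < n" if "s \<in> S" for s using sub that by auto
  show "echelon K (n + n) (S \<union> (+) n ` S) (\<lambda>s. if s < n then cat n (f s) (f' s) else cat n (h' (s - n)) (h (s - n)))"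
    unfolding echelon_def
  proof (intro conjI ballI)
    show "S \<union> (+) n ` S \<subseteq> {..<n + n}" using sub by auto
    fix s assume s: "s \<in> S \<union> (+) n ` S"
    show "vin K (n + n) (if s < n then cat n (f s) (f' s) else cat n (h' (s - n)) (h (s - n)))"
      using s lt by (auto intro!: vin_cat f f' h h')
    fix t assume t: "t \<in> S \<union> (+) n ` S"
    show "(if s < n then cat n (f s) (f' s) else cat n (h' (s - n)) (h (s - n))) t = (if s = t then 1 else 0)"
      using s t lt by (auto simp: cat_def f f' h h')
  qed
qed

text \<open>One copy of the subspace is placed in each summand.\<close>

lemma tot_isotropic_double:
  assumes K: "subfld K" and "tot_isotropic K n c m"
  shows "tot_isotropic K (n + n) (orth_sum n c (\<lambda>i j. a * c i j)) (2 * m)"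
proof -
  obtain S w where S: "card S = m" "echelon K n S w" "isotropic_family n c S w" using assms(2) unfolding tot_isotropic_def by blast
  let ?f = "\<lambda>s. if s < n then cat n (w s) (\<lambda>_. 0) else cat n (\<lambda>_. 0) (w (s - n))"
  have w: "\<And>s. s \<in> S \<Longrightarrow> vin K n (w s)" "\<And>s t. s \<in> S \<Longrightarrow> t \<in> S \<Longrightarrow> w s t = (if s = t then 1 else 0)"
    using S(2) unfolding echelon_def by blast+
  have z: "vin K n (\<lambda>_. 0)" using subfldD(1)[OF K] unfolding vin_def by simp
  have e: "card (S \<union> (+) n ` S) = 2 * card S" "echelon K (n + n) (S \<union> (+) n ` S) ?f"
    using echelon_cat[of K n S w w "\<lambda>_ _. 0" w "\<lambda>_ _. 0", OF S(2) w _ _ w] z by blast+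
  have lt: "s < n" if "s \<in> S" for s using that S(2) unfolding echelon_def by auto
  have "isotropic_family (n + n) (orth_sum n c (\<lambda>i j. a * c i j)) (S \<union> (+) n ` S) ?f"
    unfolding isotropic_family_def
  proof (intro ballI conjI)
    fix s assume s: "s \<in> S \<union> (+) n ` S"
    show "qv (n + n) (orth_sum n c (\<lambda>i j. a * c i j)) (?f s) = 0"
      using s S(3) lt by (auto simp: qv_cat qv_scalec isotropic_family_def)
    fix t assume t: "t \<in> S \<union> (+) n ` S"
    show "pol (n + n) (orth_sum n c (\<lambda>i j. a * c i j)) (?f s) (?f t) = 0"
      using s t S(3) lt by (auto simp: pol_cat pol_scalec isotropic_family_def)
  qed
  then show ?thesis unfolding tot_isotropic_def using e S(1) by (intro exI[of _ "S \<union> (+) n ` S"] exI[of _ ?f]) simp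
qed

definition unitv :: "nat \<Rightarrow> nat \<Rightarrow> 'w::zero_neq_one" where
  "unitv i = (\<lambda>k. if k = i then 1 else 0)"

lemma vin_unitv: "subfld K \<Longrightarrow> vin K n (unitv i)"
  unfolding vin_def unitv_def using subfldD(1,2) by auto

text \<open>Along the line \<open>v + t e\<close> the form is a polynomial in \<open>t\<close> with
  leading coefficient \<open>q(e)\<close>, hence of degree 2.\<close>

lemma qroot_exists:
  fixes v e :: "nat \<Rightarrow> 'w::alg_closed_field"
  assumes "qv n c e \<noteq> 0"
  shows "\<exists>t. qv n c (\<lambda>k. v k + t * e k) = 0"
proof -
  have "\<exists>t. poly [:qv n c v, pol n c v e, qv n c e:] t = 0"
    by (rule alg_closed_imp_poly_has_root) (use assms in simp)
  then obtain t where "poly [:qv n c v, pol n c v e, qv n c e:] t = 0" ..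
  then have "qv n c v + t * pol n c v e + t\<^sup>2 * qv n c e = 0" by (simp add: algebra_simps power2_eq_square)
  then show ?thesis by (intro exI[of _ t]) (simp add: qv_add qv_scale pol_scale algebra_simps)
qed

lemma qroot_quadratic:
  assumes "qv n c e \<noteq> 0" "qv n c (\<lambda>k. v k + t * e k) = 0"
  shows "t ^ 2 = (- pol n c v e / qv n c e) * t + (- qv n c v / qv n c e)"
proof -
  have h: "qv n c v + t\<^sup>2 * qv n c e + t * pol n c v e = 0" using assms(2) by (simp add: qv_add qv_scale pol_scale)
  have "t\<^sup>2 * qv n c e = - (pol n c v e * t) - qv n c v"
    using h by (simp add: algebra_simps eq_diff_eq eq_neg_iff_add_eq_0)
  then have "t\<^sup>2 = (- (pol n c v e * t) - qv n c v) / qv n c e"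
    using assms(1) by (simp add: eq_divide_eq)
  then show ?thesis by (simp add: diff_divide_distrib)
qed

text \<open>Writing the zero as \<open>x + z y\<close> with \<open>x\<close>, \<open>y\<close> over
  \<open>E\<close> already makes \<open>z\<close> quadratic over \<open>E\<close>, as
  \<open>q\<close> is anisotropic there; no degree has to be mentioned. The bound
  \<open>E \<subseteq> A\<close> ensures that elements transcendental over \<open>A\<close> are
  transcendental over each \<open>E\<close>.\<close>

definition quadratic_isotropy :: "'w::field set \<Rightarrow> 'w set \<Rightarrow> nat \<Rightarrow> (nat \<Rightarrow> nat \<Rightarrow> 'w) \<Rightarrow> nat \<Rightarrow> bool" where
  "quadratic_isotropy F A n c m \<longleftrightarrow> (\<forall>E x y z. subfld E \<and> F \<subseteq> E \<and> E \<subseteq> A \<and> aniso E n c \<and> z \<notin> E \<and> vin E n x \<and> vin E n y \<and>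
     (\<exists>k<n. y k \<noteq> 0) \<and> qv n c (\<lambda>k. x k + z * y k) = 0 \<longrightarrow> tot_isotropic (qadj E z) n c m)"

definition alg_closed_in :: "'w::field set \<Rightarrow> bool" where
  "alg_closed_in A \<longleftrightarrow> subfld A \<and> (\<forall>p z. pin A p \<and> p \<noteq> 0 \<and> poly p z = 0 \<longrightarrow> z \<in> A)"

lemma alg_closed_in_quadratic:
  assumes "alg_closed_in A" "z ^ 2 = f * z + g" "f \<in> A" "g \<in> A" shows "z \<in> A"
proof -
  have A: "subfld A" using assms unfolding alg_closed_in_def by blast
  have "pin A [:- g, - f, 1:]" using assms by (simp add: pin_intros[OF A] subfldD[OF A])
  moreover have "poly [:- g, - f, 1:] z = 0" using assms(2) by (simp add: algebra_simps power2_eq_square)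
  moreover have "[:- g, - f, 1:] \<noteq> 0" by simp
  ultimately show ?thesis using assms(1) unfolding alg_closed_in_def by blast
qed

text \<open>Anisotropy gives \<open>q(y) \<noteq> 0\<close>, so the zero \<open>x + z y\<close> is
  an honest quadratic equation for \<open>z\<close> with coefficients in \<open>E\<close>.\<close>

lemma quadratic_extension:
  assumes E: "subfld E" and c: "cin E n c" and a: "aniso E n c" and z: "z \<notin> E"
    and xy: "vin E n x" "vin E n y" "\<exists>k<n. y k \<noteq> 0" "qv n c (\<lambda>k. x k + z * y k) = 0"
  shows "qv n c y \<noteq> 0" "z ^ 2 = (- pol n c x y / qv n c y) * z + (- qv n c x / qv n c y)"
    "- pol n c x y / qv n c y \<in> E" "- qv n c x / qv n c y \<in> E" "subfld (qadj E z)"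
proof -
  show q: "qv n c y \<noteq> 0" using a xy unfolding aniso_def by blast
  show 1: "z ^ 2 = (- pol n c x y / qv n c y) * z + (- qv n c x / qv n c y)"
    by (rule qroot_quadratic[OF q xy(4)])
  show 2: "- pol n c x y / qv n c y \<in> E" "- qv n c x / qv n c y \<in> E"
    by (intro subfldD(8)[OF E] subfldD(5)[OF E] pol_in[OF E c] qv_in[OF E c] xy)+
  show "subfld (qadj E z)" by (rule subfld_qadj[OF E 1 2 z])
qed

text \<open>A pivot entry is 0 or 1 and lies in \<open>K\<close>. As 1 and \<open>\<rho>\<close> are
  independent over \<open>K\<close>, all of it belongs to the component \<open>w0\<close>.\<close>

lemma qadj_components:
  fixes w :: "nat \<Rightarrow> nat \<Rightarrow> 'w::field"
  assumes K: "subfld K" and rho: "\<rho> ^ 2 = p * \<rho> + g" "p \<in> K" "\<rho> \<notin> K" and S: "echelon (qadj K \<rho>) n S w"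
  obtains w0 w1 where "\<And>s. s \<in> S \<Longrightarrow> vin K n (w0 s)" "\<And>s. s \<in> S \<Longrightarrow> vin K n (w1 s)"
    "\<And>s k. s \<in> S \<Longrightarrow> k < n \<Longrightarrow> w s k = w0 s k + w1 s k * \<rho>"
    "\<And>s t. s \<in> S \<Longrightarrow> t \<in> S \<Longrightarrow> w0 s t = (if s = t then 1 else 0)" "\<And>s t. s \<in> S \<Longrightarrow> t \<in> S \<Longrightarrow> w1 s t = 0"
proof -
  have "\<exists>x y. s \<in> S \<and> k < n \<longrightarrow> x \<in> K \<and> y \<in> K \<and> w s k = x + y * \<rho>" for s k
    using S unfolding echelon_def vin_def qadj_def by blast
  then obtain w0 w1 where w: "\<And>s k. s \<in> S \<and> k < n \<longrightarrow> w0 s k \<in> K \<and> w1 s k \<in> K \<and> w s k = w0 s k + w1 s k * \<rho>"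
    by metis
  have "w0 s t = (if s = t then 1 else 0) \<and> w1 s t = 0" if st: "s \<in> S" "t \<in> S" for s t
  proof -
    define d :: 'w where "d = (if s = t then 1 else 0)"
    have d: "d \<in> K" using subfldD(1,2)[OF K] by (simp add: d_def)
    have t: "t < n" "w s t = d" using S st unfolding echelon_def d_def by auto
    then have wst: "w0 s t \<in> K" "w1 s t \<in> K" "w0 s t + w1 s t * \<rho> = d" using w[of s t] st(1) by auto
    then have "(w0 s t - d) + w1 s t * \<rho> = 0" by (simp add: algebra_simps)
    then have "w0 s t - d = 0 \<and> w1 s t = 0"
      using norm_nonzero(2)[OF K rho(1,2,3) subfldD(7)[OF K wst(1) d] wst(2)] by blast
    then show ?thesis unfolding d_def by simp
  qed
  then show thesis using that[of w0 w1] w by (simp add: vin_def)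
qed

lemma quadratic_isotropy_pfister:
  fixes c :: "nat \<Rightarrow> nat \<Rightarrow> 'w::alg_closed_field"
  assumes c2: "(2::'w) = 0" and A: "alg_closed_in A" and F: "subfld F" and c: "cin F n c" and a: "a \<in> F" and n: "2 \<le> n"
    and P: "quadratic_isotropy F A n c m"
  shows "quadratic_isotropy F A (n + n) (orth_sum n c (\<lambda>i j. a * c i j)) (2 * m)"
  unfolding quadratic_isotropy_def
proof (intro allI impI, elim conjE)
  let ?c = "orth_sum n c (\<lambda>i j. a * c i j)"
  fix E x1 y1 z assume E: "subfld E" "F \<subseteq> E" "E \<subseteq> A" and an: "aniso E (n + n) ?c" and z: "z \<notin> E"
    and XY: "vin E (n + n) x1" "vin E (n + n) y1" "\<exists>k<n + n. y1 k \<noteq> 0" "qv (n + n) ?c (\<lambda>k. x1 k + z * y1 k) = 0"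
  have sA: "subfld A" using A unfolding alg_closed_in_def by blast
  have cE: "cin E n c" using c E(2) unfolding cin_def by blast
  have aE: "a \<in> E" using a E by blast
  have ccE: "cin E (n + n) ?c"
    by (intro cin_orth_sum subfldD(1)[OF E(1)] cE) (use cE aE in \<open>auto simp: cin_def intro: subfldD(4)[OF E(1)]\<close>)
  have anE: "aniso E n c" unfolding aniso_def
  proof safe
    fix x i assume x: "vin E n x" "qv n c x = 0" "i < n"
    have "qv (n + n) ?c (cat n x (\<lambda>_. 0)) = 0" using x(2) by (simp add: qv_cat)
    then have "cat n x (\<lambda>_. 0) i = 0"
      using x subfldD(1)[OF E(1)] by (intro anisD[OF an, of "cat n x (\<lambda>_. 0)"]) (auto simp: vin_def cat_def)
    then show "x i = 0" using x by (simp add: cat_def)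
  qed
  define E' where "E' = qadj E z"
  note qe = quadratic_extension[OF E(1) ccE an z XY]
  have E': "subfld E'" unfolding E'_def by (rule qe(5))
  have EE': "E \<subseteq> E'" unfolding E'_def by (rule qadj_base[OF E(1)])
  have zA: "z \<in> A" by (rule alg_closed_in_quadratic[OF A qe(2)]) (use qe(3,4) E(3) in auto)
  have E'A: "E' \<subseteq> A" unfolding E'_def by (rule qadj_least[OF sA E(3) zA])
  have cE': "cin E' n c" using cE EE' unfolding cin_def by blast
  have aE': "a \<in> E'" using aE EE' by blast
  have PE: "tot_isotropic (qadj K r) n c m" if "subfld K" "E \<subseteq> K" "K \<subseteq> A" "aniso K n c" "r \<notin> K" "vin K n x" "vin K n y"
     "\<exists>k<n. y k \<noteq> 0" "qv n c (\<lambda>k. x k + r * y k) = 0" for K r x y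
    using P that E(2) unfolding quadratic_isotropy_def by blast
  show "tot_isotropic (qadj E z) (n + n) ?c (2 * m)" unfolding E'_def[symmetric]
  proof (cases "aniso E' n c")
    case False
    then obtain v k where v: "vin E' n v" "qv n c v = 0" "k < n" "v k \<noteq> 0" unfolding aniso_def by blast
    have "\<forall>k. \<exists>x y. k < n \<longrightarrow> x \<in> E \<and> y \<in> E \<and> v k = x + y * z"
      using v(1) unfolding vin_def E'_def qadj_def by blast
    then obtain x y where xy: "\<And>k. k < n \<Longrightarrow> x k \<in> E \<and> y k \<in> E \<and> v k = x k + y k * z" by metis
    have q: "qv n c (\<lambda>k. x k + z * y k) = 0"
      using v(2) qv_cong[of n v "\<lambda>k. x k + z * y k" c] xy by (simp add: mult.commute)
    \<comment> \<open>Otherwise the zero of \<open>q\<close> would already have its coordinates in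
      \<open>E\<close>.\<close>
    have "\<exists>k<n. y k \<noteq> 0"
    proof (rule ccontr)
      assume "\<not> (\<exists>k<n. y k \<noteq> 0)"
      then have "vin E n v" using xy unfolding vin_def by simp
      from anisD[OF anE this v(2,3)] v(4) show False by simp
    qed
    then have "tot_isotropic E' n c m" unfolding E'_def
      using PE[OF E(1) _ E(3) anE z, of x y] xy q unfolding vin_def by blast
    then show "tot_isotropic E' (n + n) ?c (2 * m)" by (rule tot_isotropic_double[OF E'])
  next
    case True
    define u u' where "u = (\<lambda>k. x1 k + z * y1 k)" and "u' = (\<lambda>k. x1 (n + k) + z * y1 (n + k))"
    have eq: "qv n c u + a * qv n c u' = 0" using XY(4) unfolding qv_orth_sum u_def u'_def qv_scalec .
    have inE': "x1 k + z * y1 k \<in> E'" if "k < n + n" for k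
      using XY(1,2) that unfolding vin_def E'_def by (intro qadjI[of "x1 k" E "y1 k"]) (simp_all add: mult.commute)
    have uE: "vin E' n u" "vin E' n u'" using inE' unfolding vin_def u_def u'_def by auto
    \<comment> \<open>If \<open>u'\<close> vanished, then \<open>q(u) = 0\<close> and so
      \<open>u = 0\<close> by anisotropy over \<open>E'\<close>; but \<open>x1 + z y1 = 0\<close>
      contradicts the independence of 1 and \<open>z\<close>.\<close>
    have "\<exists>k<n. u' k \<noteq> 0"
    proof (rule ccontr)
      assume h: "\<not> (\<exists>k<n. u' k \<noteq> 0)"
      then have "qv n c u' = 0" using qv_cong[of n u' "\<lambda>_. 0" c] by simp
      then have "qv n c u = 0" using eq by simp
      then have u0: "u k = 0" if "k < n" for k using anisD[OF True uE(1)] that by blast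
      obtain k where k: "k < n + n" "y1 k \<noteq> 0" using XY(3) by blast
      have "x1 k + z * y1 k = 0"
      proof (cases "k < n")
        case True
        then show ?thesis using u0 unfolding u_def by blast
      next
        case False
        then have "k - n < n" "n + (k - n) = k" using k by auto
        then show ?thesis using h unfolding u'_def by metis
      qed
      moreover have "x1 k + y1 k * z \<noteq> 0"
        by (rule norm_nonzero(2)[OF E(1) qe(2,3) z]) (use XY k in \<open>auto simp: vin_def\<close>)
      ultimately show False by (simp add: mult.commute)
    qed
    then have qu': "qv n c u' \<noteq> 0" using True uE(2) unfolding aniso_def by blast
    \<comment> \<open>Independence of \<open>u\<close> and \<open>u'\<close> is tested by this root:
      by anisotropy over \<open>E'\<close> it can lie in \<open>E'\<close> only if
      \<open>u + r u' = 0\<close>.\<close>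
    obtain r where r: "qv n c (\<lambda>k. u k + r * u' k) = 0" using qroot_exists[OF qu'] by blast
    show "tot_isotropic E' (n + n) ?c (2 * m)"
    proof (cases "r \<in> E'")
      case False
      define p where "p = - pol n c u u' / qv n c u'"
      have pE: "p \<in> E'" unfolding p_def
        by (intro subfldD(8)[OF E'] subfldD(5)[OF E'] pol_in[OF E' cE'] qv_in[OF E' cE'] uE)
      have "qv n c u = - (a * qv n c u')" using eq by (simp add: eq_neg_iff_add_eq_0)
      then have "- qv n c u / qv n c u' = a" using qu' by simp
      \<comment> \<open>The constant term is the slot \<open>a\<close> itself, because
        \<open>q(u) = - a q(u')\<close>.\<close>
      then have r2: "r ^ 2 = p * r + a" using qroot_quadratic[OF qu' r] unfolding p_def by simp
      define L where "L = qadj E' r"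
      have L: "subfld L" unfolding L_def by (rule subfld_qadj[OF E' r2 pE aE' False])
      have "tot_isotropic L n c m" unfolding L_def
        by (rule PE[OF E' EE' E'A True False uE]) (use r qu' qv_cong[of n u' "\<lambda>_. 0" c] in auto)
      then obtain S w where S: "card S = m" "echelon L n S w" "isotropic_family n c S w" unfolding tot_isotropic_def by blast
      obtain w0 w1 where w: "\<And>s. s \<in> S \<Longrightarrow> vin E' n (w0 s)" "\<And>s. s \<in> S \<Longrightarrow> vin E' n (w1 s)"
        "\<And>s k. s \<in> S \<Longrightarrow> k < n \<Longrightarrow> w s k = w0 s k + w1 s k * r"
        "\<And>s t. s \<in> S \<Longrightarrow> t \<in> S \<Longrightarrow> w0 s t = (if s = t then 1 else 0)" "\<And>s t. s \<in> S \<Longrightarrow> t \<in> S \<Longrightarrow> w1 s t = 0"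
        by (rule qadj_components[OF E' r2 pE False S(2)[unfolded L_def]]) (rule that; assumption)
      have lt: "s < n" if "s \<in> S" for s using that S(2) unfolding echelon_def by auto
      \<comment> \<open>The component of \<open>q(W0 + r W1)\<close> at 1 is
        \<open>q(W0) + a q(W1)\<close>, the value of the doubled form at \<open>(W0, W1)\<close>. So
        zeros of \<open>q\<close> over \<open>E'(r)\<close> become zeros of the doubled form over
        \<open>E'\<close>.\<close>
      have key: "qv (n + n) ?c (cat n W0 W1) = 0"
        if W: "vin E' n W0" "vin E' n W1" "qv n c (\<lambda>k. W0 k + W1 k * r) = 0" for W0 W1
      proof -
        have "qv n c (\<lambda>k. W0 k + W1 k * r) = qv n c (\<lambda>k. W0 k + r * W1 k)" by (simp add: mult.commute)
        also have "\<dots> = qv n c W0 + r\<^sup>2 * qv n c W1 + r * pol n c W0 W1"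
          by (simp only: qv_add qv_scale pol_scale)
        also have "\<dots> = (qv n c W0 + a * qv n c W1) + (p * qv n c W1 + pol n c W0 W1) * r"
          unfolding r2 by (simp add: algebra_simps)
        finally have 0: "(qv n c W0 + a * qv n c W1) + (p * qv n c W1 + pol n c W0 W1) * r = 0" using W(3) by simp
        have "qv n c W0 + a * qv n c W1 \<in> E'" "p * qv n c W1 + pol n c W0 W1 \<in> E'"
          using qv_in[OF E' cE'] pol_in[OF E' cE'] W pE aE' by (simp_all add: subfldD[OF E'])
        then have "qv n c W0 + a * qv n c W1 = 0" using norm_nonzero(2)[OF E' r2 pE False] 0 by blast
        then show ?thesis by (simp add: qv_cat qv_scalec)
      qed
      \<comment> \<open>Over \<open>E'\<close> the isotropic space has the basis \<open>w s\<close>,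
        \<open>r * w s\<close>. The second half lists the components of \<open>r * w s\<close>: by
        the equation of \<open>r\<close> they are \<open>a * w1\<close> at 1 and
        \<open>w0 + p * w1\<close> at \<open>r\<close>.\<close>
      define f where "f = (\<lambda>s. if s < n then cat n (w0 s) (w1 s)
        else cat n (\<lambda>k. a * w1 (s - n) k) (\<lambda>k. w0 (s - n) k + p * w1 (s - n) k))"
      let ?S = "S \<union> (+) n ` S"
      have v0: "vin E' n (w0 s)" "vin E' n (w1 s)" "vin E' n (\<lambda>k. a * w1 s k)" "vin E' n (\<lambda>k. w0 s k + p * w1 s k)"
        if "s \<in> S" for s using w(1,2)[OF that] aE' pE unfolding vin_def by (auto simp: subfldD[OF E'])
      have w2: "w0 s t = (if s = t then 1 else 0)" "w1 s t = 0" if "s \<in> S" "t \<in> S" for s t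
        using w(4,5) that by blast+
      have eS: "echelon E' n S w0" unfolding echelon_def using lt v0(1) w2(1) by auto
      have e: "card ?S = 2 * card S" "echelon E' (n + n) ?S f"
        unfolding f_def
        using echelon_cat[OF eS, of w0 w1 "\<lambda>s k. w0 s k + p * w1 s k" "\<lambda>s k. a * w1 s k"] v0 w2 by simp_all
      have rep: "\<exists>W0 W1. f s = cat n W0 W1 \<and> vin E' n W0 \<and> vin E' n W1 \<and> (\<exists>W\<in>lin_span L S w. \<forall>k<n. W k = W0 k + W1 k * r)"
        if s: "s \<in> ?S" for s
      proof -
        obtain s' where s': "s' \<in> S" "s = s' \<or> s = n + s'" using s by auto
        have ws: "w s' \<in> lin_span L S w" using lin_span_base[OF L echelon_finite[OF S(2)] s'(1)] .
        have wr: "(\<lambda>k. r * w s' k) \<in> lin_span L S w" using lin_span_scale[OF L ws] qadj_gen[OF E'] unfolding L_def by blast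
        have sw: "r * w s' k = a * w1 s' k + (w0 s' k + p * w1 s' k) * r" if "k < n" for k
        proof -
          have "r * w s' k = w0 s' k * r + w1 s' k * r\<^sup>2" using w(3)[OF s'(1) that] by (simp add: algebra_simps power2_eq_square)
          then show ?thesis unfolding r2 by (simp add: algebra_simps)
        qed
        show ?thesis
        proof (cases "s = s'")
          case True
          then have "f s = cat n (w0 s') (w1 s')" using lt s' unfolding f_def by simp
          then show ?thesis using v0(1,2)[OF s'(1)] ws w(3)[OF s'(1)]
            by (intro exI[of _ "w0 s'"] exI[of _ "w1 s'"] conjI bexI[of _ "w s'"]) auto
        next
          case False
          then have "f s = cat n (\<lambda>k. a * w1 s' k) (\<lambda>k. w0 s' k + p * w1 s' k)" using s' unfolding f_def by simp
          then show ?thesis using v0(3,4)[OF s'(1)] wr sw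
            by (intro exI[of _ "\<lambda>k. a * w1 s' k"] exI[of _ "\<lambda>k. w0 s' k + p * w1 s' k"] conjI
                bexI[of _ "\<lambda>k. r * w s' k"]) auto
        qed
      qed
      have qf: "qv (n + n) ?c (f s) = 0" if s: "s \<in> ?S" for s
      proof -
        obtain W0 W1 W where h: "f s = cat n W0 W1" "vin E' n W0" "vin E' n W1" "W \<in> lin_span L S w" "\<forall>k<n. W k = W0 k + W1 k * r"
          using rep[OF s] by blast
        have "qv n c (\<lambda>k. W0 k + W1 k * r) = qv n c W" by (rule qv_cong) (use h(5) in simp)
        also have "\<dots> = 0" by (rule isotropic_family_lin_span[OF S(3) h(4)])
        finally have "qv n c (\<lambda>k. W0 k + W1 k * r) = 0" .
        then show ?thesis unfolding h(1) by (rule key[OF h(2,3)])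
      qed
      \<comment> \<open>Polar products are read off from sums, which again come from vectors of the
        isotropic space.\<close>
      have qff: "qv (n + n) ?c (\<lambda>k. f s k + f t k) = 0" if s: "s \<in> ?S" "t \<in> ?S" for s t
      proof -
        obtain W0 W1 W where h: "f s = cat n W0 W1" "vin E' n W0" "vin E' n W1" "W \<in> lin_span L S w" "\<forall>k<n. W k = W0 k + W1 k * r"
          using rep[OF s(1)] by blast
        obtain V0 V1 V where g: "f t = cat n V0 V1" "vin E' n V0" "vin E' n V1" "V \<in> lin_span L S w" "\<forall>k<n. V k = V0 k + V1 k * r"
          using rep[OF s(2)] by blast
        have 1: "(\<lambda>k. f s k + f t k) = cat n (\<lambda>k. W0 k + V0 k) (\<lambda>k. W1 k + V1 k)"
          unfolding h(1) g(1) cat_def by auto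
        have "qv n c (\<lambda>k. (W0 k + V0 k) + (W1 k + V1 k) * r) = qv n c (\<lambda>k. W k + V k)"
          using h(5) g(5) by (intro qv_cong) (simp add: algebra_simps)
        also have "\<dots> = 0" by (rule isotropic_family_lin_span[OF S(3) lin_span_add[OF L h(4) g(4)]])
        finally show ?thesis unfolding 1
          using h(2,3) g(2,3) by (intro key) (auto simp: vin_def subfldD[OF E'])
      qed
      have "isotropic_family (n + n) ?c ?S f" unfolding isotropic_family_def using qf qff by (simp add: pol_qv)
      then show ?thesis unfolding tot_isotropic_def using e S(1) by (intro exI[of _ ?S] exI[of _ f]) simp
    next
      case True': True
      have u0: "u k + r * u' k = 0" if "k < n" for k
        by (rule anisD[OF True _ r that]) (use uE True' in \<open>auto simp: vin_def subfldD[OF E']\<close>)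
      have "qv n c u = qv n c (\<lambda>k. (- r) * u' k)"
        using u0 by (intro qv_cong) (simp add: eq_neg_iff_add_eq_0)
      then have "r\<^sup>2 * qv n c u' + a * qv n c u' = 0" using eq by (simp only: qv_scale) simp
      \<comment> \<open>So \<open>q(r x) + a q(x) = 0\<close> for every \<open>x\<close>: the graph
        of multiplication by \<open>r\<close> is totally isotropic. It remains to see that its
        dimension \<open>n\<close> is large enough.\<close>
      then have ra: "r\<^sup>2 + a = 0" using qu' by (simp flip: distrib_right)
      have e1: "qv n c (unitv 1) \<noteq> 0"
      proof
        assume "qv n c (unitv 1) = 0"
        from anisD[OF True vin_unitv[OF E'] this, of 1] n show False by (simp add: unitv_def)
      qed
      \<comment> \<open>An auxiliary quadratic extension of \<open>E'\<close> that makes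
        \<open>q\<close> isotropic, only to obtain \<open>2 * m \<le> n\<close>. Two basis vectors
        are available because \<open>2 \<le> n\<close>.\<close>
      obtain \<rho> where \<rho>: "qv n c (\<lambda>k. unitv 0 k + \<rho> * unitv 1 k) = 0" using qroot_exists[OF e1] by blast
      have "\<rho> \<notin> E'"
      proof
        assume "\<rho> \<in> E'"
        then have "vin E' n (\<lambda>k. unitv 0 k + \<rho> * unitv 1 k)"
          using vin_unitv[OF E'] unfolding vin_def by (auto simp: subfldD[OF E'])
        from anisD[OF True this \<rho>, of 0] n show False by (simp add: unitv_def)
      qed
      note qe' = quadratic_extension[OF E' cE' True this vin_unitv[OF E'] vin_unitv[OF E'] _ \<rho>]
      have ex1: "\<exists>k<n. unitv 1 k \<noteq> (0::'w)" using n by (auto simp: unitv_def intro!: exI[of _ 1])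
      define L where "L = qadj E' \<rho>"
      have L: "subfld L" unfolding L_def by (rule qe'(5)[OF ex1])
      have "tot_isotropic L n c m" unfolding L_def
        by (rule PE[OF E' EE' E'A True \<open>\<rho> \<notin> E'\<close> vin_unitv[OF E'] vin_unitv[OF E'] ex1 \<rho>])
      then obtain S w where S: "card S = m" "echelon L n S w" "isotropic_family n c S w" unfolding tot_isotropic_def by blast
      obtain w0 w1 where w: "\<And>s. s \<in> S \<Longrightarrow> vin E' n (w0 s)" "\<And>s. s \<in> S \<Longrightarrow> vin E' n (w1 s)"
        "\<And>s k. s \<in> S \<Longrightarrow> k < n \<Longrightarrow> w s k = w0 s k + w1 s k * \<rho>"
        "\<And>s t. s \<in> S \<Longrightarrow> t \<in> S \<Longrightarrow> w0 s t = (if s = t then 1 else 0)" "\<And>s t. s \<in> S \<Longrightarrow> t \<in> S \<Longrightarrow> w1 s t = 0"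
        by (rule qadj_components[OF E' qe'(2,3)[OF ex1] \<open>\<rho> \<notin> E'\<close> S(2)[unfolded L_def]]) (rule that; assumption)
      have fS: "finite S" and sS: "S \<subseteq> {..<n}" using echelon_finite[OF S(2)] S(2) unfolding echelon_def by auto
      \<comment> \<open>A relation among the second components gives a vector of the isotropic space
        with coordinates in \<open>E'\<close>. By anisotropy it is 0, and its pivot entries are the
        coefficients of the relation.\<close>
      have ind: "lin_indep E' n S w1" unfolding lin_indep_def
      proof safe
        fix b i assume b: "\<forall>s\<in>S. b s \<in> E'" "\<forall>k<n. (\<Sum>s\<in>S. b s * w1 s k) = 0" "i \<in> S"
        define W where "W = (\<lambda>k. \<Sum>s\<in>S. b s * w s k)"
        have W: "W k = (\<Sum>s\<in>S. b s * w0 s k)" if "k < n" for k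
        proof -
          have "W k = (\<Sum>s\<in>S. b s * w0 s k + b s * w1 s k * \<rho>)"
            unfolding W_def using w(3) that by (intro sum.cong) (auto simp: algebra_simps)
          also have "\<dots> = (\<Sum>s\<in>S. b s * w0 s k) + (\<Sum>s\<in>S. b s * w1 s k) * \<rho>"
            by (simp add: sum.distrib sum_distrib_right)
          finally show ?thesis using b(2) that by simp
        qed
        have "vin E' n W" unfolding vin_def using W b(1) w(1)
          by (auto simp: vin_def intro!: subfld_sum[OF E'] subfldD(4)[OF E'])
        moreover have "W \<in> lin_span L S w" unfolding lin_span_def W_def using b(1) qadj_base[OF E'] unfolding L_def by blast
        then have "qv n c W = 0" by (rule isotropic_family_lin_span[OF S(3)])
        ultimately have "W i = 0" using anisD[OF True, of W i] sS b(3) by auto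
        moreover have "W i = (\<Sum>s\<in>S. b s * (if s = i then 1 else 0))"
          unfolding W_def using S(2) b(3) by (intro sum.cong) (auto simp: echelon_def)
        ultimately show "b i = 0" using fS b(3) by (simp add: mult_delta_right cong: if_cong)
      qed
      from echelon_exists[OF E' subfld_valuation_ring[OF E'] fS w(2) ind] obtain R v where
        R: "card R = card S" "echelon E' n R v" "\<forall>s\<in>R. v s \<in> lin_span E' S w1" by blast
      \<comment> \<open>All \<open>w1 s\<close> vanish on \<open>S\<close>, so an echelon form of
        their span has its pivots elsewhere; together these are \<open>2 * m\<close> coordinates
        below \<open>n\<close>.\<close>
      have "R \<inter> S = {}"
      proof (rule ccontr)
        assume "R \<inter> S \<noteq> {}"
        then obtain i where i: "i \<in> R" "i \<in> S" by blast
        obtain b where b: "v i = (\<lambda>k. \<Sum>s\<in>S. b s * w1 s k)" using R(3) i(1) unfolding lin_span_def by blast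
        have "v i i = 0" unfolding b using w(5) i(2) by simp
        then show False using R(2) i(1) unfolding echelon_def by force
      qed
      then have "card (R \<union> S) = 2 * m" using R(1) S(1) fS echelon_finite[OF R(2)] by (simp add: card_Un_disjoint)
      moreover have "R \<union> S \<subseteq> {..<n}" using sS R(2) unfolding echelon_def by blast
      ultimately have "2 * m \<le> n" using card_mono[of "{..<n}" "R \<union> S"] by simp
      moreover have "tot_isotropic E' (n + n) ?c n"
      proof -
        let ?f = "\<lambda>s. cat n (\<lambda>k. r * unitv (s - n) k) (unitv (s - n))"
        have q0: "r\<^sup>2 * qv n c x + a * qv n c x = 0" for x
          using ra by (metis distrib_right mult_zero_left)
        have "echelon E' (n + n) {n..<n + n} ?f" unfolding echelon_def
        proof (intro conjI ballI)
          show "vin E' (n + n) (?f s)" for s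
            using vin_unitv[OF E', of n "s - n"] True' by (intro vin_cat) (auto simp: vin_def subfldD[OF E'])
          show "?f s t = (if s = t then 1 else 0)" if "s \<in> {n..<n + n}" "t \<in> {n..<n + n}" for s t
            using that by (auto simp: cat_def unitv_def)
        qed auto
        moreover have "isotropic_family (n + n) ?c {n..<n + n} ?f" unfolding isotropic_family_def
        proof (intro ballI conjI)
          fix s t
          show "qv (n + n) ?c (?f s) = 0" by (simp only: qv_cat qv_scalec qv_scale q0)
          have "r * (r * pol n c (unitv (s - n)) (unitv (t - n))) + a * pol n c (unitv (s - n)) (unitv (t - n))
             = (r\<^sup>2 + a) * pol n c (unitv (s - n)) (unitv (t - n))" by (simp add: algebra_simps power2_eq_square)
          then show "pol (n + n) ?c (?f s) (?f t) = 0" using ra by (simp only: pol_cat pol_scalec pol_scale pol_scale2) simp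
        qed
        ultimately show ?thesis unfolding tot_isotropic_def by (intro exI[of _ "{n..<n + n}"] exI[of _ ?f]) simp
      qed
      ultimately show ?thesis using tot_isotropic_le by blast
    qed
  qed
qed


section \<open>Specialising the generic zero\<close>

text \<open>Moving the base point along \<open>x + \<tau> w\<close> makes the equation for the zero
  in direction \<open>y\<close> polynomial in \<open>\<tau>\<close>; at \<open>\<tau> = 0\<close> it
  becomes the equation of \<open>z\<close>.\<close>

lemma tot_isotropic_specialise_form:
  fixes Z :: "'w::field"
  assumes E: "subfld E" and t: "transcendental E \<tau>" and c: "cin E n c"
    and x: "vin E n x" and w: "vin E n w" and y: "vin E n y" "qv n c y \<noteq> 0"
    and Z: "qv n c (\<lambda>k. (x k + \<tau> * w k) + Z * y k) = 0" "Z \<notin> adj E \<tau>"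
    and z: "qv n c (\<lambda>k. x k + z * y k) = 0" "z \<notin> E"
    and tot_isotropic: "tot_isotropic (qadj (adj E \<tau>) Z) n c m"
  shows "tot_isotropic (qadj E z) n c m"
proof -
  define q where "q = qv n c y"
  \<comment> \<open>With \<open>g\<close>, the coefficients \<open>- pol(x + X w, y) / q(y)\<close>
    and \<open>- q(x + X w) / q(y)\<close> of the equation of \<open>Z\<close>, as polynomials in
    \<open>X\<close>.\<close>
  define f where "f = [:- pol n c x y / q, - pol n c w y / q:]"
  define g where "g = [:- qv n c x / q, - pol n c x w / q, - qv n c w / q:]"
  have mem: "pol n c x y \<in> E" "pol n c w y \<in> E" "pol n c x w \<in> E" "qv n c x \<in> E" "qv n c w \<in> E" "q \<in> E"
    unfolding q_def by (intro pol_in[OF E c] qv_in[OF E c] x w y)+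
  have fg: "pin E f" "pin E g" unfolding f_def g_def using mem by (simp_all add: pin_intros[OF E] subfldD[OF E])
  have "Z ^ 2 = poly f \<tau> * Z + poly g \<tau>"
    using qroot_quadratic[OF y(2) Z(1)] unfolding f_def g_def q_def[symmetric]
    by (simp add: qv_add qv_scale pol_add2 pol_scale2 pol_scale add_divide_distrib diff_divide_distrib algebra_simps power2_eq_square)
  moreover have "z ^ 2 = poly f 0 * z + poly g 0"
    using qroot_quadratic[OF y(2) z(1)] unfolding f_def g_def q_def[symmetric] by simp
  ultimately show ?thesis using tot_isotropic_specialise[OF E t fg _ Z(2) _ z(2) c tot_isotropic] by blast
qed

text \<open>Stage \<open>k\<close> contains the \<open>T i\<close> with \<open>i < k\<close>, so
  \<open>T k\<close> is the element to be transcendental over it.\<close>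

fun tower :: "'w::field set \<Rightarrow> (nat \<Rightarrow> 'w) \<Rightarrow> nat \<Rightarrow> 'w set" where
  "tower E T 0 = E"
| "tower E T (Suc k) = adj (tower E T k) (T k)"

lemma subfld_tower: "subfld E \<Longrightarrow> subfld (tower E T k)"
  by (induction k) (auto intro: subfld_adj)

lemma tower_Suc: "subfld E \<Longrightarrow> tower E T k \<subseteq> tower E T (Suc k)"
  using adj_base[OF subfld_tower] by simp

lemma tower_le: "subfld E \<Longrightarrow> k \<le> l \<Longrightarrow> tower E T k \<subseteq> tower E T l"
  using tower_Suc[of E T] by (rule lift_Suc_mono_le)

lemma tower_mono: "subfld E \<Longrightarrow> subfld A \<Longrightarrow> E \<subseteq> A \<Longrightarrow> tower E T k \<subseteq> tower A T k"
  by (induction k) (auto intro: adj_mono[OF subfld_tower, THEN subsetD])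

lemma tower_gen: "subfld E \<Longrightarrow> k < l \<Longrightarrow> T k \<in> tower E T l"
  using tower_le[of E "Suc k" l T] adj_gen[OF subfld_tower[of E T k], of "T k"] by auto

lemma tower_aniso:
  assumes "(2::'w::field) = 0" "subfld E" "\<And>k. transcendental (tower E T k) (T k)" "cin E n c" "aniso E n (c :: nat \<Rightarrow> nat \<Rightarrow> 'w)"
  shows "aniso (tower E T k) n c"
proof (induction k)
  case (Suc k)
  have "cin (tower E T k) n c" using assms(4) tower_le[OF assms(2), of 0 k T] unfolding cin_def by auto
  then show ?case using aniso_adj[OF assms(1) subfld_tower[OF assms(2)] assms(3) _ Suc] by simp
qed (use assms in simp)

text \<open>
  \<open>\<xi>\<close> is a generic point of the affine quadric \<open>q(1, \<xi>\<^sub>1, \<dots>, \<xi>\<^bsub>n-1\<^esub>) = 0\<close> over \<open>F\<close>: its first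
  coordinates are successively transcendental over a tower of fields \<open>M\<close>, the last one is not
  in the tower.
\<close>

definition generic_zero :: "'w::field set \<Rightarrow> nat \<Rightarrow> (nat \<Rightarrow> nat \<Rightarrow> 'w) \<Rightarrow> (nat \<Rightarrow> 'w set) \<Rightarrow> (nat \<Rightarrow> 'w) \<Rightarrow> bool" where
  "generic_zero F n c M \<xi> \<longleftrightarrow> (\<forall>i. subfld (M i) \<and> M i \<subseteq> M (Suc i) \<and> F \<subseteq> M i) \<and> \<xi> 0 = 1 \<and>
     (\<forall>i. 1 \<le> i \<and> i < n - 1 \<longrightarrow> \<xi> i \<in> M (Suc i) \<and> transcendental (M i) (\<xi> i)) \<and>
     \<xi> (n - 1) \<notin> M (n - 1) \<and> qv n c \<xi> = 0"

text \<open>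
  A zero \<open>x + z y\<close> over \<open>E(z)\<close> is reached from a generic one in three moves: with \<open>e\<close> the last basis
  vector, the conic \<open>q(x + T\<^sub>0 y + t e) = 0\<close> has the function field \<open>E(T\<^sub>0)(t) = E(t)(T\<^sub>0)\<close> and specialises
  to \<open>E(z)\<close> at \<open>t = 0\<close>; then the coordinates of \<open>x + T\<^sub>0 y\<close> except the last are replaced by new
  variables one at a time; then one scales the first coordinate to \<open>1\<close>.
\<close>

theorem quadratic_isotropy_base:
  fixes c :: "nat \<Rightarrow> nat \<Rightarrow> 'w::alg_closed_field"
  assumes c2: "(2::'w) = 0" and A: "alg_closed_in A" and T: "\<And>k. transcendental (tower A T k) (T k)"
    and F: "subfld F" "F \<subseteq> A" and c: "cin F n c" and n: "2 \<le> n"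
    and gen: "\<And>M \<xi> L. generic_zero F n c M \<xi> \<Longrightarrow> subfld L \<Longrightarrow> F \<subseteq> L \<Longrightarrow> (\<And>i. i < n \<Longrightarrow> \<xi> i \<in> L) \<Longrightarrow> tot_isotropic L n c m"
  shows "quadratic_isotropy F A n c m"
  unfolding quadratic_isotropy_def
proof (intro allI impI, elim conjE)
  fix E x y z assume E: "subfld E" "F \<subseteq> E" "E \<subseteq> A" and an: "aniso E n c" and z: "z \<notin> E"
    and xy: "vin E n x" "vin E n y" "\<exists>k<n. y k \<noteq> 0" "qv n c (\<lambda>k. x k + z * y k) = 0"
  have sA: "subfld A" using A unfolding alg_closed_in_def by blast
  have cE: "cin E n c" using c E(2) unfolding cin_def by blast
  note qe = quadratic_extension[OF E(1) cE an z xy]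
  define B where "B = tower E T"
  have sB: "subfld (B k)" for k unfolding B_def by (rule subfld_tower[OF E(1)])
  have TB: "transcendental (B k) (T k)" for k
    unfolding B_def using transcendental_mono[OF T tower_mono[OF E(1) sA E(3)]] .
  have anB: "aniso (B k) n c" for k unfolding B_def
    by (rule tower_aniso[OF c2 E(1) _ cE an]) (use TB B_def in simp)
  have EB: "E \<subseteq> B k" for k unfolding B_def using tower_le[OF E(1), of 0 k T] by simp
  have cB: "cin (B k) n c" for k using cE EB unfolding cin_def by blast
  have BS: "B k \<subseteq> B (Suc k)" for k unfolding B_def by (rule tower_Suc[OF E(1)])
  have Bgen: "T k \<in> B l" if "k < l" for k l unfolding B_def by (rule tower_gen[OF E(1) that])
  have T0: "T k \<noteq> 0" for k using transcendental_notin[OF sB TB, of k] subfldD(1)[OF sB, of k] by metis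
  define e :: "nat \<Rightarrow> 'w" where "e = unitv (n - 1)"
  have eE: "vin K n e" if "subfld K" for K unfolding e_def by (rule vin_unitv[OF that])
  have qe0: "qv n c e \<noteq> 0"
  proof
    assume "qv n c e = 0"
    from anisD[OF an eE[OF E(1)] this, of "n - 1"] n show False by (simp add: e_def unitv_def)
  qed
  have e0: "e k = 0" if "k < n - 1" for k using that unfolding e_def unitv_def by simp
  define v where "v = (\<lambda>k. x k + T 0 * y k)"
  have vB: "vin (B 1) n v" unfolding vin_def v_def
    using xy(1,2) EB Bgen[of 0 1] by (auto simp: vin_def intro!: subfldD(3,4)[OF sB])
  \<comment> \<open>Otherwise transcendence of \<open>T 0\<close> forces \<open>x\<close> and
    \<open>y\<close> to be concentrated on the last coordinate. Then \<open>x + z y\<close> is a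
    multiple of \<open>e\<close>, and \<open>q(e) \<noteq> 0\<close> makes it 0, so
    \<open>y = 0\<close>.\<close>
  have v0: "\<exists>k<n - 1. v k \<noteq> 0"
  proof (rule ccontr)
    assume h: "\<not> (\<exists>k<n - 1. v k \<noteq> 0)"
    have xy0: "x k = 0 \<and> y k = 0" if k: "k < n - 1" for k
    proof -
      have "poly [:x k, y k:] (T 0) = 0" using h k unfolding v_def by (simp add: mult.commute)
      moreover have "pin (B 0) [:x k, y k:]"
        using xy(1,2) k EB[of 0] by (auto simp: vin_def intro!: pin_intros[OF sB])
      ultimately have "[:x k, y k:] = 0" using TB[of 0] unfolding transcendental_def by blast
      then show ?thesis by simp
    qed
    have "qv n c (\<lambda>k. x k + z * y k) = qv n c (\<lambda>k. (x (n - 1) + z * y (n - 1)) * e k)"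
      using xy0 n by (intro qv_cong) (auto simp: e_def unitv_def less_Suc_eq_le dest!: le_neq_implies_less)
    then have "(x (n - 1) + z * y (n - 1))\<^sup>2 * qv n c e = 0" using xy(4) by (simp only: qv_scale)
    then have "x (n - 1) + y (n - 1) * z = 0" using qe0 by (simp add: mult.commute)
    then have "y (n - 1) = 0"
      using norm_nonzero(2)[OF E(1) qe(2,3) z, of "x (n - 1)" "y (n - 1)"] xy(1,2) n unfolding vin_def by auto
    then have "\<forall>k<n. y k = 0" using xy0 by (metis Suc_diff_1 less_Suc_eq less_nat_zero_code linorder_cases)
    then show False using xy(3) by blast
  qed
  \<comment> \<open>\<open>T 0\<close> is already used in \<open>v\<close>, so coordinate
    \<open>i\<close> becomes \<open>T (Suc i)\<close>. As \<open>k \<le> n - 1\<close>, the last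
    coordinate is never replaced; it is governed by \<open>t\<close>.\<close>
  define u where "u = (\<lambda>k i. if i < k then T (Suc i) else v i)"
  have uB: "vin (B (Suc k)) n (u k)" for k
    unfolding vin_def u_def using vB Bgen tower_le[OF E(1), of 1 "Suc k" T] unfolding vin_def B_def[symmetric] by auto
  have u0: "\<exists>i<n - 1. u k i \<noteq> 0" if "k \<le> n - 1" for k
  proof (cases k)
    case 0
    then show ?thesis using v0 unfolding u_def by simp
  next
    case (Suc k')
    then show ?thesis using n T0 unfolding u_def by (intro exI[of _ 0]) simp
  qed
  \<comment> \<open>Adding a multiple of \<open>e\<close> does not touch the first
    \<open>n - 1\<close> coordinates. If one of them is nonzero, the zero is nontrivial, so
    \<open>t\<close> lies in no field over which \<open>q\<close> is anisotropic.\<close>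
  have tB: "t \<notin> K" if K: "subfld K" "aniso K n c" "vin K n w" "\<exists>i<n - 1. w i \<noteq> 0" "qv n c (\<lambda>i. w i + t * e i) = 0" for K w t
  proof
    assume "t \<in> K"
    then have "vin K n (\<lambda>i. w i + t * e i)" using K(3) eE[OF K(1)] unfolding vin_def by (auto intro: subfldD(3,4)[OF K(1)])
    moreover obtain i where i: "i < n - 1" "w i \<noteq> 0" using K(4) by blast
    ultimately have "w i + t * e i = 0" using anisD[OF K(2) _ K(5)] by simp
    then show False using i e0 by simp
  qed
  have claim: "tot_isotropic (qadj (B (Suc k)) t) n c m"
    if "k \<le> n - 1" "qv n c (\<lambda>i. u k i + t * e i) = 0" for k t
    using that
  proof (induction k arbitrary: t rule: inc_induct)
    case base
    \<comment> \<open>All coordinates but the last are variables now. Division by \<open>T 1\<close>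
      makes the first one 1, and the other quotients stay transcendental because \<open>T 1\<close>
      lies in the lower stages.\<close>
    define \<xi> where "\<xi> = (\<lambda>i. (u (n - 1) i + t * e i) / T 1)"
    have t: "t \<notin> B n" using tB[OF sB anB uB u0 base] n by simp
    have qt: "t ^ 2 = (- pol n c (u (n - 1)) e / qv n c e) * t + (- qv n c (u (n - 1)) / qv n c e)"
      by (rule qroot_quadratic[OF qe0 base])
    have uBn: "vin (B n) n (u (n - 1))" using uB[of "n - 1"] n by simp
    have sL: "subfld (qadj (B n) t)"
      by (rule subfld_qadj[OF sB qt _ _ t])
        (intro subfldD(8)[OF sB] subfldD(5)[OF sB] pol_in[OF sB cB] qv_in[OF sB cB] uBn eE[OF sB])+
    have T1: "T 1 \<in> B n" using Bgen[of 1 n] n by simp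
    have BL: "B n \<subseteq> qadj (B n) t" by (rule qadj_base[OF sB])
    have \<xi>i: "\<xi> i = T (Suc i) / T 1" if "i < n - 1" for i
      using that e0 unfolding \<xi>_def u_def by simp
    have "tot_isotropic (qadj (B n) t) n c m"
    proof (rule gen[of "\<lambda>i. B (Suc i)" \<xi>])
      show "generic_zero F n c (\<lambda>i. B (Suc i)) \<xi>" unfolding generic_zero_def
      proof (intro conjI allI impI)
        show "subfld (B (Suc i))" "B (Suc i) \<subseteq> B (Suc (Suc i))" "F \<subseteq> B (Suc i)" for i
          using sB BS EB E(2) by blast+
        show "\<xi> 0 = 1" using \<xi>i[of 0] n T0 by simp
        show "\<xi> i \<in> B (Suc (Suc i))" "transcendental (B (Suc i)) (\<xi> i)" if i: "1 \<le> i \<and> i < n - 1" for i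
        proof -
          have "T 1 \<in> B (Suc i)" using Bgen[of 1 "Suc i"] i by simp
          then have 1: "1 / T 1 \<in> B (Suc i)" using subfldD(2,8)[OF sB] by blast
          then show "transcendental (B (Suc i)) (\<xi> i)"
            using transcendental_affine[OF sB TB, of 0 "Suc i" "1 / T 1"] \<xi>i[of i] i subfldD(1)[OF sB] T0 by simp
          have "T (Suc i) \<in> B (Suc (Suc i))" using Bgen by simp
          then show "\<xi> i \<in> B (Suc (Suc i))"
            using \<xi>i[of i] i Bgen[of 1 "Suc (Suc i)"] subfldD(8)[OF sB] by simp
        qed
        show "\<xi> (n - 1) \<notin> B (Suc (n - 1))"
        proof
          assume "\<xi> (n - 1) \<in> B (Suc (n - 1))"
          then have "\<xi> (n - 1) * T 1 - u (n - 1) (n - 1) \<in> B n"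
            using n T1 uBn subfldD(4,7)[OF sB] unfolding vin_def by simp
          moreover have "\<xi> (n - 1) * T 1 - u (n - 1) (n - 1) = t"
            using T0 unfolding \<xi>_def e_def unitv_def by simp
          ultimately show False using t by simp
        qed
        have "qv n c \<xi> = qv n c (\<lambda>i. (1 / T 1) * (u (n - 1) i + t * e i))" unfolding \<xi>_def by (rule qv_cong) simp
        also have "\<dots> = 0" by (simp only: qv_scale base mult_zero_right)
        finally show "qv n c \<xi> = 0" .
      qed
      show "subfld (qadj (B n) t)" by (rule sL)
      show "F \<subseteq> qadj (B n) t" using E(2) EB BL by blast
      show "\<xi> i \<in> qadj (B n) t" if "i < n" for i unfolding \<xi>_def
        using that uBn eE[OF sB, of n] T1 BL qadj_gen[OF sB, of t n] unfolding vin_def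
        by (intro subfldD(8,3,4)[OF sL]) auto
    qed
    then show ?case using n by simp
  next
    case (step k)
    \<comment> \<open>Chosen so that \<open>\<tau> = 0\<close> turns \<open>u (Suc k)\<close> back
      into \<open>u k\<close>; over \<open>B (Suc k)\<close> it generates the same field as
      \<open>T (Suc k)\<close>.\<close>
    define \<tau> where "\<tau> = T (Suc k) - v k"
    have vk: "v k \<in> B (Suc k)"
      using vB tower_le[OF E(1), of 1 "Suc k" T] step.hyps unfolding vin_def B_def[symmetric] by auto
    have tr: "transcendental (B (Suc k)) \<tau>"
      using transcendental_affine[OF sB TB, of "- v k" "Suc k" 1] vk subfldD[OF sB] unfolding \<tau>_def by simp
    have adj: "adj (B (Suc k)) \<tau> = B (Suc (Suc k))"
    proof
      have "T (Suc k) \<in> B (Suc (Suc k))" "v k \<in> B (Suc (Suc k))" using Bgen vk BS by blast+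
      then show "adj (B (Suc k)) \<tau> \<subseteq> B (Suc (Suc k))"
        unfolding \<tau>_def by (intro adj_least sB BS subfldD(7)[OF sB])
      have "\<tau> + v k \<in> adj (B (Suc k)) \<tau>"
        by (intro subfldD(3)[OF subfld_adj[OF sB]] adj_gen[OF sB] subsetD[OF adj_base[OF sB] vk])
      then have "T (Suc k) \<in> adj (B (Suc k)) \<tau>" unfolding \<tau>_def by simp
      moreover have "B (Suc (Suc k)) = adj (B (Suc k)) (T (Suc k))" unfolding B_def by simp
      ultimately show "B (Suc (Suc k)) \<subseteq> adj (B (Suc k)) \<tau>"
        using adj_least[OF subfld_adj[OF sB] adj_base[OF sB]] by metis
    qed
    obtain Z where Z: "qv n c (\<lambda>i. u (Suc k) i + Z * e i) = 0" using qroot_exists[OF qe0] by blast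
    have uu: "u (Suc k) = (\<lambda>i. u k i + \<tau> * unitv k i)"
      unfolding u_def \<tau>_def unitv_def by (auto simp: less_Suc_eq)
    have kn: "k \<le> n - 1" "Suc k \<le> n - 1" using step.hyps by auto
    have Znot: "Z \<notin> adj (B (Suc k)) \<tau>" unfolding adj by (rule tB[OF sB anB uB u0[OF kn(2)] Z])
    have tnot: "t \<notin> B (Suc k)" by (rule tB[OF sB anB uB u0[OF kn(1)] step.prems])
    show ?case
      by (rule tot_isotropic_specialise_form[OF sB tr cB uB vin_unitv[OF sB] eE[OF sB] qe0 _ Znot step.prems tnot])
        (use Z uu step.IH[OF Z] adj in simp_all)
  qed
  obtain t where t: "qv n c (\<lambda>i. u 0 i + t * e i) = 0" using qroot_exists[OF qe0] by blast
  have TI1: "tot_isotropic (qadj (B 1) t) n c m" using claim[of 0 t] t by simp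
  have u0v: "u 0 = v" unfolding u_def by simp
  have comm: "(\<lambda>i. u 0 i + t * e i) = (\<lambda>i. (x i + t * e i) + T 0 * y i)" unfolding u0v v_def by (auto simp: algebra_simps)
  note t' = t[unfolded comm]
  \<comment> \<open>If \<open>t\<close> were algebraic over \<open>E\<close>, it would lie in
    \<open>A\<close>; then so would \<open>T 0\<close>, a root of a quadratic equation over
    \<open>A\<close>.\<close>
  have ttr: "transcendental E t" unfolding transcendental_def
  proof (rule ccontr)
    assume "\<not> (\<forall>p. pin E p \<and> poly p t = 0 \<longrightarrow> p = 0)"
    then obtain p where "pin E p" "poly p t = 0" "p \<noteq> 0" by blast
    then have tA: "t \<in> A" using A pin_mono[OF _ E(3)] unfolding alg_closed_in_def by blast
    have h: "vin A n (\<lambda>i. x i + t * e i)" "vin A n y" "cin A n c"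
      using xy(1,2) E(3) tA eE[OF sA, of] cE unfolding vin_def cin_def by (auto intro!: subfldD(3,4)[OF sA])
    have "- pol n c (\<lambda>i. x i + t * e i) y / qv n c y \<in> A" "- qv n c (\<lambda>i. x i + t * e i) / qv n c y \<in> A"
      by (intro subfldD(8)[OF sA] subfldD(5)[OF sA] pol_in[OF sA] qv_in[OF sA] h)+
    then have "T 0 \<in> A" using alg_closed_in_quadratic[OF A qroot_quadratic[OF qe(1) t']] by blast
    then show False using transcendental_notin[OF sA, of "T 0"] T[of 0] by simp
  qed
  define K where "K = adj E t"
  have K: "subfld K" "E \<subseteq> K" "t \<in> K" unfolding K_def using subfld_adj[OF E(1)] adj_base[OF E(1)] adj_gen[OF E(1)] by auto
  have anK: "aniso K n c" unfolding K_def by (rule aniso_adj[OF c2 E(1) ttr cE an])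
  have cK: "cin K n c" using cE K(2) unfolding cin_def by blast
  have xK: "vin K n (\<lambda>i. x i + t * e i)" "vin K n y"
    using xy(1,2) K(2,3) eE[OF K(1)] unfolding vin_def by (auto intro!: subfldD(3,4)[OF K(1)])
  \<comment> \<open>Otherwise \<open>v\<close> would have coordinates in \<open>E(t)\<close> and
    \<open>v + t e\<close> would be a zero there, although \<open>q\<close> stays anisotropic over
    this purely transcendental extension.\<close>
  have T0K: "T 0 \<notin> K"
  proof
    assume h: "T 0 \<in> K"
    have "vin K n v" unfolding v_def vin_def using xy(1,2) K(2) h by (auto simp: vin_def intro!: subfldD(3,4)[OF K(1)])
    from tB[OF K(1) anK this v0] t K(3) u0v show False by simp
  qed
  have sL: "subfld (qadj K (T 0))"
    by (rule quadratic_extension(5)[OF K(1) cK anK T0K xK xy(3) t'])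
  have KL: "K \<subseteq> qadj K (T 0)" by (rule qadj_base[OF K(1)])
  \<comment> \<open>The inclusion of \<open>E(T 0)(t)\<close> in \<open>E(t)(T 0)\<close> carries
    the isotropic space over to the field that has \<open>t\<close> as its variable.\<close>
  have "B 1 \<subseteq> qadj K (T 0)" unfolding B_def
    using adj_least[OF sL, of E "T 0"] K(2) KL qadj_gen[OF K(1)] by auto
  then have "qadj (B 1) t \<subseteq> qadj K (T 0)" using qadj_least[OF sL] KL K(3) by blast
  then have TI2: "tot_isotropic (qadj (adj E t) (T 0)) n c m" using tot_isotropic_mono[OF TI1] unfolding K_def by blast
  \<comment> \<open>At \<open>t = 0\<close> the equation of \<open>T 0\<close> becomes the equation
    of \<open>z\<close>.\<close>
  show "tot_isotropic (qadj E z) n c m"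
    by (rule tot_isotropic_specialise_form[OF E(1) ttr cE xy(1) eE[OF E(1)] xy(2) qe(1) t' _ xy(4) z TI2])
      (use T0K K_def in simp)
qed


section \<open>Polynomials in several variables\<close>

lemma finite_submultisets: "finite {k. k \<subseteq># (m :: 'c multiset)}"
proof (induction m)
  case (add x m)
  have "{k. k \<subseteq># add_mset x m} \<subseteq> {k. k \<subseteq># m} \<union> add_mset x ` {k. k \<subseteq># m}"
  proof
    fix k assume k: "k \<in> {k. k \<subseteq># add_mset x m}"
    show "k \<in> {k. k \<subseteq># m} \<union> add_mset x ` {k. k \<subseteq># m}"
    proof (cases "x \<in># k")
      case True
      then have "k = add_mset x (k - {#x#})" by simp
      moreover have "k - {#x#} \<subseteq># m" using k by (simp add: subset_eq_diff_conv)
      ultimately show ?thesis by blast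
    next
      case False
      have "count k y \<le> count m y" for y
        using k False by (cases "y = x") (auto simp: subseteq_mset_def not_in_iff dest: spec[of _ y])
      then show ?thesis by (simp add: subseteq_mset_def)
    qed
  qed
  then show ?case using add by (meson finite_Un finite_imageI finite_subset)
qed simp

text \<open>Factorisations of the monomial \<open>m\<close> correspond to its submultisets. The
  result is the convolution that \<open>mpoly_ring\<close> uses as its product.\<close>

lemma lookup_mult_mset:
  fixes p q :: "'c multiset \<Rightarrow>\<^sub>0 'w::comm_semiring_0"
  shows "Poly_Mapping.lookup (p * q) m = (\<Sum>k\<in>{k. k \<subseteq># m}. Poly_Mapping.lookup p k * Poly_Mapping.lookup q (m - k))"
proof -
  have inner: "(\<Sum>r. Poly_Mapping.lookup q r when m = l + r) = (Poly_Mapping.lookup q (m - l) when l \<subseteq># m)" for l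
  proof (cases "l \<subseteq># m")
    case True
    then have "m = l + r \<longleftrightarrow> r = m - l" for r by auto
    then show ?thesis using True by simp
  next
    case False
    then have "m \<noteq> l + r" for r by auto
    then show ?thesis using False by (simp add: when_def)
  qed
  have "Poly_Mapping.lookup (p * q) m = (\<Sum>l. Poly_Mapping.lookup p l * (Poly_Mapping.lookup q (m - l) when l \<subseteq># m))"
    unfolding lookup_mult inner ..
  also have "\<dots> = (\<Sum>l\<in>{k. k \<subseteq># m}. Poly_Mapping.lookup p l * (Poly_Mapping.lookup q (m - l) when l \<subseteq># m))"
    by (rule Sum_any.expand_superset[OF finite_submultisets]) (auto simp: when_def)
  also have "\<dots> = (\<Sum>k\<in>{k. k \<subseteq># m}. Poly_Mapping.lookup p k * Poly_Mapping.lookup q (m - k))"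
    by (intro sum.cong) (auto simp: when_def)
  finally show ?thesis .
qed

definition pvar :: "'c \<Rightarrow> 'c multiset \<Rightarrow>\<^sub>0 'w::comm_semiring_1" where
  "pvar i = Poly_Mapping.single {#i#} 1"

lemma lookup_pvar_mult:
  fixes p :: "'c multiset \<Rightarrow>\<^sub>0 'w::comm_semiring_1"
  shows "Poly_Mapping.lookup (pvar i * p) m = (if i \<in># m then Poly_Mapping.lookup p (m - {#i#}) else 0)"
proof -
  have "Poly_Mapping.lookup (pvar i * p) m = (\<Sum>k\<in>{k. k \<subseteq># m}. if k = {#i#} then Poly_Mapping.lookup p (m - k) else 0)"
    unfolding lookup_mult_mset pvar_def by (intro sum.cong) (auto simp: lookup_single)
  also have "\<dots> = (if i \<in># m then Poly_Mapping.lookup p (m - {#i#}) else 0)"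
    using finite_submultisets[of m] by (simp add: sum.delta' sum.delta)
  finally show ?thesis .
qed

definition mpoly_eval :: "('c \<Rightarrow> 'w) \<Rightarrow> ('c multiset \<Rightarrow>\<^sub>0 'w::comm_ring_1) \<Rightarrow> 'w" where
  "mpoly_eval \<xi> p = (\<Sum>m\<in>Poly_Mapping.keys p. Poly_Mapping.lookup p m * (\<Prod>i\<in>#m. \<xi> i))"

lemma mpoly_eval_superset:
  assumes "finite S" "Poly_Mapping.keys p \<subseteq> S"
  shows "mpoly_eval \<xi> p = (\<Sum>m\<in>S. Poly_Mapping.lookup p m * (\<Prod>i\<in>#m. \<xi> i))"
  unfolding mpoly_eval_def using assms by (intro sum.mono_neutral_left) (auto simp: in_keys_iff)

lemma mpoly_eval_add: "mpoly_eval \<xi> (p + q) = mpoly_eval \<xi> p + mpoly_eval \<xi> q"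
proof -
  let ?S = "Poly_Mapping.keys p \<union> Poly_Mapping.keys q"
  have k: "Poly_Mapping.keys (p + q) \<subseteq> ?S" by (auto simp: in_keys_iff lookup_add)
  show ?thesis using mpoly_eval_superset[of ?S p \<xi>] mpoly_eval_superset[of ?S q \<xi>] mpoly_eval_superset[OF _ k, of \<xi>]
    by (simp add: lookup_add sum.distrib algebra_simps)
qed

lemma mpoly_eval_single: "mpoly_eval \<xi> (Poly_Mapping.single m a) = a * (\<Prod>i\<in>#m. \<xi> i)"
  by (subst mpoly_eval_superset[of "{m}"]) auto

lemma mpoly_eval_zero [simp]: "mpoly_eval \<xi> 0 = 0"
  by (simp add: mpoly_eval_def)

lemma mpoly_eval_sum: "mpoly_eval \<xi> (\<Sum>i\<in>I. f i) = (\<Sum>i\<in>I. mpoly_eval \<xi> (f i))"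
  by (induction I rule: infinite_finite_induct) (simp_all add: mpoly_eval_add)

lemma poly_mapping_sum_single: "p = (\<Sum>m\<in>Poly_Mapping.keys p. Poly_Mapping.single m (Poly_Mapping.lookup p m))"
proof (rule poly_mapping_eqI)
  fix k
  have "Poly_Mapping.lookup (\<Sum>m\<in>Poly_Mapping.keys p. Poly_Mapping.single m (Poly_Mapping.lookup p m)) k =
    (\<Sum>m\<in>Poly_Mapping.keys p. if m = k then Poly_Mapping.lookup p m else 0)"
    unfolding lookup_sum by (intro sum.cong) (auto simp: lookup_single)
  then show "Poly_Mapping.lookup p k = Poly_Mapping.lookup (\<Sum>m\<in>Poly_Mapping.keys p. Poly_Mapping.single m (Poly_Mapping.lookup p m)) k"
    by (simp add: sum.delta in_keys_iff)
qed

lemma mpoly_eval_mult: "mpoly_eval \<xi> (p * q) = mpoly_eval \<xi> p * mpoly_eval \<xi> q"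
proof -
  have "p * q = (\<Sum>m\<in>Poly_Mapping.keys p. \<Sum>l\<in>Poly_Mapping.keys q.
      Poly_Mapping.single m (Poly_Mapping.lookup p m) * Poly_Mapping.single l (Poly_Mapping.lookup q l))"
    unfolding sum_product[symmetric] poly_mapping_sum_single[symmetric] ..
  then have "mpoly_eval \<xi> (p * q) = (\<Sum>m\<in>Poly_Mapping.keys p. \<Sum>l\<in>Poly_Mapping.keys q.
      (Poly_Mapping.lookup p m * (\<Prod>i\<in>#m. \<xi> i)) * (Poly_Mapping.lookup q l * (\<Prod>i\<in>#l. \<xi> i)))"
    by (simp add: mpoly_eval_sum mult_single mpoly_eval_single algebra_simps)
  then show ?thesis unfolding mpoly_eval_def sum_product .
qed

lemma mpoly_eval_pvar: "mpoly_eval \<xi> (pvar i) = \<xi> i"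
  by (simp add: pvar_def mpoly_eval_single)

lemma mpoly_eval_const: "mpoly_eval \<xi> (Poly_Mapping.single {#} a) = a"
  by (simp add: mpoly_eval_single)

text \<open>The rules mirror those of the carrier \<open>indexed_pset\<close>, so the image of that
  carrier can be determined by induction (\<open>mpoly_emb_image\<close>).\<close>

inductive_set mpoly_set :: "'w::comm_ring_1 set \<Rightarrow> 'c set \<Rightarrow> ('c multiset \<Rightarrow>\<^sub>0 'w) set" for K I where
  const: "k \<in> K \<Longrightarrow> Poly_Mapping.single {#} k \<in> mpoly_set K I"
| add: "p \<in> mpoly_set K I \<Longrightarrow> q \<in> mpoly_set K I \<Longrightarrow> p + q \<in> mpoly_set K I"
| var: "p \<in> mpoly_set K I \<Longrightarrow> i \<in> I \<Longrightarrow> pvar i * p \<in> mpoly_set K I"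

lemma single_empty_mult: "Poly_Mapping.single {#} a * Poly_Mapping.single {#} b = Poly_Mapping.single {#} (a * b)"
  by (simp add: mult_single)

lemma mpoly_set_smult:
  assumes K: "subfld K" and "a \<in> K" "p \<in> mpoly_set K I"
  shows "Poly_Mapping.single {#} a * p \<in> mpoly_set K I"
  using assms(3)
proof induction
  case (const k)
  then show ?case unfolding single_empty_mult using subfldD(4)[OF K assms(2)] by (intro mpoly_set.const) auto
next
  case (add p q)
  then show ?case unfolding distrib_left by (intro mpoly_set.add)
next
  case (var p i)
  then have "pvar i * (Poly_Mapping.single {#} a * p) \<in> mpoly_set K I" by (intro mpoly_set.var)
  then show ?case by (simp only: mult.left_commute)
qed

lemma mpoly_set_mult:
  assumes K: "subfld K" and "p \<in> mpoly_set K I" "q \<in> mpoly_set K I"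
  shows "p * q \<in> mpoly_set K I"
  using assms(2)
proof induction
  case (const k)
  then show ?case using mpoly_set_smult[OF K _ assms(3)] by blast
next
  case (add p q)
  then show ?case unfolding distrib_right by (intro mpoly_set.add)
next
  case (var p i)
  then show ?case unfolding mult.assoc by (intro mpoly_set.var)
qed

lemma mpoly_set_zero: "subfld K \<Longrightarrow> 0 \<in> mpoly_set K I"
  using mpoly_set.const[of 0 K I] subfldD(1)[of K] by simp

lemma mpoly_set_one: "subfld K \<Longrightarrow> 1 \<in> mpoly_set K I"
  using mpoly_set.const[of 1 K I] subfldD(2)[of K] by (simp add: zero_multiset_def[symmetric])

lemma mpoly_set_pvar: "subfld K \<Longrightarrow> i \<in> I \<Longrightarrow> pvar i \<in> mpoly_set K I"
  using mpoly_set.var[OF mpoly_set_one, of K i I] by simp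

lemma mpoly_set_uminus: "subfld K \<Longrightarrow> p \<in> mpoly_set K I \<Longrightarrow> - p \<in> mpoly_set K I"
  using mpoly_set_smult[of K "- 1" p I] subfldD(2,5)[of K]
  by (simp add: single_uminus zero_multiset_def[symmetric])

lemma mpoly_set_diff: "subfld K \<Longrightarrow> p \<in> mpoly_set K I \<Longrightarrow> q \<in> mpoly_set K I \<Longrightarrow> p - q \<in> mpoly_set K I"
  using mpoly_set.add[OF _ mpoly_set_uminus, of p K I q] by simp

lemma mpoly_set_sum: "subfld K \<Longrightarrow> (\<And>s. s \<in> S \<Longrightarrow> f s \<in> mpoly_set K I) \<Longrightarrow> sum f S \<in> mpoly_set K I"
  by (induction S rule: infinite_finite_induct) (auto intro: mpoly_set.add mpoly_set_zero)

lemma mpoly_set_mono: "p \<in> mpoly_set K I \<Longrightarrow> I \<subseteq> J \<Longrightarrow> p \<in> mpoly_set K J"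
  by (induction rule: mpoly_set.induct) (auto intro: mpoly_set.intros)

lemma mpoly_eval_in:
  assumes "p \<in> mpoly_set K I" "subfld L" "K \<subseteq> L" "\<And>i. i \<in> I \<Longrightarrow> \<xi> i \<in> L"
  shows "mpoly_eval \<xi> p \<in> L"
  using assms(1)
  by induction (use assms(3,4) in \<open>auto simp: mpoly_eval_const mpoly_eval_add mpoly_eval_mult mpoly_eval_pvar intro: subfldD(3,4)[OF assms(2)]\<close>)

text \<open>Sorting by powers of \<open>v\<close> reduces questions about several variables to
  polynomials in one.\<close>

lemma mpoly_set_insert_poly:
  assumes K: "subfld K" and "p \<in> mpoly_set K (insert v I)"
  shows "\<exists>P. (\<forall>j. Polynomial.coeff P j \<in> mpoly_set K I) \<and> p = poly P (pvar v)"
  using assms(2)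
proof induction
  case (const k)
  then show ?case using mpoly_set_zero[OF K]
    by (intro exI[of _ "[:Poly_Mapping.single {#} k:]"]) (auto simp: coeff_pCons mpoly_set.const split: nat.split)
next
  case (add p q)
  then obtain P Q where "\<forall>j. Polynomial.coeff P j \<in> mpoly_set K I" "p = poly P (pvar v)"
    "\<forall>j. Polynomial.coeff Q j \<in> mpoly_set K I" "q = poly Q (pvar v)" by blast
  then show ?case by (intro exI[of _ "P + Q"]) (auto intro: mpoly_set.add)
next
  case (var p i)
  then obtain P where P: "\<forall>j. Polynomial.coeff P j \<in> mpoly_set K I" "p = poly P (pvar v)" by blast
  show ?case
  proof (cases "i = v")
    case True
    then show ?thesis using P mpoly_set_zero[OF K]
      by (intro exI[of _ "pCons 0 P"]) (auto simp: coeff_pCons split: nat.split)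
  next
    case False
    then show ?thesis using P var by (intro exI[of _ "smult (pvar i) P"]) (auto intro: mpoly_set.var)
  qed
qed

lemma mpoly_set_empty: "p \<in> mpoly_set K {} \<Longrightarrow> subfld K \<Longrightarrow> \<exists>k\<in>K. p = Poly_Mapping.single {#} k"
proof (induction rule: mpoly_set.induct)
  case (add p q)
  then show ?case using subfldD(3)[of K] by (metis single_add)
qed auto

text \<open>Successively transcendental elements are algebraically independent: sorted by the last
  variable, a polynomial has coefficients whose values lie in \<open>M k\<close>, over which
  \<open>\<xi> k\<close> is transcendental. Variables start at 1 because coordinate 0 of a generic
  zero is 1.\<close>

lemma mpoly_eval_inj:
  fixes K :: "'w::field set" and \<xi> :: "nat \<Rightarrow> 'w"
  assumes K: "subfld K" and M: "\<And>i. subfld (M i)" "\<And>i. K \<subseteq> M i" "\<And>i. M i \<subseteq> M (Suc i)"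
    and \<xi>: "\<And>i. 1 \<le> i \<Longrightarrow> i < k \<Longrightarrow> \<xi> i \<in> M (Suc i) \<and> transcendental (M i) (\<xi> i)"
    and "p \<in> mpoly_set K {1..<k}" "mpoly_eval \<xi> p = 0"
  shows "p = 0"
  using assms(5-)
proof (induction k arbitrary: p)
  case 0
  then obtain a where "p = Poly_Mapping.single {#} a" using mpoly_set_empty[OF _ K] by auto
  then show ?case using 0 by (simp add: mpoly_eval_const)
next
  case (Suc k)
  show ?case
  proof (cases "k = 0")
    case True
    then obtain a where "p = Poly_Mapping.single {#} a" using mpoly_set_empty[OF _ K] Suc.prems by auto
    then show ?thesis using Suc.prems by (simp add: mpoly_eval_const)
  next
    case False
    then have "{1..<Suc k} = insert k {1..<k}" by auto
    then obtain P where P: "\<forall>j. Polynomial.coeff P j \<in> mpoly_set K {1..<k}" "p = poly P (pvar k)"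
      using mpoly_set_insert_poly[OF K] Suc.prems(2) by metis
    have "mpoly_eval \<xi> (poly P q) = poly (map_poly (mpoly_eval \<xi>) P) (mpoly_eval \<xi> q)" for q
      by (induction P) (simp_all add: mpoly_eval_add mpoly_eval_mult map_poly_pCons)
    then have 0: "poly (map_poly (mpoly_eval \<xi>) P) (\<xi> k) = 0" using Suc.prems(3) P(2) by (simp add: mpoly_eval_pvar)
    have mono: "M i \<subseteq> M j" if "i \<le> j" for i j
      using M(3) that by (rule lift_Suc_mono_le)
    have "mpoly_eval \<xi> (Polynomial.coeff P j) \<in> M k" for j
    proof (rule mpoly_eval_in[OF _ M(1,2)])
      show "Polynomial.coeff P j \<in> mpoly_set K {1..<k}" using P(1) by blast
      show "\<xi> i \<in> M k" if "i \<in> {1..<k}" for i using that Suc.prems(1)[of i] mono[of "Suc i" k] by auto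
    qed
    then have "pin (M k) (map_poly (mpoly_eval \<xi>) P)" unfolding pin_def by (simp add: coeff_map_poly)
    moreover have "transcendental (M k) (\<xi> k)" using Suc.prems(1)[of k] False by simp
    ultimately have "map_poly (mpoly_eval \<xi>) P = 0" using 0 unfolding transcendental_def by blast
    then have "mpoly_eval \<xi> (Polynomial.coeff P j) = 0" for j by (metis coeff_map_poly mpoly_eval_zero coeff_0)
    then have "Polynomial.coeff P j = 0" for j using Suc.IH[of "Polynomial.coeff P j"] Suc.prems(1) P(1) by simp
    then have "P = 0" by (simp add: poly_eq_iff)
    then show ?thesis using P(2) by simp
  qed
qed

text \<open>In the variable \<open>v\<close> the leading coefficient of \<open>f\<close> is the
  invertible constant \<open>a\<close>, so division with remainder works without fractions.\<close>

lemma mpoly_set_divide_quadratic: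
  assumes K: "subfld K" and a: "a \<in> K" "a \<noteq> 0" and L: "l \<in> mpoly_set K I" "r \<in> mpoly_set K I"
    and f: "f = Poly_Mapping.single {#} a * (pvar v * pvar v) + l * pvar v + r"
    and "p \<in> mpoly_set K (insert v I)"
  shows "\<exists>q\<in>mpoly_set K (insert v I). \<exists>s\<in>mpoly_set K I. \<exists>t\<in>mpoly_set K I. p = q * f + s * pvar v + t"
  using assms(7)
proof induction
  case (const k)
  then have "Poly_Mapping.single {#} k \<in> mpoly_set K I" by (rule mpoly_set.const)
  then show ?case using mpoly_set_zero[OF K] by (intro bexI[of _ 0] bexI[of _ "Poly_Mapping.single {#} k"]) auto
next
  case (add p p')
  then obtain q s t q' s' t' where h: "q \<in> mpoly_set K (insert v I)" "s \<in> mpoly_set K I" "t \<in> mpoly_set K I" "p = q * f + s * pvar v + t"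
    "q' \<in> mpoly_set K (insert v I)" "s' \<in> mpoly_set K I" "t' \<in> mpoly_set K I" "p' = q' * f + s' * pvar v + t'" by blast
  have "p + p' = (q + q') * f + (s + s') * pvar v + (t + t')" unfolding h(4,8) by (simp add: algebra_simps)
  then show ?case using h mpoly_set.add by blast
next
  case (var p i)
  then obtain q s t where h: "q \<in> mpoly_set K (insert v I)" "s \<in> mpoly_set K I" "t \<in> mpoly_set K I" "p = q * f + s * pvar v + t" by blast
  show ?case
  proof (cases "i = v")
    case False
    have "pvar i * p = (pvar i * q) * f + (pvar i * s) * pvar v + (pvar i * t)" unfolding h(4) by (simp add: algebra_simps)
    moreover have "pvar i * q \<in> mpoly_set K (insert v I)" "pvar i * s \<in> mpoly_set K I" "pvar i * t \<in> mpoly_set K I"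
      using False var(2) h by (auto intro: mpoly_set.var)
    ultimately show ?thesis by blast
  next
    case True
    define b :: "'b multiset \<Rightarrow>\<^sub>0 'a" where "b = Poly_Mapping.single {#} (inverse a)"
    have iK: "inverse a \<in> K" using subfldD(6)[OF K a(1)] .
    have b: "b \<in> mpoly_set K J" for J unfolding b_def by (rule mpoly_set.const[OF iK])
    have b1: "b * Poly_Mapping.single {#} a = 1"
      unfolding b_def single_empty_mult using a(2) by (simp add: zero_multiset_def[symmetric])
    \<comment> \<open>Multiplying by \<open>v\<close> turns the remainder \<open>s v + t\<close>
      into \<open>s v^2 + t v\<close>, where \<open>v^2\<close> must be reduced modulo
      \<open>f\<close>.\<close>
    have "b * f = b * Poly_Mapping.single {#} a * (pvar v * pvar v) + b * (l * pvar v + r)"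
      unfolding f by (simp add: algebra_simps)
    then have sq: "pvar v * pvar v = b * f - b * l * pvar v - b * r" unfolding b1 by (simp add: algebra_simps)
    have "pvar i * p = (pvar v * q) * f + s * (pvar v * pvar v) + t * pvar v"
      unfolding True h(4) by (simp add: algebra_simps)
    also have "\<dots> = (pvar v * q + s * b) * f + (t - s * (b * l)) * pvar v + - (s * (b * r))"
      unfolding sq by (simp add: algebra_simps)
    finally have e: "pvar i * p = (pvar v * q + s * b) * f + (t - s * (b * l)) * pvar v + - (s * (b * r))" .
    have "s \<in> mpoly_set K (insert v I)" using mpoly_set_mono[OF h(2)] by blast
    then have "pvar v * q + s * b \<in> mpoly_set K (insert v I)" using h(1) b
      by (intro mpoly_set.add mpoly_set.var mpoly_set_mult[OF K]) auto
    moreover have "t - s * (b * l) \<in> mpoly_set K I" "- (s * (b * r)) \<in> mpoly_set K I"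
      using h b L by (auto intro!: mpoly_set_diff[OF K] mpoly_set_uminus[OF K] mpoly_set_mult[OF K])
    ultimately show ?thesis using e by blast
  qed
qed


section \<open>Embedding ring records into types\<close>

text \<open>The bridge from ring records to type classes: by injectivity, identities in a record can
  be checked in the type.\<close>

definition ring_emb :: "('b, 'm) ring_scheme \<Rightarrow> ('b \<Rightarrow> 'w::comm_ring_1) \<Rightarrow> bool" where
  "ring_emb R g \<longleftrightarrow> cring R \<and> inj_on g (carrier R) \<and> g \<one>\<^bsub>R\<^esub> = 1 \<and>
    (\<forall>x\<in>carrier R. \<forall>y\<in>carrier R. g (x \<oplus>\<^bsub>R\<^esub> y) = g x + g y \<and> g (x \<otimes>\<^bsub>R\<^esub> y) = g x * g y)"

lemma rembD:
  assumes "ring_emb R g"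
  shows "cring R" "inj_on g (carrier R)" "g \<one>\<^bsub>R\<^esub> = 1"
    "\<And>x y. x \<in> carrier R \<Longrightarrow> y \<in> carrier R \<Longrightarrow> g (x \<oplus>\<^bsub>R\<^esub> y) = g x + g y"
    "\<And>x y. x \<in> carrier R \<Longrightarrow> y \<in> carrier R \<Longrightarrow> g (x \<otimes>\<^bsub>R\<^esub> y) = g x * g y"
  using assms unfolding ring_emb_def by blast+

lemma ring_emb_zero: assumes "ring_emb R g" shows "g \<zero>\<^bsub>R\<^esub> = 0"
proof -
  interpret cring R using rembD[OF assms] by simp
  have "g (\<zero>\<^bsub>R\<^esub> \<oplus>\<^bsub>R\<^esub> \<zero>\<^bsub>R\<^esub>) = g \<zero>\<^bsub>R\<^esub> + g \<zero>\<^bsub>R\<^esub>" using rembD(4)[OF assms] by blast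
  then show ?thesis by simp
qed

lemma ring_emb_uminus: assumes "ring_emb R g" "x \<in> carrier R" shows "g (\<ominus>\<^bsub>R\<^esub> x) = - g x"
proof -
  interpret cring R using rembD[OF assms(1)] by simp
  have "g (\<ominus>\<^bsub>R\<^esub> x \<oplus>\<^bsub>R\<^esub> x) = g (\<ominus>\<^bsub>R\<^esub> x) + g x" using rembD(4)[OF assms(1)] assms(2) by blast
  then have "g (\<ominus>\<^bsub>R\<^esub> x) + g x = 0" using assms(2) ring_emb_zero[OF assms(1)] by (simp add: l_neg)
  then show ?thesis by (simp add: eq_neg_iff_add_eq_0)
qed

lemma ring_emb_inj: "ring_emb R g \<Longrightarrow> x \<in> carrier R \<Longrightarrow> y \<in> carrier R \<Longrightarrow> g x = g y \<Longrightarrow> x = y"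
  unfolding ring_emb_def inj_on_def by blast

lemma ring_emb_eq_0: "ring_emb R g \<Longrightarrow> x \<in> carrier R \<Longrightarrow> g x = 0 \<longleftrightarrow> x = \<zero>\<^bsub>R\<^esub>"
  using ring_emb_inj[of R g x "\<zero>\<^bsub>R\<^esub>"] ring_emb_zero[of R g] rembD(1)[of R g] cring.cring_simprules(2) by fastforce

lemma finsum_closed':
  assumes "cring R" "\<And>i. i \<in> S \<Longrightarrow> f i \<in> carrier R"
  shows "finsum R f S \<in> carrier R"
proof -
  interpret cring R by (rule assms)
  show ?thesis by (rule finsum_closed) (use assms(2) in auto)
qed

lemma ring_emb_finsum:
  assumes g: "ring_emb R g" and "\<And>i. i \<in> S \<Longrightarrow> f i \<in> carrier R"
  shows "g (finsum R f S) = (\<Sum>i\<in>S. g (f i))"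
proof -
  interpret cring R using rembD[OF g] by simp
  show ?thesis using assms(2)
  proof (induction S rule: infinite_finite_induct)
    case (insert i S)
    then show ?case using rembD(4)[OF g] finsum_closed'[OF is_cring] by (simp add: Pi_def)
  qed (simp_all add: ring_emb_zero[OF g])
qed

text \<open>The ring laws are pulled back along the injective map \<open>g\<close>; in the record
  only closure and the existence of negatives remain to be checked.\<close>

lemma rembI:
  fixes g :: "'b \<Rightarrow> 'w::comm_ring_1"
  assumes inj: "inj_on g (carrier R)" and g: "g \<one>\<^bsub>R\<^esub> = 1" "g \<zero>\<^bsub>R\<^esub> = 0"
    "\<And>x y. x \<in> carrier R \<Longrightarrow> y \<in> carrier R \<Longrightarrow> g (x \<oplus>\<^bsub>R\<^esub> y) = g x + g y"
    "\<And>x y. x \<in> carrier R \<Longrightarrow> y \<in> carrier R \<Longrightarrow> g (x \<otimes>\<^bsub>R\<^esub> y) = g x * g y"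
    and cl: "\<one>\<^bsub>R\<^esub> \<in> carrier R" "\<zero>\<^bsub>R\<^esub> \<in> carrier R"
    "\<And>x y. x \<in> carrier R \<Longrightarrow> y \<in> carrier R \<Longrightarrow> x \<oplus>\<^bsub>R\<^esub> y \<in> carrier R"
    "\<And>x y. x \<in> carrier R \<Longrightarrow> y \<in> carrier R \<Longrightarrow> x \<otimes>\<^bsub>R\<^esub> y \<in> carrier R"
    "\<And>x. x \<in> carrier R \<Longrightarrow> \<exists>y\<in>carrier R. g y = - g x"
  shows "ring_emb R g"
proof -
  have e: "x = y" if "g x = g y" "x \<in> carrier R" "y \<in> carrier R" for x y
    using inj_onD[OF inj that] .
  have "cring R"
  proof (rule cringI)
    show "abelian_group R"
    proof (rule abelian_groupI)
      show "\<exists>y\<in>carrier R. y \<oplus>\<^bsub>R\<^esub> x = \<zero>\<^bsub>R\<^esub>" if "x \<in> carrier R" for x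
      proof -
        obtain y where "y \<in> carrier R" "g y = - g x" using cl(5)[OF \<open>x \<in> carrier R\<close>] by blast
        then show ?thesis using that by (intro bexI[of _ y] e) (simp_all add: g cl)
      qed
    qed (auto simp: g cl algebra_simps intro!: e)
    show "comm_monoid R"
      by (rule comm_monoidI) (auto simp: g cl algebra_simps intro!: e)
  qed (auto simp: g cl algebra_simps intro!: e)
  then show ?thesis unfolding ring_emb_def using inj g by blast
qed

lemma qeval_ring_emb:
  assumes g: "ring_emb R g" and c: "quadratic_form R \<phi>" and x: "\<And>i. i < qdim \<phi> \<Longrightarrow> x i \<in> carrier R"
  shows "qeval R \<phi> x \<in> carrier R"
    "g (qeval R \<phi> x) = (\<Sum>j<qdim \<phi>. \<Sum>i\<le>j. g (qcoeff \<phi> i j) * g (x i) * g (x j))"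
proof -
  interpret cring R using rembD[OF g] by simp
  have t: "qcoeff \<phi> i j \<otimes>\<^bsub>R\<^esub> x i \<otimes>\<^bsub>R\<^esub> x j \<in> carrier R" if "j < qdim \<phi>" "i \<le> j" for i j
    using c x that unfolding quadratic_form_def by simp
  have s: "(\<Oplus>\<^bsub>R\<^esub>i\<in>{..j}. qcoeff \<phi> i j \<otimes>\<^bsub>R\<^esub> x i \<otimes>\<^bsub>R\<^esub> x j) \<in> carrier R" if "j < qdim \<phi>" for j
    using t[OF that] by (intro finsum_closed'[OF is_cring]) auto
  show "qeval R \<phi> x \<in> carrier R" unfolding qeval_def by (rule finsum_closed'[OF is_cring]) (use s in auto)
  have "g (qeval R \<phi> x) = (\<Sum>j<qdim \<phi>. g (\<Oplus>\<^bsub>R\<^esub>i\<in>{..j}. qcoeff \<phi> i j \<otimes>\<^bsub>R\<^esub> x i \<otimes>\<^bsub>R\<^esub> x j))"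
    unfolding qeval_def using s by (intro ring_emb_finsum[OF g]) auto
  also have "\<dots> = (\<Sum>j<qdim \<phi>. \<Sum>i\<le>j. g (qcoeff \<phi> i j) * g (x i) * g (x j))"
  proof (rule sum.cong[OF refl])
    fix j assume "j \<in> {..<qdim \<phi>}"
    then have j: "j < qdim \<phi>" by simp
    have "g (\<Oplus>\<^bsub>R\<^esub>i\<in>{..j}. qcoeff \<phi> i j \<otimes>\<^bsub>R\<^esub> x i \<otimes>\<^bsub>R\<^esub> x j) = (\<Sum>i\<le>j. g (qcoeff \<phi> i j \<otimes>\<^bsub>R\<^esub> x i \<otimes>\<^bsub>R\<^esub> x j))"
      using t[OF j] by (intro ring_emb_finsum[OF g]) auto
    also have "\<dots> = (\<Sum>i\<le>j. g (qcoeff \<phi> i j) * g (x i) * g (x j))"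
      using c x j unfolding quadratic_form_def by (intro sum.cong) (simp_all add: rembD(5)[OF g])
    finally show "g (\<Oplus>\<^bsub>R\<^esub>i\<in>{..j}. qcoeff \<phi> i j \<otimes>\<^bsub>R\<^esub> x i \<otimes>\<^bsub>R\<^esub> x j) = (\<Sum>i\<le>j. g (qcoeff \<phi> i j) * g (x i) * g (x j))" .
  qed
  finally show "g (qeval R \<phi> x) = (\<Sum>j<qdim \<phi>. \<Sum>i\<le>j. g (qcoeff \<phi> i j) * g (x i) * g (x j))" .
qed

lemma ring_emb_field_image:
  fixes h :: "'b \<Rightarrow> 'w::field"
  assumes "field R" "ring_emb R h"
  shows "subfld (h ` carrier R)"
proof -
  interpret field R by (rule assms)
  note h = rembD[OF assms(2)]
  have inv: "inverse (h x) \<in> h ` carrier R" if x: "x \<in> carrier R" for x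
  proof (cases "x = \<zero>\<^bsub>R\<^esub>")
    case True
    then show ?thesis using ring_emb_zero[OF assms(2)] by (metis imageI inverse_zero zero_closed)
  next
    case False
    then have "x \<in> Units R" using x field_Units by blast
    then have "inv\<^bsub>R\<^esub> x \<in> carrier R" "x \<otimes>\<^bsub>R\<^esub> inv\<^bsub>R\<^esub> x = \<one>\<^bsub>R\<^esub>" by auto
    then have "h x * h (inv\<^bsub>R\<^esub> x) = 1" using h(3,5) x by metis
    then have "inverse (h x) = h (inv\<^bsub>R\<^esub> x)" by (rule inverse_unique)
    then show ?thesis using \<open>inv\<^bsub>R\<^esub> x \<in> carrier R\<close> by blast
  qed
  have "h x + h y \<in> h ` carrier R" "h x * h y \<in> h ` carrier R" if "x \<in> carrier R" "y \<in> carrier R" for x y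
    using h(4,5)[OF that] that by (metis imageI add.m_closed, metis imageI m_closed)
  moreover have "0 \<in> h ` carrier R" "1 \<in> h ` carrier R"
    using ring_emb_zero[OF assms(2)] h(3) by (metis imageI zero_closed, metis imageI one_closed)
  moreover have "- h x \<in> h ` carrier R" if "x \<in> carrier R" for x
    using ring_emb_uminus[OF assms(2) that] that by (metis imageI a_inv_closed)
  ultimately show ?thesis unfolding subfld_def using inv by auto
qed

subsection \<open>The polynomial ring\<close>

text \<open>Meaningful on the carrier of the polynomial ring, where
  \<open>indexed_pset_finite\<close> provides the finite support.\<close>

definition mpoly_emb :: "('b \<Rightarrow> 'w::comm_ring_1) \<Rightarrow> ('c multiset \<Rightarrow> 'b) \<Rightarrow> 'c multiset \<Rightarrow>\<^sub>0 'w" where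
  "mpoly_emb h P = Abs_poly_mapping (\<lambda>m. h (P m))"

context
  fixes F :: "('b, 'm) ring_scheme" and h :: "'b \<Rightarrow> 'w::field" and I :: "'c set"
  assumes fieldF: "field F" and h: "ring_emb F h"
begin

interpretation field F by (rule fieldF)

private abbreviation "S \<equiv> indexed_pset I (carrier F)"

private lemma sK: "subfld (h ` carrier F)" by (rule ring_emb_field_image[OF fieldF h])

lemma indexed_pset_coeff: "P \<in> S \<Longrightarrow> P m \<in> carrier F"
  using indexed_pset_in_carrier[of "carrier F" P I] unfolding carrier_coeff_def by blast

lemma indexed_pset_finite: "P \<in> S \<Longrightarrow> finite {m. h (P m) \<noteq> 0}"
proof (induction rule: indexed_pset.induct)
  case (indexed_const k)
  then show ?case unfolding indexed_const_def using ring_emb_zero[OF h]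
    by (auto intro!: rev_finite_subset[of "{{#}}"])
next
  case (indexed_padd P Q)
  then have "{m. h (indexed_padd P Q m) \<noteq> 0} \<subseteq> {m. h (P m) \<noteq> 0} \<union> {m. h (Q m) \<noteq> 0}"
    using indexed_pset_coeff rembD(4)[OF h] unfolding indexed_padd_def by auto
  then show ?case using indexed_padd by (meson finite_Un finite_subset)
next
  case (indexed_pmult P i)
  have "{m. h (indexed_pmult P i m) \<noteq> 0} \<subseteq> (\<lambda>m. add_mset i m) ` {m. h (P m) \<noteq> 0}"
  proof
    fix m assume "m \<in> {m. h (indexed_pmult P i m) \<noteq> 0}"
    then have "i \<in># m" "h (P (m - {#i#})) \<noteq> 0" using ring_emb_zero[OF h] unfolding indexed_pmult_def by (auto split: if_splits)
    then show "m \<in> (\<lambda>m. add_mset i m) ` {m. h (P m) \<noteq> 0}" by (intro image_eqI[of _ _ "m - {#i#}"]) auto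
  qed
  then show ?case using indexed_pmult by (meson finite_imageI finite_subset)
qed

lemma lookup_mpoly_emb: "P \<in> S \<Longrightarrow> Poly_Mapping.lookup (mpoly_emb h P) m = h (P m)"
  unfolding mpoly_emb_def using indexed_pset_finite by simp

lemma mpoly_emb_const:
  assumes "k \<in> carrier F"
  shows "mpoly_emb h (indexed_const k :: 'c multiset \<Rightarrow> 'b) = Poly_Mapping.single {#} (h k)"
  by (rule poly_mapping_eqI, subst lookup_mpoly_emb[OF indexed_pset.indexed_const[OF assms]])
    (simp add: lookup_single indexed_const_def ring_emb_zero[OF h] when_def)

lemma mpoly_emb_padd:
  assumes "P \<in> S" "Q \<in> S"
  shows "mpoly_emb h (indexed_padd P Q) = mpoly_emb h P + mpoly_emb h Q"
  by (rule poly_mapping_eqI, subst lookup_mpoly_emb[OF indexed_pset.indexed_padd[OF assms]])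
    (simp add: lookup_mpoly_emb assms lookup_add indexed_padd_def rembD(4)[OF h] indexed_pset_coeff)

lemma mpoly_emb_pmult:
  assumes "P \<in> S" "i \<in> I"
  shows "mpoly_emb h (indexed_pmult P i) = pvar i * mpoly_emb h P"
  by (rule poly_mapping_eqI, subst lookup_mpoly_emb[OF indexed_pset.indexed_pmult[OF assms]])
    (simp add: lookup_mpoly_emb assms lookup_pvar_mult indexed_pmult_def ring_emb_zero[OF h])

lemma mpoly_emb_inj: "P \<in> S \<Longrightarrow> Q \<in> S \<Longrightarrow> mpoly_emb h P = mpoly_emb h Q \<Longrightarrow> P = Q"
proof
  fix m assume a: "P \<in> S" "Q \<in> S" "mpoly_emb h P = mpoly_emb h Q"
  then have "h (P m) = h (Q m)" using lookup_mpoly_emb by metis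
  then show "P m = Q m" using ring_emb_inj[OF h] indexed_pset_coeff a by blast
qed

lemma mpoly_emb_image: "mpoly_emb h ` S = mpoly_set (h ` carrier F) I"
proof
  show "mpoly_emb h ` S \<subseteq> mpoly_set (h ` carrier F) I"
  proof
    fix p assume "p \<in> mpoly_emb h ` S"
    then obtain P where P: "P \<in> S" "p = mpoly_emb h P" by blast
    have "mpoly_emb h P \<in> mpoly_set (h ` carrier F) I" using P(1)
      by induction (simp_all add: mpoly_emb_const mpoly_emb_padd mpoly_emb_pmult mpoly_set.intros)
    then show "p \<in> mpoly_set (h ` carrier F) I" using P by simp
  qed
  show "mpoly_set (h ` carrier F) I \<subseteq> mpoly_emb h ` S"
  proof
    fix p assume "p \<in> mpoly_set (h ` carrier F) I"
    then show "p \<in> mpoly_emb h ` S"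
    proof induction
      case (const k)
      then obtain a where "a \<in> carrier F" "k = h a" by blast
      then show ?case using mpoly_emb_const indexed_pset.indexed_const by (metis imageI)
    next
      case (add p q)
      then show ?case using mpoly_emb_padd indexed_pset.indexed_padd by (smt (verit) imageE imageI)
    next
      case (var p i)
      then show ?case using mpoly_emb_pmult indexed_pset.indexed_pmult by (smt (verit) imageE imageI)
    qed
  qed
qed

text \<open>The inductive carrier has no rule for products. Closure comes from the type: the product
  of the images is the image of some \<open>R\<close>, and the convolution agrees with
  \<open>R\<close> in every coefficient.\<close>

lemma mpoly_mult:
  assumes P: "P \<in> S" "Q \<in> S"
  shows "P \<otimes>\<^bsub>mpoly_ring F I\<^esub> Q \<in> S" "mpoly_emb h (P \<otimes>\<^bsub>mpoly_ring F I\<^esub> Q) = mpoly_emb h P * mpoly_emb h Q"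
proof -
  have "mpoly_emb h P * mpoly_emb h Q \<in> mpoly_set (h ` carrier F) I"
    using P mpoly_emb_image by (intro mpoly_set_mult[OF sK]) auto
  then obtain R where R: "R \<in> S" "mpoly_emb h R = mpoly_emb h P * mpoly_emb h Q" using mpoly_emb_image by (metis imageE)
  have "P \<otimes>\<^bsub>mpoly_ring F I\<^esub> Q = R"
  proof
    fix m
    have c: "(\<Oplus>\<^bsub>F\<^esub>k\<in>{k. k \<subseteq># m}. P k \<otimes>\<^bsub>F\<^esub> Q (m - k)) \<in> carrier F"
      using P indexed_pset_coeff by (intro finsum_closed'[OF is_cring]) auto
    have "h (\<Oplus>\<^bsub>F\<^esub>k\<in>{k. k \<subseteq># m}. P k \<otimes>\<^bsub>F\<^esub> Q (m - k)) = (\<Sum>k\<in>{k. k \<subseteq># m}. h (P k \<otimes>\<^bsub>F\<^esub> Q (m - k)))"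
      using P indexed_pset_coeff by (intro ring_emb_finsum[OF h]) auto
    also have "\<dots> = (\<Sum>k\<in>{k. k \<subseteq># m}. h (P k) * h (Q (m - k)))"
      using P indexed_pset_coeff rembD(5)[OF h] by (intro sum.cong) auto
    also have "\<dots> = Poly_Mapping.lookup (mpoly_emb h P * mpoly_emb h Q) m"
      unfolding lookup_mult_mset using P by (simp add: lookup_mpoly_emb)
    also have "\<dots> = h (R m)" using R lookup_mpoly_emb by metis
    finally have "h (\<Oplus>\<^bsub>F\<^esub>k\<in>{k. k \<subseteq># m}. P k \<otimes>\<^bsub>F\<^esub> Q (m - k)) = h (R m)" .
    then have "(\<Oplus>\<^bsub>F\<^esub>k\<in>{k. k \<subseteq># m}. P k \<otimes>\<^bsub>F\<^esub> Q (m - k)) = R m"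
      using ring_emb_inj[OF h c] indexed_pset_coeff[OF R(1)] by blast
    then show "(P \<otimes>\<^bsub>mpoly_ring F I\<^esub> Q) m = R m" unfolding mpoly_ring_def by simp
  qed
  then show "P \<otimes>\<^bsub>mpoly_ring F I\<^esub> Q \<in> S" "mpoly_emb h (P \<otimes>\<^bsub>mpoly_ring F I\<^esub> Q) = mpoly_emb h P * mpoly_emb h Q" using R by auto
qed

lemma ring_emb_mpoly: "ring_emb (mpoly_ring F I) (mpoly_emb h)"
proof (rule rembI)
  have car: "carrier (mpoly_ring F I) = S" and add: "add (mpoly_ring F I) = indexed_padd"
    and one: "\<one>\<^bsub>mpoly_ring F I\<^esub> = indexed_const \<one>\<^bsub>F\<^esub>" and zero: "\<zero>\<^bsub>mpoly_ring F I\<^esub> = indexed_const \<zero>\<^bsub>F\<^esub>"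
    unfolding mpoly_ring_def by simp_all
  show "inj_on (mpoly_emb h) (carrier (mpoly_ring F I))" unfolding car using mpoly_emb_inj by (intro inj_onI) blast
  show "mpoly_emb h \<one>\<^bsub>mpoly_ring F I\<^esub> = 1" "mpoly_emb h \<zero>\<^bsub>mpoly_ring F I\<^esub> = 0" unfolding one zero
    using rembD(3)[OF h] ring_emb_zero[OF h] by (simp_all add: mpoly_emb_const zero_multiset_def[symmetric])
  show "\<one>\<^bsub>mpoly_ring F I\<^esub> \<in> carrier (mpoly_ring F I)" "\<zero>\<^bsub>mpoly_ring F I\<^esub> \<in> carrier (mpoly_ring F I)"
    unfolding one zero car by (simp_all add: indexed_pset.indexed_const)
  fix P assume P: "P \<in> carrier (mpoly_ring F I)"
  have "- mpoly_emb h P \<in> mpoly_set (h ` carrier F) I"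
    using P mpoly_emb_image unfolding car by (intro mpoly_set_uminus[OF sK]) auto
  then show "\<exists>Q\<in>carrier (mpoly_ring F I). mpoly_emb h Q = - mpoly_emb h P" unfolding car mpoly_emb_image[symmetric] by force
  fix Q assume Q: "Q \<in> carrier (mpoly_ring F I)"
  show "mpoly_emb h (P \<oplus>\<^bsub>mpoly_ring F I\<^esub> Q) = mpoly_emb h P + mpoly_emb h Q" "P \<oplus>\<^bsub>mpoly_ring F I\<^esub> Q \<in> carrier (mpoly_ring F I)"
    using P Q unfolding car add by (simp_all add: mpoly_emb_padd indexed_pset.indexed_padd)
  show "mpoly_emb h (P \<otimes>\<^bsub>mpoly_ring F I\<^esub> Q) = mpoly_emb h P * mpoly_emb h Q" "P \<otimes>\<^bsub>mpoly_ring F I\<^esub> Q \<in> carrier (mpoly_ring F I)"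
    using P Q mpoly_mult unfolding car by blast+
qed

lemma carrier_mpoly: "carrier (mpoly_ring F I) = S"
  unfolding mpoly_ring_def by simp

lemma mpoly_emb_var:
  assumes "i \<in> I"
  shows "indexed_var i \<in> S" "mpoly_emb h (indexed_var i) = pvar i"
proof -
  have 1: "indexed_const \<one>\<^bsub>F\<^esub> \<in> S" by (rule indexed_pset.indexed_const) simp
  show "indexed_var i \<in> S" unfolding indexed_var_def by (rule indexed_pset.indexed_pmult[OF 1 assms])
  show "mpoly_emb h (indexed_var i) = pvar i"
    unfolding indexed_var_def mpoly_emb_pmult[OF 1 assms] mpoly_emb_const[OF one_closed] rembD(3)[OF h]
    by (simp add: zero_multiset_def[symmetric])
qed

end

subsection \<open>Fraction fields\<close>

text \<open>A class goes to the common quotient \<open>g a / g b\<close> of its representatives.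
  That products of denominators are nonzero is inherited from the target field.\<close>

lemma ring_emb_fraction_field:
  fixes g :: "'d \<Rightarrow> 'w::field"
  assumes g: "ring_emb D g"
  defines "G \<equiv> \<lambda>x. the_elem ((\<lambda>(a, b). g a / g b) ` x)"
  shows "ring_emb (fraction_field D) G"
    "\<And>a b. a \<in> carrier D \<Longrightarrow> b \<in> carrier D \<Longrightarrow> b \<noteq> \<zero>\<^bsub>D\<^esub> \<Longrightarrow> frac_class D a b \<in> carrier (fraction_field D) \<and> G (frac_class D a b) = g a / g b"
    "\<And>x. x \<in> carrier (fraction_field D) \<Longrightarrow> \<exists>a b. a \<in> carrier D \<and> b \<in> carrier D \<and> b \<noteq> \<zero>\<^bsub>D\<^esub> \<and> x = frac_class D a b"
proof -
  interpret cring D using rembD(1)[OF g] .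
  let ?V = "\<lambda>a b. a \<in> carrier D \<and> b \<in> carrier D \<and> b \<noteq> \<zero>\<^bsub>D\<^esub>"
  have nz: "g b \<noteq> 0" if "?V a b" for a b using ring_emb_eq_0[OF g, of b] that by blast
  have rel: "((a, b), (c, d)) \<in> frac_rel D \<longleftrightarrow> ?V a b \<and> ?V c d \<and> g a / g b = g c / g d" for a b c d
  proof -
    have "a \<otimes>\<^bsub>D\<^esub> d = c \<otimes>\<^bsub>D\<^esub> b \<longleftrightarrow> g a / g b = g c / g d" if v: "?V a b" "?V c d"
    proof -
      have "a \<otimes>\<^bsub>D\<^esub> d = c \<otimes>\<^bsub>D\<^esub> b \<longleftrightarrow> g (a \<otimes>\<^bsub>D\<^esub> d) = g (c \<otimes>\<^bsub>D\<^esub> b)"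
        using ring_emb_inj[OF g, of "a \<otimes>\<^bsub>D\<^esub> d" "c \<otimes>\<^bsub>D\<^esub> b"] v by auto
      also have "\<dots> \<longleftrightarrow> g a * g d = g c * g b" using v by (simp add: rembD(5)[OF g])
      also have "\<dots> \<longleftrightarrow> g a / g b = g c / g d" using nz[OF v(1)] nz[OF v(2)] by (simp add: frac_eq_eq)
      finally show ?thesis .
    qed
    then show ?thesis unfolding frac_rel_def by auto
  qed
  have cls: "frac_class D a b = {(c, d). ?V c d \<and> g c / g d = g a / g b}" if "?V a b" for a b
    unfolding frac_class_def using that by (auto simp: rel)
  have car: "x \<in> carrier (fraction_field D) \<longleftrightarrow> (\<exists>a b. ?V a b \<and> x = frac_class D a b)" for x
    unfolding fraction_field_def frac_class_def quotient_def by auto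
  have Gc: "G (frac_class D a b) = g a / g b" if v: "?V a b" for a b
  proof -
    have "(\<lambda>(c, d). g c / g d) ` frac_class D a b = {g a / g b}"
    proof
      show "(\<lambda>(c, d). g c / g d) ` frac_class D a b \<subseteq> {g a / g b}" unfolding cls[OF v] by auto
      have "(a, b) \<in> frac_class D a b" unfolding cls[OF v] using v by simp
      then have "(\<lambda>(c, d). g c / g d) (a, b) \<in> (\<lambda>(c, d). g c / g d) ` frac_class D a b" by (rule imageI)
      then show "{g a / g b} \<subseteq> (\<lambda>(c, d). g c / g d) ` frac_class D a b" by simp
    qed
    then show ?thesis unfolding G_def by simp
  qed
  have ceq: "frac_class D a b = frac_class D c d" if "?V a b" "?V c d" "g a / g b = g c / g d" for a b c d
    using cls that by simp
  have V: "?V (a \<otimes>\<^bsub>D\<^esub> c) (b \<otimes>\<^bsub>D\<^esub> d)" "?V ((a \<otimes>\<^bsub>D\<^esub> d) \<oplus>\<^bsub>D\<^esub> (c \<otimes>\<^bsub>D\<^esub> b)) (b \<otimes>\<^bsub>D\<^esub> d)"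
    if v: "?V a b" "?V c d" for a b c d
  proof -
    have "g (b \<otimes>\<^bsub>D\<^esub> d) \<noteq> 0" using v nz[OF v(1)] nz[OF v(2)] rembD(5)[OF g] by simp
    then have "b \<otimes>\<^bsub>D\<^esub> d \<noteq> \<zero>\<^bsub>D\<^esub>" using ring_emb_zero[OF g] by auto
    then show "?V (a \<otimes>\<^bsub>D\<^esub> c) (b \<otimes>\<^bsub>D\<^esub> d)" "?V ((a \<otimes>\<^bsub>D\<^esub> d) \<oplus>\<^bsub>D\<^esub> (c \<otimes>\<^bsub>D\<^esub> b)) (b \<otimes>\<^bsub>D\<^esub> d)" using v by auto
  qed
  have gV: "g (a \<otimes>\<^bsub>D\<^esub> c) / g (b \<otimes>\<^bsub>D\<^esub> d) = (g a / g b) * (g c / g d)"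
    "g ((a \<otimes>\<^bsub>D\<^esub> d) \<oplus>\<^bsub>D\<^esub> (c \<otimes>\<^bsub>D\<^esub> b)) / g (b \<otimes>\<^bsub>D\<^esub> d) = g a / g b + g c / g d"
    if v: "?V a b" "?V c d" for a b c d
    using v nz[OF v(1)] nz[OF v(2)] by (simp_all add: rembD(4,5)[OF g] add_frac_eq)
  \<comment> \<open>All choices of representatives give the same class, so the unions in the
    definitions of sum and product collapse to it. Here \<open>p\<close> is the numerator of the
    result and \<open>r\<close> the corresponding operation on quotients.\<close>
  have un: "(\<Union>(a', b')\<in>frac_class D a b. \<Union>(c', d')\<in>frac_class D c d. frac_class D (p a' b' c' d') (b' \<otimes>\<^bsub>D\<^esub> d'))
      = frac_class D (p a b c d) (b \<otimes>\<^bsub>D\<^esub> d)"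
    if v: "?V a b" "?V c d" and p: "\<And>a b c d. ?V a b \<Longrightarrow> ?V c d \<Longrightarrow> ?V (p a b c d) (b \<otimes>\<^bsub>D\<^esub> d)"
      "\<And>a b c d. ?V a b \<Longrightarrow> ?V c d \<Longrightarrow> g (p a b c d) / g (b \<otimes>\<^bsub>D\<^esub> d) = r (g a / g b) (g c / g d)" for a b c d p r
  proof -
    have e: "frac_class D (p a' b' c' d') (b' \<otimes>\<^bsub>D\<^esub> d') = frac_class D (p a b c d) (b \<otimes>\<^bsub>D\<^esub> d)"
      if "(a', b') \<in> frac_class D a b" "(c', d') \<in> frac_class D c d" for a' b' c' d'
    proof -
      have w: "?V a' b'" "g a' / g b' = g a / g b" "?V c' d'" "g c' / g d' = g c / g d"
        using that v cls by auto
      show ?thesis using p(1)[OF w(1,3)] p(1)[OF v] p(2)[OF w(1,3)] p(2)[OF v] w(2,4) by (intro ceq) auto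
    qed
    have "(a, b) \<in> frac_class D a b" "(c, d) \<in> frac_class D c d" using v cls by auto
    then show ?thesis using e by fast
  qed
  have mult: "frac_class D a b \<otimes>\<^bsub>fraction_field D\<^esub> frac_class D c d = frac_class D (a \<otimes>\<^bsub>D\<^esub> c) (b \<otimes>\<^bsub>D\<^esub> d)"
    if v: "?V a b" "?V c d" for a b c d
  proof -
    have "x \<otimes>\<^bsub>fraction_field D\<^esub> y = (\<Union>(a, b)\<in>x. \<Union>(c, d)\<in>y. frac_class D (a \<otimes>\<^bsub>D\<^esub> c) (b \<otimes>\<^bsub>D\<^esub> d))" for x y
      unfolding fraction_field_def by simp
    then show ?thesis using un[OF v, of "\<lambda>a b c d. a \<otimes>\<^bsub>D\<^esub> c" "(*)", OF V(1) gV(1)] by simp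
  qed
  have add: "frac_class D a b \<oplus>\<^bsub>fraction_field D\<^esub> frac_class D c d = frac_class D ((a \<otimes>\<^bsub>D\<^esub> d) \<oplus>\<^bsub>D\<^esub> (c \<otimes>\<^bsub>D\<^esub> b)) (b \<otimes>\<^bsub>D\<^esub> d)"
    if v: "?V a b" "?V c d" for a b c d
  proof -
    have "x \<oplus>\<^bsub>fraction_field D\<^esub> y = (\<Union>(a, b)\<in>x. \<Union>(c, d)\<in>y. frac_class D ((a \<otimes>\<^bsub>D\<^esub> d) \<oplus>\<^bsub>D\<^esub> (c \<otimes>\<^bsub>D\<^esub> b)) (b \<otimes>\<^bsub>D\<^esub> d))" for x y
      unfolding fraction_field_def by simp
    then show ?thesis
      using un[OF v, of "\<lambda>a b c d. (a \<otimes>\<^bsub>D\<^esub> d) \<oplus>\<^bsub>D\<^esub> (c \<otimes>\<^bsub>D\<^esub> b)" "(+)", OF V(2) gV(2)] by simp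
  qed
  have one0: "\<one>\<^bsub>D\<^esub> \<noteq> \<zero>\<^bsub>D\<^esub>" using rembD(3)[OF g] ring_emb_zero[OF g] by auto
  have V1: "?V \<one>\<^bsub>D\<^esub> \<one>\<^bsub>D\<^esub>" "?V \<zero>\<^bsub>D\<^esub> \<one>\<^bsub>D\<^esub>" using one0 by auto
  have onezero: "\<one>\<^bsub>fraction_field D\<^esub> = frac_class D \<one>\<^bsub>D\<^esub> \<one>\<^bsub>D\<^esub>" "\<zero>\<^bsub>fraction_field D\<^esub> = frac_class D \<zero>\<^bsub>D\<^esub> \<one>\<^bsub>D\<^esub>"
    unfolding fraction_field_def by simp_all
  show "ring_emb (fraction_field D) G"
  proof (rule rembI)
    show "inj_on G (carrier (fraction_field D))"
    proof (rule inj_onI)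
      fix x y assume "x \<in> carrier (fraction_field D)" "y \<in> carrier (fraction_field D)" "G x = G y"
      then obtain a b c d where v: "?V a b" "x = frac_class D a b" "?V c d" "y = frac_class D c d" "G x = G y"
        unfolding car by blast
      then show "x = y" using ceq[OF v(1,3)] Gc by simp
    qed
    show "G \<one>\<^bsub>fraction_field D\<^esub> = 1" "G \<zero>\<^bsub>fraction_field D\<^esub> = 0"
      unfolding onezero using Gc[OF V1(1)] Gc[OF V1(2)] rembD(3)[OF g] ring_emb_zero[OF g] by auto
    show "\<one>\<^bsub>fraction_field D\<^esub> \<in> carrier (fraction_field D)" "\<zero>\<^bsub>fraction_field D\<^esub> \<in> carrier (fraction_field D)"
      unfolding onezero car using V1 by blast+
    fix x assume "x \<in> carrier (fraction_field D)"
    then obtain a b where x: "?V a b" "x = frac_class D a b" unfolding car by blast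
    show "\<exists>y\<in>carrier (fraction_field D). G y = - G x"
    proof (intro bexI[of _ "frac_class D (\<ominus>\<^bsub>D\<^esub> a) b"])
      have v: "?V (\<ominus>\<^bsub>D\<^esub> a) b" using x(1) by auto
      show "frac_class D (\<ominus>\<^bsub>D\<^esub> a) b \<in> carrier (fraction_field D)" unfolding car using v by blast
      show "G (frac_class D (\<ominus>\<^bsub>D\<^esub> a) b) = - G x"
        using Gc[OF v] Gc[OF x(1)] x ring_emb_uminus[OF g] by simp
    qed
    fix y assume "y \<in> carrier (fraction_field D)"
    then obtain c d where y: "?V c d" "y = frac_class D c d" unfolding car by blast
    show "G (x \<oplus>\<^bsub>fraction_field D\<^esub> y) = G x + G y" "G (x \<otimes>\<^bsub>fraction_field D\<^esub> y) = G x * G y"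
      unfolding x(2) y(2) add[OF x(1) y(1)] mult[OF x(1) y(1)]
        Gc[OF V(1)[OF x(1) y(1)]] Gc[OF V(2)[OF x(1) y(1)]] Gc[OF x(1)] Gc[OF y(1)] by (rule gV[OF x(1) y(1)])+
    show "x \<oplus>\<^bsub>fraction_field D\<^esub> y \<in> carrier (fraction_field D)" "x \<otimes>\<^bsub>fraction_field D\<^esub> y \<in> carrier (fraction_field D)"
      unfolding x(2) y(2) add[OF x(1) y(1)] mult[OF x(1) y(1)] car using V[OF x(1) y(1)] by blast+
  qed
  show "frac_class D a b \<in> carrier (fraction_field D) \<and> G (frac_class D a b) = g a / g b"
    if "a \<in> carrier D" "b \<in> carrier D" "b \<noteq> \<zero>\<^bsub>D\<^esub>" for a b using Gc car that by blast
  show "\<exists>a b. a \<in> carrier D \<and> b \<in> carrier D \<and> b \<noteq> \<zero>\<^bsub>D\<^esub> \<and> x = frac_class D a b"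
    if "x \<in> carrier (fraction_field D)" for x using car that by blast
qed


subsection \<open>The function field of a quadric\<close>

lemma ring_emb_image_closed:
  fixes R :: "('b, 'm) ring_scheme" and g :: "'b \<Rightarrow> 'w::comm_ring_1"
  assumes g: "ring_emb R g"
  shows "0 \<in> g ` carrier R \<and> 1 \<in> g ` carrier R \<and> (\<forall>x\<in>g ` carrier R. \<forall>y\<in>g ` carrier R.
    x + y \<in> g ` carrier R \<and> x * y \<in> g ` carrier R) \<and> (\<forall>x\<in>g ` carrier R. - x \<in> g ` carrier R)"
proof -
  interpret cring R by (rule rembD(1)[OF g])
  have "g \<zero>\<^bsub>R\<^esub> \<in> g ` carrier R" "g \<one>\<^bsub>R\<^esub> \<in> g ` carrier R" by blast+
  then have 01: "0 \<in> g ` carrier R" "1 \<in> g ` carrier R" unfolding ring_emb_zero[OF g] rembD(3)[OF g] .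
  have "g a + g b \<in> g ` carrier R \<and> g a * g b \<in> g ` carrier R" if "a \<in> carrier R" "b \<in> carrier R" for a b
    unfolding rembD(4,5)[OF g that, symmetric] using that by blast
  moreover have "- g a \<in> g ` carrier R" if "a \<in> carrier R" for a
    unfolding ring_emb_uminus[OF g that, symmetric] using that by blast
  ultimately show ?thesis using 01 by blast
qed

text \<open>
  Division by \<open>q(1, X)\<close> with respect to the last variable shows that the ideal of the generic zero is
  principal; in particular \<open>q(1, X)\<close> is prime.
\<close>

lemma generic_zero_ideal:
  fixes c :: "nat \<Rightarrow> nat \<Rightarrow> 'w::field"
  assumes K: "subfld K" and n: "2 \<le> n" and c: "cin K n c" "c (n - 1) (n - 1) \<noteq> 0" and gen: "generic_zero K n c M \<xi>"
  defines "y \<equiv> \<lambda>i. if i = 0 then 1 else pvar i"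
  defines "f \<equiv> \<Sum>j<n. \<Sum>i\<le>j. Poly_Mapping.single {#} (c i j) * y i * y j"
  assumes p: "p \<in> mpoly_set K {1..<n}"
  shows "mpoly_eval \<xi> p = 0 \<longleftrightarrow> (\<exists>q\<in>mpoly_set K {1..<n}. p = q * f)"
proof -
  define v where "v = n - 1"
  have nv: "n = Suc v" "1 \<le> v" using n unfolding v_def by auto
  have I: "{1..<n} = insert v {1..<v}" using nv by auto
  have M: "\<And>i. subfld (M i)" "\<And>i. M i \<subseteq> M (Suc i)" "\<And>i. K \<subseteq> M i" "\<xi> 0 = 1"
    "\<And>i. 1 \<le> i \<Longrightarrow> i < v \<Longrightarrow> \<xi> i \<in> M (Suc i) \<and> transcendental (M i) (\<xi> i)" "\<xi> v \<notin> M v" "qv n c \<xi> = 0"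
    using gen unfolding generic_zero_def v_def by auto
  have my: "mpoly_eval \<xi> (y i) = \<xi> i" for i
    using mpoly_eval_const[of \<xi> 1] by (simp add: y_def mpoly_eval_pvar M(4) zero_multiset_def[symmetric])
  have yI: "y i \<in> mpoly_set K {1..<k}" if "i < k" for i k
    using that unfolding y_def by (auto intro: mpoly_set_one[OF K] mpoly_set_pvar[OF K])
  have cI: "Poly_Mapping.single {#} (c i j) \<in> mpoly_set K J" if "i \<le> j" "j < n" for i j and J :: "nat set"
    using c(1) that unfolding cin_def by (intro mpoly_set.const) blast
  define l where "l = (\<Sum>i<v. Poly_Mapping.single {#} (c i v) * y i)"
  define r where "r = (\<Sum>j<v. \<Sum>i\<le>j. Poly_Mapping.single {#} (c i j) * y i * y j)"
  have lI: "l \<in> mpoly_set K {1..<v}" unfolding l_def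
    using nv by (intro mpoly_set_sum[OF K] mpoly_set_mult[OF K] cI yI) auto
  have rI: "r \<in> mpoly_set K {1..<v}" unfolding r_def
    using nv by (intro mpoly_set_sum[OF K] mpoly_set_mult[OF K] cI yI) auto
  have "{..v} = insert v {..<v}" by auto
  \<comment> \<open>\<open>f\<close> sorted by the last variable; the leading coefficient
    \<open>c v v\<close> is a nonzero constant.\<close>
  then have f1: "f = Poly_Mapping.single {#} (c v v) * (pvar v * pvar v) + l * pvar v + r"
    unfolding f_def nv(1) l_def r_def using nv(2)
    by (simp add: sum_distrib_left sum_distrib_right algebra_simps) (simp add: y_def sum_distrib_left algebra_simps)
  have mf: "mpoly_eval \<xi> f = 0"
    using M(7) unfolding f_def qv_def by (simp add: mpoly_eval_sum mpoly_eval_mult mpoly_eval_const my)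
  have mM: "mpoly_eval \<xi> s \<in> M v" if "s \<in> mpoly_set K {1..<v}" for s
  proof (rule mpoly_eval_in[OF that M(1,3)])
    fix i assume "i \<in> {1..<v}"
    then show "\<xi> i \<in> M v" using M(5)[of i] lift_Suc_mono_le[of M "Suc i" v] M(2) by auto
  qed
  have inj: "s = 0" if "s \<in> mpoly_set K {1..<v}" "mpoly_eval \<xi> s = 0" for s
    using mpoly_eval_inj[of K M v \<xi> s, OF K M(1,3,2,5) that] .
  show ?thesis
  proof
    assume 0: "mpoly_eval \<xi> p = 0"
    have "c v v \<in> K" using c(1) nv unfolding cin_def by auto
    from mpoly_set_divide_quadratic[OF K this _ lI rI f1 p[unfolded I]] c(2)
    obtain q s t where h: "q \<in> mpoly_set K {1..<n}" "s \<in> mpoly_set K {1..<v}" "t \<in> mpoly_set K {1..<v}" "p = q * f + s * pvar v + t"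
      unfolding I v_def by blast
    \<comment> \<open>Only the remainder survives evaluation. The values of \<open>s\<close> and
      \<open>t\<close> lie in \<open>M v\<close> and \<open>\<xi> v\<close> does not, so both values
      vanish.\<close>
    have e: "mpoly_eval \<xi> s * \<xi> v + mpoly_eval \<xi> t = 0" using 0 mf unfolding h(4) by (simp add: mpoly_eval_add mpoly_eval_mult mpoly_eval_pvar)
    have "mpoly_eval \<xi> s = 0"
    proof (rule ccontr)
      assume n: "mpoly_eval \<xi> s \<noteq> 0"
      have "\<xi> v * mpoly_eval \<xi> s = - mpoly_eval \<xi> t" using e by (simp add: eq_neg_iff_add_eq_0 mult.commute)
      then have "\<xi> v = - mpoly_eval \<xi> t / mpoly_eval \<xi> s" using n by (metis nonzero_mult_div_cancel_right)
      then show False using M(6) mM h(2,3) subfldD(5,8)[OF M(1)] by simp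
    qed
    moreover from this have "mpoly_eval \<xi> t = 0" using e by simp
    ultimately have "s = 0" "t = 0" using inj h(2,3) by blast+
    then show "\<exists>q\<in>mpoly_set K {1..<n}. p = q * f" using h(1,4) by auto
  next
    assume "\<exists>q\<in>mpoly_set K {1..<n}. p = q * f"
    then show "mpoly_eval \<xi> p = 0" using mf by (auto simp: mpoly_eval_mult)
  qed
qed

text \<open>The function field is identified with the subfield generated by the image of
  \<open>F\<close> and the coordinates of a generic zero; the last clause is minimality. Any generic
  zero may be used, which later allows it to be built from prescribed variables.\<close>

theorem function_field_embedding:
  fixes F :: "('b, 'm) ring_scheme" and h :: "'b \<Rightarrow> 'w::field" and \<psi> :: "'b qform"
  assumes fieldF: "field F" and h: "ring_emb F h" and \<psi>: "quadratic_form F \<psi>" and n: "2 \<le> qdim \<psi>"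
    and c0: "h (qcoeff \<psi> (qdim \<psi> - 1) (qdim \<psi> - 1)) \<noteq> 0"
    and gen: "generic_zero (h ` carrier F) (qdim \<psi>) (\<lambda>i j. h (qcoeff \<psi> i j)) M \<xi>"
  shows "\<exists>g. ring_emb (function_field F \<psi>) g \<and>
    (\<forall>a\<in>carrier F. function_field_emb F \<psi> a \<in> carrier (function_field F \<psi>) \<and> g (function_field_emb F \<psi> a) = h a) \<and>
    subfld (g ` carrier (function_field F \<psi>)) \<and> (\<forall>i<qdim \<psi>. \<xi> i \<in> g ` carrier (function_field F \<psi>)) \<and>
    (\<forall>L. subfld L \<and> h ` carrier F \<subseteq> L \<and> (\<forall>i<qdim \<psi>. \<xi> i \<in> L) \<longrightarrow> g ` carrier (function_field F \<psi>) \<subseteq> L)"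
proof -
  interpret F: field F by (rule fieldF)
  define n where "n = qdim \<psi>"
  define I where "I = {1..<n}"
  define P where "P = mpoly_ring F I"
  define K where "K = h ` carrier F"
  define c where "c = (\<lambda>i j. h (qcoeff \<psi> i j))"
  define f where "f = dehomogenized F \<psi>"
  have sK: "subfld K" unfolding K_def by (rule ring_emb_field_image[OF fieldF h])
  have P: "ring_emb P (mpoly_emb h)" unfolding P_def by (rule ring_emb_mpoly[OF fieldF h])
  interpret P: cring P by (rule rembD(1)[OF P])
  have cP: "carrier P = F.indexed_pset I (carrier F)" unfolding P_def by (rule carrier_mpoly[OF fieldF h])
  have im: "mpoly_emb h ` carrier P = mpoly_set K I" unfolding cP K_def by (rule mpoly_emb_image[OF fieldF h])
  have constP: "F.indexed_const a \<in> carrier P" "mpoly_emb h (F.indexed_const a :: nat multiset \<Rightarrow> 'b) = Poly_Mapping.single {#} (h a)"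
    if "a \<in> carrier F" for a
    unfolding cP using F.indexed_pset.indexed_const[OF that] mpoly_emb_const[OF fieldF h that] by auto
  define x where "x = (\<lambda>i. if i = 0 then \<one>\<^bsub>P\<^esub> else F.indexed_var i)"
  have xP: "x i \<in> carrier P" "mpoly_emb h (x i) = (if i = 0 then 1 else pvar i)" if "i < n" for i
  proof -
    have "F.indexed_var i \<in> carrier P \<and> mpoly_emb h (F.indexed_var i) = pvar i" if "i \<in> I"
      unfolding cP using mpoly_emb_var[OF fieldF h that] by blast
    moreover have "i \<in> I" if "i \<noteq> 0" using that \<open>i < n\<close> unfolding I_def by simp
    ultimately show "x i \<in> carrier P" "mpoly_emb h (x i) = (if i = 0 then 1 else pvar i)"
      using rembD(3)[OF P] unfolding x_def by auto
  qed
  have qf: "quadratic_form P (map_qform F.indexed_const \<psi>)"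
    using \<psi> constP unfolding quadratic_form_def map_qform_def by simp
  have fe: "f = qeval P (map_qform F.indexed_const \<psi>) x"
    unfolding f_def dehomogenized_def x_def P_def I_def n_def Let_def ..
  have fP: "f \<in> carrier P" unfolding fe
    using xP by (intro qeval_ring_emb(1)[OF P qf]) (simp add: map_qform_def n_def)
  have "mpoly_emb h f = (\<Sum>j<n. \<Sum>i\<le>j. mpoly_emb h (F.indexed_const (qcoeff \<psi> i j)) * mpoly_emb h (x i) * mpoly_emb h (x j))"
    unfolding fe using qeval_ring_emb(2)[OF P qf, of x] xP by (simp add: map_qform_def n_def)
  also have "\<dots> = (\<Sum>j<n. \<Sum>i\<le>j. Poly_Mapping.single {#} (c i j) * (if i = 0 then 1 else pvar i) * (if j = 0 then 1 else pvar j))"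
    using \<psi> xP constP unfolding quadratic_form_def c_def n_def by (intro sum.cong) auto
  finally have mf: "mpoly_emb h f = (\<Sum>j<n. \<Sum>i\<le>j. Poly_Mapping.single {#} (c i j) * (if i = 0 then 1 else pvar i) * (if j = 0 then 1 else pvar j))" .
  have cK: "cin K n c" using \<psi> unfolding cin_def c_def K_def quadratic_form_def n_def by auto
  have n': "2 \<le> n" and c': "c (n - 1) (n - 1) \<noteq> 0" and gen': "generic_zero K n c M \<xi>"
    using n c0 gen unfolding n_def c_def K_def by blast+
  have ideal: "mpoly_eval \<xi> p = 0 \<longleftrightarrow> (\<exists>q\<in>mpoly_set K I. p = q * mpoly_emb h f)" if "p \<in> mpoly_set K I" for p
    using generic_zero_ideal[OF sK n' cK c' gen' that[unfolded I_def]] unfolding I_def mf .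
  \<comment> \<open>Evaluation at the generic zero. Its kernel is the principal ideal of the
    dehomogenized form, so the homomorphism theorem embeds the coordinate ring.\<close>
  define e where "e = (\<lambda>p. mpoly_eval \<xi> (mpoly_emb h p))"
  define W :: "'w ring" where "W = ring_of_type_algebra"
  have Wf: "cring W" unfolding W_def by (rule cring_from_type_algebra)
  have eW: "ring_hom_ring P W e"
  proof (rule ring_hom_ringI)
    show "ring P" "ring W" using P.ring_axioms Wf cring.axioms(1) by auto
  qed (auto simp: W_def ring_of_type_algebra_def e_def rembD[OF P] mpoly_eval_add mpoly_eval_mult mpoly_eval_const[of \<xi> 1, simplified]
      intro!: mpoly_eval_const[of \<xi> 1, unfolded zero_multiset_def[symmetric] single_one])
  interpret e: ring_hom_ring P W e by (rule eW)
  have ker: "a_kernel P W e = PIdl\<^bsub>P\<^esub> f"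
  proof -
    have "e p = 0 \<longleftrightarrow> (\<exists>q\<in>carrier P. p = q \<otimes>\<^bsub>P\<^esub> f)" if p: "p \<in> carrier P" for p
    proof -
      have "e p = 0 \<longleftrightarrow> (\<exists>q\<in>mpoly_set K I. mpoly_emb h p = q * mpoly_emb h f)" unfolding e_def
        by (rule ideal) (use im p in blast)
      also have "\<dots> \<longleftrightarrow> (\<exists>q\<in>carrier P. mpoly_emb h p = mpoly_emb h q * mpoly_emb h f)" unfolding im[symmetric] by blast
      also have "\<dots> \<longleftrightarrow> (\<exists>q\<in>carrier P. p = q \<otimes>\<^bsub>P\<^esub> f)"
        using rembD(5)[OF P _ fP] ring_emb_inj[OF P p P.m_closed[OF _ fP]] by metis
      finally show ?thesis .
    qed
    then have "{p \<in> carrier P. e p = 0} = {x \<otimes>\<^bsub>P\<^esub> f |x. x \<in> carrier P}" using P.m_closed[OF _ fP] by blast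
    then show ?thesis unfolding a_kernel_def' cgenideal_def by (simp add: W_def ring_of_type_algebra_def)
  qed
  define A where "A = coordinate_ring F \<psi>"
  have A: "A = P Quot (a_kernel P W e)"
    unfolding A_def coordinate_ring_def ker unfolding P_def I_def n_def f_def Let_def ..
  define g where "g = (\<lambda>x. the_elem (e ` x))"
  have iso: "g \<in> ring_iso A (W\<lparr>carrier := e ` carrier P\<rparr>)" unfolding g_def A by (rule e.FactRing_iso_set_aux)
  have gA: "ring_emb A g" unfolding ring_emb_def
  proof (intro conjI ballI)
    show "cring A" unfolding A by (rule ideal.quotient_is_cring[OF e.kernel_is_ideal P.is_cring])
    show "inj_on g (carrier A)" using iso unfolding ring_iso_def bij_betw_def by blast
    have hom: "g \<in> ring_hom A (W\<lparr>carrier := e ` carrier P\<rparr>)" using iso unfolding ring_iso_def by blast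
    show "g \<one>\<^bsub>A\<^esub> = 1" using ring_hom_one[OF hom] by (simp add: W_def ring_of_type_algebra_def)
    fix x y assume "x \<in> carrier A" "y \<in> carrier A"
    then show "g (x \<oplus>\<^bsub>A\<^esub> y) = g x + g y" "g (x \<otimes>\<^bsub>A\<^esub> y) = g x * g y"
      using ring_hom_add[OF hom] ring_hom_mult[OF hom] by (simp_all add: W_def ring_of_type_algebra_def)
  qed
  have gs: "g (a_kernel P W e +>\<^bsub>P\<^esub> p) = e p" "a_kernel P W e +>\<^bsub>P\<^esub> p \<in> carrier A" if "p \<in> carrier P" for p
    using that e.the_elem_simp[OF that] unfolding g_def A FactRing_def A_RCOSETS_def' by auto
  have gim: "g ` carrier A = e ` carrier P" unfolding g_def A by (rule e.the_elem_surj)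
  define G where "G = (\<lambda>x. the_elem ((\<lambda>(a, b). g a / g b) ` x))"
  have frac: "ring_emb (fraction_field A) G"
    "\<And>a b. a \<in> carrier A \<Longrightarrow> b \<in> carrier A \<Longrightarrow> b \<noteq> \<zero>\<^bsub>A\<^esub> \<Longrightarrow>
      frac_class A a b \<in> carrier (fraction_field A) \<and> G (frac_class A a b) = g a / g b"
    "\<And>x. x \<in> carrier (fraction_field A) \<Longrightarrow>
      \<exists>a b. a \<in> carrier A \<and> b \<in> carrier A \<and> b \<noteq> \<zero>\<^bsub>A\<^esub> \<and> x = frac_class A a b"
    using ring_emb_fraction_field[OF gA] unfolding G_def by blast+
  have FF: "function_field F \<psi> = fraction_field A" unfolding function_field_def A_def ..
  have one: "\<one>\<^bsub>A\<^esub> \<in> carrier A" "g \<one>\<^bsub>A\<^esub> = 1" "\<one>\<^bsub>A\<^esub> \<noteq> \<zero>\<^bsub>A\<^esub>"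
    using rembD(1,3)[OF gA] ring_emb_zero[OF gA] cring.cring_simprules(6) by (blast, blast, force)
  have emb: "function_field_emb F \<psi> a \<in> carrier (fraction_field A) \<and> G (function_field_emb F \<psi> a) = h a"
    if a: "a \<in> carrier F" for a
  proof -
    have "function_field_emb F \<psi> a = frac_class A (a_kernel P W e +>\<^bsub>P\<^esub> F.indexed_const a) \<one>\<^bsub>A\<^esub>"
      unfolding function_field_emb_def ker unfolding A_def P_def I_def n_def f_def Let_def ..
    moreover have "e (F.indexed_const a) = h a" unfolding e_def constP(2)[OF a] by (rule mpoly_eval_const)
    ultimately show ?thesis using frac(2)[OF gs(2)[OF constP(1)[OF a]] one(1,3)] gs(1)[OF constP(1)[OF a]] one(2) by simp
  qed
  have mem: "e p \<in> G ` carrier (fraction_field A)" if "p \<in> carrier P" for p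
    using frac(2)[OF gs(2)[OF that] one(1,3)] gs(1)[OF that] one(2)
    by (intro image_eqI[of _ _ "frac_class A (a_kernel P W e +>\<^bsub>P\<^esub> p) \<one>\<^bsub>A\<^esub>"]) auto
  have rep: "\<exists>a b. a \<in> carrier A \<and> b \<in> carrier A \<and> b \<noteq> \<zero>\<^bsub>A\<^esub> \<and> u = g a / g b"
    if u: "u \<in> G ` carrier (fraction_field A)" for u
  proof -
    obtain w where w: "w \<in> carrier (fraction_field A)" "u = G w" using u by blast
    obtain a b where ab: "a \<in> carrier A" "b \<in> carrier A" "b \<noteq> \<zero>\<^bsub>A\<^esub>" "w = frac_class A a b"
      using frac(3)[OF w(1)] by blast
    have "u = g a / g b" unfolding w(2) ab(4) using frac(2)[OF ab(1-3)] by blast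
    then show ?thesis using ab(1-3) by blast
  qed
  have inv: "inverse u \<in> G ` carrier (fraction_field A)" if u: "u \<in> G ` carrier (fraction_field A)" for u
  proof -
    obtain a b where ab: "a \<in> carrier A" "b \<in> carrier A" "b \<noteq> \<zero>\<^bsub>A\<^esub>" "u = g a / g b"
      using rep[OF u] by blast
    show ?thesis
    proof (cases "a = \<zero>\<^bsub>A\<^esub>")
      case True
      then show ?thesis using ab(4) ring_emb_zero[OF gA] ring_emb_image_closed[OF frac(1)] by simp
    next
      case False
      then show ?thesis using frac(2)[OF ab(2,1)] ab(4)
        by (intro image_eqI[of _ _ "frac_class A b a"]) auto
    qed
  qed
  have sub: "subfld (G ` carrier (fraction_field A))"
    unfolding subfld_def using ring_emb_image_closed[OF frac(1)] inv by blast
  have xi: "\<xi> i \<in> G ` carrier (fraction_field A)" if "i < n" for i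
  proof -
    have "\<xi> 0 = 1" using gen unfolding generic_zero_def by blast
    then have "e (x i) = \<xi> i" unfolding e_def using xP(2)[OF that]
      by (simp add: mpoly_eval_pvar mpoly_eval_const[of \<xi> 1, unfolded zero_multiset_def[symmetric] single_one])
    then show ?thesis using mem[OF xP(1)[OF that]] by simp
  qed
  have least: "G ` carrier (fraction_field A) \<subseteq> L"
    if L: "subfld L" "h ` carrier F \<subseteq> L" "\<forall>i<qdim \<psi>. \<xi> i \<in> L" for L
  proof
    fix u assume "u \<in> G ` carrier (fraction_field A)"
    then obtain a b where ab: "a \<in> carrier A" "b \<in> carrier A" "b \<noteq> \<zero>\<^bsub>A\<^esub>" "u = g a / g b"
      using rep by blast
    have "e p \<in> L" if "p \<in> carrier P" for p
      unfolding e_def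
    proof (rule mpoly_eval_in[OF _ L(1), of _ K I])
      show "mpoly_emb h p \<in> mpoly_set K I" using im that by blast
      show "K \<subseteq> L" using L(2) unfolding K_def .
      show "\<xi> i \<in> L" if "i \<in> I" for i using that L(3) unfolding I_def n_def by simp
    qed
    then have "g ` carrier A \<subseteq> L" unfolding gim by blast
    then show "u \<in> L" using ab by (auto intro: subfldD(8)[OF L(1)])
  qed
  show ?thesis unfolding FF
    using frac(1) emb sub xi least n_def by (intro exI[of _ G]) blast
qed


section \<open>Witt decomposition\<close>

text \<open>The rows of \<open>C\<close> express the unit vectors in the basis and inherit their
  independence, which gives \<open>n \<le> d\<close>. Independence of \<open>b\<close> then turns
  the one-sided inverse into a two-sided one.\<close>

lemma basis_matrix:
  fixes b :: "nat \<Rightarrow> nat \<Rightarrow> 'w::field"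
  assumes K: "subfld K" and b: "\<And>k. k < d \<Longrightarrow> vin K n (b k)" and ind: "lin_indep K n {..<d} b"
    and span: "\<And>u. vin K n u \<Longrightarrow> \<exists>x. vin K d x \<and> (\<forall>k<n. u k = (\<Sum>l<d. x l * b l k))"
  shows "d = n" "\<exists>C. (\<forall>k<n. vin K n (C k)) \<and> (\<forall>i<n. \<forall>j<n. (\<Sum>k<n. b i k * C k j) = (if i = j then 1 else 0)) \<and>
    (\<forall>i<n. \<forall>j<n. (\<Sum>k<n. C i k * b k j) = (if i = j then 1 else 0))"
proof -
  have "\<exists>x. i < n \<longrightarrow> vin K d x \<and> (\<forall>k<n. unitv i k = (\<Sum>l<d. x l * b l k))" for i
    using span[OF vin_unitv[OF K]] by blast
  then obtain C where C: "\<And>i. i < n \<Longrightarrow> vin K d (C i)" "\<And>i k. i < n \<Longrightarrow> k < n \<Longrightarrow> unitv i k = (\<Sum>l<d. C i l * b l k)"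
    by metis
  have dn: "d \<le> n" using lin_indep_card_le[OF K _ _ ind] b by simp
  have "lin_indep K d {..<n} C" unfolding lin_indep_def
  proof safe
    fix a i assume a: "\<forall>l<d. (\<Sum>i<n. a i * C i l) = 0" "i < n"
    have "a i = (\<Sum>i'<n. a i' * unitv i' i)" using a(2) by (simp add: unitv_def mult_delta_right cong: if_cong)
    also have "\<dots> = (\<Sum>i'<n. \<Sum>l<d. a i' * C i' l * b l i)"
      using C(2) a(2) by (simp add: sum_distrib_left mult.assoc)
    also have "\<dots> = (\<Sum>l<d. (\<Sum>i'<n. a i' * C i' l) * b l i)" by (subst sum.swap) (simp add: sum_distrib_right)
    also have "\<dots> = 0" using a(1) by simp
    finally show "a i = 0" .
  qed
  from lin_indep_card_le[OF K _ _ this] C(1) have "n \<le> d" by simp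
  with dn show d: "d = n" by simp
  have CB: "(\<Sum>k<n. C i k * b k j) = (if i = j then 1 else 0)" if "i < n" "j < n" for i j
    using C(2)[OF that] d unfolding unitv_def by auto
  have BC: "(\<Sum>k<n. b i k * C k j) = (if i = j then 1 else 0)" if ij: "i < n" "j < n" for i j
  proof -
    define a where "a = (\<lambda>l. (\<Sum>k<n. b i k * C k l) - (if l = i then 1 else 0))"
    have "a j = 0"
    proof (rule indepD[OF ind])
      show "a l \<in> K" if "l \<in> {..<d}" for l
        using that b ij(1) C(1) d unfolding a_def vin_def
        by (intro subfldD(7)[OF K] subfld_sum[OF K] subfldD(4)[OF K]) (auto simp: subfldD(1,2)[OF K])
      show "j \<in> {..<d}" using ij d by simp
      fix m assume m: "m < n"
      have "(\<Sum>l<n. a l * b l m) = (\<Sum>l<n. (\<Sum>k<n. b i k * C k l) * b l m) - (\<Sum>l<n. (if l = i then 1 else 0) * b l m)"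
        unfolding a_def by (simp only: left_diff_distrib sum_subtractf)
      also have "(\<Sum>l<n. (if l = i then 1 else 0) * b l m) = b i m"
        using ij by (simp add: mult_delta_left cong: if_cong)
      also have "(\<Sum>l<n. (\<Sum>k<n. b i k * C k l) * b l m) = (\<Sum>k<n. b i k * (\<Sum>l<n. C k l * b l m))"
        unfolding sum_distrib_right sum_distrib_left by (subst sum.swap) (simp add: mult.assoc)
      also have "\<dots> = (\<Sum>k<n. b i k * (if k = m then 1 else 0))" using CB m by (intro sum.cong) auto
      also have "\<dots> = b i m" using m by (simp add: mult_delta_right cong: if_cong)
      finally show "(\<Sum>l<d. a l * b l m) = 0" using d by simp
    qed
    then show ?thesis unfolding a_def by auto
  qed
  show "\<exists>C. (\<forall>k<n. vin K n (C k)) \<and> (\<forall>i<n. \<forall>j<n. (\<Sum>k<n. b i k * C k j) = (if i = j then 1 else 0)) \<and>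
    (\<forall>i<n. \<forall>j<n. (\<Sum>k<n. C i k * b k j) = (if i = j then 1 else 0))"
    using C(1) BC CB d by (intro exI[of _ C]) auto
qed

lemma sum_pairs: "(\<Sum>k<2 * (i::nat). f k) = (\<Sum>l<i. f (2 * l) + f (2 * l + 1))" for f :: "nat \<Rightarrow> 'b::comm_monoid_add"
  by (induction i) (simp_all add: algebra_simps)

text \<open>Hyperbolic pairs \<open>v l\<close>, \<open>w l\<close> spanning mutually orthogonal
  hyperbolic planes.\<close>

definition hyp_system :: "'w::field set \<Rightarrow> nat \<Rightarrow> (nat \<Rightarrow> nat \<Rightarrow> 'w) \<Rightarrow> nat \<Rightarrow> (nat \<Rightarrow> nat \<Rightarrow> 'w) \<Rightarrow> (nat \<Rightarrow> nat \<Rightarrow> 'w) \<Rightarrow> bool" where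
  "hyp_system K n c i v w \<longleftrightarrow> (\<forall>l<i. vin K n (v l) \<and> vin K n (w l) \<and> qv n c (v l) = 0 \<and> qv n c (w l) = 0 \<and>
     (\<forall>m<i. pol n c (v l) (v m) = 0 \<and> pol n c (w l) (w m) = 0 \<and> pol n c (v l) (w m) = (if l = m then 1 else 0)))"

lemma hyp_systemD:
  assumes "hyp_system K n c i v w" "l < i"
  shows "vin K n (v l)" "vin K n (w l)" "qv n c (v l) = 0" "qv n c (w l) = 0"
    "\<And>m. m < i \<Longrightarrow> pol n c (v l) (v m) = 0" "\<And>m. m < i \<Longrightarrow> pol n c (w l) (w m) = 0"
    "\<And>m. m < i \<Longrightarrow> pol n c (v l) (w m) = (if l = m then 1 else 0)"
    "\<And>m. m < i \<Longrightarrow> pol n c (w l) (v m) = (if l = m then 1 else 0)"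
  using assms pol_sym[of n c] unfolding hyp_system_def by auto

text \<open>Pairing a relation among the \<open>v l\<close> with \<open>w m\<close> isolates the
  coefficient at \<open>m\<close>, so the \<open>v l\<close> are independent.\<close>

lemma hyp_system_le:
  assumes K: "subfld K" and h: "hyp_system K n c i v w"
  shows "i \<le> n"
proof -
  have "lin_indep K n {..<i} v" unfolding lin_indep_def
  proof safe
    fix a m assume a: "\<forall>k<n. (\<Sum>l<i. a l * v l k) = 0" "m < i"
    have "0 = pol n c (\<lambda>k. \<Sum>l<i. a l * v l k) (w m)"
      using pol_cong[of n "\<lambda>k. \<Sum>l<i. a l * v l k" "\<lambda>_. 0" "w m" "w m" c] a(1) by simp
    also have "\<dots> = (\<Sum>l<i. a l * (if l = m then 1 else 0))"
      unfolding pol_sum2 using hyp_systemD(7)[OF h] a(2) by (intro sum.cong) auto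
    also have "\<dots> = a m" using a(2) by (simp add: mult_delta_right cong: if_cong)
    finally show "a m = 0" by simp
  qed
  from lin_indep_card_le[OF K _ _ this] hyp_systemD(1)[OF h] show ?thesis by simp
qed

text \<open>An isotropic vector that is not orthogonal to everything lies in a hyperbolic plane, and
  a plane orthogonal to the old pairs can be added to them.\<close>

lemma hyp_system_extend:
  assumes K: "subfld K" and c: "cin K n c" and h: "hyp_system K n c i v w" and c2: "(2::'w::field) = 0"
    and u: "vin K n u" "vin K n u'" "qv n c u = 0" "pol n c u u' \<noteq> (0::'w)"
    and p: "\<And>l. l < i \<Longrightarrow> pol n c u (v l) = 0 \<and> pol n c u (w l) = 0 \<and> pol n c u' (v l) = 0 \<and> pol n c u' (w l) = 0"
  shows "\<exists>v w. hyp_system K n c (Suc i) v w"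
proof -
  define \<beta> where "\<beta> = inverse (pol n c u u')"
  define y where "y = (\<lambda>k. \<beta> * u' k)"
  \<comment> \<open>Since \<open>pol u y = 1\<close> and \<open>q(u) = 0\<close>, adding
    \<open>s u\<close> changes \<open>q(y)\<close> by exactly \<open>s\<close>; this choice makes
    \<open>z\<close> isotropic.\<close>
  define s where "s = - qv n c y"
  define z where "z = (\<lambda>k. y k + s * u k)"
  have \<beta>K: "\<beta> \<in> K" unfolding \<beta>_def by (intro subfldD(6)[OF K] pol_in[OF K c] u)
  have yK: "vin K n y" using u(2) \<beta>K unfolding y_def vin_def by (auto intro: subfldD(4)[OF K])
  have sK: "s \<in> K" unfolding s_def by (intro subfldD(5)[OF K] qv_in[OF K c] yK)
  have zK: "vin K n z" using u(1) yK sK unfolding z_def vin_def by (auto intro: subfldD(3,4)[OF K])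
  have uy: "pol n c u y = 1" unfolding y_def pol_scale \<beta>_def using u(4) by simp
  have uz: "pol n c u z = 1" unfolding z_def pol_add pol_scale pol_self_char2[OF c2] using uy by simp
  have qz: "qv n c z = 0" unfolding z_def qv_add qv_scale pol_scale u(3) s_def using uy pol_sym[of n c y u] by simp
  have yp: "pol n c y (v l) = 0 \<and> pol n c y (w l) = 0" if "l < i" for l
    unfolding y_def pol_scale2 using p[OF that] by simp
  have zp: "pol n c z (v l) = 0 \<and> pol n c z (w l) = 0" if "l < i" for l
    unfolding z_def pol_add2 pol_scale2 using p[OF that] yp[OF that] by simp
  note s = pol_self_char2[OF c2]
  have "hyp_system K n c (Suc i) (v(i := u)) (w(i := z))"
    unfolding hyp_system_def
  proof (intro allI impI)
    fix l assume l: "l < Suc i"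
    show "vin K n ((v(i := u)) l) \<and> vin K n ((w(i := z)) l) \<and> qv n c ((v(i := u)) l) = 0 \<and> qv n c ((w(i := z)) l) = 0 \<and>
     (\<forall>m<Suc i. pol n c ((v(i := u)) l) ((v(i := u)) m) = 0 \<and> pol n c ((w(i := z)) l) ((w(i := z)) m) = 0 \<and>
        pol n c ((v(i := u)) l) ((w(i := z)) m) = (if l = m then 1 else 0))"
    proof (cases "l = i")
      case True
      then show ?thesis using u zK qz s uz p zp by (auto simp: less_Suc_eq)
    next
      case False
      then have li: "l < i" using l by simp
      have "pol n c (v l) u = 0" "pol n c (w l) z = 0" "pol n c (v l) z = 0"
        using p[OF li] zp[OF li] pol_sym[of n c] by metis+
      then show ?thesis using False hyp_systemD[OF h li] by (auto simp: less_Suc_eq)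
    qed
  qed
  then show ?thesis by blast
qed

text \<open>A maximal system of hyperbolic pairs is split off. In its orthogonal complement every
  isotropic vector is then orthogonal to the whole complement, so these vectors form a subspace, the
  zero part, and any linear complement of it is anisotropic.\<close>

theorem witt_basis_exists:
  fixes c :: "nat \<Rightarrow> nat \<Rightarrow> 'w::field"
  assumes c2: "(2::'w) = 0" and K: "subfld K" and c: "cin K n c"
  shows "\<exists>i e j b d. 2 * i + (e + j) = n \<and> (\<forall>k<n. vin K n (b k)) \<and> lin_indep K n {..<n} b \<and>
    (\<forall>u. vin K n u \<longrightarrow> (\<exists>x. vin K n x \<and> (\<forall>k<n. u k = (\<Sum>l<n. x l * b l k)))) \<and>
    cin K e d \<and> aniso K e d \<and>
    (\<forall>x. qv n c (\<lambda>k. \<Sum>l<n. x l * b l k) = (\<Sum>l<i. x (2 * l) * x (2 * l + 1)) + qv e d (\<lambda>k. x (2 * i + k)))"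
proof -
  define Q where "Q = (\<lambda>i. \<exists>v w. hyp_system K n c i v w)"
  have "Q 0" unfolding Q_def hyp_system_def by simp
  moreover have "\<And>i. Q i \<Longrightarrow> i \<le> n" unfolding Q_def using hyp_system_le[OF K] by blast
  ultimately obtain i where i: "Q i" "\<And>i'. Q i' \<Longrightarrow> i' \<le> i"
    using Nat.ex_has_greatest_nat[of Q 0 n] by metis
  then obtain v w where h: "hyp_system K n c i v w" unfolding Q_def by blast
  note hD = hyp_systemD[OF h]
  define PP where "PP = {u. vin K n u \<and> (\<forall>l<i. pol n c u (v l) = 0 \<and> pol n c u (w l) = 0)}"
  define N where "N = {u \<in> PP. qv n c u = 0}"
  \<comment> \<open>By maximality, since otherwise \<open>u\<close> and \<open>u'\<close> would
    provide one more hyperbolic pair.\<close>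
  have rad: "pol n c u u' = 0" if "u \<in> N" "u' \<in> PP" for u u'
  proof (rule ccontr)
    assume "pol n c u u' \<noteq> 0"
    then have "Q (Suc i)" unfolding Q_def
      using that by (intro hyp_system_extend[OF K c h c2, of u u']) (auto simp: N_def PP_def)
    then show False using i(2) by fastforce
  qed
  have PPc: "(\<lambda>k. x k - y k) \<in> PP" if "x \<in> PP" "y \<in> PP" for x y
    using that unfolding PP_def vin_def by (auto simp: pol_diff2 subfldD(7)[OF K])
  have PPs: "(\<lambda>k. a * x k) \<in> PP" if "x \<in> PP" "a \<in> K" for x a
    using that unfolding PP_def vin_def by (auto simp: pol_scale2 subfldD(4)[OF K])
  have qdiff: "qv n c (\<lambda>k. x k - y k) = qv n c x + qv n c y - pol n c x y" for x y
    using qv_add[of n c x "\<lambda>k. - 1 * y k"] unfolding qv_scale pol_scale by simp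
  \<comment> \<open>Isotropic vectors are not closed under subtraction in general; here the polar
    term vanishes by \<open>rad\<close>.\<close>
  have Nc: "(\<lambda>k. x k - y k) \<in> N" if "x \<in> N" "y \<in> N" for x y
    using that PPc rad[of x y] unfolding N_def by (simp add: qdiff)
  have Ns: "(\<lambda>k. a * x k) \<in> N" if "x \<in> N" "a \<in> K" for x a
    using that PPs unfolding N_def by (simp add: qv_scale)
  have NV: "vin K n u" if "u \<in> N" for u using that unfolding N_def PP_def by blast
  obtain S2 r where S2: "echelon K n S2 r" "\<forall>s\<in>S2. r s \<in> N" "\<forall>u\<in>N. \<forall>k<n. u k = (\<Sum>s\<in>S2. u s * r s k)"
    using subspace_echelon_basis[OF K NV Nc Ns] by blast
  have sub2: "S2 \<subseteq> {..<n}" and f2: "finite S2" using S2(1) echelon_finite[OF S2(1)] unfolding echelon_def by auto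
  \<comment> \<open>Vanishing at the pivots of \<open>N\<close> cuts out a complement of
    \<open>N\<close> in \<open>PP\<close> without passing to a quotient.\<close>
  define U where "U = {u \<in> PP. \<forall>s\<in>S2. u s = 0}"
  have Uc: "(\<lambda>k. x k - y k) \<in> U" if "x \<in> U" "y \<in> U" for x y using that PPc unfolding U_def by simp
  have Us: "(\<lambda>k. a * x k) \<in> U" if "x \<in> U" "a \<in> K" for x a using that PPs unfolding U_def by simp
  have UV: "vin K n u" if "u \<in> U" for u using that unfolding U_def PP_def by blast
  obtain S1 g where S1: "echelon K n S1 g" "\<forall>s\<in>S1. g s \<in> U" "\<forall>u\<in>U. \<forall>k<n. u k = (\<Sum>s\<in>S1. u s * g s k)"
    using subspace_echelon_basis[OF K UV Uc Us] by blast
  have sub1: "S1 \<subseteq> {..<n}" and f1: "finite S1" using S1(1) echelon_finite[OF S1(1)] unfolding echelon_def by auto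
  define e where "e = card S1"
  define j where "j = card S2"
  obtain \<alpha> where \<alpha>: "bij_betw \<alpha> {..<e} S1" using ex_bij_betw_nat_finite[OF f1] unfolding e_def atLeast0LessThan by blast
  obtain \<gamma> where \<gamma>: "bij_betw \<gamma> {..<j} S2" using ex_bij_betw_nat_finite[OF f2] unfolding j_def atLeast0LessThan by blast
  have \<alpha>S: "\<alpha> k \<in> S1" if "k < e" for k using \<alpha> that unfolding bij_betw_def by auto
  have \<gamma>S: "\<gamma> k \<in> S2" if "k < j" for k using \<gamma> that unfolding bij_betw_def by auto
  \<comment> \<open>The order follows \<open>witt_decomposition\<close>: the pairs interleaved, then
    the anisotropic part, then the zeros.\<close>
  define b where "b = (\<lambda>k. if k < 2 * i then (if even k then v (k div 2) else w (k div 2))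
     else if k < 2 * i + e then g (\<alpha> (k - 2 * i)) else r (\<gamma> (k - 2 * i - e)))"
  have b1: "b (2 * l) = v l" "b (2 * l + 1) = w l" if "l < i" for l using that unfolding b_def by auto
  have b2: "b (2 * i + k) = g (\<alpha> k)" if "k < e" for k using that unfolding b_def by auto
  have b3: "b (2 * i + (e + k)) = r (\<gamma> k)" for k unfolding b_def by auto
  let ?d = "2 * i + (e + j)"
  define vP where "vP = (\<lambda>x k. \<Sum>l<i. x (2 * l) * v l k + x (2 * l + 1) * w l k)"
  define vG where "vG = (\<lambda>x k. \<Sum>l<e. x (2 * i + l) * g (\<alpha> l) k)"
  define vR where "vR = (\<lambda>x k. \<Sum>l<j. x (2 * i + (e + l)) * r (\<gamma> l) k)"
  have sp: "(\<Sum>l<?d. x l * b l k) = vP x k + (vG x k + vR x k)" for x k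
    unfolding sum_split_lt sum_pairs vP_def vG_def vR_def using b1 b2 b3 by simp
  have gU: "g (\<alpha> l) \<in> U" if "l < e" for l using S1(2) \<alpha>S[OF that] by blast
  have rN: "r (\<gamma> l) \<in> N" if "l < j" for l using S2(2) \<gamma>S[OF that] by blast
  have gP: "pol n c (g (\<alpha> l)) (v m) = 0" "pol n c (g (\<alpha> l)) (w m) = 0" if "l < e" "m < i" for l m
    using gU[OF that(1)] that(2) unfolding U_def PP_def by auto
  have rP: "pol n c (r (\<gamma> l)) (v m) = 0" "pol n c (r (\<gamma> l)) (w m) = 0" if "l < j" "m < i" for l m
    using rN[OF that(1)] that(2) unfolding N_def PP_def by auto
  have pGv: "pol n c (vG x) (v m) = 0" "pol n c (vG x) (w m) = 0" if "m < i" for m x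
    unfolding vG_def pol_sum2 using gP that by simp_all
  have pRv: "pol n c (vR x) (v m) = 0" "pol n c (vR x) (w m) = 0" if "m < i" for m x
    unfolding vR_def pol_sum2 using rP that by simp_all
  have vP2: "vP x = (\<lambda>k. (\<Sum>l<i. x (2 * l) * v l k) + (\<Sum>l<i. x (2 * l + 1) * w l k))" for x
    unfolding vP_def by (simp add: sum.distrib)
  have delta: "(\<Sum>l<i. f l * (if l = m then 1 else 0)) = f m" if "m < i" for m and f :: "nat \<Rightarrow> 'w"
    using that by (simp add: mult_delta_right cong: if_cong)
  have pPw: "pol n c (vP x) (w m) = x (2 * m)" if m: "m < i" for m x
  proof -
    have "pol n c (vP x) (w m) = (\<Sum>l<i. x (2 * l) * pol n c (v l) (w m)) + (\<Sum>l<i. x (2 * l + 1) * pol n c (w l) (w m))"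
      unfolding vP2 pol_add2 pol_sum2 ..
    also have "\<dots> = (\<Sum>l<i. x (2 * l) * (if l = m then 1 else 0))" using hD(6,7) m by simp
    finally show ?thesis unfolding delta[OF m] .
  qed
  have pPv: "pol n c (vP x) (v m) = x (2 * m + 1)" if m: "m < i" for m x
  proof -
    have "pol n c (vP x) (v m) = (\<Sum>l<i. x (2 * l) * pol n c (v l) (v m)) + (\<Sum>l<i. x (2 * l + 1) * pol n c (w l) (v m))"
      unfolding vP2 pol_add2 pol_sum2 ..
    also have "\<dots> = (\<Sum>l<i. x (2 * l + 1) * (if l = m then 1 else 0))" using hD(5,8) m by simp
    finally show ?thesis unfolding delta[OF m] .
  qed
  have bV: "vin K n (b k)" if "k < ?d" for k
    unfolding b_def using that hD(1,2) UV[OF gU] NV[OF rN] by (auto simp: less_mult_imp_div_less)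
  \<comment> \<open>Hyperbolic coordinates are recovered by pairing with the partner vector, then
    those of the zero part at the pivots \<open>S2\<close>, where \<open>U\<close> vanishes, and
    finally those of the anisotropic part at the pivots \<open>S1\<close>.\<close>
  have ind: "lin_indep K n {..<?d} b" unfolding lin_indep_def
  proof safe
    fix x m assume x: "\<forall>k<n. (\<Sum>l<?d. x l * b l k) = 0" "m < ?d"
    then have 0: "vP x k + (vG x k + vR x k) = 0" if "k < n" for k using that sp by simp
    have z: "pol n c (\<lambda>k. vP x k + (vG x k + vR x k)) y = 0" for y
      using pol_cong[of n "\<lambda>k. vP x k + (vG x k + vR x k)" "\<lambda>_. 0" y y c] 0 by simp
    have P0: "x (2 * l) = 0 \<and> x (2 * l + 1) = 0" if l: "l < i" for l
      using z[of "w l"] z[of "v l"] pPw[OF l] pPv[OF l] pGv[OF l] pRv[OF l] by (simp only: pol_add2) simp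
    then have "vP x k = 0" for k unfolding vP_def by simp
    then have 1: "vG x k + vR x k = 0" if "k < n" for k using 0 that by simp
    have R0: "x (2 * i + (e + l)) = 0" if l: "l < j" for l
    proof -
      have "vG x (\<gamma> l) = 0" unfolding vG_def using gU \<gamma>S[OF l] unfolding U_def by simp
      then have "vR x (\<gamma> l) = 0" using 1[of "\<gamma> l"] \<gamma>S[OF l] sub2 by auto
      moreover have "vR x (\<gamma> l) = (\<Sum>m<j. x (2 * i + (e + m)) * (if m = l then 1 else 0))"
        unfolding vR_def
      proof (rule sum.cong)
        fix m assume m: "m \<in> {..<j}"
        have "r (\<gamma> m) (\<gamma> l) = (if \<gamma> m = \<gamma> l then 1 else 0)" using S2(1) \<gamma>S l m unfolding echelon_def by auto
        also have "\<gamma> m = \<gamma> l \<longleftrightarrow> m = l" using \<gamma> m l unfolding bij_betw_def inj_on_def by auto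
        finally show "x (2 * i + (e + m)) * r (\<gamma> m) (\<gamma> l) = x (2 * i + (e + m)) * (if m = l then 1 else 0)" by simp
      qed simp
      ultimately show ?thesis using l by (simp add: mult_delta_right cong: if_cong)
    qed
    then have "vR x k = 0" for k unfolding vR_def by simp
    then have 2: "vG x k = 0" if "k < n" for k using 1 that by simp
    have G0: "x (2 * i + l) = 0" if l: "l < e" for l
    proof -
      have "vG x (\<alpha> l) = 0" using 2[of "\<alpha> l"] \<alpha>S[OF l] sub1 by auto
      moreover have "vG x (\<alpha> l) = (\<Sum>m<e. x (2 * i + m) * (if m = l then 1 else 0))"
        unfolding vG_def
      proof (rule sum.cong)
        fix m assume m: "m \<in> {..<e}"
        have "g (\<alpha> m) (\<alpha> l) = (if \<alpha> m = \<alpha> l then 1 else 0)" using S1(1) \<alpha>S l m unfolding echelon_def by auto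
        also have "\<alpha> m = \<alpha> l \<longleftrightarrow> m = l" using \<alpha> m l unfolding bij_betw_def inj_on_def by auto
        finally show "x (2 * i + m) * g (\<alpha> m) (\<alpha> l) = x (2 * i + m) * (if m = l then 1 else 0)" by simp
      qed simp
      ultimately show ?thesis using l by (simp add: mult_delta_right cong: if_cong)
    qed
    consider "m < 2 * i" | l where "l < e" "m = 2 * i + l" | l where "l < j" "m = 2 * i + (e + l)"
      using x(2) by (metis add_less_cancel_left le_add_diff_inverse not_less)
    then show "x m = 0"
    proof cases
      case 1
      then have "m div 2 < i" by simp
      then show ?thesis using P0[of "m div 2"] by (cases "even m") (auto elim!: evenE oddE)
    qed (use G0 R0 in auto)
  qed
  have span: "\<exists>x. vin K ?d x \<and> (\<forall>k<n. u k = (\<Sum>l<?d. x l * b l k))" if u: "vin K n u" for u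
  proof -
    \<comment> \<open>The coordinate at \<open>v l\<close> is the pairing with \<open>w l\<close>,
      and conversely.\<close>
    define x1 where "x1 = (\<lambda>k. if even k then pol n c u (w (k div 2)) else pol n c u (v (k div 2)))"
    have x1K: "x1 k \<in> K" if "k < 2 * i" for k
    proof -
      have "k div 2 < i" using that by simp
      then show ?thesis unfolding x1_def using pol_in[OF K c u] hD(1,2) by auto
    qed
    define u1 where "u1 = (\<lambda>k. u k - vP x1 k)"
    have "vP x1 k \<in> K" if "k < n" for k
      unfolding vP_def using x1K hD(1,2) that unfolding vin_def
      by (auto intro!: subfld_sum[OF K] subfldD(3,4)[OF K])
    then have u1K: "vin K n u1" using u unfolding u1_def vin_def by (auto intro: subfldD(7)[OF K])
    have u1P: "u1 \<in> PP" unfolding PP_def u1_def[symmetric]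
      using u1K pPw[of _ x1] pPv[of _ x1] unfolding u1_def by (auto simp: pol_diff2 x1_def)
    define u2 where "u2 = (\<lambda>k. u1 k - (\<Sum>s\<in>S2. u1 s * r s k))"
    have u2P: "u2 \<in> PP"
    proof -
      have "(\<lambda>k. x k - (\<Sum>s\<in>S. u1 s * r s k)) \<in> PP" if "x \<in> PP" "S \<subseteq> S2" for x S
        using finite_subset[OF that(2) f2] that
      proof (induction S arbitrary: x rule: finite_induct)
        case (insert s S)
        have "u1 s \<in> K" using u1K insert.prems(2) sub2 unfolding vin_def by auto
        moreover have "r s \<in> PP" using S2(2) insert.prems(2) unfolding N_def by auto
        ultimately have "(\<lambda>k. x k - u1 s * r s k) \<in> PP" using insert.prems(1) PPc PPs by blast
        from insert.IH[OF this] insert.prems(2) show ?case using insert.hyps by (simp add: algebra_simps)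
      qed simp
      then show ?thesis unfolding u2_def using u1P by blast
    qed
    have u2U: "u2 \<in> U"
    proof -
      have "u2 t = 0" if t: "t \<in> S2" for t
      proof -
        have "(\<Sum>s\<in>S2. u1 s * r s t) = (\<Sum>s\<in>S2. u1 s * (if s = t then 1 else 0))"
          using S2(1) t by (intro sum.cong) (auto simp: echelon_def)
        also have "\<dots> = u1 t" using f2 t by (simp add: mult_delta_right cong: if_cong)
        finally show ?thesis unfolding u2_def by simp
      qed
      then show ?thesis unfolding U_def using u2P by blast
    qed
    define x where "x = (\<lambda>k. if k < 2 * i then x1 k else if k < 2 * i + e then u2 (\<alpha> (k - 2 * i)) else u1 (\<gamma> (k - 2 * i - e)))"
    have "vin K ?d x" unfolding vin_def
    proof (intro allI impI)
      fix k assume k: "k < ?d"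
      have "u2 (\<alpha> (k - 2 * i)) \<in> K" if "k - 2 * i < e" using UV[OF u2U] \<alpha>S[OF that] sub1 unfolding vin_def by auto
      moreover have "u1 (\<gamma> (k - 2 * i - e)) \<in> K" if "k - 2 * i - e < j" using u1K \<gamma>S[OF that] sub2 unfolding vin_def by auto
      ultimately show "x k \<in> K" unfolding x_def using k x1K by auto
    qed
    moreover have "u k = (\<Sum>l<?d. x l * b l k)" if k: "k < n" for k
    proof -
      have "vP x k = vP x1 k" unfolding vP_def x_def by (intro sum.cong) auto
      moreover have "vG x k = (\<Sum>l<e. u2 (\<alpha> l) * g (\<alpha> l) k)" unfolding vG_def x_def by (intro sum.cong) auto
      moreover have "\<dots> = (\<Sum>s\<in>S1. u2 s * g s k)" by (rule sum.reindex_bij_betw[OF \<alpha>])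
      moreover have "\<dots> = u2 k" using S1(3) u2U k by simp
      moreover have "vR x k = (\<Sum>l<j. u1 (\<gamma> l) * r (\<gamma> l) k)" unfolding vR_def x_def by (intro sum.cong) auto
      moreover have "\<dots> = (\<Sum>s\<in>S2. u1 s * r s k)" by (rule sum.reindex_bij_betw[OF \<gamma>])
      ultimately show ?thesis unfolding sp u2_def u1_def by simp
    qed
    ultimately show ?thesis by blast
  qed
  have dn: "?d = n" by (rule basis_matrix(1)[OF K bV ind span])
  define d where "d = (\<lambda>k l. if k = l then qv n c (g (\<alpha> k)) else pol n c (g (\<alpha> k)) (g (\<alpha> l)))"
  have dK: "cin K e d" unfolding cin_def d_def
    using qv_in[OF K c] pol_in[OF K c] UV gU by auto
  have qG: "qv n c (\<lambda>k. \<Sum>l<e. y l * g (\<alpha> l) k) = qv e d y" for y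
    unfolding qv_sum qv_split[of e d] by (intro sum.cong arg_cong2[of _ _ _ _ "(+)"]) (auto simp: d_def)
  have an: "aniso K e d" unfolding aniso_def
  proof safe
    fix y m assume y: "vin K e y" "qv e d y = 0" "m < e"
    define Y' where "Y' = (\<lambda>k. \<Sum>l<e. y l * g (\<alpha> l) k)"
    have "Y' \<in> U"
    proof -
      have "(\<lambda>k. \<Sum>l<e'. y l * g (\<alpha> l) k) \<in> U" if "e' \<le> e" for e'
        using that
      proof (induction e')
        case 0
        have "(\<lambda>k. g (\<alpha> m) k - g (\<alpha> m) k) \<in> U" using Uc gU[OF y(3)] by blast
        then show ?case by simp
      next
        case (Suc e')
        have "(\<lambda>k. (- y e') * g (\<alpha> e') k) \<in> U"
          using y(1) Suc.prems unfolding vin_def by (intro Us gU subfldD(5)[OF K]) auto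
        from Uc[OF Suc.IH this] Suc.prems show ?case by simp
      qed
      then show ?thesis unfolding Y'_def by blast
    qed
    moreover have "qv n c Y' = 0" unfolding Y'_def qG by (rule y(2))
    ultimately have "Y' \<in> U" "Y' \<in> N" unfolding N_def U_def by blast+
    \<comment> \<open>A vector of \<open>N\<close> is determined by its entries at the pivots of
      \<open>N\<close>, and elements of \<open>U\<close> vanish there.\<close>
    have z: "Y' k = 0" if "k < n" for k
    proof -
      have "Y' k = (\<Sum>s\<in>S2. Y' s * r s k)" using S2(3) \<open>Y' \<in> N\<close> that by blast
      also have "\<dots> = 0" using \<open>Y' \<in> U\<close> unfolding U_def by simp
      finally show ?thesis .
    qed
    have "Y' (\<alpha> m) = (\<Sum>l<e. y l * (if l = m then 1 else 0))"
      unfolding Y'_def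
    proof (rule sum.cong)
      fix l assume l: "l \<in> {..<e}"
      have "g (\<alpha> l) (\<alpha> m) = (if \<alpha> l = \<alpha> m then 1 else 0)" using S1(1) \<alpha>S l y(3) unfolding echelon_def by auto
      also have "\<alpha> l = \<alpha> m \<longleftrightarrow> l = m" using \<alpha> l y(3) unfolding bij_betw_def inj_on_def by auto
      finally show "y l * g (\<alpha> l) (\<alpha> m) = y l * (if l = m then 1 else 0)" by simp
    qed simp
    then show "y m = 0" using z[of "\<alpha> m"] \<alpha>S[OF y(3)] sub1 y(3) by (auto simp: mult_delta_right cong: if_cong)
  qed
  have qf: "qv n c (\<lambda>k. \<Sum>l<?d. x l * b l k) = (\<Sum>l<i. x (2 * l) * x (2 * l + 1)) + qv e d (\<lambda>k. x (2 * i + k))" for x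
  proof -
    have pvec: "pol n c y (vP x) = 0" if "\<And>m. m < i \<Longrightarrow> pol n c y (v m) = 0 \<and> pol n c y (w m) = 0" for y
      unfolding vP2 pol_add pol_sum using that by simp
    have PG: "pol n c (vP x) (vG x) = 0" "pol n c (vP x) (vR x) = 0"
      using pvec[of "vG x"] pvec[of "vR x"] pGv pRv pol_sym[of n c "vP x"] by auto
    have Rrad: "pol n c (r (\<gamma> l)) y = 0" if "l < j" "y \<in> PP" for l y using rad rN that by blast
    have GR: "pol n c (vG x) (vR x) = 0"
    proof -
      have "pol n c (r (\<gamma> l)) (g (\<alpha> m)) = 0" if "l < j" "m < e" for l m
        using Rrad[OF that(1)] gU[OF that(2)] unfolding U_def by blast
      then have "pol n c (vR x) (vG x) = 0" unfolding vR_def vG_def pol_sum pol_sum2 by simp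
      then show ?thesis by (metis pol_sym)
    qed
    have qR: "qv n c (vR x) = 0"
    proof -
      have "isotropic_family n c {..<j} (\<lambda>l. r (\<gamma> l))" unfolding isotropic_family_def
        using rN Rrad unfolding N_def by auto
      moreover have "vR x \<in> lin_span UNIV {..<j} (\<lambda>l. r (\<gamma> l))" unfolding lin_span_def vR_def
        by (auto intro!: exI[of _ "\<lambda>l. x (2 * i + (e + l))"])
      ultimately show ?thesis by (rule isotropic_family_lin_span)
    qed
    define vv where "vv = (\<lambda>k. \<Sum>l<i. x (2 * l) * v l k)"
    define ww where "ww = (\<lambda>k. \<Sum>l<i. x (2 * l + 1) * w l k)"
    have "qv n c vv = 0" "qv n c ww = 0" unfolding vv_def ww_def qv_sum using hD(3,4,5,6) by auto
    moreover have "pol n c vv ww = (\<Sum>l<i. x (2 * l) * x (2 * l + 1))"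
    proof -
      have "pol n c (v l) ww = x (2 * l + 1)" if l: "l < i" for l
      proof -
        have "pol n c (v l) ww = (\<Sum>m<i. x (2 * m + 1) * (if m = l then 1 else 0))"
          unfolding ww_def pol_sum using hD(7)[OF l] by (intro sum.cong) auto
        then show ?thesis unfolding delta[OF l] .
      qed
      then show ?thesis unfolding vv_def pol_sum2 by simp
    qed
    ultimately have qP: "qv n c (vP x) = (\<Sum>l<i. x (2 * l) * x (2 * l + 1))"
      unfolding vP2 vv_def[symmetric] ww_def[symmetric] qv_add by simp
    have "(\<lambda>k. \<Sum>l<?d. x l * b l k) = (\<lambda>k. vP x k + (vG x k + vR x k))" using sp by blast
    moreover have "qv n c (vG x) = qv e d (\<lambda>k. x (2 * i + k))" unfolding vG_def by (rule qG)
    ultimately show ?thesis using qP qR PG GR by (simp only: qv_add pol_add) simp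
  qed
  show ?thesis
    using dn bV ind span dK an qf by (intro exI[of _ i] exI[of _ e] exI[of _ j] exI[of _ b] exI[of _ d]) auto
qed

text \<open>One vector with a nonzero entry at \<open>p\<close> clears this entry in all others and
  is then discarded; the remaining pivots are unaffected.\<close>

lemma isotropic_drop:
  assumes K: "subfld K" and S: "echelon K n S w" "isotropic_family n c S w" and p: "p < n"
  shows "\<exists>S' w'. card S \<le> Suc (card S') \<and> echelon K n S' w' \<and> isotropic_family n c S' w' \<and> (\<forall>s\<in>S'. w' s \<in> lin_span K S w \<and> w' s p = 0) \<and>
    ((\<exists>s\<in>S. w s p \<noteq> 0) \<or> card S' = card S)"
proof (cases "\<exists>s\<in>S. w s p \<noteq> 0")
  case False
  then show ?thesis using S lin_span_base[OF K echelon_finite[OF S(1)]] by (intro exI[of _ S] exI[of _ w]) auto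
next
  case True
  then obtain s0 where s0: "s0 \<in> S" "w s0 p \<noteq> 0" by blast
  have fS: "finite S" by (rule echelon_finite[OF S(1)])
  have wK: "vin K n (w s)" if "s \<in> S" for s using S(1) that unfolding echelon_def by blast
  define w' where "w' = (\<lambda>s k. w s k - (w s p / w s0 p) * w s0 k)"
  have wl: "w s \<in> lin_span K S w" if "s \<in> S" for s using lin_span_base[OF K fS that] .
  have w'l: "w' s \<in> lin_span K S w" if "s \<in> S" for s unfolding w'_def
    by (rule lin_span_diff[OF K wl[OF that] lin_span_scale[OF K wl[OF s0(1)]]])
      (use wK[OF that] wK[OF s0(1)] p in \<open>auto simp: vin_def intro: subfldD(8)[OF K]\<close>)
  have "echelon K n (S - {s0}) w'" unfolding echelon_def
  proof (intro conjI ballI)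
    show "S - {s0} \<subseteq> {..<n}" using S(1) unfolding echelon_def by blast
    fix s assume s: "s \<in> S - {s0}"
    show "vin K n (w' s)" using lin_span_vin[OF K wK w'l] s by blast
    fix t assume t: "t \<in> S - {s0}"
    have "w s t = (if s = t then 1 else 0)" "w s0 t = 0" using S(1) s t s0 unfolding echelon_def by auto
    then show "w' s t = (if s = t then 1 else 0)" unfolding w'_def by simp
  qed
  moreover have "isotropic_family n c (S - {s0}) w'" unfolding isotropic_family_def
    using isotropic_family_lin_span[OF S(2) w'l] isotropic_family_lin_span_pol[OF S(2) w'l w'l] by blast
  moreover have "w' s p = 0" for s unfolding w'_def using s0 by simp
  ultimately show ?thesis using w'l s0 fS by (intro exI[of _ "S - {s0}"] exI[of _ w']) auto
qed

text \<open>The projection to the last \<open>n\<close> coordinates must be isometric and injective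
  on a subspace of codimension at most 1. If \<open>x 0\<close> is somewhere nonzero,
  \<open>x 0 = 0\<close> defines it: a vector there with zero projection is a multiple of the second
  basis vector, and orthogonality to a vector with \<open>x 0 \<noteq> 0\<close> kills it. If
  \<open>x 0\<close> vanishes throughout, \<open>x 1 = 0\<close> serves.\<close>

lemma tot_isotropic_cancel_hyperbolic:
  assumes K: "subfld K" and q: "\<And>x. qv (2 + n) c x = x 0 * x 1 + qv n c' (\<lambda>k. x (2 + k))"
    and tot_isotropic: "tot_isotropic K (2 + n) c d"
  shows "tot_isotropic K n c' (d - 1)"
proof -
  have pl: "pol (2 + n) c x y = x 0 * y 1 + y 0 * x 1 + pol n c' (\<lambda>k. x (2 + k)) (\<lambda>k. y (2 + k))" for x y
    unfolding pol_qv q by (simp add: algebra_simps)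
  obtain S w where S: "card S = d" "echelon K (2 + n) S w" "isotropic_family (2 + n) c S w" using tot_isotropic unfolding tot_isotropic_def by blast
  obtain S1 w1 where S1: "card S \<le> Suc (card S1)" "echelon K (2 + n) S1 w1" "isotropic_family (2 + n) c S1 w1"
    "\<forall>s\<in>S1. w1 s \<in> lin_span K S w \<and> w1 s 0 = 0" "(\<exists>s\<in>S. w s 0 \<noteq> 0) \<or> card S1 = card S"
    using isotropic_drop[OF K S(2,3), of 0] by auto
  have proj: "tot_isotropic K n c' (card I)"
    if I: "echelon K (2 + n) I u" "isotropic_family (2 + n) c I u" "\<And>s. s \<in> I \<Longrightarrow> u s 0 = 0"
      and inj: "\<And>y. y \<in> lin_span K I u \<Longrightarrow> \<forall>k<n. y (2 + k) = 0 \<Longrightarrow> y 1 = 0" for I u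
  proof (rule tot_isotropic_I[OF K echelon_finite[OF I(1)], of n "\<lambda>s k. u s (2 + k)"])
    show "vin K n (\<lambda>k. u s (2 + k))" if "s \<in> I" for s using I(1) that unfolding echelon_def vin_def by auto
    show "isotropic_family n c' I (\<lambda>s k. u s (2 + k))" unfolding isotropic_family_def
    proof (intro ballI conjI)
      fix s assume s: "s \<in> I"
      then show "qv n c' (\<lambda>k. u s (2 + k)) = 0" using I(2,3) q[of "u s"] unfolding isotropic_family_def by simp
      fix t assume t: "t \<in> I"
      then show "pol n c' (\<lambda>k. u s (2 + k)) (\<lambda>k. u t (2 + k)) = 0"
        using s I(2,3) pl[of "u s" "u t"] unfolding isotropic_family_def by simp
    qed
    show "lin_indep K n I (\<lambda>s k. u s (2 + k))" unfolding lin_indep_def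
    proof safe
      fix a s assume a: "\<forall>i\<in>I. a i \<in> K" "\<forall>k<n. (\<Sum>i\<in>I. a i * u i (2 + k)) = 0" "s \<in> I"
      define y where "y = (\<lambda>k. \<Sum>i\<in>I. a i * u i k)"
      have "y \<in> lin_span K I u" unfolding lin_span_def y_def using a(1) by blast
      then have y1: "y 1 = 0" using inj a(2) unfolding y_def by blast
      have y0: "y 0 = 0" unfolding y_def using I(3) by simp
      have "(\<Sum>i\<in>I. a i * u i k) = 0" if "k < 2 + n" for k
      proof -
        consider "k = 0" | "k = 1" | k' where "k = 2 + k'" "k' < n"
          using \<open>k < 2 + n\<close> by (metis One_nat_def add_less_cancel_left le_add_diff_inverse less_2_cases not_less)
        then show ?thesis using y0 y1 a(2) unfolding y_def by cases auto
      qed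
      then show "a s = 0" using indepD[OF echelon_lin_indep[OF I(1)], of a s] a(1,3) by blast
    qed
  qed
  show ?thesis
  proof (cases "\<exists>s\<in>S. w s 0 \<noteq> 0")
    case True
    then obtain s0 where s0: "s0 \<in> S" "w s0 0 \<noteq> 0" by blast
    have "tot_isotropic K n c' (card S1)"
    proof (rule proj[OF S1(2,3)])
      show "w1 s 0 = 0" if "s \<in> S1" for s using that S1(4) by blast
      fix y assume y: "y \<in> lin_span K S1 w1" "\<forall>k<n. y (2 + k) = 0"
      have "y \<in> lin_span K S w"
      proof -
        obtain a where a: "\<forall>i\<in>S1. a i \<in> K" "y = (\<lambda>k. \<Sum>i\<in>S1. a i * w1 i k)" using y(1) unfolding lin_span_def by blast
        show ?thesis unfolding a(2) by (rule lin_span_sum[OF K]) (use S1(4) a(1) in auto)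
      qed
      then have "pol (2 + n) c y (w s0) = 0"
        using isotropic_family_lin_span_pol[OF S(3) _ lin_span_base[OF K echelon_finite[OF S(2)] s0(1)]] by blast
      moreover have "y 0 = 0" using y(1) S1(4) unfolding lin_span_def by auto
      moreover have "pol n c' (\<lambda>k. y (2 + k)) z = 0" for z
        using pol_cong[of n "\<lambda>k. y (2 + k)" "\<lambda>_. 0" z z c'] y(2) by simp
      ultimately show "y 1 = 0" unfolding pl using s0(2) by simp
    qed
    then show ?thesis using tot_isotropic_le S1(1) S(1) by (metis diff_Suc_1 diff_le_mono)
  next
    case False
    then have c1: "card S1 = d" using S1(5) S(1) by blast
    obtain S2 w2 where S2: "card S1 \<le> Suc (card S2)" "echelon K (2 + n) S2 w2" "isotropic_family (2 + n) c S2 w2"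
      "\<forall>s\<in>S2. w2 s \<in> lin_span K S1 w1 \<and> w2 s 1 = 0"
      using isotropic_drop[OF K S1(2,3), of 1] by auto
    have "tot_isotropic K n c' (card S2)"
    proof (rule proj[OF S2(2,3)])
      fix s assume "s \<in> S2"
      then show "w2 s 0 = 0" using S2(4) S1(4) unfolding lin_span_def by fastforce
    next
      fix y assume "y \<in> lin_span K S2 w2"
      then show "y 1 = 0" using S2(4) unfolding lin_span_def by auto
    qed
    then show ?thesis using tot_isotropic_le S2(1) c1 by (metis diff_Suc_1 diff_le_mono)
  qed
qed

text \<open>An isotropic vector has no anisotropic component, so every pivot lies among the last
  \<open>j\<close> coordinates.\<close>

lemma tot_isotropic_aniso_zero_le:
  assumes K: "subfld K" and a: "aniso K e d" and q: "\<And>x. qv (e + j) c x = qv e d x" and tot_isotropic: "tot_isotropic K (e + j) c m"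
  shows "m \<le> j"
proof -
  obtain S w where S: "card S = m" "echelon K (e + j) S w" "isotropic_family (e + j) c S w" using tot_isotropic unfolding tot_isotropic_def by blast
  have "S \<subseteq> {e..<e + j}"
  proof
    fix s assume s: "s \<in> S"
    have "vin K e (w s)" "qv e d (w s) = 0" using S(2,3) s q unfolding echelon_def isotropic_family_def vin_def by auto
    then have "w s k = 0" if "k < e" for k using anisD[OF a] that by blast
    moreover have "w s s = 1" "s < e + j" using S(2) s unfolding echelon_def by auto
    ultimately show "s \<in> {e..<e + j}" by (metis atLeastLessThan_iff not_less zero_neq_one)
  qed
  then show ?thesis using card_mono[of "{e..<e + j}" S] S(1) by simp
qed


subsection \<open>Isometries and the Witt index of forms over a field record\<close>

definition map_coeff :: "('b \<Rightarrow> 'w) \<Rightarrow> 'b qform \<Rightarrow> nat \<Rightarrow> nat \<Rightarrow> 'w" where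
  "map_coeff g \<phi> = (\<lambda>i j. g (qcoeff \<phi> i j))"

definition uvec :: "('b, 'm) ring_scheme \<Rightarrow> nat \<Rightarrow> nat \<Rightarrow> nat \<Rightarrow> 'b" where
  "uvec L n i = (\<lambda>k\<in>{..<n}. if k = i then \<one>\<^bsub>L\<^esub> else \<zero>\<^bsub>L\<^esub>)"

lemma vecsD: "x \<in> vecs L n \<Longrightarrow> k < n \<Longrightarrow> x k \<in> carrier L"
  unfolding vecs_def by auto

lemma vecsI: "(\<And>k. k < n \<Longrightarrow> f k \<in> carrier L) \<Longrightarrow> (\<lambda>k\<in>{..<n}. f k) \<in> vecs L n"
  unfolding vecs_def by auto

lemma vecs_eqI: "x \<in> vecs L n \<Longrightarrow> y \<in> vecs L n \<Longrightarrow> (\<And>k. k < n \<Longrightarrow> x k = y k) \<Longrightarrow> x = y"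
  unfolding vecs_def by (rule PiE_ext) auto

lemma linear_isoD:
  assumes "linear_iso L n T"
  shows "bij_betw T (vecs L n) (vecs L n)"
    "\<And>x. x \<in> vecs L n \<Longrightarrow> T x \<in> vecs L n"
    "\<And>x y. x \<in> vecs L n \<Longrightarrow> y \<in> vecs L n \<Longrightarrow> T (\<lambda>i\<in>{..<n}. x i \<oplus>\<^bsub>L\<^esub> y i) = (\<lambda>i\<in>{..<n}. T x i \<oplus>\<^bsub>L\<^esub> T y i)"
    "\<And>a x. a \<in> carrier L \<Longrightarrow> x \<in> vecs L n \<Longrightarrow> T (\<lambda>i\<in>{..<n}. a \<otimes>\<^bsub>L\<^esub> x i) = (\<lambda>i\<in>{..<n}. a \<otimes>\<^bsub>L\<^esub> T x i)"
proof -
  show b: "bij_betw T (vecs L n) (vecs L n)" using assms unfolding linear_iso_def by blast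
  show "\<And>x. x \<in> vecs L n \<Longrightarrow> T x \<in> vecs L n" using bij_betw_apply[OF b] .
  show "\<And>x y. x \<in> vecs L n \<Longrightarrow> y \<in> vecs L n \<Longrightarrow> T (\<lambda>i\<in>{..<n}. x i \<oplus>\<^bsub>L\<^esub> y i) = (\<lambda>i\<in>{..<n}. T x i \<oplus>\<^bsub>L\<^esub> T y i)"
    using assms unfolding linear_iso_def by blast
  show "\<And>a x. a \<in> carrier L \<Longrightarrow> x \<in> vecs L n \<Longrightarrow> T (\<lambda>i\<in>{..<n}. a \<otimes>\<^bsub>L\<^esub> x i) = (\<lambda>i\<in>{..<n}. a \<otimes>\<^bsub>L\<^esub> T x i)"
    using assms unfolding linear_iso_def by blast
qed

lemma qv_unitv: "i < n \<Longrightarrow> qv n c (unitv i) = c i i"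
proof -
  assume i: "i < n"
  have "qv n c (unitv i) = (\<Sum>j<n. if j = i then c j j else 0)"
    unfolding qv_split by (intro sum.cong) (auto simp: unitv_def intro!: sum.neutral)
  then show ?thesis using i by simp
qed

lemma pol_unitv: "i < j \<Longrightarrow> j < n \<Longrightarrow> pol n c (unitv i) (unitv j) = c i j"
proof -
  assume ij: "i < j" "j < n"
  have "pol n c (unitv i) (unitv j) = (\<Sum>j'<n. if j' = j then c i j' else 0)"
    unfolding pol_def
  proof (rule sum.cong)
    fix j' assume "j' \<in> {..<n}"
    have "(\<Sum>i'\<le>j'. c i' j' * (unitv i i' * unitv j j' + unitv j i' * unitv i j')) =
      (\<Sum>i'\<le>j'. if i' = i then (if j' = j then c i' j' else 0) else 0)"
      using ij by (intro sum.cong) (auto simp: unitv_def)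
    also have "\<dots> = (if j' = j then c i j' else 0)" using ij by auto
    finally show "(\<Sum>i'\<le>j'. c i' j' * (unitv i i' * unitv j j' + unitv j i' * unitv i j')) = (if j' = j then c i j' else 0)" .
  qed simp
  then show ?thesis using ij by simp
qed

lemma qdim_qsum [simp]: "qdim (qsum L \<phi> \<psi>) = qdim \<phi> + qdim \<psi>"
  unfolding qsum_def by simp

lemma qtimes_Suc: "qtimes L (Suc k) \<phi> = qsum L \<phi> (qtimes L k \<phi>)"
  unfolding qtimes_def by simp

lemma qtimes_0: "qtimes L 0 \<phi> = qzero L"
  unfolding qtimes_def by simp

lemma qdim_qtimes [simp]: "qdim (qtimes L k \<phi>) = k * qdim \<phi>"
  by (induction k) (simp_all add: qtimes_Suc qtimes_0 qzero_def)

lemma qdim_hyperbolic [simp]: "qdim (hyperbolic_plane L) = 2"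
  unfolding hyperbolic_plane_def qbinary_def by simp

lemma qembed_cong:
  assumes "qembed K n c n' c'" "\<And>i j. i \<le> j \<Longrightarrow> j < n \<Longrightarrow> c i j = d i j" "\<And>i j. i \<le> j \<Longrightarrow> j < n' \<Longrightarrow> c' i j = d' i j"
  shows "qembed K n d n' d'"
proof -
  have "qv n' c' x = qv n' d' x" for x by (rule qv_ccong) (use assms(3) in blast)
  then show ?thesis using assms(1,2) unfolding qembed_def pol_qv by auto
qed

context
  fixes L :: "('b, 'm) ring_scheme" and g :: "'b \<Rightarrow> 'w::field" and K :: "'w set"
  assumes g: "ring_emb L g" and K: "subfld K" "K = g ` carrier L"
begin

interpretation cring L by (rule rembD(1)[OF g])

lemma qeval_map_coeff:
  assumes "quadratic_form L \<phi>" "x \<in> vecs L (qdim \<phi>)"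
  shows "qeval L \<phi> x \<in> carrier L" "g (qeval L \<phi> x) = qv (qdim \<phi>) (map_coeff g \<phi>) (\<lambda>i. g (x i))"
  using qeval_ring_emb[OF g assms(1)] vecsD[OF assms(2)] unfolding qv_def map_coeff_def by auto

lemma vin_vecs: "x \<in> vecs L n \<Longrightarrow> vin K n (\<lambda>i. g (x i))"
  unfolding vin_def K using vecsD by blast

lemma vecs_vin:
  assumes "vin K n u" shows "\<exists>x\<in>vecs L n. \<forall>k<n. g (x k) = u k"
proof -
  have "\<forall>k. \<exists>a. k < n \<longrightarrow> a \<in> carrier L \<and> g a = u k" using assms unfolding vin_def K by (metis imageE)
  then obtain f where f: "\<And>k. k < n \<Longrightarrow> f k \<in> carrier L \<and> g (f k) = u k" by metis
  show ?thesis using f by (intro bexI[of _ "\<lambda>k\<in>{..<n}. f k"] vecsI) auto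
qed

lemma vecs_g_eqI: "x \<in> vecs L n \<Longrightarrow> y \<in> vecs L n \<Longrightarrow> (\<And>k. k < n \<Longrightarrow> g (x k) = g (y k)) \<Longrightarrow> x = y"
  using vecs_eqI[of x L n y] ring_emb_inj[OF g] vecsD[of x L n] vecsD[of y L n] by blast

lemma uvec_vecs: "uvec L n i \<in> vecs L n"
  unfolding uvec_def by (rule vecsI) auto

lemma g_uvec: "k < n \<Longrightarrow> g (uvec L n i k) = unitv i k"
  unfolding uvec_def unitv_def using rembD(3)[OF g] ring_emb_zero[OF g] by simp

text \<open>Additivity is given for two vectors at a time, so it is applied along the truncations
  \<open>xm m\<close>, one coordinate after the other.\<close>

lemma linear_iso_expand:
  assumes T: "linear_iso L n T" and x: "x \<in> vecs L n" and k: "k < n"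
  shows "g (T x k) = (\<Sum>i<n. g (x i) * g (T (uvec L n i) k))"
proof -
  note T' = linear_isoD[OF T]
  define xm where "xm = (\<lambda>m. \<lambda>k\<in>{..<n}. if k < m then x k else \<zero>\<^bsub>L\<^esub>)"
  have xm: "xm m \<in> vecs L n" for m unfolding xm_def using vecsD[OF x] by (intro vecsI) auto
  have sc: "(\<lambda>k\<in>{..<n}. a \<otimes>\<^bsub>L\<^esub> y k) \<in> vecs L n" if "a \<in> carrier L" "y \<in> vecs L n" for a y
    using that vecsD[of y L n] by (intro vecsI) auto
  have "g (T (xm m) k) = (\<Sum>i<m. g (x i) * g (T (uvec L n i) k))" if "m \<le> n" for m
    using that
  proof (induction m)
    case 0
    have "xm 0 = (\<lambda>k\<in>{..<n}. \<zero>\<^bsub>L\<^esub> \<otimes>\<^bsub>L\<^esub> x k)" unfolding xm_def using vecsD[OF x] by auto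
    then have "T (xm 0) k = \<zero>\<^bsub>L\<^esub> \<otimes>\<^bsub>L\<^esub> T x k" using T'(4)[OF zero_closed x] k by simp
    then show ?case using vecsD[OF T'(2)[OF x] k] ring_emb_zero[OF g] by simp
  next
    case (Suc m)
    then have m: "m < n" by simp
    define y where "y = (\<lambda>k\<in>{..<n}. x m \<otimes>\<^bsub>L\<^esub> uvec L n m k)"
    have y: "y \<in> vecs L n" unfolding y_def by (rule sc[OF vecsD[OF x m] uvec_vecs])
    have "xm (Suc m) = (\<lambda>k\<in>{..<n}. xm m k \<oplus>\<^bsub>L\<^esub> y k)"
      unfolding xm_def y_def uvec_def using vecsD[OF x] m by (auto simp: less_Suc_eq fun_eq_iff)
    then have "T (xm (Suc m)) k = T (xm m) k \<oplus>\<^bsub>L\<^esub> T y k" using T'(3)[OF xm y] k by simp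
    moreover have "T y k = x m \<otimes>\<^bsub>L\<^esub> T (uvec L n m) k"
      unfolding y_def T'(4)[OF vecsD[OF x m] uvec_vecs] using k by simp
    ultimately show ?case
      using Suc vecsD[OF T'(2)[OF xm] k] vecsD[OF T'(2)[OF y] k] vecsD[OF T'(2)[OF uvec_vecs] k] vecsD[OF x m]
      by (simp add: rembD(4,5)[OF g])
  qed
  from this[of n] have "g (T (xm n) k) = (\<Sum>i<n. g (x i) * g (T (uvec L n i) k))" by simp
  moreover have "xm n = x" by (rule vecs_eqI[OF xm x]) (simp add: xm_def)
  ultimately show ?thesis by simp
qed

lemma linear_iso_inv:
  assumes T: "linear_iso L n T"
  shows "linear_iso L n (inv_into (vecs L n) T)"
  unfolding linear_iso_def
proof (intro conjI ballI)
  note T' = linear_isoD[OF T]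
  let ?S = "inv_into (vecs L n) T"
  show "bij_betw ?S (vecs L n) (vecs L n)" by (rule bij_betw_inv_into[OF T'(1)])
  have inj: "inj_on T (vecs L n)" and im: "T ` vecs L n = vecs L n" using T'(1) unfolding bij_betw_def by auto
  have TS: "T (?S y) = y" "?S y \<in> vecs L n" if "y \<in> vecs L n" for y
    using that im f_inv_into_f[of y T "vecs L n"] inv_into_into[of y T "vecs L n"] by auto
  have e: "?S y = x" if "x \<in> vecs L n" "T x = y" for x y using inv_into_f_f[OF inj that(1)] that(2) by simp
  fix x y assume x: "x \<in> vecs L n"
  show "?S (\<lambda>i\<in>{..<n}. a \<otimes>\<^bsub>L\<^esub> x i) = (\<lambda>i\<in>{..<n}. a \<otimes>\<^bsub>L\<^esub> ?S x i)" if a: "a \<in> carrier L" for a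
  proof (rule e)
    show "(\<lambda>i\<in>{..<n}. a \<otimes>\<^bsub>L\<^esub> ?S x i) \<in> vecs L n" using a vecsD[OF TS(2)[OF x]] by (intro vecsI) auto
    show "T (\<lambda>i\<in>{..<n}. a \<otimes>\<^bsub>L\<^esub> ?S x i) = (\<lambda>i\<in>{..<n}. a \<otimes>\<^bsub>L\<^esub> x i)"
      using T'(4)[OF a TS(2)[OF x]] TS(1)[OF x] by simp
  qed
  assume y: "y \<in> vecs L n"
  show "?S (\<lambda>i\<in>{..<n}. x i \<oplus>\<^bsub>L\<^esub> y i) = (\<lambda>i\<in>{..<n}. ?S x i \<oplus>\<^bsub>L\<^esub> ?S y i)"
  proof (rule e)
    show "(\<lambda>i\<in>{..<n}. ?S x i \<oplus>\<^bsub>L\<^esub> ?S y i) \<in> vecs L n"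
      using vecsD[OF TS(2)[OF x]] vecsD[OF TS(2)[OF y]] by (intro vecsI) auto
    show "T (\<lambda>i\<in>{..<n}. ?S x i \<oplus>\<^bsub>L\<^esub> ?S y i) = (\<lambda>i\<in>{..<n}. x i \<oplus>\<^bsub>L\<^esub> y i)"
      using T'(3)[OF TS(2)[OF x] TS(2)[OF y]] TS(1)[OF x] TS(1)[OF y] by simp
  qed
qed

lemma linear_iso_matrix:
  assumes B: "\<And>i. i < n \<Longrightarrow> vin K n (B i)" and C: "\<And>i. i < n \<Longrightarrow> vin K n (C i)"
    and BC: "\<And>i j. i < n \<Longrightarrow> j < n \<Longrightarrow> (\<Sum>k<n. B i k * C k j) = (if i = j then 1 else 0)"
    and CB: "\<And>i j. i < n \<Longrightarrow> j < n \<Longrightarrow> (\<Sum>k<n. C i k * B k j) = (if i = j then 1 else 0)"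
  shows "\<exists>T. linear_iso L n T \<and> (\<forall>x\<in>vecs L n. \<forall>k<n. g (T x k) = (\<Sum>i<n. g (x i) * B i k))"
proof -
  have ex: "\<exists>y\<in>vecs L n. \<forall>k<n. g (y k) = (\<Sum>i<n. g (x i) * M i k)"
    if M: "\<And>i. i < n \<Longrightarrow> vin K n (M i)" and x: "x \<in> vecs L n" for M x
  proof (rule vecs_vin)
    show "vin K n (\<lambda>k. \<Sum>i<n. g (x i) * M i k)" unfolding vin_def
      using vin_vecs[OF x] M unfolding vin_def by (auto intro!: subfld_sum[OF K(1)] subfldD(4)[OF K(1)])
  qed
  have "\<forall>x\<in>vecs L n. \<exists>y. y \<in> vecs L n \<and> (\<forall>k<n. g (y k) = (\<Sum>i<n. g (x i) * B i k))"
  proof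
    fix x assume "x \<in> vecs L n"
    from ex[of B, OF B this] show "\<exists>y. y \<in> vecs L n \<and> (\<forall>k<n. g (y k) = (\<Sum>i<n. g (x i) * B i k))" by blast
  qed
  from bchoice[OF this] obtain T where
    T: "\<And>x. x \<in> vecs L n \<Longrightarrow> T x \<in> vecs L n \<and> (\<forall>k<n. g (T x k) = (\<Sum>i<n. g (x i) * B i k))" by blast
  have "\<forall>x\<in>vecs L n. \<exists>y. y \<in> vecs L n \<and> (\<forall>k<n. g (y k) = (\<Sum>i<n. g (x i) * C i k))"
  proof
    fix x assume "x \<in> vecs L n"
    from ex[of C, OF C this] show "\<exists>y. y \<in> vecs L n \<and> (\<forall>k<n. g (y k) = (\<Sum>i<n. g (x i) * C i k))" by blast
  qed
  from bchoice[OF this] obtain S where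
    S: "\<And>x. x \<in> vecs L n \<Longrightarrow> S x \<in> vecs L n \<and> (\<forall>k<n. g (S x k) = (\<Sum>i<n. g (x i) * C i k))" by blast
  have comp: "(\<Sum>k<n. (\<Sum>i<n. z i * M i k) * N k j) = z j"
    if "\<And>i j. i < n \<Longrightarrow> j < n \<Longrightarrow> (\<Sum>k<n. M i k * N k j) = (if i = j then 1 else 0)" "j < n" for M N :: "nat \<Rightarrow> nat \<Rightarrow> 'w" and z :: "nat \<Rightarrow> 'w" and j
  proof -
    have "(\<Sum>k<n. (\<Sum>i<n. z i * M i k) * N k j) = (\<Sum>i<n. z i * (\<Sum>k<n. M i k * N k j))"
      unfolding sum_distrib_right sum_distrib_left by (subst sum.swap) (simp add: mult.assoc)
    also have "\<dots> = (\<Sum>i<n. z i * (if i = j then 1 else 0))" using that by (intro sum.cong) auto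
    also have "\<dots> = z j" using that(2) by (simp add: mult_delta_right cong: if_cong)
    finally show ?thesis .
  qed
  have ST: "S (T x) = x" if x: "x \<in> vecs L n" for x
  proof (rule vecs_g_eqI[OF _ x])
    show "S (T x) \<in> vecs L n" using S T x by blast
    fix k assume k: "k < n"
    have "g (S (T x) k) = (\<Sum>i<n. g (T x i) * C i k)" using S[of "T x"] T[OF x] k by blast
    also have "\<dots> = (\<Sum>i<n. (\<Sum>l<n. g (x l) * B l i) * C i k)" using T[OF x] by (intro sum.cong) auto
    also have "\<dots> = g (x k)" by (rule comp[OF BC k])
    finally show "g (S (T x) k) = g (x k)" .
  qed
  have TS: "T (S x) = x" if x: "x \<in> vecs L n" for x
  proof (rule vecs_g_eqI[OF _ x])
    show "T (S x) \<in> vecs L n" using S T x by blast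
    fix k assume k: "k < n"
    have "g (T (S x) k) = (\<Sum>i<n. g (S x i) * B i k)" using T[of "S x"] S[OF x] k by blast
    also have "\<dots> = (\<Sum>i<n. (\<Sum>l<n. g (x l) * C l i) * B i k)" using S[OF x] by (intro sum.cong) auto
    also have "\<dots> = g (x k)" by (rule comp[OF CB k])
    finally show "g (T (S x) k) = g (x k)" .
  qed
  have "linear_iso L n T" unfolding linear_iso_def
  proof (intro conjI ballI)
    show "bij_betw T (vecs L n) (vecs L n)"
      by (rule bij_betw_byWitness[of _ S]) (use ST TS S T in auto)
    fix x assume x: "x \<in> vecs L n"
    show "T (\<lambda>i\<in>{..<n}. a \<otimes>\<^bsub>L\<^esub> x i) = (\<lambda>i\<in>{..<n}. a \<otimes>\<^bsub>L\<^esub> T x i)" if a: "a \<in> carrier L" for a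
    proof -
      have ax: "(\<lambda>i\<in>{..<n}. a \<otimes>\<^bsub>L\<^esub> x i) \<in> vecs L n" "(\<lambda>i\<in>{..<n}. a \<otimes>\<^bsub>L\<^esub> T x i) \<in> vecs L n"
        using a vecsD[OF x] vecsD[of "T x" L n] T[OF x] by (auto intro!: vecsI)
      show ?thesis
      proof (rule vecs_g_eqI[OF _ ax(2)])
        show "T (\<lambda>i\<in>{..<n}. a \<otimes>\<^bsub>L\<^esub> x i) \<in> vecs L n" using T[OF ax(1)] by blast
        fix k assume k: "k < n"
        have "g (T (\<lambda>i\<in>{..<n}. a \<otimes>\<^bsub>L\<^esub> x i) k) = (\<Sum>i<n. g ((\<lambda>i\<in>{..<n}. a \<otimes>\<^bsub>L\<^esub> x i) i) * B i k)"
          using T[OF ax(1)] k by blast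
        also have "\<dots> = g a * (\<Sum>i<n. g (x i) * B i k)"
          using vecsD[OF x] a by (simp add: rembD(5)[OF g] sum_distrib_left mult.assoc)
        also have "\<dots> = g a * g (T x k)" using T[OF x] k by simp
        finally show "g (T (\<lambda>i\<in>{..<n}. a \<otimes>\<^bsub>L\<^esub> x i) k) = g ((\<lambda>i\<in>{..<n}. a \<otimes>\<^bsub>L\<^esub> T x i) k)"
          using k a vecsD[of "T x" L n k] T[OF x] by (simp add: rembD(5)[OF g])
      qed
    qed
    fix y assume y: "y \<in> vecs L n"
    have xy: "(\<lambda>i\<in>{..<n}. x i \<oplus>\<^bsub>L\<^esub> y i) \<in> vecs L n" "(\<lambda>i\<in>{..<n}. T x i \<oplus>\<^bsub>L\<^esub> T y i) \<in> vecs L n"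
      using vecsD[OF x] vecsD[OF y] vecsD[of "T x" L n] vecsD[of "T y" L n] T[OF x] T[OF y] by (auto intro!: vecsI)
    show "T (\<lambda>i\<in>{..<n}. x i \<oplus>\<^bsub>L\<^esub> y i) = (\<lambda>i\<in>{..<n}. T x i \<oplus>\<^bsub>L\<^esub> T y i)"
    proof (rule vecs_g_eqI[OF _ xy(2)])
      show "T (\<lambda>i\<in>{..<n}. x i \<oplus>\<^bsub>L\<^esub> y i) \<in> vecs L n" using T[OF xy(1)] by blast
      fix k assume k: "k < n"
      have "g (T (\<lambda>i\<in>{..<n}. x i \<oplus>\<^bsub>L\<^esub> y i) k) = (\<Sum>i<n. g ((\<lambda>i\<in>{..<n}. x i \<oplus>\<^bsub>L\<^esub> y i) i) * B i k)"
        using T[OF xy(1)] k by blast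
      also have "\<dots> = (\<Sum>i<n. g (x i) * B i k) + (\<Sum>i<n. g (y i) * B i k)"
        using vecsD[OF x] vecsD[OF y] by (simp add: rembD(4)[OF g] sum.distrib distrib_right)
      also have "\<dots> = g (T x k) + g (T y k)" using T[OF x] T[OF y] k by simp
      finally show "g (T (\<lambda>i\<in>{..<n}. x i \<oplus>\<^bsub>L\<^esub> y i) k) = g ((\<lambda>i\<in>{..<n}. T x i \<oplus>\<^bsub>L\<^esub> T y i) k)"
        using k vecsD[of "T x" L n k] vecsD[of "T y" L n k] T[OF x] T[OF y] by (simp add: rembD(4)[OF g])
    qed
  qed
  then show ?thesis using T by blast
qed

lemma qisometric_sym:
  assumes "qisometric L \<phi> \<psi>" shows "qisometric L \<psi> \<phi>"
proof -
  obtain T where n: "qdim \<phi> = qdim \<psi>" and T: "linear_iso L (qdim \<phi>) T" "\<forall>x\<in>vecs L (qdim \<phi>). qeval L \<psi> (T x) = qeval L \<phi> x"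
    using assms unfolding qisometric_def by blast
  have im: "T ` vecs L (qdim \<phi>) = vecs L (qdim \<phi>)" using linear_isoD(1)[OF T(1)] unfolding bij_betw_def by blast
  have "qeval L \<phi> (inv_into (vecs L (qdim \<phi>)) T y) = qeval L \<psi> y" if "y \<in> vecs L (qdim \<phi>)" for y
    using that im T(2) f_inv_into_f[of y T "vecs L (qdim \<phi>)"] inv_into_into[of y T "vecs L (qdim \<phi>)"] by metis
  then show ?thesis unfolding qisometric_def using linear_iso_inv[OF T(1)] n by metis
qed

text \<open>The rows of \<open>B\<close> and \<open>C\<close> are the images of the unit vectors
  under the isometry and its inverse. Polar products come from the values at sums of two unit
  vectors.\<close>

lemma qisometric_qembed:
  assumes iso: "qisometric L \<phi> \<psi>" and \<phi>: "quadratic_form L \<phi>" "quadratic_form L \<psi>"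
  shows "qembed K (qdim \<phi>) (map_coeff g \<phi>) (qdim \<psi>) (map_coeff g \<psi>)"
proof -
  define n where "n = qdim \<phi>"
  obtain T where n: "qdim \<psi> = n" and T: "linear_iso L n T" "\<forall>x\<in>vecs L n. qeval L \<psi> (T x) = qeval L \<phi> x"
    using iso unfolding qisometric_def n_def by auto
  define S where "S = inv_into (vecs L n) T"
  have S: "linear_iso L n S" unfolding S_def by (rule linear_iso_inv[OF T(1)])
  have ST: "S (T x) = x" if "x \<in> vecs L n" for x
    unfolding S_def using inv_into_f_f[OF _ that, of T] linear_isoD(1)[OF T(1)] unfolding bij_betw_def by blast
  note Tv = linear_isoD(2)[OF T(1)] and Sv = linear_isoD(2)[OF S]
  define B where "B = (\<lambda>i k. g (T (uvec L n i) k))"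
  define C where "C = (\<lambda>i k. g (S (uvec L n i) k))"
  have qT: "qv n (map_coeff g \<psi>) (\<lambda>k. g (T x k)) = qv n (map_coeff g \<phi>) (\<lambda>k. g (x k))" if x: "x \<in> vecs L n" for x
    using qeval_map_coeff(2)[OF \<phi>(2), of "T x"] qeval_map_coeff(2)[OF \<phi>(1), of x] Tv[OF x] x T(2) n n_def by simp
  have qB: "qv n (map_coeff g \<psi>) (B i) = qv n (map_coeff g \<phi>) (unitv i)" for i
  proof -
    have "qv n (map_coeff g \<phi>) (\<lambda>k. g (uvec L n i k)) = qv n (map_coeff g \<phi>) (unitv i)" by (rule qv_cong) (rule g_uvec)
    then show ?thesis unfolding B_def using qT[OF uvec_vecs[of n i]] by simp
  qed
  show ?thesis unfolding qembed_def n n_def[symmetric]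
  proof (rule exI[of _ B], rule exI[of _ C], intro conjI allI impI)
    show "vin K n (B i)" "vin K n (C i)" for i unfolding B_def C_def by (intro vin_vecs Tv Sv uvec_vecs)+
    show "(\<Sum>k<n. B i k * C k j) = (if i = j then 1 else 0)" if "i < n" "j < n" for i j
      using linear_iso_expand[OF S Tv[OF uvec_vecs[of n i]] that(2)] ST[OF uvec_vecs[of n i]] g_uvec[OF that(2), of i]
      unfolding B_def C_def by (auto simp: unitv_def)
    show "qv n (map_coeff g \<psi>) (B i) = map_coeff g \<phi> i i" if "i < n" for i using qB qv_unitv[OF that] by simp
    show "pol n (map_coeff g \<psi>) (B i) (B j) = map_coeff g \<phi> i j" if "j < n" "i < j" for i j
    proof -
      define x where "x = (\<lambda>k\<in>{..<n}. uvec L n i k \<oplus>\<^bsub>L\<^esub> uvec L n j k)"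
      have uc: "uvec L n i k \<in> carrier L" "T (uvec L n i) k \<in> carrier L" if "k < n" for i k
        using that vecsD uvec_vecs Tv by blast+
      have x: "x \<in> vecs L n" unfolding x_def using uc by (intro vecsI) auto
      have "T x = (\<lambda>k\<in>{..<n}. T (uvec L n i) k \<oplus>\<^bsub>L\<^esub> T (uvec L n j) k)"
        unfolding x_def by (rule linear_isoD(3)[OF T(1) uvec_vecs uvec_vecs])
      then have "qv n (map_coeff g \<psi>) (\<lambda>k. g (T x k)) = qv n (map_coeff g \<psi>) (\<lambda>k. B i k + B j k)"
        unfolding B_def using uc by (intro qv_cong) (simp add: rembD(4)[OF g])
      moreover have "qv n (map_coeff g \<phi>) (\<lambda>k. g (x k)) = qv n (map_coeff g \<phi>) (\<lambda>k. unitv i k + unitv j k)"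
        unfolding x_def using uc g_uvec by (intro qv_cong) (simp add: rembD(4)[OF g])
      ultimately have "qv n (map_coeff g \<psi>) (\<lambda>k. B i k + B j k) = qv n (map_coeff g \<phi>) (\<lambda>k. unitv i k + unitv j k)"
        using qT[OF x] by simp
      then have "pol n (map_coeff g \<psi>) (B i) (B j) = pol n (map_coeff g \<phi>) (unitv i) (unitv j)" unfolding pol_qv qB by simp
      then show ?thesis using pol_unitv[OF that(2,1)] by simp
    qed
  qed
qed

lemma map_coeff_qsum: "map_coeff g (qsum L \<phi> \<psi>) = orth_sum (qdim \<phi>) (map_coeff g \<phi>) (map_coeff g \<psi>)"
  unfolding map_coeff_def qsum_def orth_sum_def using ring_emb_zero[OF g] by (auto simp: fun_eq_iff)

lemma qv_hyperbolic: "qv 2 (map_coeff g (hyperbolic_plane L)) x = x 0 * x 1"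
proof -
  have "{..<2::nat} = {0, 1}" "{..0::nat} = {0}" "{..1::nat} = {0, 1}" by auto
  then show ?thesis unfolding qv_def map_coeff_def hyperbolic_plane_def qbinary_def
    using rembD(3)[OF g] ring_emb_zero[OF g] by simp
qed

lemma qv_qtimes_hyperbolic: "qv (2 * i) (map_coeff g (qtimes L i (hyperbolic_plane L))) x = (\<Sum>l<i. x (2 * l) * x (2 * l + 1))"
proof (induction i arbitrary: x)
  case (Suc i)
  have "qv (2 + 2 * i) (map_coeff g (qtimes L (Suc i) (hyperbolic_plane L))) x =
    x 0 * x 1 + (\<Sum>l<i. x (2 + 2 * l) * x (2 + (2 * l + 1)))"
    unfolding qtimes_Suc map_coeff_qsum qdim_hyperbolic qv_orth_sum qv_hyperbolic Suc ..
  then show ?case by (simp add: sum.lessThan_Suc_shift del: sum.lessThan_Suc)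
qed (simp add: qv_def)

lemma qv_qtimes_zero: "qv j (map_coeff g (qtimes L j (qunary \<zero>\<^bsub>L\<^esub>))) x = 0"
proof (induction j arbitrary: x)
  case (Suc j)
  have "qv (1 + j) (orth_sum 1 (map_coeff g (qunary \<zero>\<^bsub>L\<^esub>)) (map_coeff g (qtimes L j (qunary \<zero>\<^bsub>L\<^esub>)))) x = 0"
    unfolding qv_orth_sum Suc using ring_emb_zero[OF g] by (simp add: qv_def map_coeff_def qunary_def)
  then show ?case unfolding qtimes_Suc map_coeff_qsum by (simp add: qunary_def)
qed (simp add: qv_def)

text \<open>The right side of the isometry in \<open>witt_decomposition\<close>.\<close>

definition witt_form :: "nat \<Rightarrow> 'b qform \<Rightarrow> nat \<Rightarrow> 'b qform" where
  "witt_form i \<psi> j = qsum L (qtimes L i (hyperbolic_plane L)) (qsum L \<psi> (qtimes L j (qunary \<zero>\<^bsub>L\<^esub>)))"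

lemma qdim_witt_form: "qdim (witt_form i \<psi> j) = 2 * i + (qdim \<psi> + j)"
  unfolding witt_form_def by (simp add: qunary_def)

lemma qv_witt_form: "qv (2 * i + (qdim \<psi> + j)) (map_coeff g (witt_form i \<psi> j)) x =
    (\<Sum>l<i. x (2 * l) * x (2 * l + 1)) + qv (qdim \<psi>) (map_coeff g \<psi>) (\<lambda>k. x (2 * i + k))"
proof -
  have "i * 2 = 2 * i" by simp
  then show ?thesis
    unfolding witt_form_def map_coeff_qsum qdim_qtimes qdim_hyperbolic
    by (simp only: qv_orth_sum qv_qtimes_hyperbolic qv_qtimes_zero add_0_right)
qed

lemma quadratic_form_qsum:
  "quadratic_form L \<phi> \<Longrightarrow> quadratic_form L \<psi> \<Longrightarrow> quadratic_form L (qsum L \<phi> \<psi>)"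
  unfolding quadratic_form_def qsum_def by (auto simp: less_diff_conv2)

lemma quadratic_form_qtimes: "quadratic_form L \<phi> \<Longrightarrow> quadratic_form L (qtimes L k \<phi>)"
  by (induction k) (simp_all add: qtimes_Suc qtimes_0 quadratic_form_qsum, simp add: quadratic_form_def qzero_def)

lemma quadratic_form_witt_form: "quadratic_form L \<psi> \<Longrightarrow> quadratic_form L (witt_form i \<psi> j)"
  unfolding witt_form_def
  by (intro quadratic_form_qsum quadratic_form_qtimes)
    (auto simp: quadratic_form_def hyperbolic_plane_def qbinary_def qunary_def)

lemma qanisotropic_aniso:
  assumes "quadratic_form L \<psi>"
  shows "qanisotropic L \<psi> \<longleftrightarrow> aniso K (qdim \<psi>) (map_coeff g \<psi>)"
proof
  assume a: "qanisotropic L \<psi>"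
  show "aniso K (qdim \<psi>) (map_coeff g \<psi>)" unfolding aniso_def
  proof safe
    fix u k assume u: "vin K (qdim \<psi>) u" "qv (qdim \<psi>) (map_coeff g \<psi>) u = 0" "k < qdim \<psi>"
    obtain x where x: "x \<in> vecs L (qdim \<psi>)" "\<forall>k<qdim \<psi>. g (x k) = u k" using vecs_vin[OF u(1)] by blast
    have "g (qeval L \<psi> x) = qv (qdim \<psi>) (map_coeff g \<psi>) u"
      unfolding qeval_map_coeff(2)[OF assms x(1)] by (rule qv_cong) (use x(2) in blast)
    then have "qeval L \<psi> x = \<zero>\<^bsub>L\<^esub>" using u(2) ring_emb_eq_0[OF g qeval_map_coeff(1)[OF assms x(1)]] by simp
    then have "x = zero_vec L (qdim \<psi>)" using a x(1) unfolding qanisotropic_def by blast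
    then show "u k = 0" using x(2) u(3) ring_emb_zero[OF g] unfolding zero_vec_def by force
  qed
next
  assume a: "aniso K (qdim \<psi>) (map_coeff g \<psi>)"
  show "qanisotropic L \<psi>" unfolding qanisotropic_def
  proof (intro ballI impI notI)
    fix x assume x: "x \<in> vecs L (qdim \<psi>)" "x \<noteq> zero_vec L (qdim \<psi>)" "qeval L \<psi> x = \<zero>\<^bsub>L\<^esub>"
    have "qv (qdim \<psi>) (map_coeff g \<psi>) (\<lambda>i. g (x i)) = 0"
      using qeval_map_coeff(2)[OF assms x(1)] x(3) ring_emb_zero[OF g] by simp
    then have "g (x k) = 0" if "k < qdim \<psi>" for k using anisD[OF a vin_vecs[OF x(1)]] that by blast
    then have "x k = \<zero>\<^bsub>L\<^esub>" if "k < qdim \<psi>" for k using ring_emb_eq_0[OF g vecsD[OF x(1)]] that by blast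
    then have "x = zero_vec L (qdim \<psi>)"
      using x(1) by (intro vecs_eqI[of _ L "qdim \<psi>"]) (auto simp: zero_vec_def vecs_def)
    then show False using x(2) by blast
  qed
qed

lemma cin_map_coeff: "quadratic_form L \<phi> \<Longrightarrow> cin K (qdim \<phi>) (map_coeff g \<phi>)"
  unfolding cin_def quadratic_form_def map_coeff_def K by auto

section \<open>The total isotropy index as a maximal dimension\<close>

lemma witt_decomposition_exists:
  assumes c2: "(2::'w) = 0" and \<phi>: "quadratic_form L \<phi>"
  shows "\<exists>i \<psi> j. witt_decomposition L \<phi> i \<psi> j"
proof -
  define n where "n = qdim \<phi>"
  define c where "c = map_coeff g \<phi>"
  obtain i e j b d where w: "2 * i + (e + j) = n" "\<forall>k<n. vin K n (b k)" "lin_indep K n {..<n} b"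
    "\<forall>u. vin K n u \<longrightarrow> (\<exists>x. vin K n x \<and> (\<forall>k<n. u k = (\<Sum>l<n. x l * b l k)))"
    "cin K e d" "aniso K e d"
    "\<forall>x. qv n c (\<lambda>k. \<Sum>l<n. x l * b l k) = (\<Sum>l<i. x (2 * l) * x (2 * l + 1)) + qv e d (\<lambda>k. x (2 * i + k))"
    using witt_basis_exists[OF c2 K(1) cin_map_coeff[OF \<phi>]] unfolding n_def[symmetric] c_def[symmetric]
    by (elim exE conjE) (rule that; assumption)
  obtain C where C: "\<forall>k<n. vin K n (C k)" "\<forall>i<n. \<forall>j<n. (\<Sum>k<n. b i k * C k j) = (if i = j then 1 else 0)"
    "\<forall>i<n. \<forall>j<n. (\<Sum>k<n. C i k * b k j) = (if i = j then 1 else 0)"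
    using basis_matrix(2)[OF K(1) _ w(3)] w(2,4) by blast
  define ginv where "ginv = inv_into (carrier L) g"
  have gi: "ginv y \<in> carrier L" "g (ginv y) = y" if "y \<in> K" for y
    using that inv_into_into[of y g "carrier L"] f_inv_into_f[of y g "carrier L"] unfolding ginv_def K by auto
  define \<psi> where "\<psi> = QForm e (\<lambda>a b. ginv (d a b))"
  have q\<psi>: "qdim \<psi> = e" unfolding \<psi>_def by simp
  have f\<psi>: "quadratic_form L \<psi>" unfolding quadratic_form_def \<psi>_def using w(5) gi(1) unfolding cin_def by simp
  have c\<psi>: "qv e (map_coeff g \<psi>) x = qv e d x" for x
    by (rule qv_ccong) (use w(5) gi(2) in \<open>simp add: map_coeff_def \<psi>_def cin_def\<close>)
  have an: "qanisotropic L \<psi>" unfolding qanisotropic_aniso[OF f\<psi>] q\<psi> using w(6) unfolding aniso_def c\<psi> .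
  \<comment> \<open>\<open>T\<close> takes a vector to its coordinates in the basis
    \<open>b\<close>, so its matrix is the inverse \<open>C\<close>.\<close>
  obtain T where T: "linear_iso L n T" "\<forall>x\<in>vecs L n. \<forall>k<n. g (T x k) = (\<Sum>i<n. g (x i) * C i k)"
    using linear_iso_matrix[of n C b] C w(2) by blast
  have wd: "qdim (witt_form i \<psi> j) = n" unfolding qdim_witt_form q\<psi> using w(1) .
  have "qeval L (witt_form i \<psi> j) (T x) = qeval L \<phi> x" if x: "x \<in> vecs L n" for x
  proof -
    have Tx: "T x \<in> vecs L n" by (rule linear_isoD(2)[OF T(1) x])
    have e: "(\<Sum>l<n. g (T x l) * b l k) = g (x k)" if k: "k < n" for k
    proof -
      have "(\<Sum>l<n. g (T x l) * b l k) = (\<Sum>l<n. (\<Sum>m<n. g (x m) * C m l) * b l k)"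
        using T(2) x by (intro sum.cong) auto
      also have "\<dots> = (\<Sum>m<n. g (x m) * (\<Sum>l<n. C m l * b l k))"
        unfolding sum_distrib_right sum_distrib_left by (subst sum.swap) (simp add: mult.assoc)
      also have "\<dots> = (\<Sum>m<n. g (x m) * (if m = k then 1 else 0))" using C(3) k by (intro sum.cong) auto
      also have "\<dots> = g (x k)" using k by (simp add: mult_delta_right cong: if_cong)
      finally show ?thesis .
    qed
    have Tw: "T x \<in> vecs L (qdim (witt_form i \<psi> j))" using Tx wd by simp
    have x': "x \<in> vecs L (qdim \<phi>)" using x n_def by simp
    have fw: "quadratic_form L (witt_form i \<psi> j)" by (rule quadratic_form_witt_form[OF f\<psi>])
    have "g (qeval L (witt_form i \<psi> j) (T x)) = (\<Sum>l<i. g (T x (2 * l)) * g (T x (2 * l + 1))) + qv e d (\<lambda>k. g (T x (2 * i + k)))"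
      unfolding qeval_map_coeff(2)[OF fw Tw] using qv_witt_form[of i \<psi> j] c\<psi> unfolding qdim_witt_form q\<psi> by simp
    also have "\<dots> = qv n c (\<lambda>k. \<Sum>l<n. g (T x l) * b l k)" using w(7) by simp
    also have "\<dots> = qv n c (\<lambda>k. g (x k))" by (rule qv_cong[OF e])
    also have "\<dots> = g (qeval L \<phi> x)" unfolding qeval_map_coeff(2)[OF \<phi> x'] n_def c_def ..
    finally show ?thesis using ring_emb_inj[OF g qeval_map_coeff(1)[OF fw Tw] qeval_map_coeff(1)[OF \<phi> x']] by blast
  qed
  then have "qisometric L \<phi> (witt_form i \<psi> j)" unfolding qisometric_def using T(1) wd n_def by auto
  then show ?thesis unfolding witt_decomposition_def witt_form_def[symmetric] using f\<psi> an by blast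
qed

lemma tot_isotropic_cancel_hyperbolics:
  assumes "\<And>x. qv (2 * i + N) c x = (\<Sum>l<i. x (2 * l) * x (2 * l + 1)) + qv N c0 (\<lambda>k. x (2 * i + k))"
    "tot_isotropic K (2 * i + N) c d"
  shows "tot_isotropic K N c0 (d - i)"
  using assms
proof (induction i arbitrary: c d)
  case 0
  then have "qv N c x = qv N c0 x" for x by simp
  then show ?case using 0(2) unfolding tot_isotropic_def isotropic_family_def by (simp add: pol_qv)
next
  case (Suc i)
  \<comment> \<open>A coefficient matrix for the remaining \<open>i\<close> planes, because
    cancelling one plane requires the rest to be given as a form.\<close>
  define hc :: "nat \<Rightarrow> nat \<Rightarrow> 'w" where "hc = (\<lambda>a b. if even a \<and> b = a + 1 then 1 else 0)"
  have hc: "qv (2 * i) hc x = (\<Sum>l<i. x (2 * l) * x (2 * l + 1))" for x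
  proof -
    have "(\<Sum>a\<le>2 * l. hc a (2 * l) * x a * x (2 * l)) = 0" for l
      by (intro sum.neutral) (auto simp: hc_def, presburger)
    moreover have "(\<Sum>a\<le>2 * l + 1. hc a (2 * l + 1) * x a * x (2 * l + 1)) = x (2 * l) * x (2 * l + 1)" for l
    proof -
      have "(\<Sum>a\<le>2 * l + 1. hc a (2 * l + 1) * x a * x (2 * l + 1)) = (\<Sum>a\<le>2 * l + 1. if a = 2 * l then x a * x (2 * l + 1) else 0)"
        by (intro sum.cong) (auto simp: hc_def)
      then show ?thesis by simp
    qed
    ultimately show ?thesis unfolding qv_def sum_pairs by simp
  qed
  have "tot_isotropic K (2 * i + N) (orth_sum (2 * i) hc c0) (d - 1)"
  proof (rule tot_isotropic_cancel_hyperbolic[OF K(1)])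
    show "tot_isotropic K (2 + (2 * i + N)) c d" using Suc.prems(2) by simp
    have "2 + (2 * i + N) = 2 * Suc i + N" by simp
    then show "qv (2 + (2 * i + N)) c x = x 0 * x 1 + qv (2 * i + N) (orth_sum (2 * i) hc c0) (\<lambda>k. x (2 + k))" for x
      unfolding qv_orth_sum hc using Suc.prems(1)[of x] by (simp add: sum.lessThan_Suc_shift add.assoc del: sum.lessThan_Suc)
  qed
  from Suc.IH[OF _ this] show ?case unfolding qv_orth_sum hc by simp
qed

text \<open>One vector from each plane together with the zero part gives dimension
  \<open>i + j\<close>. Conversely, cancelling a plane costs at most one dimension, and what is left
  embeds in the zero part.\<close>

theorem witt_decomposition_tot_isotropic:
  assumes c2: "(2::'w) = 0" and \<phi>: "quadratic_form L \<phi>" and w: "witt_decomposition L \<phi> i \<psi> j"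
  shows "tot_isotropic K (qdim \<phi>) (map_coeff g \<phi>) (i + j)" "tot_isotropic K (qdim \<phi>) (map_coeff g \<phi>) m \<Longrightarrow> m \<le> i + j"
proof -
  have f\<psi>: "quadratic_form L \<psi>" and an: "qanisotropic L \<psi>" and iso: "qisometric L \<phi> (witt_form i \<psi> j)"
    using w unfolding witt_decomposition_def witt_form_def by auto
  define e where "e = qdim \<psi>"
  define c where "c = map_coeff g (witt_form i \<psi> j)"
  define N where "N = 2 * i + (e + j)"
  have fw: "quadratic_form L (witt_form i \<psi> j)" by (rule quadratic_form_witt_form[OF f\<psi>])
  have wd: "qdim (witt_form i \<psi> j) = N" unfolding qdim_witt_form N_def e_def ..
  have qc: "qv N c x = (\<Sum>l<i. x (2 * l) * x (2 * l + 1)) + qv e (map_coeff g \<psi>) (\<lambda>k. x (2 * i + k))" for x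
    unfolding N_def c_def e_def by (rule qv_witt_form)
  have emb: "qembed K N c (qdim \<phi>) (map_coeff g \<phi>)" "qembed K (qdim \<phi>) (map_coeff g \<phi>) N c"
    using qisometric_qembed[OF qisometric_sym[OF iso] fw \<phi>] qisometric_qembed[OF iso \<phi> fw]
    unfolding wd c_def by auto
  \<comment> \<open>The even indices below \<open>2 * i\<close> select one vector of each pair; the
    last \<open>j\<close> indices are the zero part.\<close>
  define S where "S = (\<lambda>l. 2 * l) ` {..<i} \<union> (\<lambda>l. 2 * i + (e + l)) ` {..<j}"
  have cS: "card S = i + j"
  proof -
    have "(\<lambda>l. 2 * l) ` {..<i} \<inter> (\<lambda>l. 2 * i + (e + l)) ` {..<j} = {}" by auto
    then show ?thesis unfolding S_def by (simp add: card_Un_disjoint card_image inj_on_def)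
  qed
  have "echelon K N S unitv" unfolding echelon_def S_def N_def using vin_unitv[OF K(1)] by (auto simp: unitv_def)
  moreover have "isotropic_family N c S unitv"
  proof -
    have 0: "qv N c x = 0" if h: "\<And>k. k \<notin> S \<Longrightarrow> x k = 0" for x
    proof -
      have "x (2 * l + 1) = 0" if l: "l < i" for l
      proof (rule h)
        have "2 * l + 1 \<noteq> 2 * i + (e + m)" for m using l by linarith
        moreover have "2 * l + 1 \<noteq> 2 * m" for m by presburger
        ultimately show "2 * l + 1 \<notin> S" unfolding S_def by blast
      qed
      moreover have "qv e (map_coeff g \<psi>) (\<lambda>k. x (2 * i + k)) = qv e (map_coeff g \<psi>) (\<lambda>_. 0)"
      proof (rule qv_cong, rule h)
        fix k assume "k < e"
        then show "2 * i + k \<notin> S" unfolding S_def by auto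
      qed
      ultimately show ?thesis unfolding qc by simp
    qed
    have "qv N c (unitv s) = 0" if "s \<in> S" for s by (rule 0) (use that in \<open>auto simp: unitv_def\<close>)
    moreover have "qv N c (\<lambda>k. unitv s k + unitv t k) = 0" if "s \<in> S" "t \<in> S" for s t
      by (rule 0) (use that in \<open>auto simp: unitv_def\<close>)
    ultimately show ?thesis unfolding isotropic_family_def pol_qv by simp
  qed
  ultimately have "tot_isotropic K N c (i + j)" unfolding tot_isotropic_def using cS by blast
  then show "tot_isotropic K (qdim \<phi>) (map_coeff g \<phi>) (i + j)" using qembed_tot_isotropic[OF emb(1) subset_refl K(1)] by blast
  assume "tot_isotropic K (qdim \<phi>) (map_coeff g \<phi>) m"
  then have "tot_isotropic K N c m" using qembed_tot_isotropic[OF emb(2) subset_refl K(1)] by blast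
  then have TI1: "tot_isotropic K (e + j) (orth_sum e (map_coeff g \<psi>) (\<lambda>_ _. 0)) (m - i)"
    unfolding N_def
  proof (rule tot_isotropic_cancel_hyperbolics[rotated])
    show "qv (2 * i + (e + j)) c x = (\<Sum>l<i. x (2 * l) * x (2 * l + 1)) + qv (e + j) (orth_sum e (map_coeff g \<psi>) (\<lambda>_ _. 0)) (\<lambda>k. x (2 * i + k))" for x
      using qc[of x] unfolding N_def qv_orth_sum by (simp add: qv_def[of j])
  qed
  have "aniso K e (map_coeff g \<psi>)" using an qanisotropic_aniso[OF f\<psi>] unfolding e_def by blast
  from tot_isotropic_aniso_zero_le[OF K(1) this _ TI1] have "m - i \<le> j" unfolding qv_orth_sum by (simp add: qv_def[of j])
  then show "m \<le> i + j" by simp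
qed

text \<open>Every decomposition has \<open>i + j\<close> equal to the maximal dimension, so all
  decompositions agree and the definite description denotes this number.\<close>

theorem total_isotropy_index_tot_isotropic:
  assumes c2: "(2::'w) = 0" and \<phi>: "quadratic_form L \<phi>"
  shows "tot_isotropic K (qdim \<phi>) (map_coeff g \<phi>) (total_isotropy_index L \<phi>)"
    "tot_isotropic K (qdim \<phi>) (map_coeff g \<phi>) m \<Longrightarrow> m \<le> total_isotropy_index L \<phi>"
proof -
  note tot_isotropic = witt_decomposition_tot_isotropic[OF c2 \<phi>]
  obtain i \<psi> j where w: "witt_decomposition L \<phi> i \<psi> j" using witt_decomposition_exists[OF c2 \<phi>] by blast
  have "total_isotropy_index L \<phi> = i + j"
    unfolding total_isotropy_index_def
  proof (rule the_equality)
    show "\<exists>i' \<psi> j'. witt_decomposition L \<phi> i' \<psi> j' \<and> i + j = i' + j'" using w by blast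
    fix k assume "\<exists>i' \<psi> j'. witt_decomposition L \<phi> i' \<psi> j' \<and> k = i' + j'"
    then obtain i' \<psi>' j' where w': "witt_decomposition L \<phi> i' \<psi>' j'" "k = i' + j'" by blast
    show "k = i + j" using tot_isotropic(2)[OF w tot_isotropic(1)[OF w'(1)]] tot_isotropic(2)[OF w'(1) tot_isotropic(1)[OF w]] w'(2) by simp
  qed
  then show "tot_isotropic K (qdim \<phi>) (map_coeff g \<phi>) (total_isotropy_index L \<phi>)"
    "tot_isotropic K (qdim \<phi>) (map_coeff g \<phi>) m \<Longrightarrow> m \<le> total_isotropy_index L \<phi>" using tot_isotropic[OF w] by auto
qed

text \<open>Anisotropy forces \<open>i = j = 0\<close>, so the chosen part is isometric to the form.
  It need not be equal to it, hence the embeddings in both directions.\<close>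

theorem anisotropic_part_qembed:
  assumes c2: "(2::'w) = 0" and \<phi>: "quadratic_form L \<phi>" "qanisotropic L \<phi>"
  defines "\<psi> \<equiv> anisotropic_part L \<phi>"
  shows "quadratic_form L \<psi>" "qanisotropic L \<psi>" "qdim \<psi> = qdim \<phi>"
    "qembed K (qdim \<phi>) (map_coeff g \<phi>) (qdim \<phi>) (map_coeff g \<psi>)" "qembed K (qdim \<phi>) (map_coeff g \<psi>) (qdim \<phi>) (map_coeff g \<phi>)"
proof -
  have "\<exists>\<psi> i j. witt_decomposition L \<phi> i \<psi> j" using witt_decomposition_exists[OF c2 \<phi>(1)] by blast
  then obtain i j where w: "witt_decomposition L \<phi> i \<psi> j"
    unfolding \<psi>_def anisotropic_part_def using someI_ex[of "\<lambda>\<psi>. \<exists>i j. witt_decomposition L \<phi> i \<psi> j"] by blast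
  have "aniso K (qdim \<phi>) (map_coeff g \<phi>)" using qanisotropic_aniso[OF \<phi>(1)] \<phi>(2) by blast
  then have "i + j = 0" using aniso_tot_isotropic witt_decomposition_tot_isotropic(1)[OF c2 \<phi>(1) w] by blast
  then have ij: "i = 0" "j = 0" by auto
  show f: "quadratic_form L \<psi>" "qanisotropic L \<psi>" using w unfolding witt_decomposition_def by auto
  have iso: "qisometric L \<phi> (witt_form 0 \<psi> 0)" using w unfolding witt_decomposition_def ij witt_form_def by auto
  have qd: "qdim (witt_form 0 \<psi> 0) = qdim \<psi>" unfolding qdim_witt_form by simp
  show d: "qdim \<psi> = qdim \<phi>" using iso qd unfolding qisometric_def by simp
  have fw: "quadratic_form L (witt_form 0 \<psi> 0)" by (rule quadratic_form_witt_form[OF f(1)])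
  have cw: "map_coeff g (witt_form 0 \<psi> 0) i j = map_coeff g \<psi> i j" if "i \<le> j" "j < qdim \<phi>" for i j
    unfolding witt_form_def map_coeff_qsum using that d by (simp add: orth_sum_def)
  show "qembed K (qdim \<phi>) (map_coeff g \<phi>) (qdim \<phi>) (map_coeff g \<psi>)"
    using qisometric_qembed[OF iso \<phi>(1) fw] unfolding qd d by (rule qembed_cong) (use cw in auto)
  show "qembed K (qdim \<phi>) (map_coeff g \<psi>) (qdim \<phi>) (map_coeff g \<phi>)"
    using qisometric_qembed[OF qisometric_sym[OF iso] fw \<phi>(1)] unfolding qd d by (rule qembed_cong) (use cw in auto)
qed

end


section \<open>Tensor products with diagonal forms\<close>

lemma sum_blocks: "(\<Sum>q<k * n. f q) = (\<Sum>m<k. \<Sum>r<n. f (m * n + r))" for f :: "nat \<Rightarrow> 'b::comm_monoid_add"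
proof (induction k)
  case (Suc k)
  have "(\<Sum>q<Suc k * n. f q) = (\<Sum>q<k * n + n. f q)" by (simp add: add.commute)
  then show ?case unfolding sum_split_lt Suc by simp
qed simp

text \<open>An index is \<open>l * n + r\<close> with block \<open>l\<close> and position
  \<open>r\<close>; the form is \<open>c\<close> scaled by \<open>d l\<close> on block
  \<open>l\<close>.\<close>

definition diag_tensor :: "nat \<Rightarrow> (nat \<Rightarrow> nat \<Rightarrow> 'w::semiring_0) \<Rightarrow> (nat \<Rightarrow> 'w) \<Rightarrow> nat \<Rightarrow> nat \<Rightarrow> 'w" where
  "diag_tensor n c d = (\<lambda>p q. if p div n = q div n then d (p div n) * c (p mod n) (q mod n) else 0)"

lemma qv_diag_tensor: "qv (k * n) (diag_tensor n c d) x = (\<Sum>l<k. d l * qv n c (\<lambda>r. x (l * n + r)))"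
proof -
  have "(\<Sum>p\<le>l * n + r. diag_tensor n c d p (l * n + r) * x p * x (l * n + r)) =
      (\<Sum>i\<le>r. d l * (c i r * x (l * n + i) * x (l * n + r)))" if r: "r < n" for l r
  proof -
    have "diag_tensor n c d p (l * n + r) = 0" if "p < l * n" for p
      using that r less_mult_imp_div_less[OF that] by (simp add: diag_tensor_def)
    then have "(\<Sum>p\<le>l * n + r. diag_tensor n c d p (l * n + r) * x p * x (l * n + r)) =
      (\<Sum>i\<le>r. diag_tensor n c d (l * n + i) (l * n + r) * x (l * n + i) * x (l * n + r))"
      unfolding sum_split_le by simp
    also have "\<dots> = (\<Sum>i\<le>r. d l * (c i r * x (l * n + i) * x (l * n + r)))"
      using r by (intro sum.cong) (auto simp: diag_tensor_def mult.assoc)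
    finally show ?thesis .
  qed
  then show ?thesis unfolding qv_def sum_blocks by (simp add: sum_distrib_left)
qed

lemma tot_isotropic_qcong: "(\<And>x. qv n c x = qv n d x) \<Longrightarrow> tot_isotropic K n c m \<longleftrightarrow> tot_isotropic K n d m"
  unfolding tot_isotropic_def isotropic_family_def pol_qv by simp

lemma aniso_qcong: "(\<And>x. qv n c x = qv n d x) \<Longrightarrow> aniso K n c \<longleftrightarrow> aniso K n d"
  unfolding aniso_def by simp

lemma quadratic_isotropy_qcong: "(\<And>x. qv n c x = qv n d x) \<Longrightarrow> quadratic_isotropy F A n c m \<longleftrightarrow> quadratic_isotropy F A n d m"
  unfolding quadratic_isotropy_def using tot_isotropic_qcong[of n c d] aniso_qcong[of n c d] by simp

lemma quadratic_isotropy_scale: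
  assumes P: "quadratic_isotropy F A n c m" and s: "s \<noteq> 0"
  shows "quadratic_isotropy F A n (\<lambda>i j. s * c i j) m"
  unfolding quadratic_isotropy_def
proof (intro allI impI)
  fix E x y z
  assume h: "subfld E \<and> F \<subseteq> E \<and> E \<subseteq> A \<and> aniso E n (\<lambda>i j. s * c i j) \<and> z \<notin> E \<and> vin E n x \<and> vin E n y \<and>
     (\<exists>k<n. y k \<noteq> 0) \<and> qv n (\<lambda>i j. s * c i j) (\<lambda>k. x k + z * y k) = 0"
  then have "aniso E n c" "qv n c (\<lambda>k. x k + z * y k) = 0" using s unfolding aniso_def qv_scalec by simp_all
  then have "tot_isotropic (qadj E z) n c m" using P h unfolding quadratic_isotropy_def by blast
  then show "tot_isotropic (qadj E z) n (\<lambda>i j. s * c i j) m" by (rule tot_isotropic_scale)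
qed

text \<open>The embedding of \<open>c\<close> in \<open>c'\<close> pulls anisotropy back and pushes
  the isotropic space forward; the other embedding carries the given zero to
  \<open>c\<close>.\<close>

lemma quadratic_isotropy_qembed:
  assumes P: "quadratic_isotropy F A n c m" and c: "cin F n c" and e: "qembed F n c n c'" "qembed F n c' n c"
  shows "quadratic_isotropy F A n c' m"
  unfolding quadratic_isotropy_def
proof (intro allI impI, elim conjE)
  fix E x y z
  assume E: "subfld E" "F \<subseteq> E" "E \<subseteq> A" "aniso E n c'" "z \<notin> E" and xy: "vin E n x" "vin E n y" "\<exists>k<n. y k \<noteq> 0"
    and q: "qv n c' (\<lambda>k. x k + z * y k) = 0"
  have an: "aniso E n c" by (rule qembed_aniso[OF e(1) E(2,1,4)])
  have cE: "cin E n c" using c E(2) unfolding cin_def by blast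
  show "tot_isotropic (qadj E z) n c' m"
  proof (rule qembedE[OF e(2) E(2,1)])
    fix T assume T: "\<And>u. vin E n u \<Longrightarrow> vin E n (T u)" "\<And>u. qv n c (T u) = qv n c' u"
      "\<And>u u'. pol n c (T u) (T u') = pol n c' u u'"
      "\<And>a u (I :: nat set). T (\<lambda>k. \<Sum>i\<in>I. a i * u i k) = (\<lambda>k. \<Sum>i\<in>I. a i * T (u i) k)"
      "\<And>u i. \<forall>k<n. T u k = 0 \<Longrightarrow> i < n \<Longrightarrow> u i = 0"
    have "T (\<lambda>k. x k + z * y k) = (\<lambda>k. T x k + z * T y k)"
      using T(4)[of "\<lambda>i. if i = 0 then 1 else z" "\<lambda>i. if i = 0 then x else y" "{0, 1}"] by simp
    then have q': "qv n c (\<lambda>k. T x k + z * T y k) = 0" using T(2)[of "\<lambda>k. x k + z * y k"] q by simp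
    have y': "\<exists>k<n. T y k \<noteq> 0" using T(5)[of y] xy(3) by blast
    have "tot_isotropic (qadj E z) n c m"
      using P E(1-3,5) an T(1)[OF xy(1)] T(1)[OF xy(2)] y' q' unfolding quadratic_isotropy_def by blast
    moreover have "subfld (qadj E z)"
      by (rule quadratic_extension(5)[OF E(1) cE an E(5) T(1)[OF xy(1)] T(1)[OF xy(2)] y' q'])
    moreover have "F \<subseteq> qadj E z" using E(2) qadj_base[OF E(1)] by blast
    ultimately show ?thesis using qembed_tot_isotropic[OF e(1)] by blast
  qed
qed

text \<open>\<open>S\<close> is the matrix of an isometry of the diagonal bilinear forms; it acts on the blocks.\<close>

lemma diag_tensor_qembed:
  fixes d d' :: "nat \<Rightarrow> 'w::field"
  assumes F: "subfld F" and S: "\<And>l. l < k \<Longrightarrow> vin F k (S l)" "\<And>l. l < k \<Longrightarrow> vin F k (S' l)"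
    and SS': "\<And>i j. i < k \<Longrightarrow> j < k \<Longrightarrow> (\<Sum>m<k. S i m * S' m j) = (if i = j then 1 else 0)"
    and gram: "\<And>i j. i < k \<Longrightarrow> j < k \<Longrightarrow> (\<Sum>m<k. d' m * S i m * S j m) = (if i = j then d i else 0)"
  shows "qembed F (k * n) (diag_tensor n c d) (k * n) (diag_tensor n c d')"
proof -
  define B where "B = (\<lambda>S p q. if q mod n = p mod n then (S :: nat \<Rightarrow> nat \<Rightarrow> 'w) (p div n) (q div n) else 0)"
  define T where "T = (\<lambda>x q. \<Sum>l<k. x (l * n + q mod n) * S l (q div n))"
  have BF: "vin F (k * n) (B S p)" if p: "p < k * n" and S: "\<And>l. l < k \<Longrightarrow> vin F k (S l)" for p S
    using that less_mult_imp_div_less unfolding B_def vin_def by (auto simp: subfldD(1)[OF F])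
  have qT: "qv (k * n) (diag_tensor n c d') (T x) = qv (k * n) (diag_tensor n c d) x" for x
  proof -
    let ?x = "\<lambda>l r. x (l * n + r)"
    have "qv n c (\<lambda>r. T x (m * n + r)) = (\<Sum>j<k. (S j m)\<^sup>2 * qv n c (?x j) + (\<Sum>i<j. S i m * S j m * pol n c (?x i) (?x j)))" for m
    proof -
      have "qv n c (\<lambda>r. T x (m * n + r)) = qv n c (\<lambda>r. \<Sum>l<k. S l m * ?x l r)"
        unfolding T_def by (rule qv_cong) (simp add: mult.commute)
      then show ?thesis unfolding qv_sum .
    qed
    then have "qv (k * n) (diag_tensor n c d') (T x) =
      (\<Sum>m<k. \<Sum>j<k. d' m * ((S j m)\<^sup>2 * qv n c (?x j) + (\<Sum>i<j. S i m * S j m * pol n c (?x i) (?x j))))"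
      unfolding qv_diag_tensor by (simp add: sum_distrib_left)
    \<comment> \<open>Summing over \<open>m\<close> first produces the Gram entries of the rows of
      \<open>S\<close>: the mixed ones vanish and the diagonal ones are \<open>d j\<close>.\<close>
    also have "\<dots> = (\<Sum>j<k. \<Sum>m<k. d' m * ((S j m)\<^sup>2 * qv n c (?x j) + (\<Sum>i<j. S i m * S j m * pol n c (?x i) (?x j))))"
      by (rule sum.swap)
    also have "\<dots> = (\<Sum>j<k. d j * qv n c (?x j))"
    proof (rule sum.cong[OF refl])
      fix j assume "j \<in> {..<k}"
      then have j: "j < k" by simp
      have "(\<Sum>m<k. d' m * ((S j m)\<^sup>2 * qv n c (?x j) + (\<Sum>i<j. S i m * S j m * pol n c (?x i) (?x j)))) =
        (\<Sum>m<k. d' m * S j m * S j m) * qv n c (?x j) + (\<Sum>m<k. \<Sum>i<j. d' m * S i m * S j m * pol n c (?x i) (?x j))"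
        by (simp add: distrib_left sum.distrib sum_distrib_left sum_distrib_right power2_eq_square mult.assoc)
      also have "(\<Sum>m<k. \<Sum>i<j. d' m * S i m * S j m * pol n c (?x i) (?x j)) =
        (\<Sum>i<j. (\<Sum>m<k. d' m * S i m * S j m) * pol n c (?x i) (?x j))"
        unfolding sum_distrib_right by (rule sum.swap)
      also have "\<dots> = 0" using gram[OF _ j] j by (intro sum.neutral) auto
      finally show "(\<Sum>m<k. d' m * ((S j m)\<^sup>2 * qv n c (?x j) + (\<Sum>i<j. S i m * S j m * pol n c (?x i) (?x j)))) = d j * qv n c (?x j)"
        using gram[OF j j] by simp
    qed
    finally show ?thesis unfolding qv_diag_tensor .
  qed
  have TB: "T (unitv p) q = B S p q" if "p < k * n" for p q
  proof -
    have n: "0 < n" using that by (cases n) auto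
    have pk: "p div n < k" using that less_mult_imp_div_less by blast
    have "T (unitv p) q = (\<Sum>l<k. if l = p div n then (if q mod n = p mod n then S l (q div n) else 0) else 0)"
      unfolding T_def unitv_def
    proof (rule sum.cong[OF refl])
      fix l
      have "l * n + q mod n = p \<longleftrightarrow> l = p div n \<and> q mod n = p mod n"
        using n by (metis div_mult_mod_eq div_mult_self3 mod_div_trivial mod_mult_self3 add.left_neutral add.commute mod_mod_trivial nat_neq_iff)
      then show "(if l * n + q mod n = p then 1 else 0) * S l (q div n) =
        (if l = p div n then (if q mod n = p mod n then S l (q div n) else 0) else 0)" by auto
    qed
    also have "\<dots> = B S p q" unfolding B_def using pk by simp
    finally show ?thesis .
  qed
  have Tadd: "T (\<lambda>k. x k + y k) = (\<lambda>q. T x q + T y q)" for x y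
    unfolding T_def by (simp add: sum.distrib distrib_right)
  have qB: "qv (k * n) (diag_tensor n c d') (B S p) = qv (k * n) (diag_tensor n c d) (unitv p)" if "p < k * n" for p
    unfolding qT[symmetric] by (rule qv_cong) (simp add: TB that)
  show ?thesis unfolding qembed_def
  proof (rule exI[of _ "B S"], rule exI[of _ "B S'"], intro conjI allI impI)
    show "vin F (k * n) (B S p)" "vin F (k * n) (B S' p)" if "p < k * n" for p
      using BF that S by blast+
    show "(\<Sum>q<k * n. B S i q * B S' q j) = (if i = j then 1 else 0)" if ij: "i < k * n" "j < k * n" for i j
    proof -
      have n: "0 < n" using ij by (cases n) auto
      have ik: "i div n < k" "j div n < k" using ij less_mult_imp_div_less by blast+
      have "(\<Sum>q<k * n. B S i q * B S' q j) = (\<Sum>m<k. \<Sum>r<n. if r = i mod n then (if j mod n = i mod n then S (i div n) m * S' m (j div n) else 0) else 0)"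
        unfolding sum_blocks by (intro sum.cong refl) (auto simp: B_def)
      also have "\<dots> = (\<Sum>m<k. if j mod n = i mod n then S (i div n) m * S' m (j div n) else 0)"
        using n by simp
      also have "\<dots> = (if j mod n = i mod n then (if i div n = j div n then 1 else 0) else 0)"
        using SS'[OF ik] by auto
      also have "\<dots> = (if i = j then 1 else 0)" by (metis div_mult_mod_eq)
      finally show ?thesis .
    qed
    show "qv (k * n) (diag_tensor n c d') (B S p) = diag_tensor n c d p p" if "p < k * n" for p
      using qB[OF that] qv_unitv[OF that] by simp
    show "pol (k * n) (diag_tensor n c d') (B S p) (B S q) = diag_tensor n c d p q" if pq: "q < k * n" "p < q" for p q
    proof -
      have p: "p < k * n" using pq by simp
      have "qv (k * n) (diag_tensor n c d') (\<lambda>r. B S p r + B S q r) = qv (k * n) (diag_tensor n c d) (\<lambda>r. unitv p r + unitv q r)"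
        unfolding qT[symmetric] Tadd by (rule qv_cong) (simp add: TB p pq)
      then have "pol (k * n) (diag_tensor n c d') (B S p) (B S q) = pol (k * n) (diag_tensor n c d) (unitv p) (unitv q)"
        unfolding pol_qv qB[OF p] qB[OF pq(1)] by simp
      then show ?thesis using pol_unitv[OF pq(2,1)] by simp
    qed
  qed
qed

text \<open>The diagonal of \<open>\<langle>\<langle>a\<^sub>1, \<dots>, a\<^sub>k\<rangle>\<rangle>\<close>.\<close>

fun pflist :: "'w::comm_ring_1 list \<Rightarrow> 'w list" where
  "pflist [] = [1]"
| "pflist (a # as) = pflist as @ map ((*) a) (pflist as)"

lemma length_pflist: "length (pflist as) = 2 ^ length as"
  by (induction as) simp_all

lemma pflist_in: "subfld F \<Longrightarrow> set as \<subseteq> F \<Longrightarrow> set (pflist as) \<subseteq> F"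
  by (induction as) (auto simp: subfldD)

lemma cin_diag_tensor:
  assumes F: "subfld F" and c: "cin F n c" and d: "\<And>l. l < k \<Longrightarrow> d l \<in> F"
  shows "cin F (k * n) (diag_tensor n c d)"
  unfolding cin_def
proof (intro allI impI)
  fix q p assume pq: "q < k * n" "p \<le> q"
  then have n: "0 < n" by (cases n) auto
  show "diag_tensor n c d p q \<in> F"
  proof (cases "p div n = q div n")
    case True
    have "p mod n \<le> q mod n" using pq(2) True by (metis add_le_cancel_left div_mult_mod_eq)
    moreover have "q mod n < n" using n by simp
    ultimately have "c (p mod n) (q mod n) \<in> F" using c unfolding cin_def by blast
    moreover have "d (p div n) \<in> F" using True pq(1) less_mult_imp_div_less d by metis
    ultimately show ?thesis using True by (simp add: diag_tensor_def subfldD(4)[OF F])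
  qed (simp add: diag_tensor_def subfldD(1)[OF F])
qed

text \<open>The second half of \<open>pflist\<close> is \<open>a\<close> times the first, so each
  slot is one passage from \<open>q\<close> to \<open>q \<bottom> a q\<close>.\<close>

lemma quadratic_isotropy_pflist:
  fixes c :: "nat \<Rightarrow> nat \<Rightarrow> 'w::alg_closed_field"
  assumes c2: "(2::'w) = 0" and A: "alg_closed_in A" and F: "subfld F" and c: "cin F n c" and n: "2 \<le> n"
    and P: "quadratic_isotropy F A n c m" and as: "set as \<subseteq> F"
  shows "quadratic_isotropy F A (2 ^ length as * n) (diag_tensor n c (\<lambda>l. pflist as ! l)) (2 ^ length as * m)"
  using as
proof (induction as)
  case Nil
  have "qv (1 * n) (diag_tensor n c (\<lambda>l. pflist [] ! l)) x = qv n c x" for x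
    unfolding qv_diag_tensor by simp
  then show ?case using P quadratic_isotropy_qcong[of n "diag_tensor n c (\<lambda>l. pflist [] ! l)" c] by simp
next
  case (Cons a as)
  let ?k = "2 ^ length as" and ?d = "\<lambda>l. pflist as ! l"
  have "set (pflist as) \<subseteq> F" using pflist_in[OF F] Cons.prems by simp
  then have dF: "?d l \<in> F" if "l < ?k" for l using that length_pflist[of as] by (metis nth_mem subsetD)
  have "2 ^ length as \<ge> (1::nat)" by simp
  then have "1 * 2 \<le> ?k * n" using n by (intro mult_le_mono) auto
  then have kn: "2 \<le> ?k * n" by simp
  have "quadratic_isotropy F A (?k * n + ?k * n) (orth_sum (?k * n) (diag_tensor n c ?d) (\<lambda>i j. a * diag_tensor n c ?d i j)) (2 * (?k * m))"
    using Cons by (intro quadratic_isotropy_pfister[OF c2 A F cin_diag_tensor[OF F c dF] _ kn]) auto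
  moreover have "qv (?k * n + ?k * n) (orth_sum (?k * n) (diag_tensor n c ?d) (\<lambda>i j. a * diag_tensor n c ?d i j)) x =
      qv (?k * n + ?k * n) (diag_tensor n c (\<lambda>l. pflist (a # as) ! l)) x" for x
  proof -
    have "qv ((?k + ?k) * n) (diag_tensor n c (\<lambda>l. pflist (a # as) ! l)) x =
      (\<Sum>l<?k. ?d l * qv n c (\<lambda>r. x (l * n + r))) + (\<Sum>l<?k. a * ?d l * qv n c (\<lambda>r. x ((?k + l) * n + r)))"
      unfolding qv_diag_tensor sum_split_lt by (simp add: nth_append length_pflist)
    also have "\<dots> = qv (?k * n) (diag_tensor n c ?d) x + a * qv (?k * n) (diag_tensor n c ?d) (\<lambda>r. x (?k * n + r))"
      unfolding qv_diag_tensor by (simp add: sum_distrib_left algebra_simps)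
    finally show ?thesis unfolding qv_orth_sum qv_scalec by (simp add: distrib_right)
  qed
  ultimately have "quadratic_isotropy F A (?k * n + ?k * n) (diag_tensor n c (\<lambda>l. pflist (a # as) ! l)) (2 * (?k * m))"
    using quadratic_isotropy_qcong by blast
  moreover have "?k * n + ?k * n = 2 ^ length (a # as) * n" "2 * (?k * m) = 2 ^ length (a # as) * m" by simp_all
  ultimately show ?case by (simp only:)
qed


subsection \<open>Diagonalisations of a bilinear form\<close>

fun pflist_ring :: "('b, 'm) ring_scheme \<Rightarrow> 'b list \<Rightarrow> 'b list" where
  "pflist_ring F [] = [\<one>\<^bsub>F\<^esub>]"
| "pflist_ring F (a # as) = pflist_ring F as @ map (\<lambda>b. a \<otimes>\<^bsub>F\<^esub> b) (pflist_ring F as)"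

lemma length_pflist_ring: "length (pflist_ring F as) = 2 ^ length as"
  by (induction as) simp_all

lemma bdim_pfister: "bdim (pfister F as) = 2 ^ length as"
  unfolding pfister_def by (induction as) (simp_all add: btensor_def bdiag_def)

lemma pfister_Cons: "pfister F (a # as) = btensor F (bdiag F [\<one>\<^bsub>F\<^esub>, a]) (pfister F as)"
  unfolding pfister_def by simp

lemma linear_iso_comp:
  assumes T: "linear_iso L n T" and U: "linear_iso L n U"
  shows "linear_iso L n (U \<circ> T)"
  unfolding linear_iso_def
proof (intro conjI ballI)
  note T' = linear_isoD[OF T] and U' = linear_isoD[OF U]
  show "bij_betw (U \<circ> T) (vecs L n) (vecs L n)" by (rule bij_betw_trans[OF T'(1) U'(1)])
  fix x assume x: "x \<in> vecs L n"
  show "(U \<circ> T) (\<lambda>i\<in>{..<n}. a \<otimes>\<^bsub>L\<^esub> x i) = (\<lambda>i\<in>{..<n}. a \<otimes>\<^bsub>L\<^esub> (U \<circ> T) x i)" if "a \<in> carrier L" for a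
    using T'(4)[OF that x] U'(4)[OF that T'(2)[OF x]] by simp
  fix y assume y: "y \<in> vecs L n"
  show "(U \<circ> T) (\<lambda>i\<in>{..<n}. x i \<oplus>\<^bsub>L\<^esub> y i) = (\<lambda>i\<in>{..<n}. (U \<circ> T) x i \<oplus>\<^bsub>L\<^esub> (U \<circ> T) y i)"
    using T'(3)[OF x y] U'(3)[OF T'(2)[OF x] T'(2)[OF y]] by simp
qed

context
  fixes F :: "('b, 'm) ring_scheme" and g :: "'b \<Rightarrow> 'w::field" and K :: "'w set"
  assumes fieldF: "field F" and g: "ring_emb F g" and K: "subfld K" "K = g ` carrier F"
begin

interpretation field F by (rule fieldF)

lemma pflist_ring_carrier: "set as \<subseteq> carrier F \<Longrightarrow> set (pflist_ring F as) \<subseteq> carrier F"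
  by (induction as) auto

lemma pflist_ring_pflist: "set as \<subseteq> carrier F \<Longrightarrow> map g (pflist_ring F as) = pflist (map g as)"
proof (induction as)
  case (Cons a as)
  have "set (pflist_ring F as) \<subseteq> carrier F" using pflist_ring_carrier Cons.prems by simp
  then have e: "map g (map (\<lambda>b. a \<otimes>\<^bsub>F\<^esub> b) (pflist_ring F as)) = map ((*) (g a)) (map g (pflist_ring F as))"
    using Cons.prems rembD(5)[OF g] by auto
  have IH: "map g (pflist_ring F as) = pflist (map g as)" using Cons by simp
  show ?case unfolding pflist_ring.simps pflist.simps list.map map_append e IH ..
qed (simp add: rembD(3)[OF g])

text \<open>An index splits into a block, carrying 1 or \<open>a\<close>, and a position inside the
  previous form; two indices agree exactly when both parts do.\<close>

lemma gram_pfister: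
  assumes "set as \<subseteq> carrier F" "i < 2 ^ length as" "j < 2 ^ length as"
  shows "gram (pfister F as) i j = (if i = j then pflist_ring F as ! i else \<zero>\<^bsub>F\<^esub>)"
  using assms
proof (induction as arbitrary: i j)
  case Nil
  then show ?case unfolding pfister_def bdiag_def by simp
next
  case (Cons a as)
  let ?N = "2 ^ length as :: nat"
  have N: "0 < ?N" by simp
  have a: "a \<in> carrier F" and as: "set as \<subseteq> carrier F" using Cons.prems by auto
  have r: "pflist_ring F as ! l \<in> carrier F" if "l < ?N" for l
    using pflist_ring_carrier[OF as] length_pflist_ring[of F as] that by (metis nth_mem subsetD)
  have ij: "i div ?N < 2" "j div ?N < 2" "i mod ?N < ?N" "j mod ?N < ?N"
    using Cons.prems N by (auto intro: less_mult_imp_div_less)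
  have e: "i = j \<longleftrightarrow> i div ?N = j div ?N \<and> i mod ?N = j mod ?N" by (metis div_mult_mod_eq)
  have IH: "gram (pfister F as) (i mod ?N) (j mod ?N) = (if i mod ?N = j mod ?N then pflist_ring F as ! (i mod ?N) else \<zero>\<^bsub>F\<^esub>)"
    by (rule Cons.IH[OF as ij(3,4)])
  have "gram (pfister F (a # as)) i j = (if i div ?N = j div ?N then [\<one>\<^bsub>F\<^esub>, a] ! (i div ?N) else \<zero>\<^bsub>F\<^esub>) \<otimes>\<^bsub>F\<^esub>
      (if i mod ?N = j mod ?N then pflist_ring F as ! (i mod ?N) else \<zero>\<^bsub>F\<^esub>)"
    unfolding pfister_Cons btensor_def bdim_pfister IH[symmetric] by (simp add: bdiag_def)
  moreover have "[\<one>\<^bsub>F\<^esub>, a] ! (i div ?N) \<in> carrier F" using ij(1) a by (auto simp: less_2_cases_iff)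
  moreover have "pflist_ring F (a # as) ! i = [\<one>\<^bsub>F\<^esub>, a] ! (i div ?N) \<otimes>\<^bsub>F\<^esub> pflist_ring F as ! (i mod ?N)"
  proof (cases "i < ?N")
    case True
    then show ?thesis using r[OF ij(3)] by (simp add: nth_append length_pflist_ring)
  next
    case False
    then have "i div ?N = 1" using ij(1) by (metis One_nat_def div_less_iff_less_mult less_2_cases mult_1 N mult_is_0 not_less0 nat_mult_1 less_Suc0 add.right_neutral div_mult_mod_eq mult_0 ij(3) add_0)
    moreover from this have "i mod ?N = i - ?N" by (metis add_diff_cancel_left' div_mult_mod_eq mult_1)
    ultimately show ?thesis using False ij(3) by (simp add: nth_append length_pflist_ring)
  qed
  ultimately show ?case using e r[OF ij(3)] by auto
qed

lemma beval_ring_emb: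
  assumes B: "\<And>i j. i < bdim B \<Longrightarrow> j < bdim B \<Longrightarrow> gram B i j \<in> carrier F" and x: "x \<in> vecs F (bdim B)" "y \<in> vecs F (bdim B)"
  shows "beval F B x y \<in> carrier F" "g (beval F B x y) = (\<Sum>i<bdim B. \<Sum>j<bdim B. g (gram B i j) * g (x i) * g (y j))"
proof -
  have t: "gram B i j \<otimes>\<^bsub>F\<^esub> x i \<otimes>\<^bsub>F\<^esub> y j \<in> carrier F" if "i < bdim B" "j < bdim B" for i j
    using B vecsD[OF x(1)] vecsD[OF x(2)] that by simp
  have s: "(\<Oplus>\<^bsub>F\<^esub>j\<in>{..<bdim B}. gram B i j \<otimes>\<^bsub>F\<^esub> x i \<otimes>\<^bsub>F\<^esub> y j) \<in> carrier F" if "i < bdim B" for i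
    using t[OF that] by (intro finsum_closed'[OF is_cring]) auto
  show "beval F B x y \<in> carrier F" unfolding beval_def by (rule finsum_closed'[OF is_cring]) (use s in auto)
  have "g (beval F B x y) = (\<Sum>i<bdim B. g (\<Oplus>\<^bsub>F\<^esub>j\<in>{..<bdim B}. gram B i j \<otimes>\<^bsub>F\<^esub> x i \<otimes>\<^bsub>F\<^esub> y j))"
    unfolding beval_def using s by (intro ring_emb_finsum[OF g]) auto
  also have "\<dots> = (\<Sum>i<bdim B. \<Sum>j<bdim B. g (gram B i j) * g (x i) * g (y j))"
  proof (rule sum.cong[OF refl])
    fix i assume "i \<in> {..<bdim B}"
    then have i: "i < bdim B" by simp
    have "g (\<Oplus>\<^bsub>F\<^esub>j\<in>{..<bdim B}. gram B i j \<otimes>\<^bsub>F\<^esub> x i \<otimes>\<^bsub>F\<^esub> y j) = (\<Sum>j<bdim B. g (gram B i j \<otimes>\<^bsub>F\<^esub> x i \<otimes>\<^bsub>F\<^esub> y j))"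
      using t[OF i] by (intro ring_emb_finsum[OF g]) auto
    also have "\<dots> = (\<Sum>j<bdim B. g (gram B i j) * g (x i) * g (y j))"
      using B[OF i] vecsD[OF x(1) i] vecsD[OF x(2)] by (intro sum.cong) (simp_all add: rembD(5)[OF g])
    finally show "g (\<Oplus>\<^bsub>F\<^esub>j\<in>{..<bdim B}. gram B i j \<otimes>\<^bsub>F\<^esub> x i \<otimes>\<^bsub>F\<^esub> y j) = (\<Sum>j<bdim B. g (gram B i j) * g (x i) * g (y j))" .
  qed
  finally show "g (beval F B x y) = (\<Sum>i<bdim B. \<Sum>j<bdim B. g (gram B i j) * g (x i) * g (y j))" .
qed

lemma beval_scaled:
  assumes d: "bdim C = bdim B" and B: "\<And>i j. i < bdim B \<Longrightarrow> j < bdim B \<Longrightarrow> gram B i j \<in> carrier F"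
    and a: "a \<in> carrier F" and C: "\<And>i j. i < bdim B \<Longrightarrow> j < bdim B \<Longrightarrow> gram C i j = a \<otimes>\<^bsub>F\<^esub> gram B i j"
    and x: "x \<in> vecs F (bdim B)" "y \<in> vecs F (bdim B)"
  shows "beval F C x y = a \<otimes>\<^bsub>F\<^esub> beval F B x y"
proof -
  have CF: "gram C i j \<in> carrier F" if "i < bdim C" "j < bdim C" for i j using C B a d that by simp
  have xC: "x \<in> vecs F (bdim C)" "y \<in> vecs F (bdim C)" using x d by simp_all
  have "g (beval F C x y) = (\<Sum>i<bdim B. \<Sum>j<bdim B. g (gram C i j) * g (x i) * g (y j))"
    using beval_ring_emb(2)[OF CF xC] d by simp
  also have "\<dots> = g a * (\<Sum>i<bdim B. \<Sum>j<bdim B. g (gram B i j) * g (x i) * g (y j))"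
    unfolding sum_distrib_left using C B a by (intro sum.cong refl) (simp add: rembD(5)[OF g] mult.assoc)
  also have "\<dots> = g (a \<otimes>\<^bsub>F\<^esub> beval F B x y)"
    using beval_ring_emb[OF B x] a by (simp add: rembD(5)[OF g])
  finally show ?thesis using ring_emb_inj[OF g] beval_ring_emb(1)[OF CF xC] beval_ring_emb(1)[OF B x] a by blast
qed

text \<open>\<open>qtensor\<close> picks its diagonalisation by choice. Two diagonalisations of
  \<open>P\<close> differ by an isometry of diagonal forms, whose matrix satisfies the Gram
  relations required by \<open>diag_tensor_qembed\<close>.\<close>

lemma bdiag_qembed:
  assumes ds: "set ds \<subseteq> carrier F" "set es \<subseteq> carrier F" and iso: "bisometric F P (bdiag F ds)" "bisometric F P (bdiag F es)"
  shows "length ds = bdim P" "length es = bdim P"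
    "qembed K (bdim P * n) (diag_tensor n c (\<lambda>l. g (ds ! l))) (bdim P * n) (diag_tensor n c (\<lambda>l. g (es ! l)))"
proof -
  define k where "k = bdim P"
  obtain T1 where T1: "length ds = k" "linear_iso F k T1"
    "\<forall>x\<in>vecs F k. \<forall>y\<in>vecs F k. beval F (bdiag F ds) (T1 x) (T1 y) = beval F P x y"
    using iso(1) unfolding bisometric_def k_def bdiag_def by auto
  obtain T2 where T2: "length es = k" "linear_iso F k T2"
    "\<forall>x\<in>vecs F k. \<forall>y\<in>vecs F k. beval F (bdiag F es) (T2 x) (T2 y) = beval F P x y"
    using iso(2) unfolding bisometric_def k_def bdiag_def by auto
  show "length ds = bdim P" "length es = bdim P" using T1(1) T2(1) k_def by auto
  define J where "J = inv_into (vecs F k) T1"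
  have J: "linear_iso F k J" unfolding J_def by (rule linear_iso_inv[OF g K T1(2)])
  have im: "T1 ` vecs F k = vecs F k" using linear_isoD(1)[OF T1(2)] unfolding bij_betw_def by blast
  have TJ: "T1 (J x) = x" "J x \<in> vecs F k" if "x \<in> vecs F k" for x
    using that im f_inv_into_f[of x T1 "vecs F k"] inv_into_into[of x T1 "vecs F k"] unfolding J_def by auto
  \<comment> \<open>From the first diagonalisation back to \<open>P\<close> and on to the
    second.\<close>
  define U where "U = T2 \<circ> J"
  have U: "linear_iso F k U" unfolding U_def by (rule linear_iso_comp[OF J T2(2)])
  have Ub: "beval F (bdiag F es) (U x) (U y) = beval F (bdiag F ds) x y" if "x \<in> vecs F k" "y \<in> vecs F k" for x y
    using T2(3) T1(3) TJ that unfolding U_def by (metis comp_apply)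
  define V where "V = inv_into (vecs F k) U"
  have V: "linear_iso F k V" unfolding V_def by (rule linear_iso_inv[OF g K U])
  have VU: "V (U x) = x" if "x \<in> vecs F k" for x
    unfolding V_def using inv_into_f_f[OF _ that, of U] linear_isoD(1)[OF U] unfolding bij_betw_def by blast
  note Uv = linear_isoD(2)[OF U] and Vv = linear_isoD(2)[OF V]
  note uv = uvec_vecs[OF g K, of k]
  have diag: "g (beval F (bdiag F fs) x y) = (\<Sum>m<k. g (fs ! m) * g (x m) * g (y m))"
    if fs: "length fs = k" "set fs \<subseteq> carrier F" and x: "x \<in> vecs F k" "y \<in> vecs F k" for fs x y
  proof -
    have bd: "bdim (bdiag F fs) = k" using fs by (simp add: bdiag_def)
    have c: "fs ! m \<in> carrier F" if "m < k" for m using fs that by (metis nth_mem subsetD)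
    have "g (beval F (bdiag F fs) x y) = (\<Sum>i<k. \<Sum>j<k. g (gram (bdiag F fs) i j) * g (x i) * g (y j))"
      using beval_ring_emb(2)[of "bdiag F fs" x y] x c unfolding bd by (simp add: bdiag_def)
    also have "\<dots> = (\<Sum>i<k. \<Sum>j<k. if j = i then g (fs ! i) * g (x i) * g (y i) else 0)"
      by (intro sum.cong refl) (auto simp: bdiag_def ring_emb_zero[OF g])
    finally show ?thesis by simp
  qed
  have "qembed K (k * n) (diag_tensor n c (\<lambda>l. g (ds ! l))) (k * n) (diag_tensor n c (\<lambda>l. g (es ! l)))"
  proof (rule diag_tensor_qembed[OF K(1), of k "\<lambda>i m. g (U (uvec F k i) m)" "\<lambda>i m. g (V (uvec F k i) m)"])
    show "vin K k (\<lambda>m. g (U (uvec F k l) m))" "vin K k (\<lambda>m. g (V (uvec F k l) m))" for l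
      by (intro vin_vecs[OF g K] Uv Vv uv)+
    fix i j assume ij: "i < k" "j < k"
    show "(\<Sum>m<k. g (U (uvec F k i) m) * g (V (uvec F k m) j)) = (if i = j then 1 else 0)"
      using linear_iso_expand[OF g K V Uv[OF uv[of i]] ij(2)] VU[OF uv[of i]] g_uvec[OF g K ij(2), of i]
      by (auto simp: unitv_def)
    have "(\<Sum>m<k. g (es ! m) * g (U (uvec F k i) m) * g (U (uvec F k j) m)) = g (beval F (bdiag F es) (U (uvec F k i)) (U (uvec F k j)))"
      by (rule diag[OF T2(1) ds(2) Uv[OF uv] Uv[OF uv], symmetric])
    also have "\<dots> = g (beval F (bdiag F ds) (uvec F k i) (uvec F k j))" using Ub[OF uv uv] by simp
    also have "\<dots> = (\<Sum>m<k. g (ds ! m) * unitv i m * unitv j m)"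
      unfolding diag[OF T1(1) ds(1) uv uv] using g_uvec[OF g K] by (intro sum.cong) auto
    also have "\<dots> = (\<Sum>m<k. if m = i then (if i = j then g (ds ! i) else 0) else 0)"
      by (intro sum.cong) (auto simp: unitv_def)
    also have "\<dots> = (if i = j then g (ds ! i) else 0)" using ij by simp
    finally show "(\<Sum>m<k. g (es ! m) * g (U (uvec F k i) m) * g (U (uvec F k j) m)) = (if i = j then g (ds ! i) else 0)" .
  qed
  then show "qembed K (bdim P * n) (diag_tensor n c (\<lambda>l. g (ds ! l))) (bdim P * n) (diag_tensor n c (\<lambda>l. g (es ! l)))"
    unfolding k_def .
qed

text \<open>An isometry of bilinear forms stays one when both forms are scaled by \<open>a\<close>,
  so the similarity and the isometry with the Pfister form compose.\<close>

lemma similar_pfister_diagonal: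
  assumes B: "bilinear_pfister_form F B" "bsimilar F P B"
  shows "\<exists>a as. a \<in> carrier F \<and> a \<noteq> \<zero>\<^bsub>F\<^esub> \<and> set as \<subseteq> carrier F \<and>
    bisometric F P (bdiag F (map (\<lambda>b. a \<otimes>\<^bsub>F\<^esub> b) (pflist_ring F as)))"
proof -
  obtain as where as: "set as \<subseteq> carrier F - {\<zero>\<^bsub>F\<^esub>}" "bisometric F B (pfister F as)" and bB: "bilinear_form F B"
    using B(1) unfolding bilinear_pfister_form_def by blast
  obtain a where a: "a \<in> carrier F" "a \<noteq> \<zero>\<^bsub>F\<^esub>" "bisometric F P (bscale F a B)" using B(2) unfolding bsimilar_def by blast
  have asc: "set as \<subseteq> carrier F" using as(1) by blast
  define k where "k = bdim P"
  obtain T1 where T1: "bdim B = k" "linear_iso F k T1"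
    "\<forall>x\<in>vecs F k. \<forall>y\<in>vecs F k. beval F (bscale F a B) (T1 x) (T1 y) = beval F P x y"
    using a(3) unfolding bisometric_def k_def bscale_def by auto
  obtain T2 where T2: "bdim (pfister F as) = k" "linear_iso F k T2"
    "\<forall>x\<in>vecs F k. \<forall>y\<in>vecs F k. beval F (pfister F as) (T2 x) (T2 y) = beval F B x y"
    using as(2) T1(1) unfolding bisometric_def by auto
  define ds where "ds = map (\<lambda>b. a \<otimes>\<^bsub>F\<^esub> b) (pflist_ring F as)"
  have k: "k = 2 ^ length as" using T2(1) bdim_pfister[of F as] by simp
  have r: "pflist_ring F as ! l \<in> carrier F" if "l < k" for l
    using pflist_ring_carrier[OF asc] length_pflist_ring[of F as] that unfolding k by (metis nth_mem subsetD)
  have gp: "gram (pfister F as) i j = (if i = j then pflist_ring F as ! i else \<zero>\<^bsub>F\<^esub>)" if "i < k" "j < k" for i j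
    using gram_pfister[OF asc] that unfolding k by blast
  have dd: "bdim (bdiag F ds) = k" unfolding ds_def bdiag_def k by (simp add: length_pflist_ring)
  have 1: "beval F (bdiag F ds) x y = a \<otimes>\<^bsub>F\<^esub> beval F (pfister F as) x y" if "x \<in> vecs F k" "y \<in> vecs F k" for x y
  proof (rule beval_scaled)
    show "gram (pfister F as) i j \<in> carrier F" if "i < bdim (pfister F as)" "j < bdim (pfister F as)" for i j
      using that r gp unfolding T2(1) by simp
    show "gram (bdiag F ds) i j = a \<otimes>\<^bsub>F\<^esub> gram (pfister F as) i j"
      if "i < bdim (pfister F as)" "j < bdim (pfister F as)" for i j
      using that gp a(1) unfolding T2(1) by (simp add: bdiag_def ds_def length_pflist_ring k)
  qed (use that T2(1) dd a in auto)
  have 2: "beval F (bscale F a B) x y = a \<otimes>\<^bsub>F\<^esub> beval F B x y" if "x \<in> vecs F k" "y \<in> vecs F k" for x y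
    by (rule beval_scaled) (use that bB T1(1) a in \<open>auto simp: bscale_def bilinear_form_def\<close>)
  have "bisometric F P (bdiag F ds)" unfolding bisometric_def dd k_def[symmetric]
  proof (intro conjI exI[of _ "T2 \<circ> T1"] ballI)
    show "linear_iso F k (T2 \<circ> T1)" by (rule linear_iso_comp[OF T1(2) T2(2)])
    fix x y assume x: "x \<in> vecs F k" "y \<in> vecs F k"
    note T1x = linear_isoD(2)[OF T1(2) x(1)] linear_isoD(2)[OF T1(2) x(2)]
    note T2x = linear_isoD(2)[OF T2(2) T1x(1)] linear_isoD(2)[OF T2(2) T1x(2)]
    show "beval F (bdiag F ds) ((T2 \<circ> T1) x) ((T2 \<circ> T1) y) = beval F P x y"
      using 1[OF T2x] 2[OF T1x] T1(3) T2(3) T1x x by simp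
  qed simp
  then show ?thesis using a asc unfolding ds_def by blast
qed

lemma qtensor_list:
  assumes \<phi>: "quadratic_form F \<phi>" and as: "set as \<subseteq> carrier F"
  defines "\<Phi> \<equiv> foldr (\<lambda>a. qsum F (qscale F a \<phi>)) as (qzero F)"
  shows "quadratic_form F \<Phi>" "qdim \<Phi> = length as * qdim \<phi>"
    "qv (length as * qdim \<phi>) (map_coeff g \<Phi>) x = qv (length as * qdim \<phi>) (diag_tensor (qdim \<phi>) (map_coeff g \<phi>) (\<lambda>l. g (as ! l))) x"
proof -
  define n where "n = qdim \<phi>"
  have "quadratic_form F (foldr (\<lambda>a. qsum F (qscale F a \<phi>)) as (qzero F)) \<and>
    qdim (foldr (\<lambda>a. qsum F (qscale F a \<phi>)) as (qzero F)) = length as * n \<and>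
    (\<forall>x. qv (length as * n) (map_coeff g (foldr (\<lambda>a. qsum F (qscale F a \<phi>)) as (qzero F))) x =
      (\<Sum>l<length as. g (as ! l) * qv n (map_coeff g \<phi>) (\<lambda>r. x (l * n + r))))"
    using as
  proof (induction as)
    case Nil
    show ?case by (simp add: quadratic_form_def qzero_def qv_def)
  next
    case (Cons a as)
    let ?R = "foldr (\<lambda>a. qsum F (qscale F a \<phi>)) as (qzero F)"
    have a: "a \<in> carrier F" using Cons.prems by simp
    have IH: "quadratic_form F ?R" "qdim ?R = length as * n"
      "\<And>x. qv (length as * n) (map_coeff g ?R) x = (\<Sum>l<length as. g (as ! l) * qv n (map_coeff g \<phi>) (\<lambda>r. x (l * n + r)))"
      using Cons by auto
    have s: "quadratic_form F (qscale F a \<phi>)" "qdim (qscale F a \<phi>) = n"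
      using \<phi> a unfolding quadratic_form_def qscale_def map_qform_def n_def by auto
    have sq: "qv n (map_coeff g (qscale F a \<phi>)) x = g a * qv n (map_coeff g \<phi>) x" for x
    proof -
      have "qv n (map_coeff g (qscale F a \<phi>)) x = qv n (\<lambda>i j. g a * map_coeff g \<phi> i j) x"
        using \<phi> a unfolding quadratic_form_def n_def
        by (intro qv_ccong) (simp add: map_coeff_def qscale_def map_qform_def rembD(5)[OF g])
      then show ?thesis unfolding qv_scalec .
    qed
    have "qv (n + length as * n) (map_coeff g (qsum F (qscale F a \<phi>) ?R)) x =
      (\<Sum>l<length (a # as). g ((a # as) ! l) * qv n (map_coeff g \<phi>) (\<lambda>r. x (l * n + r)))" for x
      unfolding map_coeff_qsum[OF g K] s(2) qv_orth_sum sq IH(3)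
      by (simp add: sum.lessThan_Suc_shift add.assoc del: sum.lessThan_Suc)
    then show ?case using quadratic_form_qsum[OF g K s(1) IH(1)] s(2) IH(2) by simp
  qed
  then show "quadratic_form F \<Phi>" "qdim \<Phi> = length as * qdim \<phi>"
    "qv (length as * qdim \<phi>) (map_coeff g \<Phi>) x = qv (length as * qdim \<phi>) (diag_tensor (qdim \<phi>) (map_coeff g \<phi>) (\<lambda>l. g (as ! l))) x"
    unfolding \<Phi>_def n_def qv_diag_tensor by blast+
qed

end


section \<open>The theorem over a field with enough transcendental elements\<close>

lemma map_coeff_map_qform:
  assumes "quadratic_form F \<phi>" "\<And>a. a \<in> carrier F \<Longrightarrow> g (e a) = h a" "i \<le> j" "j < qdim \<phi>"
  shows "map_coeff g (map_qform e \<phi>) i j = map_coeff h \<phi> i j"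
  using assms unfolding map_coeff_def map_qform_def quadratic_form_def by simp

text \<open>Two supplies of variables occur. The \<open>T k\<close> are free over \<open>A\<close>
  and establish \<open>quadratic_isotropy\<close> for all \<open>E\<close> inside \<open>A\<close>.
  The \<open>S k\<close> lie inside \<open>A\<close> and build the function field of the product, to
  which that property is applied.\<close>

theorem first_isotropy_index_Pfister:
  fixes F :: "('b, 'm) ring_scheme" and h :: "'b \<Rightarrow> 'w::alg_closed_field" and \<phi> :: "'b qform" and P :: "'b bform"
  assumes c2: "(2::'w) = 0" and fieldF: "field F" and h: "ring_emb F h"
    and A: "alg_closed_in A" "h ` carrier F \<subseteq> A" and T: "\<And>k. transcendental (tower A T k) (T k)"
    and S: "\<And>k. S k \<in> A" "\<And>k. transcendental (tower (h ` carrier F) S k) (S k)"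
    and \<phi>: "quadratic_form F \<phi>" "2 \<le> qdim \<phi>"
    and B: "bilinear_pfister_form F B" "bsimilar F P B"
    and an: "qanisotropic F (qtensor F P \<phi>)"
  shows "first_isotropy_index F (qtensor F P \<phi>) \<ge> bdim P * first_isotropy_index F \<phi>"
proof -
  define K where "K = h ` carrier F"
  have sK: "subfld K" unfolding K_def by (rule ring_emb_field_image[OF fieldF h])
  have sA: "subfld A" using A(1) unfolding alg_closed_in_def by blast
  define n where "n = qdim \<phi>"
  define c where "c = map_coeff h \<phi>"
  define \<Phi> where "\<Phi> = qtensor F P \<phi>"
  define k where "k = bdim P"
  note R = h sK K_def
  obtain s ps where ps: "s \<in> carrier F" "s \<noteq> \<zero>\<^bsub>F\<^esub>" "set ps \<subseteq> carrier F"
    "bisometric F P (bdiag F (map (\<lambda>b. s \<otimes>\<^bsub>F\<^esub> b) (pflist_ring F ps)))"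
    using similar_pfister_diagonal[OF fieldF R B] by blast
  interpret F: field F by (rule fieldF)
  define ds where "ds = map (\<lambda>b. s \<otimes>\<^bsub>F\<^esub> b) (pflist_ring F ps)"
  have rc: "set (pflist_ring F ps) \<subseteq> carrier F" by (rule pflist_ring_carrier[OF fieldF R ps(3)])
  have ds: "set ds \<subseteq> carrier F" unfolding ds_def using ps(1) rc by auto
  define as where "as = (SOME as. set as \<subseteq> carrier F \<and> bisometric F P (bdiag F as))"
  have "set as \<subseteq> carrier F \<and> bisometric F P (bdiag F as)"
    unfolding as_def by (rule someI[of _ ds]) (use ds ps(4) ds_def in blast)
  then have as: "set as \<subseteq> carrier F" "bisometric F P (bdiag F as)" by auto
  have \<Phi>_eq: "\<Phi> = foldr (\<lambda>a. qsum F (qscale F a \<phi>)) as (qzero F)"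
    unfolding \<Phi>_def qtensor_def as_def[symmetric] by (simp add: Let_def)
  have la: "length as = k" and ld: "length ds = k"
    using bdiag_qembed(1,2)[OF fieldF R ds as(1) ps(4)[folded ds_def] as(2)] unfolding k_def by auto
  have k: "k = 2 ^ length ps" using ld unfolding ds_def by (simp add: length_pflist_ring)
  have k1: "1 \<le> k" unfolding k by simp
  define N where "N = k * n"
  have n2: "2 \<le> n" using \<phi>(2) unfolding n_def .
  have N2: "2 \<le> N" unfolding N_def using mult_le_mono[OF k1 n2] by simp
  define D where "D = diag_tensor n c (\<lambda>l. h (ds ! l))"
  define D' where "D' = diag_tensor n c (\<lambda>l. h (as ! l))"
  have emb: "qembed K N D N D'" "qembed K N D' N D"
    using bdiag_qembed(3)[OF fieldF R ds as(1) ps(4)[folded ds_def] as(2), of n c]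
      bdiag_qembed(3)[OF fieldF R as(1) ds as(2) ps(4)[folded ds_def], of n c]
    unfolding D_def D'_def N_def k_def by auto
  have f\<Phi>: "quadratic_form F \<Phi>" "qdim \<Phi> = N"
    using qtensor_list(1,2)[OF fieldF R \<phi>(1) as(1)] unfolding \<Phi>_eq N_def la n_def by auto
  have q\<Phi>: "qv N (map_coeff h \<Phi>) x = qv N D' x" for x
    using qtensor_list(3)[OF fieldF R \<phi>(1) as(1), of x] unfolding \<Phi>_eq N_def la n_def D'_def c_def .
  have an\<Phi>: "aniso K N (map_coeff h \<Phi>)" using an qanisotropic_aniso[OF R f\<Phi>(1)] f\<Phi>(2) unfolding \<Phi>_def by blast
  have hnz: "h a \<noteq> 0" if "a \<in> carrier F" "a \<noteq> \<zero>\<^bsub>F\<^esub>" for a using ring_emb_eq_0[OF h that(1)] that(2) by blast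
  \<comment> \<open>Up to the factor \<open>as ! 0\<close>, \<open>\<phi>\<close> is the first block
    of the product; a zero of it, extended by 0, is a zero of the product.\<close>
  have an\<phi>: "aniso K n c" unfolding aniso_def
  proof safe
    fix x i assume x: "vin K n x" "qv n c x = 0" "i < n"
    define y where "y = (\<lambda>q. if q < n then x q else 0)"
    have "qv n c (\<lambda>r. y (l * n + r)) = 0" for l
    proof (cases "l = 0")
      case True
      have "qv n c (\<lambda>r. y (l * n + r)) = qv n c x" using True by (intro qv_cong) (simp add: y_def)
      then show ?thesis using x(2) by simp
    next
      case False
      then have "y (l * n + r) = 0" for r unfolding y_def by (cases l) auto
      then show ?thesis by simp
    qed
    moreover have "qv N (map_coeff h \<Phi>) y = (\<Sum>l<k. h (as ! l) * qv n c (\<lambda>r. y (l * n + r)))"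
      using q\<Phi>[of y] unfolding D'_def N_def qv_diag_tensor .
    ultimately have "qv N (map_coeff h \<Phi>) y = 0" by simp
    moreover have "vin K N y" unfolding vin_def y_def using x(1) subfldD(1)[OF sK] unfolding vin_def by simp
    moreover have "i < N" using less_le_trans[OF x(3), of N] mult_le_mono1[OF k1, of n] unfolding N_def by simp
    ultimately have "y i = 0" using anisD[OF an\<Phi>] by blast
    then show "x i = 0" using x(3) unfolding y_def by simp
  qed
  have cK: "cin K n c" unfolding n_def c_def by (rule cin_map_coeff[OF R \<phi>(1)])
  have qan: "qanisotropic F \<phi>" using qanisotropic_aniso[OF R \<phi>(1)] an\<phi> unfolding n_def c_def by blast
  define \<psi> where "\<psi> = anisotropic_part F \<phi>"
  note \<psi> = anisotropic_part_qembed[OF R c2 \<phi>(1) qan, folded \<psi>_def n_def c_def]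
  define m where "m = first_isotropy_index F \<phi>"
  have m: "m = total_isotropy_index (function_field F \<psi>) (map_qform (function_field_emb F \<psi>) \<phi>)"
    unfolding m_def first_isotropy_index_def \<psi>_def by (simp add: Let_def)
  have c\<psi>K: "cin K n (map_coeff h \<psi>)" using cin_map_coeff[OF R \<psi>(1)] \<psi>(3) by simp
  \<comment> \<open>This coefficient is the value at a unit vector. It is the leading coefficient in
    the division that determines the ideal of a generic zero.\<close>
  have last: "h (qcoeff f (qdim f - 1) (qdim f - 1)) \<noteq> 0" if f: "quadratic_form F f" "qanisotropic F f" "2 \<le> qdim f" for f
  proof
    assume "h (qcoeff f (qdim f - 1) (qdim f - 1)) = 0"
    then have "qv (qdim f) (map_coeff h f) (unitv (qdim f - 1)) = 0" using f(3) by (subst qv_unitv) (auto simp: map_coeff_def)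
    moreover have "aniso K (qdim f) (map_coeff h f)" using qanisotropic_aniso[OF R f(1)] f(2) by blast
    ultimately have "unitv (qdim f - 1) (qdim f - 1) = (0::'w)"
      using anisD[of K "qdim f" "map_coeff h f" "unitv (qdim f - 1)" "qdim f - 1"] vin_unitv[OF sK] f(3) by simp
    then show False by (simp add: unitv_def)
  qed
  \<comment> \<open>Seen in the type, extending scalars to a function field leaves the coefficients
    unchanged, so the extended form can be replaced by \<open>map_coeff h\<close>.\<close>
  have mapTI: "K \<subseteq> g ` carrier L \<and> quadratic_form L (map_qform e f) \<and>
      (\<forall>x. qv (qdim f) (map_coeff g (map_qform e f)) x = qv (qdim f) (map_coeff h f) x)"
    if e: "\<forall>a\<in>carrier F. e a \<in> carrier L \<and> g (e a) = h a" and f: "quadratic_form F f"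
    for L :: "('d, 'k) ring_scheme" and g e f
  proof (intro conjI allI)
    show "K \<subseteq> g ` carrier L" unfolding K_def using e by force
    show "quadratic_form L (map_qform e f)" using e f unfolding quadratic_form_def map_qform_def by simp
    show "qv (qdim f) (map_coeff g (map_qform e f)) x = qv (qdim f) (map_coeff h f) x" for x
      by (rule qv_ccong) (use map_coeff_map_qform[OF f] e in blast)
  qed
  have dmap: "qdim (map_qform e f) = qdim f" for e :: "'x \<Rightarrow> 'y" and f unfolding map_qform_def by simp
  \<comment> \<open>The function field in the index is that of the chosen anisotropic part
    \<open>\<psi>\<close>, so the property is shown for \<open>\<psi>\<close> and then carried to
    \<open>\<phi>\<close>.\<close>
  have P1: "quadratic_isotropy K A n (map_coeff h \<psi>) m"
  proof (rule quadratic_isotropy_base[OF c2 A(1) T sK _ c\<psi>K n2])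
    show "K \<subseteq> A" unfolding K_def by (rule A(2))
    fix M \<xi> L assume gz: "generic_zero K n (map_coeff h \<psi>) M \<xi>" and L: "subfld L" "K \<subseteq> L" "\<And>i. i < n \<Longrightarrow> \<xi> i \<in> L"
    have "2 \<le> qdim \<psi>" using \<psi>(3) n2 by simp
    from function_field_embedding[OF fieldF h \<psi>(1) this last[OF \<psi>(1,2) this], of M \<xi>] gz
    obtain g where g: "ring_emb (function_field F \<psi>) g"
      "\<forall>a\<in>carrier F. function_field_emb F \<psi> a \<in> carrier (function_field F \<psi>) \<and> g (function_field_emb F \<psi> a) = h a"
      "subfld (g ` carrier (function_field F \<psi>))"
      "\<forall>L. subfld L \<and> h ` carrier F \<subseteq> L \<and> (\<forall>i<qdim \<psi>. \<xi> i \<in> L) \<longrightarrow> g ` carrier (function_field F \<psi>) \<subseteq> L"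
      unfolding K_def \<psi>(3)[symmetric] map_coeff_def by blast
    note mt = mapTI[OF g(2) \<phi>(1)]
    have "tot_isotropic (g ` carrier (function_field F \<psi>)) n (map_coeff g (map_qform (function_field_emb F \<psi>) \<phi>)) m"
      using total_isotropy_index_tot_isotropic(1)[OF g(1,3) refl c2, of "map_qform (function_field_emb F \<psi>) \<phi>"] mt
      unfolding m dmap n_def by blast
    then have "tot_isotropic (g ` carrier (function_field F \<psi>)) n c m"
      using tot_isotropic_qcong[of n "map_coeff g (map_qform (function_field_emb F \<psi>) \<phi>)" c] mt unfolding n_def c_def by blast
    then have "tot_isotropic (g ` carrier (function_field F \<psi>)) n (map_coeff h \<psi>) m"
      using qembed_tot_isotropic[OF \<psi>(4) _ g(3)] mt by blast
    moreover have "g ` carrier (function_field F \<psi>) \<subseteq> L" using g(4) L \<psi>(3) unfolding K_def by auto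
    ultimately show "tot_isotropic L n (map_coeff h \<psi>) m" by (rule tot_isotropic_mono)
  qed
  have P2: "quadratic_isotropy K A n c m" by (rule quadratic_isotropy_qembed[OF P1 c\<psi>K \<psi>(5,4)])
  have hps: "set (map h ps) \<subseteq> K" unfolding K_def using ps(3) by auto
  have "quadratic_isotropy K A (2 ^ length (map h ps) * n) (diag_tensor n c (\<lambda>l. pflist (map h ps) ! l)) (2 ^ length (map h ps) * m)"
    by (rule quadratic_isotropy_pflist[OF c2 A(1) sK cK n2 P2 hps])
  then have "quadratic_isotropy K A N (\<lambda>i j. h s * diag_tensor n c (\<lambda>l. pflist (map h ps) ! l) i j) (k * m)"
    unfolding N_def k using quadratic_isotropy_scale hnz[OF ps(1,2)] by simp
  moreover have "qv N (\<lambda>i j. h s * diag_tensor n c (\<lambda>l. pflist (map h ps) ! l) i j) x = qv N D x" for x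
  proof -
    have "h (ds ! l) = h s * pflist (map h ps) ! l" if "l < k" for l
    proof -
      have l: "l < length (pflist_ring F ps)" using that k by (simp add: length_pflist_ring)
      then have "pflist_ring F ps ! l \<in> carrier F" using rc by (meson nth_mem subsetD)
      moreover have "h (pflist_ring F ps ! l) = pflist (map h ps) ! l"
        using pflist_ring_pflist[OF fieldF R ps(3)] l by (metis nth_map)
      ultimately show ?thesis unfolding ds_def using l ps(1) by (simp add: rembD(5)[OF h])
    qed
    then show ?thesis unfolding N_def D_def qv_scalec qv_diag_tensor by (simp add: sum_distrib_left mult.assoc)
  qed
  ultimately have P3: "quadratic_isotropy K A N D (k * m)" using quadratic_isotropy_qcong by blast
  have dsK: "h (ds ! l) \<in> K" if "l < k" for l unfolding K_def using ds ld that by (metis imageI nth_mem subsetD)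
  have DK: "cin K N D" unfolding N_def D_def by (rule cin_diag_tensor[OF sK cK dsK])
  have "quadratic_isotropy K A N D' (k * m)" by (rule quadratic_isotropy_qembed[OF P3 DK emb])
  then have P4: "quadratic_isotropy K A N (map_coeff h \<Phi>) (k * m)" using quadratic_isotropy_qcong[of N "map_coeff h \<Phi>" D'] q\<Phi> by blast
  have c\<Phi>K: "cin K N (map_coeff h \<Phi>)" using cin_map_coeff[OF R f\<Phi>(1)] f\<Phi>(2) by simp
  define \<Psi> where "\<Psi> = anisotropic_part F \<Phi>"
  have an': "qanisotropic F \<Phi>" using an unfolding \<Phi>_def .
  note \<Psi> = anisotropic_part_qembed[OF R c2 f\<Phi>(1) an', folded \<Psi>_def, unfolded f\<Phi>(2)]
  have P5: "quadratic_isotropy K A N (map_coeff h \<Psi>) (k * m)" by (rule quadratic_isotropy_qembed[OF P4 c\<Phi>K \<Psi>(4,5)])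
  have c\<Psi>K: "cin K N (map_coeff h \<Psi>)" using cin_map_coeff[OF R \<Psi>(1)] \<Psi>(3) by simp
  have an\<Psi>: "aniso K N (map_coeff h \<Psi>)" using qanisotropic_aniso[OF R \<Psi>(1)] \<Psi>(2,3) by simp
  \<comment> \<open>\<open>generic_zero\<close> counts the free coordinates from 1: coordinate
    \<open>i\<close> is \<open>S (i - 1)\<close>, and \<open>M 1\<close> is still
    \<open>K\<close>.\<close>
  define M where "M = (\<lambda>i. tower K S (i - 1))"
  have sM: "subfld (M i)" for i unfolding M_def by (rule subfld_tower[OF sK])
  have MA: "M i \<subseteq> A" for i
  proof -
    have "tower K S j \<subseteq> A" for j
      by (induction j) (use A(2) K_def adj_least[OF sA] S(1) in auto)
    then show ?thesis unfolding M_def by blast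
  qed
  have KM: "K \<subseteq> M i" for i unfolding M_def using tower_le[OF sK, of 0 "i - 1" S] by simp
  have MM: "M i \<subseteq> M (Suc i)" for i unfolding M_def using tower_le[OF sK, of "i - 1" i S] by simp
  have anM: "aniso (M i) N (map_coeff h \<Psi>)" for i unfolding M_def
    by (rule tower_aniso[OF c2 sK _ c\<Psi>K an\<Psi>]) (use S(2) K_def in simp)
  have SM: "S (i - 1) \<in> M (Suc i)" if "1 \<le> i" for i unfolding M_def using tower_gen[OF sK, of "i - 1" i S] that by simp
  \<comment> \<open>First coordinate 1, then variables; the last entry is 0 because the root
    \<open>z\<close> in direction \<open>y\<close> will supply it.\<close>
  define x where "x = (\<lambda>i. if i = 0 then 1 else if i < N - 1 then S (i - 1) else 0)"
  define E where "E = M (N - 1)"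
  have Mle: "M i \<subseteq> M j" if "i \<le> j" for i j using MM that by (rule lift_Suc_mono_le)
  have SE: "S (i - 1) \<in> E" if "1 \<le> i" "i < N - 1" for i
    using SM[OF that(1)] Mle[of "Suc i" "N - 1"] that(2) unfolding E_def by auto
  have sE: "subfld E" unfolding E_def by (rule sM)
  have xE: "vin E N x" unfolding vin_def x_def using SE subfldD(1,2)[OF sE] by auto
  define y :: "nat \<Rightarrow> 'w" where "y = unitv (N - 1)"
  have yE: "vin E N y" unfolding y_def E_def by (rule vin_unitv[OF sM])
  have y0: "\<exists>i<N. y i \<noteq> 0" using N2 unfolding y_def unitv_def by (intro exI[of _ "N - 1"]) auto
  have anE: "aniso E N (map_coeff h \<Psi>)" unfolding E_def by (rule anM)
  have "qv N (map_coeff h \<Psi>) y \<noteq> 0" using anE yE y0 unfolding aniso_def by blast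
  then obtain z where z: "qv N (map_coeff h \<Psi>) (\<lambda>i. x i + z * y i) = 0" using qroot_exists by blast
  have zE: "z \<notin> E"
  proof
    assume "z \<in> E"
    then have "vin E N (\<lambda>i. x i + z * y i)" using xE yE unfolding vin_def by (auto intro: subfldD(3,4)[OF sE])
    from anisD[OF anE this z, of 0] show False using N2 by (simp add: x_def y_def unitv_def)
  qed
  have TI1: "tot_isotropic (qadj E z) N (map_coeff h \<Psi>) (k * m)"
    using P5 sM KM MA anE zE xE yE y0 z unfolding quadratic_isotropy_def E_def by blast
  define \<xi> where "\<xi> = (\<lambda>i. x i + z * y i)"
  have \<xi>x: "\<xi> i = x i" if "i < N - 1" for i using that unfolding \<xi>_def y_def unitv_def by simp
  have \<xi>z: "\<xi> (N - 1) = z" using N2 unfolding \<xi>_def x_def y_def unitv_def by simp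
  have gz: "generic_zero K N (map_coeff h \<Psi>) M \<xi>" unfolding generic_zero_def
  proof (intro conjI allI impI)
    show "subfld (M i)" "M i \<subseteq> M (Suc i)" "K \<subseteq> M i" for i using sM MM KM by blast+
    show "\<xi> 0 = 1" using \<xi>x[of 0] N2 by (simp add: x_def)
    show "\<xi> i \<in> M (Suc i)" "transcendental (M i) (\<xi> i)" if "1 \<le> i \<and> i < N - 1" for i
      using that \<xi>x[of i] SM[of i] S(2)[of "i - 1"] unfolding x_def M_def K_def by auto
    show "\<xi> (N - 1) \<notin> M (N - 1)" using zE unfolding \<xi>z E_def .
    show "qv N (map_coeff h \<Psi>) \<xi> = 0" using z unfolding \<xi>_def .
  qed
  have N2': "2 \<le> qdim \<Psi>" using \<Psi>(3) N2 by simp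
  from function_field_embedding[OF fieldF h \<Psi>(1) N2' last[OF \<Psi>(1,2) N2'], of M \<xi>] gz
  obtain g where g: "ring_emb (function_field F \<Psi>) g"
    "\<forall>a\<in>carrier F. function_field_emb F \<Psi> a \<in> carrier (function_field F \<Psi>) \<and> g (function_field_emb F \<Psi> a) = h a"
    "subfld (g ` carrier (function_field F \<Psi>))"
    "\<forall>i<qdim \<Psi>. \<xi> i \<in> g ` carrier (function_field F \<Psi>)"
    unfolding K_def \<Psi>(3)[symmetric] map_coeff_def by blast
  define G where "G = g ` carrier (function_field F \<Psi>)"
  note mt = mapTI[OF g(2) f\<Phi>(1), unfolded f\<Phi>(2), folded G_def]
  have sG: "subfld G" unfolding G_def by (rule g(3))
  have \<xi>G: "\<xi> i \<in> G" if "i < N" for i using g(4) that \<Psi>(3) unfolding G_def by simp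
  \<comment> \<open>The coordinates of \<open>\<xi>\<close> lie in \<open>G\<close>, among them the
    \<open>S j\<close> with \<open>j < N - 2\<close>, which generate \<open>E\<close> over
    \<open>K\<close>.\<close>
  have "tower K S j \<subseteq> G" if "j \<le> N - 2" for j
    using that
  proof (induction j)
    case 0
    then show ?case using mt by simp
  next
    case (Suc j)
    then have "S j = \<xi> (Suc j)" using \<xi>x[of "Suc j"] by (simp add: x_def)
    then have "S j \<in> G" using \<xi>G[of "Suc j"] Suc.prems by simp
    then show ?case using adj_least[OF sG] Suc by simp
  qed
  then have "E \<subseteq> G" unfolding E_def M_def by (simp add: numeral_2_eq_2)
  moreover have "z \<in> G" using \<xi>G[of "N - 1"] \<xi>z N2 by simp
  ultimately have "qadj E z \<subseteq> G" by (rule qadj_least[OF sG])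
  then have "tot_isotropic G N (map_coeff h \<Psi>) (k * m)" by (rule tot_isotropic_mono[OF TI1])
  then have "tot_isotropic G N (map_coeff h \<Phi>) (k * m)" using qembed_tot_isotropic[OF \<Psi>(5) _ sG] mt by blast
  then have "tot_isotropic G N (map_coeff g (map_qform (function_field_emb F \<Psi>) \<Phi>)) (k * m)"
    using tot_isotropic_qcong[of N "map_coeff g (map_qform (function_field_emb F \<Psi>) \<Phi>)" "map_coeff h \<Phi>"] mt by blast
  then have "k * m \<le> total_isotropy_index (function_field F \<Psi>) (map_qform (function_field_emb F \<Psi>) \<Phi>)"
    using total_isotropy_index_tot_isotropic(2)[OF g(1,3) refl c2, of "map_qform (function_field_emb F \<Psi>) \<Phi>" "k * m"] mt f\<Phi>(2)
    unfolding dmap G_def by simp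
  also have "\<dots> = first_isotropy_index F \<Phi>"
    unfolding first_isotropy_index_def \<Psi>_def by (simp add: Let_def)
  finally show ?thesis unfolding k_def m_def \<Phi>_def .
qed


section \<open>A universe of fields\<close>

definition mpfree :: "nat \<Rightarrow> (nat multiset \<Rightarrow>\<^sub>0 'k::comm_ring_1) set" where
  "mpfree k = {p. \<forall>m. Poly_Mapping.lookup p m \<noteq> 0 \<longrightarrow> set_mset m \<subseteq> {..<k}}"

lemma mpfree_add: "p \<in> mpfree k \<Longrightarrow> q \<in> mpfree k \<Longrightarrow> p + q \<in> mpfree k"
  unfolding mpfree_def by (auto simp: lookup_add) (metis add.right_neutral in_mono lessThan_iff)

lemma mpfree_uminus: "p \<in> mpfree k \<Longrightarrow> - p \<in> mpfree k"
  unfolding mpfree_def by auto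

lemma mpfree_mult: "p \<in> mpfree k \<Longrightarrow> q \<in> mpfree k \<Longrightarrow> p * q \<in> mpfree k"
  unfolding mpfree_def
proof (intro CollectI allI impI)
  fix m assume h: "p \<in> {p. \<forall>m. Poly_Mapping.lookup p m \<noteq> 0 \<longrightarrow> set_mset m \<subseteq> {..<k}}"
    "q \<in> {p. \<forall>m. Poly_Mapping.lookup p m \<noteq> 0 \<longrightarrow> set_mset m \<subseteq> {..<k}}" "Poly_Mapping.lookup (p * q) m \<noteq> 0"
  then obtain l where l: "l \<subseteq># m" "Poly_Mapping.lookup p l * Poly_Mapping.lookup q (m - l) \<noteq> 0"
    unfolding lookup_mult_mset by (metis (mono_tags, lifting) mem_Collect_eq sum.neutral)
  then have "Poly_Mapping.lookup p l \<noteq> 0" "Poly_Mapping.lookup q (m - l) \<noteq> 0" by auto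
  then have "set_mset l \<subseteq> {..<k}" "set_mset (m - l) \<subseteq> {..<k}" using h by auto
  moreover have "m = l + (m - l)" using l(1) by simp
  ultimately show "set_mset m \<subseteq> {..<k}" by (metis Un_least set_mset_union)
qed

lemma mpfree_const: "Poly_Mapping.single {#} a \<in> mpfree k"
  unfolding mpfree_def by (auto simp: lookup_single when_def split: if_splits)

lemma mpfree_pvar: "i < k \<Longrightarrow> pvar i \<in> mpfree k"
  unfolding mpfree_def pvar_def by (auto simp: lookup_single when_def split: if_splits)

lemma mpfree_mono: "k \<le> l \<Longrightarrow> mpfree k \<subseteq> mpfree l"
  unfolding mpfree_def by auto (metis in_mono lessThan_iff order_less_le_trans)

text \<open>A monomial free of \<open>k\<close> times the \<open>i\<close>-th power of the variable
  \<open>k\<close> can occur in the value of \<open>P\<close> only through the coefficient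
  \<open>i\<close>, so all coefficients can be read off.\<close>

lemma mpfree_transcendental:
  assumes "\<And>i. Polynomial.coeff P i \<in> mpfree k" "poly P (pvar k) = 0"
  shows "P = 0"
proof -
  have key: "Poly_Mapping.lookup (poly P (pvar k)) (m + replicate_mset i k) = Poly_Mapping.lookup (Polynomial.coeff P i) m"
    if "k \<notin># m" for m i
    using assms(1)
  proof (induction P arbitrary: i)
    case (pCons a P)
    have P: "Polynomial.coeff P l \<in> mpfree k" for l using pCons.prems[of "Suc l"] by simp
    have a: "a \<in> mpfree k" using pCons.prems[of 0] by simp
    show ?case
    proof (cases i)
      case 0
      then show ?thesis using that by (simp add: lookup_add lookup_pvar_mult)
    next
      case (Suc i')
      have "Poly_Mapping.lookup a (m + replicate_mset i k) = 0"
        using a Suc unfolding mpfree_def by auto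
      then show ?thesis using Suc pCons.IH[OF P, of i'] by (simp add: lookup_add lookup_pvar_mult)
    qed
  qed simp
  have "Polynomial.coeff P i = 0" for i
  proof (rule poly_mapping_eqI)
    fix m
    show "Poly_Mapping.lookup (Polynomial.coeff P i) m = Poly_Mapping.lookup 0 m"
    proof (cases "k \<in># m")
      case True
      then show ?thesis using assms(1)[of i] unfolding mpfree_def by auto
    next
      case False
      then show ?thesis using key[of m i] assms(2) by simp
    qed
  qed
  then show ?thesis by (simp add: poly_eq_iff)
qed

section \<open>Algebraic closure of a rational function field in countably many variables\<close>

type_synonym 'k ext = "(nat multiset \<Rightarrow>\<^sub>0 'k) fract alg_closure"

definition mpext :: "(nat multiset \<Rightarrow>\<^sub>0 'k::field) \<Rightarrow> 'k ext" where
  "mpext p = to_ac (Fract p 1)"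

definition ext_emb :: "'k::field \<Rightarrow> 'k ext" where
  "ext_emb a = mpext (Poly_Mapping.single {#} a)"

definition ext_var :: "nat \<Rightarrow> 'k::field ext" where
  "ext_var i = mpext (pvar i)"

lemma mpext_hom: "mpext 0 = 0" "mpext 1 = 1" "mpext (p + q) = mpext p + mpext q" "mpext (p * q) = mpext p * mpext q"
  "mpext (- p) = - mpext p"
  unfolding mpext_def Zero_fract_def[symmetric] One_fract_def[symmetric]
  by (simp_all flip: to_ac_add to_ac_mult to_ac_minus)

lemma to_ac_eq_0: "to_ac x = 0 \<longleftrightarrow> x = 0"
proof
  assume h: "to_ac x = 0"
  show "x = 0"
  proof (rule ccontr)
    assume "x \<noteq> 0"
    then have "to_ac x * to_ac (inverse x) = 1" by (simp flip: to_ac_mult)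
    then show False using h by simp
  qed
qed simp

lemma mpext_eq_0: "mpext p = 0 \<longleftrightarrow> p = 0"
  unfolding mpext_def to_ac_eq_0 by (simp add: Zero_fract_def eq_fract)

lemma ext_emb_hom: "ext_emb 0 = 0" "ext_emb 1 = 1" "ext_emb (a + b) = ext_emb a + ext_emb b"
  "ext_emb (a * b) = ext_emb a * ext_emb b"
  unfolding ext_emb_def
  by (simp_all add: mpext_hom single_add flip: single_empty_mult)

lemma mpext_poly: "poly (map_poly mpext P) (mpext x) = mpext (poly P x)"
  by (induction P) (simp_all add: map_poly_pCons mpext_hom)

definition mpfrac :: "nat \<Rightarrow> 'k::field ext set" where
  "mpfrac k = {mpext p / mpext q | p q. p \<in> mpfree k \<and> q \<in> mpfree k \<and> q \<noteq> 0}"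

lemma mpfracI: "p \<in> mpfree k \<Longrightarrow> q \<in> mpfree k \<Longrightarrow> q \<noteq> 0 \<Longrightarrow> x = mpext p / mpext q \<Longrightarrow> x \<in> mpfrac k"
  unfolding mpfrac_def by blast

lemma mpfree_01: "0 \<in> mpfree k" "1 \<in> mpfree k"
  using mpfree_const[of 0 k] mpfree_const[of 1 k] by (simp_all add: zero_multiset_def[symmetric])

lemma subfld_mpfrac: "subfld (mpfrac k)"
  unfolding subfld_def
proof (intro conjI ballI)
  show 0: "0 \<in> mpfrac k" "1 \<in> mpfrac k"
    using mpfracI[of 0 k 1 0] mpfracI[of 1 k 1 1] mpfree_01[of k] by (auto simp: mpext_hom)
  fix x :: "'a ext" assume "x \<in> mpfrac k"
  then obtain p q where x: "x = mpext p / mpext q" "p \<in> mpfree k" "q \<in> mpfree k" "q \<noteq> 0" unfolding mpfrac_def by blast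
  show "- x \<in> mpfrac k" using x by (intro mpfracI[of "- p" k q] mpfree_uminus) (auto simp: mpext_hom)
  show "inverse x \<in> mpfrac k"
  proof (cases "p = 0")
    case True
    then show ?thesis using x 0 by (simp add: mpext_hom)
  next
    case False
    then show ?thesis using x by (intro mpfracI[of q k p]) auto
  qed
  fix y :: "'a ext" assume "y \<in> mpfrac k"
  then obtain r s where y: "y = mpext r / mpext s" "r \<in> mpfree k" "s \<in> mpfree k" "s \<noteq> 0" unfolding mpfrac_def by blast
  have nz: "mpext q \<noteq> 0" "mpext s \<noteq> 0" using x(4) y(4) mpext_eq_0 by blast+
  have "x + y = mpext (p * s + r * q) / mpext (q * s)" unfolding x(1) y(1) mpext_hom using nz by (simp add: add_frac_eq)
  then show "x + y \<in> mpfrac k" using x(2-4) y(2-4)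
    by (intro mpfracI[of "p * s + r * q" k "q * s"]) (auto intro!: mpfree_add mpfree_mult)
  have "x * y = mpext (p * r) / mpext (q * s)" unfolding x(1) y(1) mpext_hom by simp
  then show "x * y \<in> mpfrac k" using x(2-4) y(2-4)
    by (intro mpfracI[of "p * r" k "q * s"]) (auto intro!: mpfree_mult)
qed

lemma mpext_mpfrac: "p \<in> mpfree k \<Longrightarrow> mpext p \<in> mpfrac k"
  by (rule mpfracI[of p k 1]) (simp_all add: mpfree_01 mpext_hom)

text \<open>Clearing denominators turns a relation over the fractions into one with polynomial
  coefficients.\<close>

lemma mpfrac_transcendental: "transcendental (mpfrac k) (ext_var k :: 'k::field ext)"
  unfolding transcendental_def
proof safe
  fix p :: "'k ext poly" assume p: "pin (mpfrac k) p" "poly p (ext_var k) = 0"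
  have "\<exists>b P. b \<in> mpfree k \<and> b \<noteq> 0 \<and> (\<forall>i. Polynomial.coeff P i \<in> mpfree k) \<and> map_poly mpext P = smult (mpext b) p"
    using p(1)
  proof (induction p)
    case 0
    then show ?case using mpfree_01[of k] by (intro exI[of _ 1] exI[of _ 0]) auto
  next
    case (pCons c p)
    have "c \<in> mpfrac k" "pin (mpfrac k) p" using pin_pCons[OF pCons.prems] by auto
    then obtain b P r q where h: "b \<in> mpfree k" "b \<noteq> 0" "\<forall>i. Polynomial.coeff P i \<in> mpfree k" "map_poly mpext P = smult (mpext b) p"
      "c = mpext r / mpext q" "r \<in> mpfree k" "q \<in> mpfree k" "q \<noteq> 0"
      using pCons.IH unfolding mpfrac_def by blast
    have nz: "mpext q \<noteq> 0" using h(8) mpext_eq_0 by blast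
    have "map_poly mpext (smult q P) = smult (mpext q) (map_poly mpext P)"
      by (rule poly_eqI) (simp add: coeff_map_poly mpext_hom)
    then have "map_poly mpext (pCons (r * b) (smult q P)) = smult (mpext (q * b)) (pCons c p)"
      using h(4,5) nz by (simp add: map_poly_pCons mpext_hom)
    moreover have "\<forall>i. Polynomial.coeff (pCons (r * b) (smult q P)) i \<in> mpfree k"
      using h by (auto simp: coeff_pCons mpfree_mult split: nat.split)
    moreover have "q * b \<in> mpfree k" "q * b \<noteq> 0" using h by (auto simp: mpfree_mult)
    ultimately show ?case by blast
  qed
  then obtain b P where h: "b \<noteq> 0" "\<forall>i. Polynomial.coeff P i \<in> mpfree k" "map_poly mpext P = smult (mpext b) p" by blast
  have "mpext (poly P (pvar k)) = 0"
    using p(2) h(3) mpext_poly[of P "pvar k"] unfolding ext_var_def by simp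
  then have "P = 0" using mpfree_transcendental h(2) mpext_eq_0 by blast
  then have "smult (mpext b) p = 0" using h(3) by simp
  then show "p = 0" using h(1) by (simp add: mpext_eq_0)
qed

lemma tower_mpfrac: "tower (range ext_emb) ext_var k \<subseteq> mpfrac k"
proof (induction k)
  case 0
  show ?case unfolding ext_emb_def using mpext_mpfrac[OF mpfree_const] by auto
next
  case (Suc k)
  have "mpfrac k \<subseteq> (mpfrac (Suc k) :: 'a ext set)" unfolding mpfrac_def using mpfree_mono[of k "Suc k"] by fastforce
  moreover have "ext_var k \<in> mpfrac (Suc k)" unfolding ext_var_def by (rule mpext_mpfrac[OF mpfree_pvar]) simp
  ultimately show ?case using adj_least[OF subfld_mpfrac, of _ "Suc k" "ext_var k"] Suc by auto
qed

lemma ext_var_transcendental: "transcendental (tower (range ext_emb) ext_var k) (ext_var k)"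
  by (rule transcendental_mono[OF mpfrac_transcendental tower_mpfrac])

lemma ext_emb_uminus: "ext_emb (- a) = - ext_emb a"
proof -
  have "ext_emb (- a) + ext_emb a = 0" by (simp flip: ext_emb_hom(3) add: ext_emb_hom(1))
  then show ?thesis by (simp add: eq_neg_iff_add_eq_0)
qed

lemma ext_emb_eq_0: "ext_emb a = 0 \<longleftrightarrow> a = 0"
  unfolding ext_emb_def mpext_eq_0 by (metis lookup_single_eq lookup_zero single_zero)

lemma ext_emb_inj: "ext_emb a = ext_emb b \<longleftrightarrow> a = b"
  using ext_emb_eq_0[of "a + - b"] unfolding ext_emb_hom ext_emb_uminus by simp

lemma ext_emb_inverse: "ext_emb (inverse a) = inverse (ext_emb a)"
proof (cases "a = 0")
  case False
  then have "ext_emb a * ext_emb (inverse a) = 1" by (simp flip: ext_emb_hom(4) add: ext_emb_hom(2))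
  then show ?thesis by (rule inverse_unique[symmetric])
qed (simp add: ext_emb_hom)

lemma subfld_ext_emb: "subfld K \<Longrightarrow> subfld (ext_emb ` K)"
proof -
  assume K: "subfld K"
  have "0 \<in> ext_emb ` K" "1 \<in> ext_emb ` K"
    using subfldD(1,2)[OF K] ext_emb_hom(1,2) by (metis imageI)+
  moreover have "ext_emb a + ext_emb b \<in> ext_emb ` K" "ext_emb a * ext_emb b \<in> ext_emb ` K"
    if "a \<in> K" "b \<in> K" for a b
    using that subfldD(3,4)[OF K that] by (simp_all flip: ext_emb_hom)
  moreover have "- ext_emb a \<in> ext_emb ` K" "inverse (ext_emb a) \<in> ext_emb ` K" if "a \<in> K" for a
    using subfldD(5,6)[OF K that] by (simp_all flip: ext_emb_uminus ext_emb_inverse)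
  ultimately show ?thesis unfolding subfld_def by auto
qed

lemma ext_emb_diff: "ext_emb (a - b) = ext_emb a - ext_emb b"
  using ext_emb_hom(3)[of "a - b" b] by (simp add: algebra_simps)

lemma ext_emb_poly: "poly (map_poly ext_emb P) (ext_emb x) = ext_emb (poly P x)"
  by (induction P) (simp_all add: map_poly_pCons ext_emb_hom)

lemma pin_image: "pin (ext_emb ` K) p \<Longrightarrow> 0 \<in> K \<Longrightarrow> \<exists>q. pin K q \<and> p = map_poly ext_emb q"
proof (induction p)
  case 0
  then show ?case by (intro exI[of _ 0]) (simp add: pin_def)
next
  case (pCons c p)
  then obtain q a where "pin K q" "p = map_poly ext_emb q" "a \<in> K" "c = ext_emb a"
    using pin_pCons[OF pCons.prems(1)] by blast
  then show ?case
    by (intro exI[of _ "pCons a q"]) (auto simp: map_poly_pCons ext_emb_hom pin_def coeff_pCons split: nat.split)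
qed

lemma transcendental_image:
  assumes K: "subfld K" and t: "transcendental K t"
  shows "transcendental (ext_emb ` K) (ext_emb t)"
  unfolding transcendental_def
proof safe
  fix p assume p: "pin (ext_emb ` K) p" "poly p (ext_emb t) = 0"
  then obtain q where q: "pin K q" "p = map_poly ext_emb q" using pin_image subfldD(1)[OF K] by blast
  then have "ext_emb (poly q t) = 0" using p(2) by (simp add: ext_emb_poly)
  then have "poly q t = 0" using ext_emb_eq_0 by blast
  then have "q = 0" using t q(1) unfolding transcendental_def by blast
  then show "p = 0" using q(2) by simp
qed

lemma tower_image:
  assumes "subfld K"
  shows "tower (ext_emb ` K) (\<lambda>i. ext_emb (S i)) k \<subseteq> ext_emb ` tower K S k"
proof (induction k)
  case (Suc k)
  have sub: "subfld (ext_emb ` adj (tower K S k) (S k))"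
    by (intro subfld_ext_emb subfld_adj subfld_tower assms)
  show ?case unfolding tower.simps
    by (rule adj_least[OF sub])
      (use Suc adj_base[OF subfld_tower[OF assms]] adj_gen[OF subfld_tower[OF assms]] in \<open>blast+\<close>)
qed simp

text \<open>Over an algebraically closed field a polynomial splits into linear factors, so passing
  to a larger field adds no roots.\<close>

lemma alg_closed_in_ext_emb: "alg_closed_in (range (ext_emb :: 'k::alg_closed_field \<Rightarrow> 'k ext))"
  unfolding alg_closed_in_def
proof (intro conjI allI impI)
  have U: "subfld (UNIV :: 'k set)" unfolding subfld_def by simp
  show "subfld (range (ext_emb :: 'k \<Rightarrow> 'k ext))" by (rule subfld_ext_emb[OF U])
  fix p and z :: "'k ext" assume h: "pin (range ext_emb) p \<and> p \<noteq> 0 \<and> poly p z = 0"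
  then obtain q where q: "p = map_poly ext_emb q" using pin_image[of UNIV p] by auto
  have *: "z \<in> range ext_emb" if "q \<noteq> 0" "poly (map_poly ext_emb q) z = 0" for q :: "'k poly"
    using that
  proof (induction "Polynomial.degree q" arbitrary: q rule: less_induct)
    case less
    show ?case
    proof (cases "Polynomial.degree q = 0")
      case True
      then obtain a where "q = [:a:]" using degree_eq_zeroE by blast
      then show ?thesis using less.prems by (auto simp: map_poly_pCons ext_emb_hom ext_emb_eq_0)
    next
      case False
      then obtain x where "poly q x = 0" using alg_closed_imp_poly_has_root[of q] by auto
      then obtain r where r: "q = [:- x, 1:] * r" using poly_eq_0_iff_dvd by (metis dvdE)
      have r0: "r \<noteq> 0" using r less.prems(1) by auto
      have "Polynomial.degree q = Suc (Polynomial.degree r)"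
        unfolding r using r0 by (subst degree_mult_eq) auto
      moreover have "map_poly ext_emb q = [:- ext_emb x, 1:] * map_poly ext_emb r"
        unfolding r by (rule poly_eqI)
          (simp add: coeff_map_poly coeff_pCons ext_emb_hom ext_emb_uminus ext_emb_diff split: nat.split)
      then have "poly ([:- ext_emb x, 1:] * map_poly ext_emb r) z = 0" using less.prems(2) by metis
      then have "(z - ext_emb x) * poly (map_poly ext_emb r) z = 0" by (simp add: algebra_simps)
      then have "z = ext_emb x \<or> poly (map_poly ext_emb r) z = 0" by auto
      ultimately show ?thesis using less.hyps[of r] r0 by auto
    qed
  qed
  have "q \<noteq> 0" "poly (map_poly ext_emb q) z = 0" using h q by auto
  then show "z \<in> range ext_emb" by (rule *)
qed

text \<open>\<open>ext\<close> is applied twice. The first step supplies the variables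
  \<open>S k\<close> and an algebraically closed field, whose image in the second step is
  \<open>A\<close>; the second step supplies the \<open>T k\<close>, free over
  \<open>A\<close>.\<close>

theorem first_isotropy_index_Pfister_type:
  fixes F :: "('b, 'm) ring_scheme" and h :: "'b \<Rightarrow> 'k::field"
  assumes c2: "(2::'k) = 0" and fieldF: "field F" and h: "ring_emb F h"
    and \<phi>: "quadratic_form F \<phi>" "2 \<le> qdim \<phi>"
    and B: "bilinear_pfister_form F B" "bsimilar F P B"
    and an: "qanisotropic F (qtensor F P \<phi>)"
  shows "first_isotropy_index F (qtensor F P \<phi>) \<ge> bdim P * first_isotropy_index F \<phi>"
proof -
  define h1 :: "'b \<Rightarrow> 'k ext" where "h1 = ext_emb \<circ> h"
  define h2 :: "'b \<Rightarrow> 'k ext ext" where "h2 = ext_emb \<circ> h1"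
  have step: "ring_emb F (ext_emb \<circ> f)" if f: "ring_emb F f" for f :: "'b \<Rightarrow> 'x::field"
    using f unfolding ring_emb_def inj_on_def by (auto simp: ext_emb_hom ext_emb_inj)
  have R: "ring_emb F h1" "ring_emb F h2" unfolding h1_def h2_def by (intro step h)+
  have two: "(2 :: 'x::field ext) = 0" if "(2::'x) = 0"
    using ext_emb_hom(3)[of 1 "1::'x"] that ext_emb_hom(1,2) by (metis one_add_one)
  define A where "A = range (ext_emb :: 'k ext \<Rightarrow> 'k ext ext)"
  define K1 where "K1 = h1 ` carrier F"
  have sK1: "subfld K1" unfolding K1_def by (rule ring_emb_field_image[OF fieldF R(1)])
  have hK: "h2 ` carrier F = ext_emb ` K1" unfolding h2_def K1_def by auto
  have sU: "subfld (range (ext_emb :: 'k \<Rightarrow> 'k ext))"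
    by (rule subfld_ext_emb) (simp add: subfld_def)
  show ?thesis
  proof (rule first_isotropy_index_Pfister[OF _ fieldF R(2), of A ext_var "\<lambda>i. ext_emb (ext_var i)"])
    show "(2 :: 'k ext ext) = 0" by (rule two[OF two[OF c2]])
    show "alg_closed_in A" unfolding A_def by (rule alg_closed_in_ext_emb)
    show "h2 ` carrier F \<subseteq> A" "\<And>k. ext_emb (ext_var k) \<in> A" unfolding hK A_def by auto
    show "transcendental (tower A ext_var k) (ext_var k)" for k unfolding A_def by (rule ext_var_transcendental)
    have "K1 \<subseteq> range ext_emb" unfolding K1_def h1_def by auto
    then have "transcendental (tower K1 ext_var k) (ext_var k)" for k
      by (rule transcendental_mono[OF ext_var_transcendental tower_mono[OF sK1 sU]])
    then show "transcendental (tower (h2 ` carrier F) (\<lambda>i. ext_emb (ext_var i)) k) (ext_emb (ext_var k))" for k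
      unfolding hK using transcendental_mono[OF transcendental_image[OF subfld_tower[OF sK1]] tower_image[OF sK1]] by blast
  qed (rule \<phi> B an)+
qed

section \<open>From a field record to a type of class \<open>field\<close>\<close>

definition counterexample :: "('a, 'm) ring_scheme \<Rightarrow> bool" where
  "counterexample F \<longleftrightarrow> field F \<and> ring_char F = 2 \<and>
    (\<exists>\<phi> \<pi> B. quadratic_form F \<phi> \<and> 2 \<le> qdim \<phi> \<and> bilinear_pfister_form F B \<and> bsimilar F \<pi> B \<and>
      qanisotropic F (qtensor F \<pi> \<phi>) \<and>
      first_isotropy_index F (qtensor F \<pi> \<phi>) < bdim \<pi> * first_isotropy_index F \<phi>)"

definition GF2 :: "bool ring" where
  "GF2 = \<lparr>carrier = UNIV, monoid.mult = (\<and>), one = True, ring.zero = False, ring.add = (\<noteq>)\<rparr>"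

lemma field_GF2: "field GF2"
proof (rule cring.cring_fieldI2)
  show "cring GF2"
    by (intro cringI abelian_groupI comm_monoidI) (auto simp: GF2_def)
qed (auto simp: GF2_def)

text \<open>
  The function fields are embedded into a type of class \<open>field\<close>, but \<open>F\<close> is a variable and a type cannot
  depend on it. In a proof by contradiction one may take a fixed counterexample for \<open>F\<close>; \<open>GF2\<close> only
  makes the type inhabited if there is none.
\<close>

definition chosen_field :: "('a, 'm) ring_scheme itself \<Rightarrow> ('a + bool) ring" where
  "chosen_field _ = (if \<exists>F :: ('a, 'm) ring_scheme. counterexample F
    then image_ring Inl (SOME F :: ('a, 'm) ring_scheme. counterexample F) else image_ring Inr GF2)"

lemma two_eq_0_of_ring_char:
  assumes "field F" and "ring_char F = 2"
  shows "\<one>\<^bsub>F\<^esub> \<oplus>\<^bsub>F\<^esub> \<one>\<^bsub>F\<^esub> = \<zero>\<^bsub>F\<^esub>"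
proof -
  interpret field F by fact
  have ex: "\<exists>n>0. [(n::nat)] \<cdot>\<^bsub>F\<^esub> \<one>\<^bsub>F\<^esub> = \<zero>\<^bsub>F\<^esub>"
    using assms(2) unfolding ring_char_def by (auto split: if_splits)
  then have "[(2::nat)] \<cdot>\<^bsub>F\<^esub> \<one>\<^bsub>F\<^esub> = \<zero>\<^bsub>F\<^esub>"
    using LeastI_ex[OF ex] assms(2) unfolding ring_char_def by auto
  then show ?thesis by (simp add: numeral_2_eq_2 add.nat_pow_Suc)
qed

lemma image_ring_field:
  assumes F: "field F" and f: "inj_on f (carrier F)"
  shows "field (image_ring f F)"
    and "\<one>\<^bsub>F\<^esub> \<oplus>\<^bsub>F\<^esub> \<one>\<^bsub>F\<^esub> = \<zero>\<^bsub>F\<^esub> \<Longrightarrow>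
      \<one>\<^bsub>image_ring f F\<^esub> \<oplus>\<^bsub>image_ring f F\<^esub> \<one>\<^bsub>image_ring f F\<^esub> = \<zero>\<^bsub>image_ring f F\<^esub>"
proof -
  interpret field F by fact
  show "field (image_ring f F)" by (rule inj_imp_image_ring_is_field[OF f])
  have "f \<in> ring_hom F (image_ring f F)" using inj_imp_image_ring_iso[OF f] unfolding ring_iso_def by auto
  then show "\<one>\<^bsub>image_ring f F\<^esub> \<oplus>\<^bsub>image_ring f F\<^esub> \<one>\<^bsub>image_ring f F\<^esub> = \<zero>\<^bsub>image_ring f F\<^esub>"
    if "\<one>\<^bsub>F\<^esub> \<oplus>\<^bsub>F\<^esub> \<one>\<^bsub>F\<^esub> = \<zero>\<^bsub>F\<^esub>"
    using that ring_hom_add[of f F "image_ring f F" "\<one>\<^bsub>F\<^esub>" "\<one>\<^bsub>F\<^esub>"] ring_hom_one[of f F "image_ring f F"]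
    by (simp add: image_ring_zero)
qed

lemma chosen_field:
  shows "field (chosen_field TYPE(('a, 'm) ring_scheme))" (is "field ?K")
    and "\<one>\<^bsub>chosen_field TYPE(('a, 'm) ring_scheme)\<^esub> \<oplus>\<^bsub>chosen_field TYPE(('a, 'm) ring_scheme)\<^esub>
      \<one>\<^bsub>chosen_field TYPE(('a, 'm) ring_scheme)\<^esub> = \<zero>\<^bsub>chosen_field TYPE(('a, 'm) ring_scheme)\<^esub>"
proof -
  have "field ?K \<and> \<one>\<^bsub>?K\<^esub> \<oplus>\<^bsub>?K\<^esub> \<one>\<^bsub>?K\<^esub> = \<zero>\<^bsub>?K\<^esub>"
  proof (cases "\<exists>F :: ('a, 'm) ring_scheme. counterexample F")
    case True
    define F where "F = (SOME F :: ('a, 'm) ring_scheme. counterexample F)"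
    have "counterexample F" unfolding F_def using True by (rule someI_ex)
    then have "field F" "ring_char F = 2" unfolding counterexample_def by auto
    moreover have "?K = image_ring Inl F" unfolding chosen_field_def F_def using True by simp
    ultimately show ?thesis
      using image_ring_field[of F Inl] two_eq_0_of_ring_char[of F] by simp
  next
    case False
    then have "?K = image_ring Inr GF2" unfolding chosen_field_def by (rule if_not_P)
    then show ?thesis using image_ring_field[OF field_GF2, of Inr] by (simp add: GF2_def)
  qed
  then show "field ?K" "\<one>\<^bsub>?K\<^esub> \<oplus>\<^bsub>?K\<^esub> \<one>\<^bsub>?K\<^esub> = \<zero>\<^bsub>?K\<^esub>" by auto
qed

typedef ('a, 'm) fld = "carrier (chosen_field TYPE(('a, 'm) ring_scheme))"
  by (rule exI[of _ "\<one>\<^bsub>chosen_field TYPE(('a, 'm) ring_scheme)\<^esub>"]) (use chosen_field(1) in \<open>blast intro: monoid.one_closed field.is_ring ring.is_monoid\<close>)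

setup_lifting type_definition_fld

instantiation fld :: (type, type) field
begin

context
  fixes K
  defines "K \<equiv> chosen_field TYPE(('a, 'b) ring_scheme)"
begin

interpretation field K
  unfolding K_def by (rule chosen_field)

lift_definition zero_fld :: "('a, 'b) fld" is "ring.zero K"
  by (fold K_def) (rule ring_simprules)

lift_definition one_fld :: "('a, 'b) fld" is "monoid.one K"
  by (fold K_def) (rule ring_simprules)

lift_definition plus_fld :: "('a, 'b) fld \<Rightarrow> ('a, 'b) fld \<Rightarrow> ('a, 'b) fld" is "ring.add K"
  by (fold K_def) (rule ring_simprules)

lift_definition minus_fld :: "('a, 'b) fld \<Rightarrow> ('a, 'b) fld \<Rightarrow> ('a, 'b) fld" is "a_minus K"
  by (fold K_def) (rule ring_simprules)

lift_definition times_fld :: "('a, 'b) fld \<Rightarrow> ('a, 'b) fld \<Rightarrow> ('a, 'b) fld" is "monoid.mult K"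
  by (fold K_def) (rule ring_simprules)

lift_definition uminus_fld :: "('a, 'b) fld \<Rightarrow> ('a, 'b) fld" is "a_inv K"
  by (fold K_def) (rule ring_simprules)

text \<open>The class \<open>field\<close> demands \<open>inverse 0 = 0\<close>, so the zero element
  is treated separately from the units.\<close>

lift_definition inverse_fld :: "('a, 'b) fld \<Rightarrow> ('a, 'b) fld"
  is "\<lambda>x. if x = ring.zero K then ring.zero K else m_inv K x"
  by (fold K_def) (auto simp: field_Units)

lift_definition divide_fld :: "('a, 'b) fld \<Rightarrow> ('a, 'b) fld \<Rightarrow> ('a, 'b) fld"
  is "\<lambda>x y. if y = ring.zero K then ring.zero K else monoid.mult K x (m_inv K y)"
  by (fold K_def) (auto simp: field_Units)

end

instance proof -
  define K where "K = chosen_field TYPE(('a, 'b) ring_scheme)"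
  interpret field K unfolding K_def by (rule chosen_field)
  show "OFCLASS(('a, 'b) fld, field_class)"
  proof (intro_classes, goal_cases)
    case 1 show ?case by (transfer, fold K_def) (rule m_assoc)
  next
    case 2 show ?case by (transfer, fold K_def) (rule m_comm)
  next
    case 3 show ?case by (transfer, fold K_def) (rule l_one)
  next
    case 4 show ?case by (transfer, fold K_def) (rule a_assoc)
  next
    case 5 show ?case by (transfer, fold K_def) (rule a_comm)
  next
    case 6 show ?case by (transfer, fold K_def) (rule l_zero)
  next
    case 7 show ?case by (transfer, fold K_def) (rule ring_simprules)
  next
    case 8 show ?case by (transfer, fold K_def) (rule ring_simprules)
  next
    case 9 show ?case by (transfer, fold K_def) (rule ring_simprules)
  next
    case 10 show ?case by (transfer, fold K_def) (rule zero_not_one)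
  next
    case 11 then show ?case by (transfer, fold K_def) (auto simp: field_Units)
  next
    case 12 show ?case by (transfer, fold K_def) auto
  next
    case 13 show ?case by (transfer, fold K_def) auto
  qed
qed

end

lemma two_fld: "(2 :: ('a, 'm) fld) = 0"
proof -
  have "(1 :: ('a, 'm) fld) + 1 = 0" by transfer (rule chosen_field(2))
  then show ?thesis by simp
qed

text \<open>If a counterexample exists, the type is a copy of the carrier of the chosen one, tagged
  by \<open>Inl\<close>.\<close>

lemma ring_emb_fld:
  assumes ex: "\<exists>F :: ('a, 'm) ring_scheme. counterexample F"
  defines "F \<equiv> SOME F :: ('a, 'm) ring_scheme. counterexample F"
  shows "ring_emb F (\<lambda>a. Abs_fld (Inl a) :: ('a, 'm) fld)"
proof -
  have "counterexample F" unfolding F_def using ex by (rule someI_ex)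
  then interpret field F unfolding counterexample_def by blast
  have K: "chosen_field TYPE(('a, 'm) ring_scheme) = image_ring Inl F"
    unfolding chosen_field_def F_def using ex by simp
  have hom: "Inl \<in> ring_hom F (image_ring Inl F :: ('a + bool) ring)"
    using inj_imp_image_ring_iso[of Inl F] unfolding ring_iso_def by auto
  have c: "Inl a \<in> carrier (image_ring Inl F :: ('a + bool) ring)" if "a \<in> carrier F" for a
    using that by (simp add: image_ring_carrier)
  have inj: "Abs_fld (Inl a) = (Abs_fld (Inl b) :: ('a, 'm) fld) \<longleftrightarrow> a = b"
    if "a \<in> carrier F" "b \<in> carrier F" for a b
    using that Abs_fld_inject[where 'a = 'a and 'm = 'm, of "Inl a" "Inl b"] unfolding K by (simp add: c)
  have 1: "Abs_fld (Inl \<one>\<^bsub>F\<^esub>) = (1 :: ('a, 'm) fld)"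
    using ring_hom_one[OF hom] unfolding one_fld_def K by simp
  have add: "Abs_fld (Inl (a \<oplus>\<^bsub>F\<^esub> b)) = (Abs_fld (Inl a) + Abs_fld (Inl b) :: ('a, 'm) fld)"
    and mult: "Abs_fld (Inl (a \<otimes>\<^bsub>F\<^esub> b)) = (Abs_fld (Inl a) * Abs_fld (Inl b) :: ('a, 'm) fld)"
    if "a \<in> carrier F" "b \<in> carrier F" for a b
    using that ring_hom_add[OF hom that] ring_hom_mult[OF hom that]
    by (simp_all add: plus_fld_def times_fld_def K c Abs_fld_inverse)
  show ?thesis unfolding ring_emb_def using inj 1 add mult by (auto intro!: inj_onI simp: is_cring)
qed

theorem theorem3p3:
  fixes F :: "('a, 'm) ring_scheme" and \<phi> :: "'a qform" and \<pi> :: "'a bform"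
  assumes "field F" and "ring_char F = 2"
    and "quadratic_form F \<phi>" and "qdim \<phi> \<ge> 2"
    and "bilinear_form F \<pi>"
    and "\<exists>B. bilinear_pfister_form F B \<and> banisotropic F B \<and> bsimilar F \<pi> B"
    and "qanisotropic F (qtensor F \<pi> \<phi>)"
  shows "first_isotropy_index F (qtensor F \<pi> \<phi>) \<ge> bdim \<pi> * first_isotropy_index F \<phi>"
proof (rule ccontr)
  assume "\<not> ?thesis"
  then have "counterexample F" unfolding counterexample_def using assms by (auto simp: not_le)
  then have ex: "\<exists>F :: ('a, 'm) ring_scheme. counterexample F" by blast
  \<comment> \<open>The type was built from this counterexample, which may differ from
    \<open>F\<close>; the contradiction is reached for \<open>F0\<close>.\<close>
  define F0 where "F0 = (SOME F :: ('a, 'm) ring_scheme. counterexample F)"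
  have "counterexample F0" unfolding F0_def using ex by (rule someI_ex)
  then obtain \<phi> P B where 0: "field F0" "quadratic_form F0 \<phi>" "2 \<le> qdim \<phi>" "bilinear_pfister_form F0 B"
      "bsimilar F0 P B" "qanisotropic F0 (qtensor F0 P \<phi>)"
    and less: "first_isotropy_index F0 (qtensor F0 P \<phi>) < bdim P * first_isotropy_index F0 \<phi>"
    unfolding counterexample_def by blast
  have "ring_emb F0 (\<lambda>a. Abs_fld (Inl a) :: ('a, 'm) fld)" unfolding F0_def by (rule ring_emb_fld[OF ex])
  from first_isotropy_index_Pfister_type[OF two_fld 0(1) this 0(2-6)] less show False by simp
qed


end
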